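(* For any $\epsilon>0$, as $x\to\infty$, $$\sum_{n\le x}\Lambda\left(\left[\frac{x}{n}\right]\right)=x\sum_{d\ge 1}\frac{\Lambda(d)}{d(d+1)}+O_{\epsilon}\left(x^{\frac{17}{36}+\epsilon}\right),$$ where $n$ and $d$ run over positive integers.
   Context: $\Lambda$ is the von Mangoldt function and $[t]$ denotes the integral part of the real number $t$. *)

theory Defs
  imports
    "HOL-Analysis.Analysis"
    "HOL-Number_Theory.Prime_Powers"
    "HOL-Library.Landau_Symbols"
begin

end

theory Submission
  imports Defs "HOL-Real_Asymp.Real_Asymp"
begin

text \<open>Grouping the \<open>n\<close> with \<open>[x / n] = d\<close> turns the sum into
  \<open>\<Sum>d. \<Lambda> d * ([x / d] - [x / (d + 1)])\<close>, so the error term consists of sums of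
  \<open>\<Lambda> d * \<psi> (x / (d + \<delta>))\<close> with \<open>\<delta> \<in> {0, 1}\<close> and \<open>\<psi>\<close> the sawtooth function. The ranges \<open>n \<le> x powr (17/36)\<close> and
  \<open>d \<le> x powr (17/36)\<close> are estimated trivially, which leaves \<open>x powr (17/36) \<le> d \<le> x powr (19/36)\<close>. There
  \<open>\<psi>\<close> is replaced by a trigonometric polynomial and \<open>\<Lambda>\<close> is decomposed by Vaughan's identity with
  \<open>U = x powr (1/9)\<close>. Type I sums are estimated by van der Corput's second derivative test. In a type II sum over
  \<open>n ~ N \<le> m ~ M\<close> and frequencies \<open>h ~ H\<close>, one variable is split into blocks of length \<open>x powr (1/9)\<close>. If \<open>N\<close> is
  small, Cauchy's inequality over the blocks of \<open>n\<close> leaves smooth sums over \<open>m\<close>. Otherwise the squares over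
  the blocks of \<open>m\<close> are summed over the points \<open>h x / n\<close> by the double large sieve, and the savings come
  from counting near coincidences among the differences \<open>1 / m - 1 / m'\<close> of block mates, by a curvature argument.\<close>

text \<open>Put \<open>T = x powr (17/36)\<close>. For \<open>d\<close> of size \<open>D\<close>
  about \<open>D / T\<close> frequencies are needed, and Cauchy's inequality over blocks of length
  \<open>A\<close> leaves a diagonal of relative size \<open>1 / A\<close>. It is harmless only if
  \<open>A \<ge> (D / T)\<^sup>2\<close>, which at \<open>D = x powr (19/36)\<close> means the block
  length \<open>x powr (1/9)\<close>. The same size of \<open>U\<close> makes each type II variable
  long enough to be cut into such blocks. The large sieve asks for a phase that is a product of a
  function of \<open>(h, n)\<close> and a function of \<open>m\<close>; the shift \<delta> and the
  condition on the product spoil this, and only inside blocks can both be removed cheaply. For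
  \<open>N = x powr n\<close> the large sieve tolerates about \<open>x powr (1 - 2 * n)\<close> near
  coincidences. The trivial count \<open>A\<^sup>2 * M\<close> respects this unless both variables
  are close to the square root of \<open>D\<close>: at \<open>N = M = x powr (19/72)\<close> it is
  too large by \<open>x powr (1/72)\<close>. This gap is what the curvature argument has to close,
  and it gains about \<open>x powr (1/60)\<close>.\<close>

definition ee :: "real \<Rightarrow> complex" where
  "ee t = cis (2 * pi * t)"

lemma norm_ee [simp]: "norm (ee t) = 1"
  by (simp add: ee_def)

lemma ee_add: "ee (s + t) = ee s * ee t"
  by (simp add: ee_def cis_mult distrib_left)

lemma ee_diff: "ee (s - t) = ee s * cnj (ee t)"
  by (simp add: ee_def cis_cnj cis_mult algebra_simps)

lemma ee_0 [simp]: "ee 0 = 1"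
  by (simp add: ee_def)

lemma ee_minus: "ee (- t) = cnj (ee t)"
  by (simp add: ee_def cis_cnj)

lemma ee_of_int [simp]: "ee (of_int k) = 1"
  unfolding ee_def by (rule cis_multiple_2pi) auto

lemma ee_add_int [simp]: "ee (t + of_int k) = ee t"
  by (simp add: ee_add)

text \<open>A weak form of Jordan's inequality, \<open>sin y \<ge> y / 2\<close> on
  \<open>[0, pi / 2]\<close>, combined with \<open>pi \<ge> 2\<close>. Up to \<open>pi / 3\<close>
  the function \<open>sin y - y / 2\<close> increases because \<open>cos y \<ge> 1 / 2\<close>
  there.\<close>

lemma sin_pi_ge:
  assumes "0 \<le> t" "t \<le> 1/2"
  shows "t \<le> sin (pi * t)"
proof -
  have pi3: "pi \<ge> 2" using pi_ge_two .
  have half: "x / 2 \<le> sin x" if "0 \<le> x" "x \<le> pi / 3" for x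
  proof -
    have "sin 0 - 0 / 2 \<le> sin x - x / 2"
    proof (rule DERIV_nonneg_imp_nondecreasing[OF that(1)])
      fix y :: real assume y: "0 \<le> y" "y \<le> x"
      have "cos y \<ge> cos (pi/3)"
        using y that pi3 by (intro cos_monotone_0_pi_le) auto
      hence "cos y - 1/2 \<ge> 0" by (simp add: cos_60)
      moreover have "((\<lambda>x. sin x - x / 2) has_real_derivative (cos y - 1/2)) (at y)"
        by (auto intro!: derivative_eq_intros)
      ultimately show "\<exists>d. ((\<lambda>x. sin x - x / 2) has_real_derivative d) (at y) \<and> 0 \<le> d" by blast
    qed
    thus ?thesis by simp
  qed
  have "pi * t / 2 \<le> sin (pi * t)"
  proof (cases "pi * t \<le> pi / 3")
    case True
    thus ?thesis using half[of "pi*t"] assms by simp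
  next
    case False
    \<comment> \<open>On the remaining range the sine is at least
      \<open>sqrt 3 / 2 \<ge> 0.85\<close>, while
      \<open>pi * t / 2 \<le> pi / 4 < 0.8\<close>.\<close>
    have "sin (pi/3) \<le> sin (pi * t)"
      using False assms by (intro sin_monotone_2pi_le) (auto simp: field_simps)
    moreover have "sin (pi/3) = sqrt 3 / 2" by (simp add: sin_60)
    moreover have "sqrt 3 \<ge> 1.7" by (rule real_le_rsqrt) (simp add: power2_eq_square)
    moreover have "pi * t \<le> pi * (1/2)" using assms by (intro mult_left_mono) auto
    moreover have "pi < 3.2" using pi_approx by simp
    ultimately show ?thesis by linarith
  qed
  moreover have "2 * t \<le> pi * t" using assms pi3 by (intro mult_right_mono) auto
  ultimately show ?thesis by simp
qed

lemma sin_pi_ge':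
  assumes "d \<le> t" "t \<le> 1 - d" "0 \<le> d"
  shows "d \<le> sin (pi * t)"
proof (cases "t \<le> 1/2")
  case True thus ?thesis using sin_pi_ge[of t] assms by simp
next
  case False
  have "sin (pi * (1 - t)) = sin (pi * t)"
    using sin_pi_minus[of "pi * t"] by (simp add: algebra_simps)
  thus ?thesis using sin_pi_ge[of "1 - t"] assms False by simp
qed

lemma ee_minus_one: "ee t - 1 = 2 * \<i> * sin (pi * t) * cis (pi * t)"
proof -
  have "cos (2 * pi * t) = 1 - 2 * (sin (pi * t))^2" "sin (2 * pi * t) = 2 * sin (pi * t) * cos (pi * t)"
    using cos_double_sin[of "pi * t"] sin_double[of "pi * t"] by (simp_all add: mult.assoc)
  thus ?thesis by (simp add: complex_eq_iff ee_def power2_eq_square)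
qed

lemma norm_ee_minus_one: "norm (ee t - 1) = 2 * \<bar>sin (pi * t)\<bar>"
  by (simp add: ee_minus_one norm_mult)

lemma finite_nat_le_real: "finite {n :: nat. real n \<le> x}"
  by (rule finite_subset[of _ "{..nat \<lfloor>x\<rfloor>}"]) (auto simp: le_nat_floor)

lemma real_nat_div_ge: "real n / real d - 1 \<le> real (n div d)"
  using real_of_int_div3[of "int n" "int d"] by (simp flip: of_nat_div)

section \<open>Exponential sums with monotone phase differences\<close>

text \<open>The value of \<open>1 / (ee t - 1)\<close>. Its real part is constant, so differences of
  two values are purely imaginary and are controlled by the monotone function
  \<open>cot\<close>.\<close>

definition inverse_ee_minus_one :: "real \<Rightarrow> complex" where
  "inverse_ee_minus_one t = Complex (- 1 / 2) (- cot (pi * t) / 2)"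

lemma inverse_ee_minus_one_mult:
  assumes "sin (pi * t) \<noteq> 0"
  shows "inverse_ee_minus_one t * (ee t - 1) = 1"
proof -
  have "cos (pi * t) * cos (pi * t) = 1 - sin (pi * t) * sin (pi * t)"
    using sin_cos_squared_add[of "pi * t"] by (simp add: power2_eq_square)
  hence "cot (pi * t) * (sin (pi * t) * cos (pi * t)) = 1 - sin (pi * t) * sin (pi * t)"
    "cot (pi * t) * (sin (pi * t) * sin (pi * t)) = sin (pi * t) * cos (pi * t)"
    using assms by (simp_all add: cot_def)
  thus ?thesis
    by (simp add: inverse_ee_minus_one_def ee_minus_one complex_eq_iff)
qed

lemma norm_inverse_ee_minus_one:
  assumes "0 < d" "d \<le> t" "t \<le> 1 - d"
  shows "norm (inverse_ee_minus_one t) \<le> 1 / (2 * d)"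
proof -
  have s: "d \<le> sin (pi * t)" using sin_pi_ge'[of d t] assms by simp
  hence "norm (inverse_ee_minus_one t) * (2 * sin (pi * t)) = 1"
    using inverse_ee_minus_one_mult[of t] norm_mult[of "inverse_ee_minus_one t" "ee t - 1"] norm_ee_minus_one[of t] assms by auto
  hence "norm (inverse_ee_minus_one t) = 1 / (2 * sin (pi * t))" using s assms by (simp add: field_simps)
  also have "\<dots> \<le> 1 / (2 * d)" using s assms by (intro divide_left_mono) auto
  finally show ?thesis .
qed

lemma cot_pi_antimono:
  assumes "0 < s" "s \<le> t" "t < 1"
  shows "cot (pi * t) \<le> cot (pi * s)"
proof -
  have pos: "sin (pi * s) > 0" "sin (pi * t) > 0"
    using assms by (auto intro!: sin_gt_zero)
  have "0 \<le> sin (pi * t - pi * s)"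
  proof (rule sin_ge_zero)
    show "0 \<le> pi * t - pi * s" using assms by simp
    have "pi * (t - s) \<le> pi * 1" using assms by (intro mult_left_mono) auto
    thus "pi * t - pi * s \<le> pi" by (simp add: algebra_simps)
  qed
  thus ?thesis using pos by (simp add: cot_def sin_diff field_simps)
qed

lemma abs_cot_pi:
  assumes "0 < d" "d \<le> t" "t \<le> 1 - d"
  shows "\<bar>cot (pi * t)\<bar> \<le> 1 / d"
proof -
  have s: "d \<le> sin (pi * t)" using sin_pi_ge'[of d t] assms by simp
  have "\<bar>cot (pi * t)\<bar> = \<bar>cos (pi * t)\<bar> / sin (pi * t)"
    using s assms by (simp add: cot_def abs_divide)
  also have "\<dots> \<le> 1 / d" using s assms by (intro frac_le) auto
  finally show ?thesis .
qed

text \<open>Kusmin-Landau inequality by partial summation: with \<open>g n = f (Suc n) - f n\<close>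
  each term equals \<open>inverse_ee_minus_one (g n) * (ee (f (Suc n)) - ee (f n))\<close>. The
  coefficients move monotonically along a vertical line, so their total variation telescopes to half
  a difference of two cotangents, which is at most \<open>1 / d\<close>.\<close>

lemma kusmin_landau_0:
  fixes f :: "nat \<Rightarrow> real"
  assumes d: "0 < d" "d \<le> 1" and "a \<le> b"
    and rng: "\<And>n. a \<le> n \<Longrightarrow> n < b \<Longrightarrow> d \<le> f (Suc n) - f n \<and> f (Suc n) - f n \<le> 1 - d"
    and mono: "\<And>n. a \<le> n \<Longrightarrow> Suc n < b \<Longrightarrow> f (Suc n) - f n \<le> f (Suc (Suc n)) - f (Suc n)"
  shows "norm (\<Sum>n=a..b. ee (f n)) \<le> 3 / d"
proof (cases "a = b")
  case True
  thus ?thesis using d by (simp add: field_simps)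
next
  case False
  define g where "g n = f (Suc n) - f n" for n
  \<comment> \<open>Both boundary terms of the partial summation are kept inside the norm, so that a
    step of the induction adds exactly the variation of the coefficient between \<open>j\<close> and
    \<open>Suc j\<close>.\<close>
  have key: "norm ((\<Sum>n=a..j. ee (f n)) - inverse_ee_minus_one (g j) * ee (f (Suc j)) + inverse_ee_minus_one (g a) * ee (f a))
      \<le> (cot (pi * g a) - cot (pi * g j)) / 2" if "a \<le> j" "j < b" for j
    using that
  proof (induction j rule: dec_induct)
    case base
    have "sin (pi * g a) \<noteq> 0" using sin_pi_ge'[of d "g a"] rng[of a] base d by (auto simp: g_def)
    hence "inverse_ee_minus_one (g a) * (ee (g a) - 1) = 1" by (rule inverse_ee_minus_one_mult)
    moreover have "ee (f (Suc a)) = ee (g a) * ee (f a)" by (simp add: g_def flip: ee_add)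
    ultimately have "inverse_ee_minus_one (g a) * (ee (f (Suc a)) - ee (f a)) = ee (f a)"
      by (metis (no_types, lifting) left_diff_distrib mult.assoc mult_1)
    thus ?case by (simp add: algebra_simps)
  next
    case (step j)
    have IH: "norm ((\<Sum>n=a..j. ee (f n)) - inverse_ee_minus_one (g j) * ee (f (Suc j)) + inverse_ee_minus_one (g a) * ee (f a))
      \<le> (cot (pi * g a) - cot (pi * g j)) / 2" using step by simp
    let ?k = "Suc j"
    have r: "d \<le> g ?k" "g ?k \<le> 1 - d" "d \<le> g j" "g j \<le> g ?k"
      using rng[of ?k] rng[of j] mono[of j] step by (auto simp: g_def)
    have "sin (pi * g ?k) \<noteq> 0" using sin_pi_ge'[of d "g ?k"] r d by auto
    hence "inverse_ee_minus_one (g ?k) * (ee (g ?k) - 1) = 1" by (rule inverse_ee_minus_one_mult)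
    moreover have "ee (f (Suc ?k)) = ee (g ?k) * ee (f ?k)" by (simp add: g_def flip: ee_add)
    ultimately have eq: "inverse_ee_minus_one (g ?k) * (ee (f (Suc ?k)) - ee (f ?k)) = ee (f ?k)"
      by (metis (no_types, lifting) left_diff_distrib mult.assoc mult_1)
    have "(\<Sum>n=a..?k. ee (f n)) = (\<Sum>n=a..j. ee (f n)) + ee (f ?k)"
      using step by simp
    hence "(\<Sum>n=a..?k. ee (f n)) - inverse_ee_minus_one (g ?k) * ee (f (Suc ?k)) + inverse_ee_minus_one (g a) * ee (f a)
      = ((\<Sum>n=a..j. ee (f n)) - inverse_ee_minus_one (g j) * ee (f (Suc j)) + inverse_ee_minus_one (g a) * ee (f a))
        + (inverse_ee_minus_one (g j) - inverse_ee_minus_one (g ?k)) * ee (f ?k)"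
      using eq by (simp add: algebra_simps)
    also have "norm \<dots> \<le> (cot (pi * g a) - cot (pi * g j)) / 2 + norm (inverse_ee_minus_one (g j) - inverse_ee_minus_one (g ?k))"
      by (rule order_trans[OF norm_triangle_ineq]) (use IH in \<open>simp add: norm_mult\<close>)
    also have "inverse_ee_minus_one (g j) - inverse_ee_minus_one (g ?k) = \<i> * of_real ((cot (pi * g ?k) - cot (pi * g j)) / 2)"
      by (simp add: inverse_ee_minus_one_def complex_eq_iff field_simps)
    also have "norm \<dots> = (cot (pi * g j) - cot (pi * g ?k)) / 2"
      using cot_pi_antimono[of "g j" "g ?k"] r d by (simp add: norm_mult del: of_real_divide)
    finally show ?case by (simp add: field_simps)
  qed
  define j where "j = b - 1"
  have j: "a \<le> j" "j < b" "b = Suc j" using False assms(3) by (auto simp: j_def)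
  have rj: "d \<le> g j" "g j \<le> 1 - d" "d \<le> g a" "g a \<le> 1 - d"
    using rng[of j] rng[of a] j by (auto simp: g_def)
  let ?S = "\<Sum>n=a..j. ee (f n)"
  let ?X = "?S - inverse_ee_minus_one (g j) * ee (f (Suc j)) + inverse_ee_minus_one (g a) * ee (f a)"
  have "(\<Sum>n=a..b. ee (f n)) = ?X + inverse_ee_minus_one (g j) * ee (f (Suc j)) - inverse_ee_minus_one (g a) * ee (f a) + ee (f b)"
    using j by simp
  also have "norm \<dots> \<le> norm ?X + norm (inverse_ee_minus_one (g j) * ee (f (Suc j))) + norm (inverse_ee_minus_one (g a) * ee (f a)) + norm (ee (f b))"
    by (meson add_mono norm_triangle_ineq norm_triangle_ineq4 norm_triangle_le norm_triangle_le_diff order_refl)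
  also have "\<dots> \<le> 3 * (1 / d)"
  proof -
    have "norm (inverse_ee_minus_one (g j) * ee (f (Suc j))) \<le> (1 / d) / 2" "norm (inverse_ee_minus_one (g a) * ee (f a)) \<le> (1 / d) / 2"
      using norm_inverse_ee_minus_one[of d "g j"] norm_inverse_ee_minus_one[of d "g a"] rj d by (simp_all add: norm_mult)
    moreover have "1 \<le> 1 / d" using d by simp
    moreover have "norm ?X \<le> 1 / d"
    proof -
      have "norm ?X \<le> (cot (pi * g a) - cot (pi * g j)) / 2" by (rule key[OF j(1,2)])
      moreover have "cot (pi * g a) \<le> 1 / d" "- cot (pi * g j) \<le> 1 / d"
        using abs_cot_pi[OF d(1) rj(3,4)] abs_cot_pi[OF d(1) rj(1,2)] by (simp_all add: abs_le_iff)
      ultimately show ?thesis by (simp add: field_simps)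
    qed
    ultimately have "norm ?X + norm (inverse_ee_minus_one (g j) * ee (f (Suc j))) + norm (inverse_ee_minus_one (g a) * ee (f a)) + norm (ee (f b))
       \<le> 1 / d + (1 / d) / 2 + (1 / d) / 2 + 1 / d"
      by (intro add_mono) simp_all
    thus ?thesis by simp
  qed
  also have "\<dots> = 3 / d" using d by (simp add: field_simps)
  finally show ?thesis .
qed

lemma kusmin_landau:
  fixes f :: "nat \<Rightarrow> real" and k :: int and d :: real
  assumes d: "0 < d" "d \<le> 1" and "a \<le> b"
    and rng: "\<And>n. a \<le> n \<Longrightarrow> n < b \<Longrightarrow> k + d \<le> f (Suc n) - f n \<and> f (Suc n) - f n \<le> k + 1 - d"
    and mono: "\<And>n. a \<le> n \<Longrightarrow> Suc n < b \<Longrightarrow> f (Suc n) - f n \<le> f (Suc (Suc n)) - f (Suc n)"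
  shows "norm (\<Sum>n=a..b. ee (f n)) \<le> 3 / d"
proof -
  have "ee (f n - k * n) = ee (f n)" for n
    using ee_add_int[of "f n" "- k * int n"] by simp
  moreover have "norm (\<Sum>n=a..b. ee (f n - k * n)) \<le> 3 / d"
  proof (rule kusmin_landau_0[OF d \<open>a \<le> b\<close>])
    have e: "(f (Suc n) - of_int (k * int (Suc n))) - (f n - of_int (k * int n)) = (f (Suc n) - f n) - k" for n
      by (simp add: algebra_simps)
    fix n assume n: "a \<le> n"
    show "d \<le> (f (Suc n) - of_int (k * int (Suc n))) - (f n - of_int (k * int n)) \<and>
        (f (Suc n) - of_int (k * int (Suc n))) - (f n - of_int (k * int n)) \<le> 1 - d" if "n < b"
      unfolding e using rng[OF n that] by linarith
    show "(f (Suc n) - of_int (k * int (Suc n))) - (f n - of_int (k * int n))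
        \<le> (f (Suc (Suc n)) - of_int (k * int (Suc (Suc n)))) - (f (Suc n) - of_int (k * int (Suc n)))" if "Suc n < b"
      unfolding e using mono[OF n that] by linarith
  qed
  ultimately show ?thesis by simp
qed

lemma convex_nat_set_interval:
  fixes S :: "nat set"
  assumes "finite S" "S \<noteq> {}" and conv: "\<And>m n k. m \<in> S \<Longrightarrow> k \<in> S \<Longrightarrow> m \<le> n \<Longrightarrow> n \<le> k \<Longrightarrow> n \<in> S"
  obtains p q where "p \<le> q" "S = {p..q}"
proof (rule that[of "Min S" "Max S"])
  show "Min S \<le> Max S" using assms(1,2) by simp
  have mm: "Min S \<in> S" "Max S \<in> S" using assms(1,2) by simp_all
  show "S = {Min S..Max S}"
  proof (intro equalityI subsetI)
    fix n assume "n \<in> S"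
    thus "n \<in> {Min S..Max S}" using assms(1) by simp
  next
    fix n assume "n \<in> {Min S..Max S}"
    hence "Min S \<le> n" "n \<le> Max S" by (simp_all only: atLeastAtMost_iff)
    thus "n \<in> S" by (rule conv[OF mm])
  qed
qed

text \<open>Van der Corput's second derivative test in terms of differences. The slopes
  \<open>g\<close> grow by between \<open>lam\<close> and \<open>mu\<close> per step, so they meet
  at most \<open>mu * (b - a) + 2\<close> unit intervals. Within one of these, the few points with
  slope near an integer are counted trivially and the others are handled by
  \<open>kusmin_landau\<close>. The value \<open>f b\<close> enters as the endpoint of the last
  slope although \<open>b\<close> is not summed.\<close>

lemma second_difference_test_interval:
  fixes f :: "nat \<Rightarrow> real"
  assumes lam: "0 < lam" "lam \<le> 1" and mu: "0 \<le> mu" and "a < b"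
    and sd: "\<And>n. a \<le> n \<Longrightarrow> Suc n < b \<Longrightarrow> lam \<le> f (n + 2) - 2 * f (n + 1) + f n \<and> f (n + 2) - 2 * f (n + 1) + f n \<le> mu"
  shows "norm (\<Sum>n=a..<b. ee (f n)) \<le> (mu * (real b - real a) + 2) * (9 / sqrt lam)"
proof -
  define g where "g n = f (Suc n) - f n" for n
  have glow: "g m + lam * (real n - real m) \<le> g n" if "a \<le> m" "m \<le> n" "n < b" for m n
    using that(2,1,3)
  proof (induction n rule: dec_induct)
    case (step n)
    thus ?case using sd[of n] by (simp add: g_def algebra_simps)
  qed simp
  have gup: "g n \<le> g a + mu * (real n - real a)" if "a \<le> n" "n < b" for n
    using that
  proof (induction n rule: dec_induct)
    case (step n)
    thus ?case using sd[of n] by (simp add: g_def algebra_simps)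
  qed simp
  have gmono: "g m \<le> g n" if "a \<le> m" "m \<le> n" "n < b" for m n
  proof -
    have "0 \<le> lam * (real n - real m)" using lam that by simp
    thus ?thesis using glow[OF that] by linarith
  qed
  \<comment> \<open>This width balances the number of points near an integer, about
    \<open>d / lam\<close>, against the bound \<open>3 / d\<close> for the others.\<close>
  define d where "d = sqrt lam / 2"
  have sq: "0 < sqrt lam" "sqrt lam \<le> 1" "sqrt lam * sqrt lam = lam" using lam by auto
  have d: "0 < d" "d \<le> 1/2" using sq by (auto simp: d_def)
  have card_le: "real (card A) \<le> w / lam + 1"
    if A: "A \<subseteq> {a..<b}" "\<And>m n. m \<in> A \<Longrightarrow> n \<in> A \<Longrightarrow> g n - g m \<le> w" "w \<ge> 0" for A w
  proof (cases "A = {}")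
    case True thus ?thesis using that lam by simp
  next
    case False
    have fin: "finite A" using A(1) finite_subset by blast
    have mm: "Min A \<in> A" "Max A \<in> A" "Min A \<le> Max A" using False fin by auto
    have "A \<subseteq> {Min A..Max A}" using fin by auto
    hence "card A \<le> Suc (Max A) - Min A" by (metis card_atLeastAtMost card_mono finite_atLeastAtMost)
    hence "real (card A) \<le> real (Max A) - real (Min A) + 1" using mm by linarith
    moreover have "lam * (real (Max A) - real (Min A)) \<le> w"
    proof -
      have "Min A \<ge> a" "Max A < b" using mm(1,2) A(1) by (auto simp: subset_iff)
      thus ?thesis using glow[of "Min A" "Max A"] A(2)[OF mm(1,2)] mm(3) by linarith
    qed
    hence "real (Max A) - real (Min A) \<le> w / lam" using lam by (simp add: field_simps)
    ultimately show ?thesis by linarith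
  qed
  have bound: "norm (\<Sum>n | n \<in> {a..<b} \<and> \<lfloor>g n\<rfloor> = k. ee (f n)) \<le> 9 / sqrt lam" for k :: int
  proof -
    let ?N = "{n. n \<in> {a..<b} \<and> \<lfloor>g n\<rfloor> = k}"
    let ?A = "{n \<in> ?N. g n < k + d}" and ?B = "{n \<in> ?N. k + d \<le> g n \<and> g n \<le> k + 1 - d}"
      and ?C = "{n \<in> ?N. g n > k + 1 - d}"
    have fin: "finite ?A" "finite ?B" "finite ?C" by auto
    have N: "?N = ?A \<union> (?B \<union> ?C)" using d by auto
    have disj: "?A \<inter> (?B \<union> ?C) = {}" "?B \<inter> ?C = {}" using d by auto
    have "(\<Sum>n\<in>?N. ee (f n)) = (\<Sum>n\<in>?A \<union> (?B \<union> ?C). ee (f n))"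
      using N by (rule arg_cong)
    also have "\<dots> = (\<Sum>n\<in>?A. ee (f n)) + (\<Sum>n\<in>?B \<union> ?C. ee (f n))"
      by (rule sum.union_disjoint) (use fin disj in simp_all)
    finally have eq1: "(\<Sum>n\<in>?N. ee (f n)) = (\<Sum>n\<in>?A. ee (f n)) + (\<Sum>n\<in>?B \<union> ?C. ee (f n))" .
    have eq2: "(\<Sum>n\<in>?B \<union> ?C. ee (f n)) = (\<Sum>n\<in>?B. ee (f n)) + (\<Sum>n\<in>?C. ee (f n))"
      by (rule sum.union_disjoint) (use fin disj in simp_all)
    have "norm (\<Sum>n\<in>?N. ee (f n)) \<le> norm (\<Sum>n\<in>?A. ee (f n)) + (norm (\<Sum>n\<in>?B. ee (f n)) + norm (\<Sum>n\<in>?C. ee (f n)))"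
      unfolding eq1 eq2 by (rule norm_triangle_mono[OF order_refl norm_triangle_ineq])
    also have "\<dots> \<le> (d / lam + 1) + (3 / d + (d / lam + 1))"
    proof (intro add_mono)
      have triv: "norm (\<Sum>n\<in>X. ee (f n)) \<le> card X" for X
        by (rule order_trans[OF norm_sum]) simp
      show "norm (\<Sum>n\<in>?A. ee (f n)) \<le> d / lam + 1"
      proof (rule order_trans[OF triv], rule card_le)
        show "?A \<subseteq> {a..<b}" by auto
        show "g n - g m \<le> d" if "m \<in> ?A" "n \<in> ?A" for m n
        proof -
          have "real_of_int k \<le> g m" using that by (auto simp: floor_eq_iff)
          thus ?thesis using that by auto
        qed
      qed (use d in auto)
      show "norm (\<Sum>n\<in>?C. ee (f n)) \<le> d / lam + 1"
      proof (rule order_trans[OF triv], rule card_le)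
        show "?C \<subseteq> {a..<b}" by auto
        show "g n - g m \<le> d" if "m \<in> ?C" "n \<in> ?C" for m n
        proof -
          have "g n < real_of_int k + 1" using that by (auto simp: floor_eq_iff)
          thus ?thesis using that by auto
        qed
      qed (use d in auto)
      show "norm (\<Sum>n\<in>?B. ee (f n)) \<le> 3 / d"
      proof (cases "?B = {}")
        case True thus ?thesis unfolding True using d by simp
      next
        case False
        obtain p q where pq: "p \<le> q" "?B = {p..q}"
        proof (rule convex_nat_set_interval[OF fin(2) False])
          fix m n l assume ml: "m \<in> ?B" "l \<in> ?B" "m \<le> n" "n \<le> l"
          have "g m \<le> g n" "g n \<le> g l" using ml by (auto intro!: gmono)
          moreover have "a \<le> n" "n < b" using ml by auto
          ultimately show "n \<in> ?B" using ml d by (auto simp: floor_eq_iff)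
        qed
        have in_B: "k + d \<le> g n \<and> g n \<le> k + 1 - d \<and> a \<le> n \<and> n < b" if "p \<le> n" "n \<le> q" for n
        proof -
          have "n \<in> ?B" unfolding pq(2) using that by simp
          thus ?thesis by auto
        qed
        have "norm (\<Sum>n=p..q. ee (f n)) \<le> 3 / d"
        proof (rule kusmin_landau[where k = k])
          show "k + d \<le> f (Suc n) - f n \<and> f (Suc n) - f n \<le> k + 1 - d" if "p \<le> n" "n < q" for n
            using in_B[of n] that by (simp add: g_def)
          show "f (Suc n) - f n \<le> f (Suc (Suc n)) - f (Suc n)" if "p \<le> n" "Suc n < q" for n
            using gmono[of n "Suc n"] in_B[of n] in_B[of "Suc n"] that unfolding g_def by simp
        qed (use d pq in auto)
        thus ?thesis unfolding pq(2) .
      qed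
    qed
    \<comment> \<open>The two edge pieces give \<open>1 / (2 * sqrt lam) + 1\<close> each, the
      middle one gives \<open>6 / sqrt lam\<close>.\<close>
    also have "\<dots> = 7 / sqrt lam + 2"
    proof -
      have "d / lam = 1 / (2 * sqrt lam)"
        using sq lam by (subst sq(3) [symmetric]) (simp add: d_def field_simps)
      thus ?thesis using sq by (simp add: d_def)
    qed
    also have "\<dots> \<le> 9 / sqrt lam" using sq by (simp add: field_simps)
    finally show ?thesis .
  qed
  let ?K = "(\<lambda>n. \<lfloor>g n\<rfloor>) ` {a..<b}"
  have "(\<Sum>n=a..<b. ee (f n)) = (\<Sum>k\<in>?K. \<Sum>n | n \<in> {a..<b} \<and> \<lfloor>g n\<rfloor> = k. ee (f n))"
    by (rule sum.image_gen) simp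
  also have "norm \<dots> \<le> (\<Sum>k\<in>?K. 9 / sqrt lam)"
    by (intro sum_norm_le bound)
  also have "\<dots> = card ?K * (9 / sqrt lam)" by simp
  also have "\<dots> \<le> (mu * (real b - real a) + 2) * (9 / sqrt lam)"
  proof (intro mult_right_mono)
    have b1: "a \<le> b - 1" "b - 1 < b" using \<open>a < b\<close> by auto
    have "?K \<subseteq> {\<lfloor>g a\<rfloor>..\<lfloor>g (b - 1)\<rfloor>}"
      using gmono b1 by (auto intro!: floor_mono)
    hence "card ?K \<le> card {\<lfloor>g a\<rfloor>..\<lfloor>g (b - 1)\<rfloor>}" by (intro card_mono) auto
    also have "\<dots> = nat (\<lfloor>g (b - 1)\<rfloor> - \<lfloor>g a\<rfloor> + 1)" by simp
    finally have "real (card ?K) \<le> real_of_int (\<lfloor>g (b - 1)\<rfloor> - \<lfloor>g a\<rfloor> + 1)"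
      using gmono[of a "b-1"] b1 floor_mono[of "g a" "g (b-1)"] by linarith
    also have "\<dots> \<le> g (b - 1) - g a + 2" by linarith
    also have "\<dots> \<le> mu * (real (b - 1) - real a) + 2" using gup[of "b - 1"] b1 by simp
    also have "\<dots> \<le> mu * (real b - real a) + 2"
      using mu b1 by (auto intro!: mult_left_mono)
    finally show "real (card ?K) \<le> mu * (real b - real a) + 2" .
  qed (use lam in auto)
  finally show ?thesis .
qed

text \<open>The hypotheses only concern points of \<open>S\<close>, so the maximum of
  \<open>S\<close> plays the role of the unsummed endpoint in the interval version. It is added back
  afterwards at a cost of 1, which turns the 2 into a 3.\<close>

lemma second_difference_test:
  fixes f :: "nat \<Rightarrow> real"
  assumes lam: "0 < lam" "lam \<le> 1" and mu: "0 \<le> mu" and fin: "finite S"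
    and conv: "\<And>m n k. m \<in> S \<Longrightarrow> k \<in> S \<Longrightarrow> m \<le> n \<Longrightarrow> n \<le> k \<Longrightarrow> n \<in> S"
    and sd: "\<And>n. n \<in> S \<Longrightarrow> n + 2 \<in> S \<Longrightarrow> lam \<le> f (n + 2) - 2 * f (n + 1) + f n \<and> f (n + 2) - 2 * f (n + 1) + f n \<le> mu"
  shows "norm (\<Sum>n\<in>S. ee (f n)) \<le> (mu * real (card S) + 3) * (9 / sqrt lam)"
proof (cases "S = {}")
  case True
  thus ?thesis using lam by simp
next
  case False
  obtain p q where pq: "p \<le> q" and S: "S = {p..q}"
    using convex_nat_set_interval[OF fin False conv] .
  have card: "card S = Suc q - p" by (simp add: S)
  have sq: "0 < sqrt lam" "sqrt lam \<le> 1" using lam by auto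
  have "sqrt lam \<le> 9" using sq by linarith
  hence one: "1 \<le> 9 / sqrt lam" using sq(1) by (simp add: le_divide_eq)
  have "(\<Sum>n\<in>S. ee (f n)) = (\<Sum>n=p..q. ee (f n))" by (simp only: S)
  also have "\<dots> = (\<Sum>n=p..<q. ee (f n)) + ee (f q)"
    using pq by (metis atLeastLessThanSuc_atLeastAtMost sum.atLeastLessThan_Suc)
  also have "norm \<dots> \<le> (mu * real (card S) + 2) * (9 / sqrt lam) + 1"
  proof (rule norm_triangle_mono)
    show "norm (\<Sum>n=p..<q. ee (f n)) \<le> (mu * real (card S) + 2) * (9 / sqrt lam)"
    proof (cases "p = q")
      case True
      thus ?thesis using mu lam by simp
    next
      case False
      have "norm (\<Sum>n=p..<q. ee (f n)) \<le> (mu * (real q - real p) + 2) * (9 / sqrt lam)"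
      proof (rule second_difference_test_interval[OF lam mu])
        show "p < q" using False pq by simp
        fix n assume n: "p \<le> n" "Suc n < q"
        have "n \<in> S" "n + 2 \<in> S" using n by (simp_all add: S)
        thus "lam \<le> f (n + 2) - 2 * f (n + 1) + f n \<and> f (n + 2) - 2 * f (n + 1) + f n \<le> mu"
          by (rule sd)
      qed
      also have "\<dots> \<le> (mu * real (card S) + 2) * (9 / sqrt lam)"
        using mu lam pq by (intro mult_right_mono add_right_mono mult_left_mono) (auto simp: card)
      finally show ?thesis .
    qed
  qed simp
  also have "\<dots> \<le> (mu * real (card S) + 3) * (9 / sqrt lam)"
    using one by (simp add: algebra_simps)
  finally show ?thesis .
qed

section \<open>Trigonometric approximation of the sawtooth function\<close>

definition psi :: "real \<Rightarrow> real" where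
  "psi t = t - of_int \<lfloor>t\<rfloor> - 1 / 2"

text \<open>The truncated Fourier series of \<open>- psi\<close>. Hence the truncation error appears
  below as \<open>psi + sawtooth_poly\<close>, with a plus sign.\<close>

definition sawtooth_poly :: "nat \<Rightarrow> real \<Rightarrow> real" where
  "sawtooth_poly H t = (\<Sum>h=1..H. sin (2 * pi * real h * t) / (pi * real h))"

lemma dirichlet_kernel:
  "(1 + 2 * (\<Sum>h=1..H. cos (2 * pi * real h * s))) * sin (pi * s) = sin ((2 * real H + 1) * (pi * s))"
proof (induction H)
  case (Suc H)
  have e: "(2 * real (Suc H) + 1) * (pi * s) = 2 * pi * real (Suc H) * s + pi * s"
    "(2 * real H + 1) * (pi * s) = 2 * pi * real (Suc H) * s - pi * s"
    by (simp_all add: algebra_simps)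
  have "sin ((2 * real (Suc H) + 1) * (pi * s)) = sin ((2 * real H + 1) * (pi * s)) + 2 * cos (2 * pi * real (Suc H) * s) * sin (pi * s)"
    unfolding e sin_add sin_diff by simp
  also have "sin ((2 * real H + 1) * (pi * s)) = (1 + 2 * (\<Sum>h=1..H. cos (2 * pi * real h * s))) * sin (pi * s)"
    using Suc by simp
  finally show ?case by (simp add: distrib_right)
qed simp

text \<open>The derivative of the error \<open>g\<close> is the Dirichlet kernel
  \<open>sin (N * (pi * s)) / sin (pi * s)\<close> with \<open>N = 2 * H + 1\<close>. One
  integration by parts, carried out by comparing derivatives, splits off \<open>G\<close>. The
  derivative of \<open>g - G\<close> is dominated by that of \<open>P\<close>, so
  \<open>P + (g - G)\<close> and \<open>P - (g - G)\<close> are both monotone and can be compared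
  with their common zero at \<open>1/2\<close>.\<close>

lemma sawtooth_poly_approx:
  assumes t: "0 < t" "t < 1"
  shows "\<bar>t - 1 / 2 + sawtooth_poly H t\<bar> \<le> 1 / ((2 * real H + 1) * sin (pi * t))"
proof -
  define N where "N = 2 * real H + 1"
  have N: "N > 0" by (simp add: N_def)
  have spos: "sin (pi * s) > 0" if "0 < s" "s < 1" for s
    using that by (auto intro!: sin_gt_zero)
  define g where "g s = s - 1 / 2 + sawtooth_poly H s" for s
  define G where "G s = - cos (N * (pi * s)) / (N * pi * sin (pi * s))" for s
  define P where "P s = - cot (pi * s) / (pi * N)" for s
  have dg: "(g has_real_derivative (sin (N * (pi * s)) / sin (pi * s))) (at s)" if "0 < s" "s < 1" for s
  proof -
    have "(g has_real_derivative (1 + (\<Sum>h=1..H. cos (2 * pi * real h * s) * (2 * pi * real h) / (pi * real h)))) (at s)"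
      unfolding g_def sawtooth_poly_def
      by (auto intro!: derivative_eq_intros sum.cong simp: field_simps)
    also have "(\<Sum>h=1..H. cos (2 * pi * real h * s) * (2 * pi * real h) / (pi * real h)) = 2 * (\<Sum>h=1..H. cos (2 * pi * real h * s))"
      by (simp add: sum_distrib_left field_simps)
    also have "1 + 2 * (\<Sum>h=1..H. cos (2 * pi * real h * s)) = sin (N * (pi * s)) / sin (pi * s)"
      using dirichlet_kernel[where H = H and s = s] spos[OF that] by (simp add: field_simps N_def)
    finally show ?thesis .
  qed
  have dG: "(G has_real_derivative (sin (N * (pi * s)) / sin (pi * s) + cos (N * (pi * s)) * cos (pi * s) / (N * (sin (pi * s))^2))) (at s)"
    if "0 < s" "s < 1" for s
    unfolding G_def using spos[OF that] N
    by (auto intro!: derivative_eq_intros simp: field_simps power2_eq_square)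
  have dP: "(P has_real_derivative (1 / (N * (sin (pi * s))^2))) (at s)" if "0 < s" "s < 1" for s
  proof -
    have "((\<lambda>s. cot (pi * s)) has_real_derivative (- inverse ((sin (pi * s))\<^sup>2) * pi)) (at s)"
      by (rule DERIV_chain2[OF DERIV_cot]) (use spos[OF that] in \<open>auto intro!: derivative_eq_intros\<close>)
    from DERIV_cdivide[OF DERIV_minus[OF this], of "pi * N"] show ?thesis
      unfolding P_def using spos[OF that] N by (simp add: field_simps)
  qed
  have bnd: "\<bar>cos (N * (pi * s)) * cos (pi * s) / (N * (sin (pi * s))^2)\<bar> \<le> 1 / (N * (sin (pi * s))^2)"
    if "0 < s" "s < 1" for s
  proof -
    have "\<bar>cos (N * (pi * s)) * cos (pi * s)\<bar> \<le> 1 * 1"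
      unfolding abs_mult by (intro mult_mono) auto
    thus ?thesis using N by (simp add: abs_divide divide_right_mono)
  qed
  have m1: "P a - (g a - G a) \<le> P b - (g b - G b)" if "0 < a" "a \<le> b" "b < 1" for a b
  proof (rule DERIV_nonneg_imp_nondecreasing[OF that(2)])
    fix s assume "a \<le> s" "s \<le> b"
    hence s: "0 < s" "s < 1" using that by auto
    note d = DERIV_diff[OF dP[OF s] DERIV_diff[OF dg[OF s] dG[OF s]]]
    show "\<exists>y. ((\<lambda>s. P s - (g s - G s)) has_real_derivative y) (at s) \<and> 0 \<le> y"
      by (rule exI, rule conjI, rule d) (use bnd[OF s] in \<open>simp only: abs_le_iff; linarith\<close>)
  qed
  have m2: "P a + (g a - G a) \<le> P b + (g b - G b)" if "0 < a" "a \<le> b" "b < 1" for a b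
  proof (rule DERIV_nonneg_imp_nondecreasing[OF that(2)])
    fix s assume "a \<le> s" "s \<le> b"
    hence s: "0 < s" "s < 1" using that by auto
    note d = DERIV_add[OF dP[OF s] DERIV_diff[OF dg[OF s] dG[OF s]]]
    show "\<exists>y. ((\<lambda>s. P s + (g s - G s)) has_real_derivative y) (at s) \<and> 0 \<le> y"
      by (rule exI, rule conjI, rule d) (use bnd[OF s] in \<open>simp only: abs_le_iff; linarith\<close>)
  qed
  \<comment> \<open>At the midpoint all three functions vanish: \<open>g\<close> because these sines
    are zero, \<open>G\<close> because \<open>N\<close> is odd, and \<open>P\<close> because the
    cotangent is zero.\<close>
  have "sin (2 * pi * real h * (1 / 2)) = 0" for h
    by (metis (no_types, opaque_lifting) mult.assoc mult.commute mult_2_right nonzero_mult_div_cancel_left sin_npi times_divide_eq_right mult.right_neutral zero_neq_numeral field_sum_of_halves)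
  hence g0: "g (1/2) = 0" by (simp add: g_def sawtooth_poly_def)
  have "cos (N * (pi * (1/2))) = 0"
    using cos_pi_half cos_zero_iff[of "N * (pi * (1/2))"] by (auto simp: N_def intro!: exI[of _ "2*H+1"])
  hence G0: "G (1/2) = 0" by (simp add: G_def)
  have P0: "P (1/2) = 0" by (simp add: P_def cot_def)
  have "\<bar>g t - G t\<bar> \<le> \<bar>P t\<bar>"
  proof (cases "t \<le> 1/2")
    case True
    thus ?thesis using m1[of t "1/2"] m2[of t "1/2"] t g0 G0 P0 by auto
  next
    case False
    thus ?thesis using m1[of "1/2" t] m2[of "1/2" t] t g0 G0 P0 by auto
  qed
  also have "\<bar>P t\<bar> \<le> 1 / (pi * N * sin (pi * t))"
    using N spos[OF t] by (simp add: P_def cot_def abs_divide abs_mult field_simps)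
  finally have "\<bar>g t\<bar> \<le> \<bar>G t\<bar> + 1 / (pi * N * sin (pi * t))" by linarith
  also have "\<bar>G t\<bar> \<le> 1 / (pi * N * sin (pi * t))"
    using N spos[OF t] by (simp add: G_def abs_divide abs_mult field_simps)
  also have "1 / (pi * N * sin (pi * t)) + 1 / (pi * N * sin (pi * t)) = (2 / pi) * (1 / (N * sin (pi * t)))"
    by simp
  also have "\<dots> \<le> 1 * (1 / (N * sin (pi * t)))"
    using N spos[OF t] pi_ge_two by (intro mult_right_mono) auto
  finally show ?thesis by (simp add: g_def N_def)
qed

lemma sawtooth_poly_add_int: "sawtooth_poly H (t + of_int k) = sawtooth_poly H t"
proof -
  have "sin (2 * pi * real h * (t + of_int k)) = sin (2 * pi * real h * t)" for h
  proof -
    have "2 * pi * real h * (t + of_int k) = 2 * pi * real h * t + 2 * pi * of_int (int h * k)"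
      by (simp add: algebra_simps)
    thus ?thesis by (simp only: sin_add sin_int_2pin cos_int_2pin)
  qed
  thus ?thesis by (simp add: sawtooth_poly_def)
qed

lemma psi_add_int [simp]: "psi (t + of_int k) = psi t"
  by (simp add: psi_def)

text \<open>Here \<open>\<bar>u\<bar>\<close> is the distance to the nearest integer, which bounds
  the sine from below; a negative \<open>u\<close> is moved into the unit interval by adding
  1.\<close>

lemma psi_approx:
  assumes u: "u \<noteq> 0" "\<bar>u\<bar> \<le> 1 / 2" and H: "H > 0"
  shows "\<bar>psi u + sawtooth_poly H u\<bar> \<le> 1 / (real H * \<bar>u\<bar>)"
proof -
  have aux: "1 / ((2 * real H + 1) * sin (pi * t)) \<le> 1 / (real H * \<bar>u\<bar>)"
    if "\<bar>u\<bar> \<le> t" "t \<le> 1 - \<bar>u\<bar>" for t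
  proof -
    have "\<bar>u\<bar> \<le> sin (pi * t)" using that by (intro sin_pi_ge') auto
    thus ?thesis using H u by (intro divide_left_mono mult_mono mult_pos_pos) auto
  qed
  show ?thesis
  proof (cases "u > 0")
    case True
    hence "psi u = u - 1 / 2" using u by (simp add: psi_def floor_eq_iff)
    thus ?thesis using sawtooth_poly_approx[of u H] aux[of u] True u by auto
  next
    case False
    have "psi u = u + 1 - 1 / 2"
    proof -
      have "\<lfloor>u\<rfloor> = -1" using u False by (simp add: floor_eq_iff)
      thus ?thesis by (simp add: psi_def)
    qed
    moreover have "sawtooth_poly H (u + 1) = sawtooth_poly H u"
      using sawtooth_poly_add_int[of H u 1] by simp
    ultimately show ?thesis
      using sawtooth_poly_approx[of "u + 1" H] aux[of "u + 1"] False u by auto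
  qed
qed

text \<open>Used within a distance of order \<open>1 / H\<close> from the jump, where the bound
  \<open>1 / (H * \<bar>u\<bar>)\<close> becomes useless.\<close>

lemma psi_approx_trivial: "\<bar>psi u + sawtooth_poly H u\<bar> \<le> 1 / 2 + 2 * real H * \<bar>u\<bar>"
proof -
  have "\<bar>sawtooth_poly H u\<bar> \<le> (\<Sum>h=1..H. \<bar>sin (2 * pi * real h * u) / (pi * real h)\<bar>)"
    unfolding sawtooth_poly_def by (rule sum_abs)
  also have "\<dots> \<le> (\<Sum>h=1..H. 2 * \<bar>u\<bar>)"
  proof (rule sum_mono)
    fix h assume h: "h \<in> {1..H}"
    have "\<bar>sin (2 * pi * real h * u)\<bar> \<le> \<bar>2 * pi * real h * u\<bar>" by (rule abs_sin_x_le_abs_x)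
    thus "\<bar>sin (2 * pi * real h * u) / (pi * real h)\<bar> \<le> 2 * \<bar>u\<bar>"
      using h by (simp add: abs_divide abs_mult field_simps)
  qed
  finally have "\<bar>sawtooth_poly H u\<bar> \<le> 2 * real H * \<bar>u\<bar>" by simp
  moreover have "\<bar>psi u\<bar> \<le> 1 / 2" unfolding psi_def by linarith
  ultimately show ?thesis by linarith
qed

section \<open>Fejer kernels as majorants of the truncation error\<close>

definition fejer :: "nat \<Rightarrow> real \<Rightarrow> real" where
  "fejer R t = (norm (\<Sum>r<R. ee (real r * t)))\<^sup>2 / real R"

lemma fejer_nonneg: "0 \<le> fejer R t"
  by (simp add: fejer_def)

lemma fejer_add_int: "fejer R (t + of_int k) = fejer R t"
proof -
  have "ee (real r * (t + of_int k)) = ee (real r * t)" for r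
    using ee_add_int[of "real r * t" "int r * k"] by (simp add: distrib_left)
  thus ?thesis by (simp add: fejer_def)
qed

text \<open>The kernel is normalised to have the value \<open>R\<close> at 0. For \<open>u\<close>
  this small all phases \<open>r * u\<close> stay within an eighth of a turn, so every summand has
  real part at least \<open>sqrt 2 / 2\<close>, and squaring leaves half of the maximal
  value.\<close>

lemma fejer_ge:
  assumes "R > 0" "\<bar>u\<bar> \<le> 1 / (8 * real R)"
  shows "real R / 2 \<le> fejer R u"
proof -
  have "sqrt 2 / 2 \<le> Re (ee (real r * u))" if "r < R" for r
  proof -
    have "\<bar>2 * pi * (real r * u)\<bar> \<le> 2 * pi * (real R * (1 / (8 * real R)))"
      using that assms(2) unfolding abs_mult by (intro mult_mono) auto
    also have "\<dots> = pi / 4" using assms by simp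
    finally have "cos (pi / 4) \<le> cos \<bar>2 * pi * (real r * u)\<bar>"
      using pi_gt_zero by (intro cos_monotone_0_pi_le) linarith+
    thus ?thesis by (simp add: ee_def cos_45)
  qed
  hence "(\<Sum>r<R. sqrt 2 / 2) \<le> (\<Sum>r<R. Re (ee (real r * u)))" by (intro sum_mono) auto
  also have "\<dots> = Re (\<Sum>r<R. ee (real r * u))" by simp
  also have "\<dots> \<le> norm (\<Sum>r<R. ee (real r * u))" by (rule complex_Re_le_cmod)
  finally have "(real R * (sqrt 2 / 2))\<^sup>2 \<le> (norm (\<Sum>r<R. ee (real r * u)))\<^sup>2"
    by (intro power_mono) auto
  thus ?thesis using assms by (simp add: fejer_def field_simps power2_eq_square)
qed

lemma fejer_1 [simp]: "fejer (Suc 0) t = 1"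
  by (simp add: fejer_def)

text \<open>Dominating the error by nonnegative trigonometric polynomials allows it to be summed over arbitrary points
  through exponential sums alone.\<close>

lemma psi_fejer_bound:
  "\<bar>psi t + sawtooth_poly (2 ^ J) t\<bar> \<le> 32 / 2 ^ J * (\<Sum>j\<le>J. fejer (2 ^ j) t)"
proof -
  define k where "k = round t"
  define u where "u = t - of_int k"
  have u2: "\<bar>u\<bar> \<le> 1 / 2" unfolding u_def k_def using of_int_round_abs_le[of t] by (simp add: abs_minus_commute)
  have t: "t = u + of_int k" by (simp add: u_def)
  have "\<bar>psi u + sawtooth_poly (2 ^ J) u\<bar> \<le> 32 / 2 ^ J * (\<Sum>j\<le>J. fejer (2 ^ j) u)"
  proof -
    have one: "32 / 2 ^ J * fejer (2 ^ j) u \<le> 32 / 2 ^ J * (\<Sum>j\<le>J. fejer (2 ^ j) u)" if "j \<le> J" for j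
      using that by (intro mult_left_mono member_le_sum) (auto simp: fejer_nonneg)
    \<comment> \<open>A single kernel suffices: the one with \<open>j = J\<close> next to the jump,
      the one with \<open>j = 0\<close> far from it, and otherwise the one whose width
      \<open>1 / (8 * 2 ^ j)\<close> exceeds \<open>\<bar>u\<bar>\<close> by at most a factor 2. In
      the last case \<open>1 / (2 ^ J * \<bar>u\<bar>) \<le> 16 * 2 ^ j / 2 ^ J\<close>, and the
      kernel is at least \<open>2 ^ j / 2\<close>, whence the constant 32.\<close>
    consider "\<bar>u\<bar> \<le> 1 / (8 * 2 ^ J)" | "\<bar>u\<bar> > 1 / 8" | "\<bar>u\<bar> \<le> 1 / 8" "\<not> \<bar>u\<bar> \<le> 1 / (8 * 2 ^ J)" by linarith
    thus ?thesis
    proof cases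
      case 1
      have "\<bar>psi u + sawtooth_poly (2 ^ J) u\<bar> \<le> 1 / 2 + 2 * 2 ^ J * (1 / (8 * 2 ^ J))"
        using psi_approx_trivial[of u "2 ^ J"] 1 mult_left_mono[OF 1, of "2 * 2 ^ J"] by simp
      also have "\<dots> \<le> 32 / 2 ^ J * (2 ^ J / 2)" by simp
      also have "\<dots> \<le> 32 / 2 ^ J * fejer (2 ^ J) u"
        using fejer_ge[of "2 ^ J" u] 1 by (intro mult_left_mono) auto
      finally show ?thesis using one[of J] by linarith
    next
      case 2
      have "\<bar>psi u + sawtooth_poly (2 ^ J) u\<bar> \<le> 1 / (2 ^ J * \<bar>u\<bar>)"
        using psi_approx[of u "2 ^ J"] 2 u2 by auto
      also have "\<dots> \<le> 1 / (2 ^ J * (1 / 8))" using 2 by (intro divide_left_mono mult_left_mono) auto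
      also have "\<dots> \<le> 32 / 2 ^ J * fejer (2 ^ 0) u" by (simp add: field_simps)
      finally show ?thesis using one[of 0] by linarith
    next
      case 3
      obtain j where j: "j < J" "\<bar>u\<bar> \<le> 1 / (8 * 2 ^ j)" "\<not> \<bar>u\<bar> \<le> 1 / (8 * 2 ^ Suc j)"
      proof -
        have "\<exists>j<J. \<bar>u\<bar> \<le> 1 / (8 * 2 ^ j) \<and> \<not> \<bar>u\<bar> \<le> 1 / (8 * 2 ^ Suc j)"
          using 3 by (induction J) (auto simp: less_Suc_eq)
        thus ?thesis using that by blast
      qed
      have upos: "\<bar>u\<bar> > 1 / (8 * 2 ^ Suc j)" using j by simp
      hence u0: "u \<noteq> 0" by auto
      have "\<bar>psi u + sawtooth_poly (2 ^ J) u\<bar> \<le> 1 / (2 ^ J * \<bar>u\<bar>)"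
        using psi_approx[of u "2 ^ J"] u0 u2 by auto
      also have "\<dots> \<le> 1 / (2 ^ J * (1 / (8 * 2 ^ Suc j)))"
        using upos u0 by (intro divide_left_mono mult_left_mono) auto
      also have "\<dots> = 32 / 2 ^ J * (2 ^ j / 2)" by simp
      also have "\<dots> \<le> 32 / 2 ^ J * fejer (2 ^ j) u"
        using fejer_ge[of "2 ^ j" u] j by (intro mult_left_mono) auto
      finally show ?thesis using one[of j] j by linarith
    qed
  qed
  thus ?thesis unfolding t by (simp only: psi_add_int sawtooth_poly_add_int fejer_add_int)
qed

lemma sum_abs_diff_le:
  fixes s :: "nat \<Rightarrow> real"
  assumes "\<And>h. s h \<ge> 0" "r < R"
  shows "(\<Sum>r'<R. s (nat \<bar>int r - int r'\<bar>)) \<le> 2 * (\<Sum>h<R. s h)"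
proof -
  have "(\<Sum>r'<R. s (nat \<bar>int r - int r'\<bar>)) = (\<Sum>r'\<in>{..<r}. s (nat \<bar>int r - int r'\<bar>)) + (\<Sum>r'\<in>{r..<R}. s (nat \<bar>int r - int r'\<bar>))"
    using assms(2) by (subst sum.union_disjoint [symmetric]) (auto intro!: sum.cong)
  also have "(\<Sum>r'\<in>{..<r}. s (nat \<bar>int r - int r'\<bar>)) = (\<Sum>h\<in>{1..r}. s h)"
    by (rule sum.reindex_bij_witness[of _ "\<lambda>h. r - h" "\<lambda>r'. r - r'"]) (auto simp: nat_minus_as_int)
  also have "\<dots> \<le> (\<Sum>h<R. s h)" using assms by (intro sum_mono2) auto
  also have "(\<Sum>r'\<in>{r..<R}. s (nat \<bar>int r - int r'\<bar>)) = (\<Sum>h<R - r. s h)"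
    by (rule sum.reindex_bij_witness[of _ "\<lambda>h. r + h" "\<lambda>r'. r' - r"]) (auto simp: nat_minus_as_int)
  also have "\<dots> \<le> (\<Sum>h<R. s h)" using assms by (intro sum_mono2) auto
  finally show ?thesis by simp
qed

text \<open>Expanding the square produces the frequencies \<open>r - r'\<close>. The coefficients
  \<open>c\<close> are real, so opposite frequencies have exponential sums of equal modulus, and for
  fixed \<open>r\<close> every value of \<open>\<bar>r - r'\<bar>\<close> occurs at most
  twice.\<close>

lemma fejer_sum_bound:
  fixes c t :: "'a \<Rightarrow> real"
  assumes "finite X" "R > 0"
  shows "(\<Sum>d\<in>X. c d * fejer R (t d)) \<le> 2 * (\<Sum>h<R. norm (\<Sum>d\<in>X. c d * ee (real h * t d)))"
proof -
  define s where "s h = norm (\<Sum>d\<in>X. c d * ee (real h * t d))" for h :: nat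
  have s': "norm (\<Sum>d\<in>X. c d * ee ((real r - real r') * t d)) = s (nat \<bar>int r - int r'\<bar>)" for r r' :: nat
  proof (cases "r' \<le> r")
    case True
    thus ?thesis by (simp add: s_def of_nat_diff nat_diff_distrib')
  next
    case False
    have "(real r - real r') * t d = - ((real r' - real r) * t d)" for d by (simp add: algebra_simps)
    hence "(\<Sum>d\<in>X. c d * ee ((real r - real r') * t d)) = cnj (\<Sum>d\<in>X. c d * ee ((real r' - real r) * t d))"
      by (simp only: ee_minus cnj_sum complex_cnj_mult complex_cnj_complex_of_real)
    hence "norm (\<Sum>d\<in>X. c d * ee ((real r - real r') * t d)) = norm (\<Sum>d\<in>X. c d * ee ((real r' - real r) * t d))"
      by (simp only: complex_mod_cnj)
    also have "\<dots> = s (r' - r)" using False by (simp add: s_def of_nat_diff)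
    also have "r' - r = nat \<bar>int r - int r'\<bar>" using False by auto
    finally show ?thesis .
  qed
  have "of_real (\<Sum>d\<in>X. c d * fejer R (t d)) = (\<Sum>d\<in>X. (\<Sum>r<R. \<Sum>r'<R. c d * ee ((real r - real r') * t d)) / of_nat R)"
    unfolding of_real_sum
  proof (rule sum.cong)
    fix d
    have "of_real (fejer R (t d)) = (\<Sum>r<R. ee (real r * t d)) * cnj (\<Sum>r<R. ee (real r * t d)) / of_nat R"
      by (simp add: fejer_def complex_norm_square flip: of_real_power)
    also have "(\<Sum>r<R. ee (real r * t d)) * cnj (\<Sum>r<R. ee (real r * t d)) = (\<Sum>r<R. \<Sum>r'<R. ee ((real r - real r') * t d))"
      by (simp add: sum_product cnj_sum left_diff_distrib ee_diff)
    finally show "of_real (c d * fejer R (t d)) = (\<Sum>r<R. \<Sum>r'<R. c d * ee ((real r - real r') * t d)) / of_nat R"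
      by (simp add: sum_distrib_left)
  qed simp
  also have "\<dots> = (\<Sum>r<R. \<Sum>r'<R. (\<Sum>d\<in>X. c d * ee ((real r - real r') * t d))) / of_nat R"
    unfolding sum_divide_distrib [symmetric]
    by (subst sum.swap, subst (2) sum.swap) simp
  finally have eq: "of_real (\<Sum>d\<in>X. c d * fejer R (t d)) = (\<Sum>r<R. \<Sum>r'<R. (\<Sum>d\<in>X. c d * ee ((real r - real r') * t d))) / of_nat R" .
  have "(\<Sum>d\<in>X. c d * fejer R (t d)) \<le> norm (complex_of_real (\<Sum>d\<in>X. c d * fejer R (t d)))"
    unfolding norm_of_real by (rule abs_ge_self)
  also have "\<dots> \<le> (\<Sum>r<R. \<Sum>r'<R. s (nat \<bar>int r - int r'\<bar>)) / real R"
    unfolding eq norm_divide norm_of_nat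
    by (intro divide_right_mono sum_norm_le) (auto simp: s')
  also have "\<dots> \<le> (\<Sum>r<R. 2 * (\<Sum>h<R. s h)) / real R"
    by (intro divide_right_mono sum_mono sum_abs_diff_le) (auto simp: s_def)
  also have "\<dots> = 2 * (\<Sum>h<R. s h)" using assms by simp
  finally show ?thesis by (simp add: s_def)
qed

text \<open>A weighted inequality of Erdos-Turan type. Nonnegative weights allow the pointwise
  majorant of the truncation error to be summed. The zero frequency of each kernel contributes the
  total weight over \<open>2 ^ J\<close>; the frequencies \<open>h < 2 ^ J\<close> carry a factor
  \<open>1 / 2 ^ J \<le> 1 / h\<close> and so merge with those of
  \<open>sawtooth_poly\<close>.\<close>

lemma psi_sum_bound:
  fixes c t :: "'a \<Rightarrow> real"
  assumes fin: "finite X" and c: "\<And>d. d \<in> X \<Longrightarrow> c d \<ge> 0"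
  shows "\<bar>\<Sum>d\<in>X. c d * psi (t d)\<bar>
     \<le> 65 * (real J + 1) * ((\<Sum>d\<in>X. c d) / 2 ^ J + (\<Sum>h=1..2^J. norm (\<Sum>d\<in>X. c d * ee (real h * t d)) / real h))"
proof -
  define s where "s h = norm (\<Sum>d\<in>X. c d * ee (real h * t d))" for h :: nat
  have s0: "s h \<ge> 0" for h by (simp add: s_def)
  let ?C = "\<Sum>d\<in>X. c d"
  let ?B = "\<Sum>h=1..2^J. s h / real h"
  have C0: "?C \<ge> 0" using c by (intro sum_nonneg)
  have B0: "?B \<ge> 0" using s0 by (intro sum_nonneg) auto
  have "\<bar>\<Sum>d\<in>X. c d * psi (t d)\<bar> \<le> \<bar>\<Sum>d\<in>X. c d * sawtooth_poly (2^J) (t d)\<bar>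
      + (\<Sum>d\<in>X. c d * \<bar>psi (t d) + sawtooth_poly (2^J) (t d)\<bar>)"
  proof -
    have "(\<Sum>d\<in>X. c d * psi (t d)) = (\<Sum>d\<in>X. c d * (psi (t d) + sawtooth_poly (2^J) (t d))) - (\<Sum>d\<in>X. c d * sawtooth_poly (2^J) (t d))"
      by (simp add: sum_subtractf [symmetric] algebra_simps)
    moreover have "\<bar>\<Sum>d\<in>X. c d * (psi (t d) + sawtooth_poly (2^J) (t d))\<bar> \<le> (\<Sum>d\<in>X. c d * \<bar>psi (t d) + sawtooth_poly (2^J) (t d)\<bar>)"
      by (rule order_trans[OF sum_abs]) (use c in \<open>auto simp: abs_mult intro!: sum_mono\<close>)
    ultimately show ?thesis by linarith
  qed
  also have "\<bar>\<Sum>d\<in>X. c d * sawtooth_poly (2^J) (t d)\<bar> \<le> ?B"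
  proof -
    have "(\<Sum>d\<in>X. c d * sawtooth_poly (2^J) (t d)) = (\<Sum>h=1..2^J. Im (\<Sum>d\<in>X. c d * ee (real h * t d)) / (pi * real h))"
      unfolding sawtooth_poly_def sum_distrib_left
      by (subst sum.swap) (simp add: ee_def sum_divide_distrib mult.assoc)
    also have "\<bar>\<dots>\<bar> \<le> (\<Sum>h=1..2^J. \<bar>Im (\<Sum>d\<in>X. c d * ee (real h * t d)) / (pi * real h)\<bar>)"
      by (rule sum_abs)
    also have "\<dots> \<le> ?B"
    proof (rule sum_mono)
      fix h :: nat assume h: "h \<in> {1..2^J}"
      have "\<bar>Im (\<Sum>d\<in>X. c d * ee (real h * t d))\<bar> \<le> s h" unfolding s_def by (rule abs_Im_le_cmod)
      moreover have "\<bar>pi * real h\<bar> = pi * real h" by simp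
      ultimately have "\<bar>Im (\<Sum>d\<in>X. c d * ee (real h * t d)) / (pi * real h)\<bar> \<le> s h / (pi * real h)"
        unfolding abs_divide by (simp only:) (intro divide_right_mono, auto)
      also have "\<dots> \<le> s h / (1 * real h)" using h s0[of h] pi_ge_two by (intro divide_left_mono mult_right_mono) auto
      finally show "\<bar>Im (\<Sum>d\<in>X. c d * ee (real h * t d)) / (pi * real h)\<bar> \<le> s h / real h" by simp
    qed
    finally show ?thesis .
  qed
  also have "(\<Sum>d\<in>X. c d * \<bar>psi (t d) + sawtooth_poly (2^J) (t d)\<bar>) \<le> (\<Sum>d\<in>X. c d * (32 / 2 ^ J * (\<Sum>j\<le>J. fejer (2 ^ j) (t d))))"
    using c psi_fejer_bound by (intro sum_mono mult_left_mono) auto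
  also have "\<dots> = 32 / 2 ^ J * (\<Sum>j\<le>J. \<Sum>d\<in>X. c d * fejer (2 ^ j) (t d))"
  proof -
    have "(\<Sum>d\<in>X. c d * (K * (\<Sum>j\<le>J. fejer (2 ^ j) (t d)))) = (\<Sum>d\<in>X. \<Sum>j\<le>J. K * (c d * fejer (2 ^ j) (t d)))" for K
      by (simp add: sum_distrib_left mult_ac)
    also have "\<dots> K = (\<Sum>j\<le>J. \<Sum>d\<in>X. K * (c d * fejer (2 ^ j) (t d)))" for K
      by (rule sum.swap)
    also have "\<dots> K = K * (\<Sum>j\<le>J. \<Sum>d\<in>X. c d * fejer (2 ^ j) (t d))" for K
      by (simp add: sum_distrib_left)
    finally show ?thesis .
  qed
  also have "\<dots> \<le> 32 / 2 ^ J * (\<Sum>j\<le>J. 2 * ?C + 2 * 2 ^ J * ?B)"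
  proof (intro mult_left_mono sum_mono)
    fix j assume j: "j \<in> {..J}"
    have "(\<Sum>d\<in>X. c d * fejer (2 ^ j) (t d)) \<le> 2 * (\<Sum>h<2^j. s h)"
      unfolding s_def by (intro fejer_sum_bound fin) auto
    also have "(\<Sum>h<2^j. s h) = s 0 + (\<Sum>h\<in>{1..<2^j}. s h)"
    proof -
      have "{..<(2::nat)^j} = insert 0 {1..<2^j}" by auto
      thus ?thesis by simp
    qed
    also have "s 0 = ?C" using C0 by (simp add: s_def flip: of_real_sum)
    also have "(\<Sum>h\<in>{1..<2^j}. s h) \<le> (\<Sum>h\<in>{1..<2^j}. 2 ^ J * (s h / real h))"
    proof (rule sum_mono)
      fix h :: nat assume h: "h \<in> {1..<2^j}"
      have "(2::nat)^j \<le> 2^J" using j by (intro power_increasing) auto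
      moreover have "h \<le> 2 ^ j" using h by simp
      ultimately have "h \<le> 2 ^ J" by (rule order_trans[rotated])
      hence "real h \<le> 2 ^ J" by (metis of_nat_le_iff of_nat_numeral of_nat_power)
      hence "real h * s h \<le> 2 ^ J * s h" by (intro mult_right_mono s0)
      thus "s h \<le> 2 ^ J * (s h / real h)" using h by (simp add: field_simps)
    qed
    also have "\<dots> \<le> (\<Sum>h\<in>{1..2^J}. 2 ^ J * (s h / real h))"
    proof (rule sum_mono2)
      have le: "(2::nat)^j \<le> 2^J" using j by (intro power_increasing) auto
      show "{1..<2^j} \<subseteq> {1..(2::nat)^J}"
      proof
        fix h :: nat assume "h \<in> {1..<2^j}"
        hence "1 \<le> h" "h \<le> 2^j" by simp_all
        thus "h \<in> {1..2^J}" using le unfolding atLeastAtMost_iff by (blast intro: order_trans)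
      qed
    qed (use s0 in auto)
    also have "\<dots> = 2 ^ J * ?B" by (simp add: sum_distrib_left)
    finally show "(\<Sum>d\<in>X. c d * fejer (2 ^ j) (t d)) \<le> 2 * ?C + 2 * 2 ^ J * ?B" by simp
  qed auto
  also have "\<dots> = 64 * (real J + 1) * (?C / 2 ^ J + ?B)"
    by (simp add: field_simps)
  also have "?B + 64 * (real J + 1) * (?C / 2 ^ J + ?B) \<le> 65 * (real J + 1) * (?C / 2 ^ J + ?B)"
  proof -
    define Q where "Q = ?C / 2 ^ J + ?B"
    have Q0: "Q \<ge> 0" "?B \<le> Q" using C0 B0 by (simp_all add: Q_def)
    have "?B \<le> 1 * Q" using Q0 by simp
    also have "\<dots> \<le> (real J + 1) * Q" using Q0 by (intro mult_right_mono) auto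
    finally have "?B + 64 * (real J + 1) * Q \<le> 65 * (real J + 1) * Q" by (simp add: algebra_simps)
    thus ?thesis unfolding Q_def .
  qed
  finally show ?thesis by (simp add: s_def)
qed

section \<open>The divisor bound and Vaughan's identity\<close>

definition num_divisors :: "nat \<Rightarrow> nat" where
  "num_divisors n = card {d. d dvd n}"

lemma num_divisors_prime_power_mult_le:
  assumes "prime p" "m > 0"
  shows "num_divisors (p ^ a * m) \<le> (a + 1) * num_divisors m"
proof -
  have fin: "finite ((\<lambda>(i, c). p ^ i * c) ` ({..a} \<times> {d. d dvd m}))"
    using assms by auto
  have "{d. d dvd p ^ a * m} \<subseteq> (\<lambda>(i, c). p ^ i * c) ` ({..a} \<times> {d. d dvd m})"
  proof
    fix d assume "d \<in> {d. d dvd p ^ a * m}"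
    then obtain b c where bc: "d = b * c" "b dvd p ^ a" "c dvd m"
      using division_decomp[of d "p ^ a" m] by auto
    then obtain i where "i \<le> a" "b = p ^ i"
      using assms divides_primepow_nat by blast
    thus "d \<in> (\<lambda>(i, c). p ^ i * c) ` ({..a} \<times> {d. d dvd m})" using bc by auto
  qed
  hence "num_divisors (p ^ a * m) \<le> card ((\<lambda>(i, c). p ^ i * c) ` ({..a} \<times> {d. d dvd m}))"
    unfolding num_divisors_def by (rule card_mono[OF fin])
  also have "\<dots> \<le> card ({..a} \<times> {d. d dvd m})"
    using assms by (intro card_image_le) auto
  finally show ?thesis by (simp add: num_divisors_def card_cartesian_product)
qed

lemma prime_power_factor_bound:
  fixes \<epsilon> :: real
  assumes "\<epsilon> > 0" "p \<ge> 2"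
  shows "real a + 1 \<le> (1 + 1 / (\<epsilon> * ln 2)) * (real (p ^ a) powr \<epsilon>)"
proof -
  define c where "c = \<epsilon> * ln 2"
  have c: "c > 0" using assms by (simp add: c_def)
  have "real a * c + 1 \<le> exp (real a * c)" using exp_ge_add_one_self[of "real a * c"] by linarith
  also have "exp (real a * c) = (2 ^ a) powr \<epsilon>"
    by (simp add: c_def powr_def ln_realpow mult_ac)
  also have "\<dots> \<le> real (p ^ a) powr \<epsilon>"
    using assms by (intro powr_mono2) (auto intro!: power_mono)
  finally have *: "real a * c + 1 \<le> real (p ^ a) powr \<epsilon>" .
  have "real a + 1 \<le> (1 + 1 / c) * (real a * c + 1)"
    using c by (simp add: field_simps)
  also have "\<dots> \<le> (1 + 1 / c) * (real (p ^ a) powr \<epsilon>)"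
    using * c by (intro mult_left_mono) auto
  finally show ?thesis by (simp add: c_def)
qed

text \<open>Only the finitely many primes with \<open>p powr \<epsilon> < 2\<close> cost a factor
  \<open>K\<close>: for any other prime the factor \<open>a + 1 \<le> 2 ^ a\<close> contributed by
  \<open>p ^ a\<close> is already at most \<open>(p ^ a) powr \<epsilon>\<close>. The induction
  removes one full prime power at a time.\<close>

lemma num_divisors_bound_aux:
  fixes \<epsilon> :: real
  assumes \<epsilon>: "\<epsilon> > 0" and n: "n > 0"
  defines "K \<equiv> 1 + 1 / (\<epsilon> * ln 2)"
  defines "B \<equiv> {p :: nat. prime p \<and> real p powr \<epsilon> < 2}"
  shows "real (num_divisors n) \<le> K ^ card {p \<in> B. p dvd n} * real n powr \<epsilon>"
  using n
proof (induction n rule: less_induct)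
  case (less n)
  have K: "K \<ge> 1" using \<epsilon> by (simp add: K_def)
  show ?case
  proof (cases "n = 1")
    case True
    thus ?thesis using K by (simp add: num_divisors_def one_le_power)
  next
    case False
    then obtain p where p: "prime p" "p dvd n" using prime_factor_nat by blast
    define a where "a = multiplicity p n"
    have ne: "n \<noteq> 0" "\<not> is_unit p" using less.prems p by auto
    from multiplicity_decompose'[OF ne] obtain m where "n = p ^ multiplicity p n * m" "\<not> p dvd m" by blast
    hence m: "n = p ^ a * m" "\<not> p dvd m" unfolding a_def by blast+
    have a: "a > 0" using p less.prems by (simp add: a_def prime_multiplicity_gt_zero_iff)
    have m0: "m > 0" using less.prems m by (cases m) auto
    have p2: "p \<ge> 2" using p(1) by (rule prime_ge_2_nat)
    have "p ^ a > 1" using a p2 by (metis one_less_power order_less_le_trans one_less_numeral_iff semiring_norm(76))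
    hence mn: "m < n" using m0 unfolding m(1) by simp
    have finB: "finite {p \<in> B. p dvd x}" if "x > 0" for x :: nat
      using that by (auto intro: finite_subset[OF _ finite_divisors_nat[OF that]])
    have powr: "real n powr \<epsilon> = real (p ^ a) powr \<epsilon> * real m powr \<epsilon>"
      unfolding m(1) by (simp add: powr_mult)
    have "real (num_divisors n) \<le> (real a + 1) * real (num_divisors m)"
      using num_divisors_prime_power_mult_le[OF p(1) m0, of a] unfolding m(1)
      by (metis of_nat_1 of_nat_add of_nat_le_iff of_nat_mult)
    also have "\<dots> \<le> (real a + 1) * (K ^ card {p \<in> B. p dvd m} * real m powr \<epsilon>)"
      using less.IH[OF mn m0] by (intro mult_left_mono) auto
    also have "\<dots> \<le> K ^ card {p \<in> B. p dvd n} * real n powr \<epsilon>"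
    proof (cases "p \<in> B")
      case True
      have xp: "q = p" if "prime q" "q dvd p ^ a" for q
        using that p(1) by (metis prime_dvd_power primes_dvd_imp_eq)
      have "m dvd n" using m(1) by (metis dvd_triv_right)
      have "{q \<in> B. q dvd n} = insert p {q \<in> B. q dvd m}"
      proof (intro equalityI subsetI)
        fix q assume "q \<in> {q \<in> B. q dvd n}"
        hence q: "q \<in> B" "prime q" "q dvd n" by (simp_all add: B_def)
        have "q dvd p ^ a * m" using q(3) m(1) by metis
        hence "q dvd p ^ a \<or> q dvd m" using q(2) by (simp add: prime_dvd_mult_iff)
        thus "q \<in> insert p {q \<in> B. q dvd m}" using xp q by blast
      next
        fix q assume "q \<in> insert p {q \<in> B. q dvd m}"
        thus "q \<in> {q \<in> B. q dvd n}" using True p(2) \<open>m dvd n\<close> by (blast intro: dvd_trans)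
      qed
      moreover have "p \<notin> {q \<in> B. q dvd m}" using m by auto
      ultimately have card: "card {q \<in> B. q dvd n} = Suc (card {q \<in> B. q dvd m})"
        using finB[OF m0] by simp
      have "real a + 1 \<le> K * real (p ^ a) powr \<epsilon>"
        unfolding K_def using \<epsilon> p2 by (rule prime_power_factor_bound)
      hence "(real a + 1) * (K ^ card {p \<in> B. p dvd m} * real m powr \<epsilon>)
        \<le> (K * real (p ^ a) powr \<epsilon>) * (K ^ card {p \<in> B. p dvd m} * real m powr \<epsilon>)"
        using K by (intro mult_right_mono) auto
      thus ?thesis unfolding card powr by (simp add: mult_ac)
    next
      case False
      have "{q \<in> B. q dvd m} \<subseteq> {q \<in> B. q dvd n}" unfolding m(1) by auto
      hence card: "card {q \<in> B. q dvd m} \<le> card {q \<in> B. q dvd n}"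
        using finB[OF less.prems] by (intro card_mono) auto
      have "2 ^ a \<le> (real p powr \<epsilon>) ^ a"
        using False p by (intro power_mono) (auto simp: B_def)
      also have "\<dots> = real (p ^ a) powr \<epsilon>" using p2 by (simp add: powr_power powr_powr mult.commute flip: powr_realpow)
      finally have two: "2 ^ a \<le> real (p ^ a) powr \<epsilon>" .
      have "a + 1 \<le> 2 ^ a" using less_exp[of a] by linarith
      hence "real (a + 1) \<le> real (2 ^ a)" by (simp only: of_nat_le_iff)
      hence "real a + 1 \<le> real (p ^ a) powr \<epsilon>" using two by simp
      hence "(real a + 1) * (K ^ card {p \<in> B. p dvd m} * real m powr \<epsilon>)
        \<le> real (p ^ a) powr \<epsilon> * (K ^ card {p \<in> B. p dvd n} * real m powr \<epsilon>)"
        using K card by (intro mult_mono power_increasing) auto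
      thus ?thesis unfolding powr by (simp add: mult_ac)
    qed
    finally show ?thesis .
  qed
qed

lemma num_divisors_bound:
  fixes \<epsilon> :: real
  assumes \<epsilon>: "\<epsilon> > 0"
  obtains C where "C \<ge> 1" "\<And>n. n > 0 \<Longrightarrow> real (num_divisors n) \<le> C * real n powr \<epsilon>"
proof -
  define K where "K = 1 + 1 / (\<epsilon> * ln 2)"
  define B where "B = {p :: nat. prime p \<and> real p powr \<epsilon> < 2}"
  have K: "K \<ge> 1" using \<epsilon> by (simp add: K_def)
  have "B \<subseteq> {p. real p \<le> 2 powr (1 / \<epsilon>)}"
  proof
    fix p assume "p \<in> B"
    hence p: "p > 0" "real p powr \<epsilon> < 2" by (auto simp: B_def prime_gt_0_nat)
    hence "(real p powr \<epsilon>) powr (1 / \<epsilon>) \<le> 2 powr (1 / \<epsilon>)"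
      using \<epsilon> by (intro powr_mono2) auto
    thus "p \<in> {p. real p \<le> 2 powr (1 / \<epsilon>)}" using \<epsilon> p by (simp add: powr_powr)
  qed
  moreover have "finite {p :: nat. real p \<le> 2 powr (1 / \<epsilon>)}" by (rule finite_nat_le_real)
  ultimately have finB: "finite B" using finite_subset by blast
  show ?thesis
  proof (rule that[of "K ^ card B"])
    show "K ^ card B \<ge> 1" using K by simp
    fix n :: nat assume n: "n > 0"
    have "real (num_divisors n) \<le> K ^ card {p \<in> B. p dvd n} * real n powr \<epsilon>"
      unfolding K_def B_def by (rule num_divisors_bound_aux[OF \<epsilon> n])
    also have "\<dots> \<le> K ^ card B * real n powr \<epsilon>"
      using K finB by (intro mult_right_mono power_increasing card_mono) auto
    finally show "real (num_divisors n) \<le> K ^ card B * real n powr \<epsilon>" .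
  qed
qed

section \<open>The Moebius function and its divisor sums\<close>

definition moebius_mu :: "nat \<Rightarrow> real" where
  "moebius_mu n = (if \<exists>p. prime p \<and> p ^ 2 dvd n then 0 else (- 1) ^ card (prime_factors n))"

lemma abs_moebius_mu_le: "\<bar>moebius_mu n\<bar> \<le> 1"
  by (simp add: moebius_mu_def power_abs)

lemma moebius_mu_1 [simp]: "moebius_mu (Suc 0) = 1"
  by (auto simp: moebius_mu_def)

lemma moebius_mu_prime_mult:
  assumes "prime p" "d > 0"
  shows "moebius_mu (p * d) = (if p dvd d then 0 else - moebius_mu d)"
proof (cases "p dvd d")
  case True
  hence "p ^ 2 dvd p * d" by (simp add: power2_eq_square)
  thus ?thesis using True assms by (auto simp: moebius_mu_def)
next
  case False
  have "prime_factors (p * d) = insert p (prime_factors d)"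
    using assms by (auto simp: prime_factors_product prime_factorization_prime)
  moreover have "p \<notin> prime_factors d" using False by auto
  ultimately have card: "card (prime_factors (p * d)) = Suc (card (prime_factors d))" by simp
  have "(\<exists>q. prime q \<and> q ^ 2 dvd p * d) \<longleftrightarrow> (\<exists>q. prime q \<and> q ^ 2 dvd d)"
  proof
    assume "\<exists>q. prime q \<and> q ^ 2 dvd p * d"
    then obtain q where q: "prime q" "q ^ 2 dvd p * d" by blast
    have "q \<noteq> p"
    proof
      assume "q = p"
      hence "p dvd d" using q assms by (simp add: power2_eq_square)
      thus False using False by simp
    qed
    hence "coprime (q ^ 2) p" using q assms by (simp add: primes_coprime)
    hence "q ^ 2 dvd d" using q(2) by (simp add: coprime_dvd_mult_right_iff)
    thus "\<exists>q. prime q \<and> q ^ 2 dvd d" using q by blast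
  qed auto
  thus ?thesis using False card by (simp add: moebius_mu_def)
qed

text \<open>For a prime \<open>p\<close> dividing \<open>n\<close>, the divisors that are multiples
  of \<open>p\<close> are the \<open>p * e\<close>. Only those with \<open>p\<close> not dividing
  \<open>e\<close> survive, and they cancel the divisors prime to \<open>p\<close> one by
  one.\<close>

lemma sum_moebius_mu_divisors:
  assumes "n > 1"
  shows "(\<Sum>d | d dvd n. moebius_mu d) = 0"
proof -
  obtain p where p: "prime p" "p dvd n" using assms prime_factor_nat[of n] by auto
  have n0: "n > 0" using assms by simp
  have fin: "finite {d. d dvd n}" using n0 by simp
  let ?A = "{d. d dvd n \<and> \<not> p dvd d}" and ?B = "{d. d dvd n \<and> p dvd d}" and ?E = "{e. p * e dvd n}"
  have finE: "finite ?E" by (rule finite_subset[OF _ fin]) (auto dest: dvd_mult_right)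
  have "(\<Sum>d | d dvd n. moebius_mu d) = (\<Sum>d\<in>?A. moebius_mu d) + (\<Sum>d\<in>?B. moebius_mu d)"
    by (subst sum.union_disjoint [symmetric]) (auto intro!: sum.cong finite_subset[OF _ fin])
  also have "(\<Sum>d\<in>?B. moebius_mu d) = (\<Sum>e\<in>?E. moebius_mu (p * e))"
    using p by (intro sum.reindex_bij_witness[of _ "\<lambda>e. p * e" "\<lambda>d. d div p"]) (auto simp: prime_gt_0_nat)
  also have "\<dots> = (\<Sum>e\<in>?E. if p dvd e then 0 else - moebius_mu e)"
    using n0 by (intro sum.cong refl moebius_mu_prime_mult p) (auto intro!: Nat.gr0I)
  also have "\<dots> = (\<Sum>e | p * e dvd n \<and> \<not> p dvd e. - moebius_mu e)"
    using finE by (intro sum.mono_neutral_cong_right) auto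
  also have "{e. p * e dvd n \<and> \<not> p dvd e} = ?A"
  proof (intro equalityI subsetI)
    fix e assume "e \<in> ?A"
    moreover from this have "coprime p e" using p by (simp add: prime_imp_coprime)
    ultimately show "e \<in> {e. p * e dvd n \<and> \<not> p dvd e}" using p by (auto intro: divides_mult)
  qed (auto dest: dvd_mult_right)
  finally show ?thesis by (simp add: sum_negf)
qed

section \<open>Sums over products and Vaughan's identity\<close>

definition prod_pairs :: "real \<Rightarrow> real \<Rightarrow> (nat \<times> nat) set" where
  "prod_pairs D D' = {(k, l). D < real (k * l) \<and> real (k * l) \<le> D'}"

lemma prod_pairs_pos:
  assumes "(k, l) \<in> prod_pairs D D'" "D \<ge> 0"
  shows "k > 0" "l > 0" "real k \<le> D'" "real l \<le> D'"
proof -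
  have *: "real (k * l) > 0" "real (k * l) \<le> D'" using assms by (auto simp: prod_pairs_def)
  hence "k * l > 0" by (simp only: of_nat_0_less_iff)
  thus kl: "k > 0" "l > 0" by auto
  have "k \<le> k * l" "l \<le> k * l" using kl by auto
  thus "real k \<le> D'" "real l \<le> D'" using *(2) by (meson of_nat_le_iff order_trans)+
qed

lemma finite_prod_pairs:
  assumes "D \<ge> 0"
  shows "finite (prod_pairs D D')"
proof (rule finite_subset)
  show "prod_pairs D D' \<subseteq> {n. real n \<le> D'} \<times> {n. real n \<le> D'}"
    using prod_pairs_pos[OF _ assms] by auto
qed (auto intro: finite_nat_le_real)

lemma sum_divisors_prod_pairs:
  fixes F :: "nat \<Rightarrow> nat \<Rightarrow> 'a :: comm_monoid_add"
  assumes "D \<ge> 0"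
  shows "(\<Sum>d | D < real d \<and> real d \<le> D'. \<Sum>k | k dvd d. F k (d div k)) = (\<Sum>(k, l)\<in>prod_pairs D D'. F k l)"
proof -
  have fin: "finite {d. D < real d \<and> real d \<le> D'}"
    by (rule finite_subset[OF _ finite_nat_le_real[of D']]) auto
  have "(\<Sum>d | D < real d \<and> real d \<le> D'. \<Sum>k | k dvd d. F k (d div k))
      = (\<Sum>(d, k)\<in>(SIGMA d:{d. D < real d \<and> real d \<le> D'}. {k. k dvd d}). F k (d div k))"
    using assms fin by (subst sum.Sigma) (auto intro!: finite_divisors_nat)
  also have "\<dots> = (\<Sum>(k, l)\<in>prod_pairs D D'. F k l)"
    using assms by (intro sum.reindex_bij_witness[of _ "\<lambda>(k, l). (k * l, k)" "\<lambda>(d, k). (k, d div k)"])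
      (auto simp: prod_pairs_def simp del: of_nat_mult)
  finally show ?thesis .
qed

text \<open>Both sides run over the pairs \<open>(b, c)\<close> with \<open>b * c\<close> dividing
  \<open>n\<close>, the left one grouped by the product \<open>k = b * c\<close>. This is
  associativity of Dirichlet convolution when the last factor is the constant 1.\<close>

lemma sum_divisors_assoc:
  fixes F :: "nat \<Rightarrow> nat \<Rightarrow> 'a :: comm_monoid_add"
  assumes "n > 0"
  shows "(\<Sum>k | k dvd n. \<Sum>b | b dvd k. F b (k div b)) = (\<Sum>b | b dvd n. \<Sum>c | c dvd n div b. F b c)"
proof -
  have pos: "k > 0" if "k dvd n" for k using that assms by (auto intro!: Nat.gr0I)
  have pos': "n div b > 0" if "b dvd n" for b using that assms by auto
  have "(\<Sum>k | k dvd n. \<Sum>b | b dvd k. F b (k div b)) = (\<Sum>(k, b)\<in>(SIGMA k:{k. k dvd n}. {b. b dvd k}). F b (k div b))"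
    using assms pos by (subst sum.Sigma) (auto intro!: finite_divisors_nat)
  also have "\<dots> = (\<Sum>(b, c)\<in>(SIGMA b:{b. b dvd n}. {c. c dvd n div b}). F b c)"
  proof (intro sum.reindex_bij_witness[of _ "\<lambda>(b, c). (b * c, b)" "\<lambda>(k, b). (b, k div b)"])
    fix x assume "x \<in> (SIGMA k:{k. k dvd n}. {b. b dvd k})"
    then obtain k b where x: "x = (k, b)" "k dvd n" "b dvd k" by auto
    thus "(case case x of (k, b) \<Rightarrow> (b, k div b) of (b, c) \<Rightarrow> (b * c, b)) = x" by simp
    have bn: "b dvd n" using x by auto
    moreover have "k div b dvd n div b" using x bn by (simp add: div_dvd_div)
    ultimately show "(case x of (k, b) \<Rightarrow> (b, k div b)) \<in> (SIGMA b:{b. b dvd n}. {c. c dvd n div b})"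
      using x by simp
  next
    fix x assume "x \<in> (SIGMA b:{b. b dvd n}. {c. c dvd n div b})"
    then obtain b c where x: "x = (b, c)" "b dvd n" "c dvd n div b" by auto
    have b0: "b > 0" using x pos by auto
    thus "(case case x of (b, c) \<Rightarrow> (b * c, b) of (k, b) \<Rightarrow> (b, k div b)) = x" using x by simp
    have "b * c dvd b * (n div b)" using x by (intro mult_dvd_mono) auto
    thus "(case x of (b, c) \<Rightarrow> (b * c, b)) \<in> (SIGMA k:{k. k dvd n}. {b. b dvd k})" using x by simp
  qed auto
  also have "\<dots> = (\<Sum>b | b dvd n. \<Sum>c | c dvd n div b. F b c)"
    using assms pos' by (subst sum.Sigma) (auto intro!: finite_divisors_nat)
  finally show ?thesis .
qed

text \<open>Dirichlet convolution of the Moebius and the von Mangoldt function, both truncated at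
  \<open>U\<close>; for this reason it vanishes beyond \<open>U * U\<close>.\<close>

definition vaughan_gamma :: "nat \<Rightarrow> nat \<Rightarrow> real" where
  "vaughan_gamma U k = (\<Sum>b | b dvd k. (if b \<le> U then moebius_mu b else 0) * (if k div b \<le> U then mangoldt (k div b) else 0))"

text \<open>The unit of Dirichlet convolution minus the convolution of the truncated Moebius
  function with 1. For \<open>k > 0\<close> this is the sum of \<open>moebius_mu b\<close> over the
  divisors \<open>b > U\<close>.\<close>

definition vaughan_beta :: "nat \<Rightarrow> nat \<Rightarrow> real" where
  "vaughan_beta U k = (if k = 1 then 1 else 0) - (\<Sum>b | b dvd k. if b \<le> U then moebius_mu b else 0)"

text \<open>Serves twice below: for the full von Mangoldt function, where the inner divisor sum is a
  logarithm, and for its truncation at \<open>U\<close>, where the double sum becomes a divisor sum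
  of \<open>vaughan_gamma\<close>.\<close>

lemma vaughan_beta_convolve:
  fixes G :: "nat \<Rightarrow> real"
  assumes "d > 0"
  shows "(\<Sum>k | k dvd d. vaughan_beta U k * G (d div k))
     = G d - (\<Sum>b | b dvd d. (if b \<le> U then moebius_mu b else 0) * (\<Sum>c | c dvd d div b. G c))"
proof -
  have fin: "finite {k. k dvd d}" using assms by simp
  have dd: "d div k = (d div b) div (k div b)" if bk: "b dvd k" "k dvd d" for k b
  proof -
    obtain c where c: "k = b * c" using bk by blast
    obtain e where e: "d = k * e" using bk by blast
    have "b > 0" "c > 0" using assms c e by auto
    thus ?thesis unfolding e c by (simp add: mult.assoc)
  qed
  have "(\<Sum>k | k dvd d. vaughan_beta U k * G (d div k))
      = (\<Sum>k | k dvd d. (if k = 1 then G d else 0)) - (\<Sum>k | k dvd d. \<Sum>b | b dvd k. (if b \<le> U then moebius_mu b else 0) * G ((d div b) div (k div b)))"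
    unfolding vaughan_beta_def left_diff_distrib sum_subtractf sum_distrib_right
    by (intro arg_cong2[of _ _ _ _ "(-)"] sum.cong) (use dd in auto)
  also have "(\<Sum>k | k dvd d. (if k = 1 then G d else 0)) = G d"
    using fin by (subst sum.delta) auto
  also have "(\<Sum>k | k dvd d. \<Sum>b | b dvd k. (if b \<le> U then moebius_mu b else 0) * G ((d div b) div (k div b)))
      = (\<Sum>b | b dvd d. \<Sum>c | c dvd d div b. (if b \<le> U then moebius_mu b else 0) * G ((d div b) div c))"
    using sum_divisors_assoc[OF assms, of "\<lambda>b c. (if b \<le> U then moebius_mu b else 0) * G ((d div b) div c)"] by simp
  also have "\<dots> = (\<Sum>b | b dvd d. (if b \<le> U then moebius_mu b else 0) * (\<Sum>c | c dvd d div b. G c))"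
  proof (intro sum.cong refl)
    fix b assume b: "b \<in> {b. b dvd d}"
    hence pos: "d div b > 0" using assms by auto
    have "(\<Sum>c | c dvd d div b. G ((d div b) div c)) = (\<Sum>c | c dvd d div b. G c)"
      using pos by (intro sum.reindex_bij_witness[of _ "\<lambda>c. (d div b) div c" "\<lambda>c. (d div b) div c"]) auto
    thus "(\<Sum>c | c dvd d div b. (if b \<le> U then moebius_mu b else 0) * G ((d div b) div c)) = (if b \<le> U then moebius_mu b else 0) * (\<Sum>c | c dvd d div b. G c)"
      by (simp flip: sum_distrib_left)
  qed
  finally show ?thesis .
qed

text \<open>\<open>vaughan_beta_convolve\<close> expresses \<open>mangoldt\<close> by a logarithmic
  sum and its own convolution with \<open>vaughan_beta\<close>. In this convolution
  \<open>mangoldt\<close> is split at \<open>U\<close>; the small part is evaluated by the same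
  lemma, and its leading term \<open>s d\<close> vanishes because \<open>d > U\<close>.\<close>

lemma vaughan_identity:
  assumes d: "d > U"
  shows "mangoldt d = (\<Sum>k | k dvd d. (if k \<le> U then moebius_mu k else 0) * ln (real (d div k)))
     - (\<Sum>k | k dvd d. vaughan_gamma U k)
     + (\<Sum>k | k dvd d. vaughan_beta U k * (if d div k > U then mangoldt (d div k) else 0))"
proof -
  have d0: "d > 0" using d by simp
  define s where "s c = (if c \<le> U then mangoldt c else 0 :: real)" for c
  define b where "b c = (if c > U then mangoldt c else 0 :: real)" for c
  have "(\<Sum>k | k dvd d. vaughan_beta U k * mangoldt (d div k))
      = mangoldt d - (\<Sum>b | b dvd d. (if b \<le> U then moebius_mu b else 0) * (\<Sum>c | c dvd d div b. mangoldt c))"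
    by (rule vaughan_beta_convolve[OF d0])
  also have "(\<Sum>b | b dvd d. (if b \<le> U then moebius_mu b else 0) * (\<Sum>c | c dvd d div b. mangoldt c))
      = (\<Sum>k | k dvd d. (if k \<le> U then moebius_mu k else 0) * ln (real (d div k)))"
  proof (intro sum.cong refl)
    fix k assume "k \<in> {k. k dvd d}"
    hence "d div k > 0" using d0 by auto
    thus "(if k \<le> U then moebius_mu k else 0) * (\<Sum>c | c dvd d div k. mangoldt c) = (if k \<le> U then moebius_mu k else 0) * ln (real (d div k))"
      using mangoldt_sum[of "d div k", where 'a = real] by simp
  qed
  finally have 1: "mangoldt d = (\<Sum>k | k dvd d. (if k \<le> U then moebius_mu k else 0) * ln (real (d div k)))
      + (\<Sum>k | k dvd d. vaughan_beta U k * mangoldt (d div k))" by simp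
  have "(\<Sum>k | k dvd d. vaughan_beta U k * mangoldt (d div k))
     = (\<Sum>k | k dvd d. vaughan_beta U k * s (d div k)) + (\<Sum>k | k dvd d. vaughan_beta U k * b (d div k))"
    by (simp flip: sum.distrib) (auto intro!: sum.cong simp: s_def b_def)
  also have "(\<Sum>k | k dvd d. vaughan_beta U k * s (d div k)) = s d - (\<Sum>b | b dvd d. (if b \<le> U then moebius_mu b else 0) * (\<Sum>c | c dvd d div b. s c))"
    by (rule vaughan_beta_convolve[OF d0])
  also have "s d = 0" using d by (simp add: s_def)
  also have "(\<Sum>b | b dvd d. (if b \<le> U then moebius_mu b else 0) * (\<Sum>c | c dvd d div b. s c)) = (\<Sum>k | k dvd d. vaughan_gamma U k)"
    using sum_divisors_assoc[OF d0, of "\<lambda>b c. (if b \<le> U then moebius_mu b else 0) * s c"]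
    by (simp add: vaughan_gamma_def s_def sum_distrib_left)
  finally show ?thesis using 1 by (simp add: b_def)
qed

text \<open>For \<open>k \<le> U\<close> the truncation is invisible and the Moebius sum over the
  divisors is complete.\<close>

lemma vaughan_beta_eq_0:
  assumes "k > 0" "k \<le> U"
  shows "vaughan_beta U k = 0"
proof -
  have "(\<Sum>b | b dvd k. if b \<le> U then moebius_mu b else 0) = (\<Sum>b | b dvd k. moebius_mu b)"
    using assms by (intro sum.cong) (auto dest: dvd_imp_le)
  also have "\<dots> = (if k = 1 then 1 else 0)"
    using assms sum_moebius_mu_divisors[of k] by (cases "k = 1") auto
  finally show ?thesis by (simp add: vaughan_beta_def)
qed

lemma abs_vaughan_beta_le:
  assumes "k > 1"
  shows "\<bar>vaughan_beta U k\<bar> \<le> real (num_divisors k)"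
proof -
  have "\<bar>vaughan_beta U k\<bar> \<le> (\<Sum>b | b dvd k. \<bar>if b \<le> U then moebius_mu b else 0\<bar>)"
    using assms by (simp add: vaughan_beta_def sum_abs)
  also have "\<dots> \<le> (\<Sum>b | b dvd k. 1)" by (intro sum_mono) (auto simp: abs_moebius_mu_le)
  finally show ?thesis by (simp add: num_divisors_def)
qed

lemma abs_vaughan_gamma_le:
  assumes "k > 0"
  shows "\<bar>vaughan_gamma U k\<bar> \<le> ln (real k)"
proof -
  have "\<bar>vaughan_gamma U k\<bar> \<le> (\<Sum>b | b dvd k. \<bar>(if b \<le> U then moebius_mu b else 0) * (if k div b \<le> U then mangoldt (k div b) else 0)\<bar>)"
    unfolding vaughan_gamma_def by (rule sum_abs)
  also have "\<dots> \<le> (\<Sum>b | b dvd k. 1 * mangoldt (k div b))"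
    unfolding abs_mult by (intro sum_mono mult_mono) (auto simp: abs_moebius_mu_le mangoldt_nonneg)
  also have "\<dots> = (\<Sum>c | c dvd k. mangoldt c)"
    using assms by (intro sum.reindex_bij_witness[of _ "\<lambda>c. k div c" "\<lambda>c. k div c"]) auto
  also have "\<dots> = ln (real k)" using mangoldt_sum[of k, where 'a = real] assms by simp
  finally show ?thesis .
qed

lemma vaughan_gamma_eq_0:
  assumes "k > U * U"
  shows "vaughan_gamma U k = 0"
proof -
  have "(if b \<le> U then moebius_mu b else 0) * (if k div b \<le> U then mangoldt (k div b) else 0) = 0" if "b dvd k" for b
  proof (rule ccontr)
    assume "\<not> ?thesis"
    hence "b \<le> U" "k div b \<le> U" by (auto split: if_splits)
    hence "b * (k div b) \<le> U * U" by (rule mult_le_mono)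
    thus False using that assms by simp
  qed
  thus ?thesis unfolding vaughan_gamma_def by (intro sum.neutral ballI) blast
qed

text \<open>The sum with \<open>vaughan_gamma\<close> is cut at \<open>k = U\<close> rather than
  \<open>U * U\<close>, so that all type I sums have \<open>k \<le> U\<close>, and the range
  \<open>U < k \<le> U * U\<close> is treated as type II. A nonzero coefficient there has
  \<open>l > U\<close> automatically: for \<open>l \<le> U\<close> the condition
  \<open>k * l > D \<ge> U ^ 3\<close> forces \<open>k > U * U\<close>. In the last sum
  \<open>vaughan_beta\<close> vanishes for \<open>k \<le> U\<close>.\<close>

lemma vaughan_sum:
  fixes g :: "nat \<Rightarrow> complex"
  assumes D: "real U * U * U \<le> D" "U > 0"
  shows "(\<Sum>d | D < real d \<and> real d \<le> D'. mangoldt d * g d)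
    = (\<Sum>(k, l)\<in>prod_pairs D D'. (if k \<le> U then moebius_mu k * ln (real l) else 0) * g (k * l))
    - (\<Sum>(k, l)\<in>prod_pairs D D'. (if k \<le> U then vaughan_gamma U k else 0) * g (k * l))
    - (\<Sum>(k, l)\<in>prod_pairs D D'. (if k > U \<and> l > U then vaughan_gamma U k else 0) * g (k * l))
    + (\<Sum>(k, l)\<in>prod_pairs D D'. (if k > U \<and> l > U then vaughan_beta U k * mangoldt l else 0) * g (k * l))"
proof -
  have D0: "D \<ge> 0" using D by (meson order_trans of_nat_0_le_iff mult_nonneg_nonneg)
  have UD: "real U \<le> D"
  proof -
    have "real U * 1 * 1 \<le> real U * U * U" using D(2) by (intro mult_mono) auto
    thus ?thesis using D by linarith
  qed
  have "(\<Sum>d | D < real d \<and> real d \<le> D'. mangoldt d * g d)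
    = (\<Sum>d | D < real d \<and> real d \<le> D'. \<Sum>k | k dvd d.
        of_real ((if k \<le> U then moebius_mu k * ln (real (d div k)) else 0) - vaughan_gamma U k
         + vaughan_beta U k * (if d div k > U then mangoldt (d div k) else 0)) * g (k * (d div k)))"
  proof (intro sum.cong refl)
    fix d assume "d \<in> {d. D < real d \<and> real d \<le> D'}"
    hence "d > U" using UD by auto
    hence "of_real (mangoldt d) * g d = of_real (\<Sum>k | k dvd d. ((if k \<le> U then moebius_mu k * ln (real (d div k)) else 0) - vaughan_gamma U k
         + vaughan_beta U k * (if d div k > U then mangoldt (d div k) else 0))) * g d"
      by (subst vaughan_identity) (auto simp: sum_subtractf sum.distrib intro!: sum.cong)
    thus "mangoldt d * g d = (\<Sum>k | k dvd d.
        of_real ((if k \<le> U then moebius_mu k * ln (real (d div k)) else 0) - vaughan_gamma U k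
         + vaughan_beta U k * (if d div k > U then mangoldt (d div k) else 0)) * g (k * (d div k)))"
      by (simp add: sum_distrib_right del: of_real_add of_real_diff)
  qed
  also have "\<dots> = (\<Sum>(k, l)\<in>prod_pairs D D'.
        of_real ((if k \<le> U then moebius_mu k * ln (real l) else 0) - vaughan_gamma U k
         + vaughan_beta U k * (if l > U then mangoldt l else 0)) * g (k * l))"
    by (rule sum_divisors_prod_pairs[OF D0])
  also have "\<dots> = (\<Sum>(k, l)\<in>prod_pairs D D'.
        of_real (if k \<le> U then moebius_mu k * ln (real l) else 0) * g (k * l)
        - of_real (if k \<le> U then vaughan_gamma U k else 0) * g (k * l)
        - of_real (if k > U \<and> l > U then vaughan_gamma U k else 0) * g (k * l)
        + of_real (if k > U \<and> l > U then vaughan_beta U k * mangoldt l else 0) * g (k * l))"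
  proof (intro sum.cong refl, clarify)
    fix k l assume kl: "(k, l) \<in> prod_pairs D D'"
    have pos: "k > 0" "l > 0" using prod_pairs_pos[OF kl D0] by auto
    have "vaughan_gamma U k = 0" if "l \<le> U"
    proof (rule vaughan_gamma_eq_0, rule ccontr)
      assume "\<not> U * U < k"
      hence "k * l \<le> U * U * U" using that by (intro mult_le_mono) auto
      hence "real (k * l) \<le> real (U * U * U)" by (simp only: of_nat_le_iff)
      thus False using kl D by (simp add: prod_pairs_def)
    qed
    moreover have "vaughan_beta U k = 0" if "k \<le> U" using pos that by (rule_tac vaughan_beta_eq_0) auto
    ultimately show "of_real ((if k \<le> U then moebius_mu k * ln (real l) else 0) - vaughan_gamma U k
         + vaughan_beta U k * (if l > U then mangoldt l else 0)) * g (k * l)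
      = of_real (if k \<le> U then moebius_mu k * ln (real l) else 0) * g (k * l)
        - of_real (if k \<le> U then vaughan_gamma U k else 0) * g (k * l)
        - of_real (if k > U \<and> l > U then vaughan_gamma U k else 0) * g (k * l)
        + of_real (if k > U \<and> l > U then vaughan_beta U k * mangoldt l else 0) * g (k * l)"
      by (auto simp: algebra_simps not_less)
  qed
  finally show ?thesis by (simp add: sum.distrib sum_subtractf case_prod_unfold)
qed

section \<open>The double large sieve\<close>

lemma geometric_ee_bound:
  assumes "\<theta> \<noteq> 0" "\<bar>\<theta>\<bar> \<le> 1 / 2"
  shows "norm (\<Sum>g<G. ee (real g * \<theta>)) \<le> 1 / \<bar>\<theta>\<bar>"
proof -
  have "\<bar>\<theta>\<bar> \<le> sin (pi * \<bar>\<theta>\<bar>)" using assms by (intro sin_pi_ge) auto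
  also have "\<dots> \<le> \<bar>sin (pi * \<theta>)\<bar>" by (cases "\<theta> \<ge> 0") auto
  finally have s: "\<bar>\<theta>\<bar> \<le> \<bar>sin (pi * \<theta>)\<bar>" .
  have ne: "ee \<theta> - 1 \<noteq> 0"
    using s assms norm_ee_minus_one[of \<theta>] by (metis abs_le_zero_iff abs_0 mult_eq_0_iff norm_zero zero_neq_numeral abs_zero)
  have "(\<Sum>g<G. ee (real g * \<theta>)) = (\<Sum>g<G. ee \<theta> ^ g)"
    by (simp add: ee_def Complex.DeMoivre mult_ac)
  also have "\<dots> = (ee \<theta> ^ G - 1) / (ee \<theta> - 1)"
    using ne by (simp add: geometric_sum)
  also have "norm \<dots> = norm (ee \<theta> ^ G - 1) / (2 * \<bar>sin (pi * \<theta>)\<bar>)"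
    by (simp add: norm_divide norm_ee_minus_one)
  also have "\<dots> \<le> (1 + 1) / (2 * \<bar>\<theta>\<bar>)"
    using s assms norm_triangle_ineq4[of "ee \<theta> ^ G" 1]
    by (intro frac_le) (auto simp: norm_power)
  finally show ?thesis by simp
qed

lemma sum_fiber:
  fixes F :: "'b \<Rightarrow> real"
  assumes "finite J" "finite T" "v ` J \<subseteq> T"
  shows "(\<Sum>j\<in>J. F (v j)) = (\<Sum>c\<in>T. real (card {j \<in> J. v j = c}) * F c)"
proof -
  have "(\<Sum>j\<in>J. F (v j)) = (\<Sum>c\<in>T. \<Sum>j | j \<in> J \<and> v j = c. F (v j))"
    using sum.group[OF assms, of "\<lambda>j. F (v j)"] by simp
  also have "\<dots> = (\<Sum>c\<in>T. real (card {j \<in> J. v j = c}) * F c)"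
    by (intro sum.cong refl) simp
  finally show ?thesis .
qed

lemma card_fiber_pairs:
  assumes "finite J" "finite T" "v ` J \<subseteq> T"
  shows "real (card {(i, j). i \<in> J \<and> j \<in> J \<and> v i = v j}) = (\<Sum>c\<in>T. (real (card {j \<in> J. v j = c}))\<^sup>2)"
proof -
  have "{(i, j). i \<in> J \<and> j \<in> J \<and> v i = v j} = (SIGMA i:J. {j \<in> J. v j = v i})" by auto
  hence "real (card {(i, j). i \<in> J \<and> j \<in> J \<and> v i = v j}) = (\<Sum>i\<in>J. real (card {j \<in> J. v j = v i}))"
    using assms by (simp add: card_SigmaI)
  also have "\<dots> = (\<Sum>c\<in>T. real (card {j \<in> J. v j = c}) * real (card {j \<in> J. v j = c}))"
    by (rule sum_fiber[OF assms, of "\<lambda>c. real (card {j \<in> J. v j = c})"])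
  finally show ?thesis by (simp add: power2_eq_square)
qed

text \<open>A bound of Schur type: grouping by the values of \<open>v\<close> gives a quadratic form
  in the multiplicities with the symmetric kernel \<open>1 / (\<bar>c - c'\<bar> + 1)\<close>. By
  \<open>2 * a * b \<le> a\<^sup>2 + b\<^sup>2\<close> it is at most the bound
  \<open>2 * harm K\<close> for the row sums times the sum of the squared multiplicities, which
  counts the coincidences.\<close>

lemma sum_pairs_inverse_distance:
  fixes v :: "'a \<Rightarrow> nat"
  assumes fin: "finite J" and K: "\<And>j. j \<in> J \<Longrightarrow> v j < K"
  shows "(\<Sum>i\<in>J. \<Sum>j\<in>J. 1 / (real (nat \<bar>int (v i) - int (v j)\<bar>) + 1))
      \<le> 2 * harm K * real (card {(i, j). i \<in> J \<and> j \<in> J \<and> v i = v j})"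
proof -
  define \<nu> where "\<nu> c = real (card {j \<in> J. v j = c})" for c
  define f where "f c c' = 1 / (real (nat \<bar>int c - int c'\<bar>) + 1)" for c c' :: nat
  have f0: "f c c' \<ge> 0" for c c' by (simp add: f_def)
  have half: "(a + a) / 2 = a" for a :: real by simp
  have fsym: "f c c' = f c' c" for c c' by (simp add: f_def abs_minus_commute)
  have T: "finite {..<K}" "v ` J \<subseteq> {..<K}" using K by auto
  have fsum: "(\<Sum>c'<K. f c c') \<le> 2 * harm K" if "c < K" for c
  proof -
    have "(\<Sum>c'<K. f c c') \<le> 2 * (\<Sum>h<K. 1 / (real h + 1))"
      unfolding f_def by (rule sum_abs_diff_le[of "\<lambda>h. 1 / (real h + 1)"]) (use that in auto)
    also have "(\<Sum>h<K. 1 / (real h + 1)) = harm K"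
      by (simp add: harm_altdef inverse_eq_divide add.commute)
    finally show ?thesis .
  qed
  have "(\<Sum>i\<in>J. \<Sum>j\<in>J. f (v i) (v j)) = (\<Sum>i\<in>J. \<Sum>c'<K. \<nu> c' * f (v i) c')"
    unfolding \<nu>_def by (intro sum.cong refl sum_fiber[OF fin T])
  also have "\<dots> = (\<Sum>c<K. \<nu> c * (\<Sum>c'<K. \<nu> c' * f c c'))"
    unfolding \<nu>_def by (rule sum_fiber[OF fin T, of "\<lambda>c. \<Sum>c'<K. real (card {j \<in> J. v j = c'}) * f c c'"])
  also have "\<dots> = (\<Sum>c<K. \<Sum>c'<K. \<nu> c * \<nu> c' * f c c')"
    by (simp add: sum_distrib_left mult_ac)
  also have "\<dots> \<le> (\<Sum>c<K. \<Sum>c'<K. ((\<nu> c)\<^sup>2 * f c c' + (\<nu> c')\<^sup>2 * f c c') / 2)"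
  proof (intro sum_mono)
    fix c c'
    have "2 * (\<nu> c * \<nu> c') \<le> (\<nu> c)\<^sup>2 + (\<nu> c')\<^sup>2" using sum_squares_bound[of "\<nu> c" "\<nu> c'"] by simp
    hence "2 * (\<nu> c * \<nu> c') * f c c' \<le> ((\<nu> c)\<^sup>2 + (\<nu> c')\<^sup>2) * f c c'" using f0 by (intro mult_right_mono)
    thus "\<nu> c * \<nu> c' * f c c' \<le> ((\<nu> c)\<^sup>2 * f c c' + (\<nu> c')\<^sup>2 * f c c') / 2" by (simp add: algebra_simps)
  qed
  also have "\<dots> = ((\<Sum>c<K. \<Sum>c'<K. (\<nu> c)\<^sup>2 * f c c') + (\<Sum>c<K. \<Sum>c'<K. (\<nu> c')\<^sup>2 * f c c')) / 2"
    by (simp add: sum.distrib sum_divide_distrib [symmetric])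
  also have "(\<Sum>c<K. \<Sum>c'<K. (\<nu> c')\<^sup>2 * f c c') = (\<Sum>c<K. \<Sum>c'<K. (\<nu> c)\<^sup>2 * f c c')"
    by (subst sum.swap) (simp add: fsym)
  also have "((\<Sum>c<K. \<Sum>c'<K. (\<nu> c)\<^sup>2 * f c c') + (\<Sum>c<K. \<Sum>c'<K. (\<nu> c)\<^sup>2 * f c c')) / 2 = (\<Sum>c<K. (\<nu> c)\<^sup>2 * (\<Sum>c'<K. f c c'))"
    unfolding half by (simp add: sum_distrib_left)
  also have "\<dots> \<le> (\<Sum>c<K. (\<nu> c)\<^sup>2 * (2 * harm K))"
    using fsum by (intro sum_mono mult_left_mono) auto
  also have "\<dots> = 2 * harm K * (\<Sum>c<K. (\<nu> c)\<^sup>2)" by (simp add: sum_distrib_left mult_ac)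
  also have "(\<Sum>c<K. (\<nu> c)\<^sup>2) = real (card {(i, j). i \<in> J \<and> j \<in> J \<and> v i = v j})"
    unfolding \<nu>_def by (rule card_fiber_pairs[OF fin T, symmetric])
  finally show ?thesis unfolding f_def .
qed

text \<open>The scale \<kappa> places all \<open>\<kappa> * w j\<close> in \<open>[0, 1/2]\<close>,
  so the distance of a difference from the integers is its absolute value and the geometric sums
  over \<open>g\<close> can be estimated without wrap-around. Rounding \<open>w j\<close> to cells
  of length \<open>1 / (\<kappa> * G)\<close> turns these estimates into the kernel of
  \<open>sum_pairs_inverse_distance\<close>.\<close>

lemma mean_square_grid:
  fixes w :: "'j \<Rightarrow> real" and \<beta> :: "'j \<Rightarrow> complex"
  assumes fin: "finite J" and w: "\<And>j. j \<in> J \<Longrightarrow> 0 \<le> w j \<and> w j \<le> w0" and w0: "w0 > 0" and G: "G > 0"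
    and \<beta>: "\<And>j. j \<in> J \<Longrightarrow> norm (\<beta> j) \<le> 1"
  defines "\<kappa> \<equiv> 1 / (2 * w0)"
  shows "(\<Sum>g<G. (norm (\<Sum>j\<in>J. \<beta> j * ee (real g * (\<kappa> * w j))))\<^sup>2)
     \<le> 6 * real G * harm G * real (card {(i, j). i \<in> J \<and> j \<in> J \<and> \<bar>w i - w j\<bar> * (\<kappa> * real G) \<le> 1})"
proof -
  have \<kappa>: "\<kappa> > 0" using w0 by (simp add: \<kappa>_def)
  define v where "v j = nat \<lfloor>w j * (\<kappa> * real G)\<rfloor>" for j
  have vr: "real (v j) \<le> w j * (\<kappa> * real G) \<and> w j * (\<kappa> * real G) < real (v j) + 1" if "j \<in> J" for j
  proof -
    have "w j * (\<kappa> * real G) \<ge> 0" using w[OF that] \<kappa> by auto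
    thus ?thesis unfolding v_def by linarith
  qed
  have wk: "\<kappa> * w j \<le> 1 / 2" if "j \<in> J" for j
    using w[OF that] w0 by (simp add: \<kappa>_def field_simps)
  have vG: "v j < G" if "j \<in> J" for j
  proof -
    have "w j * (\<kappa> * real G) = (\<kappa> * w j) * real G" by simp
    also have "\<dots> \<le> 1 / 2 * real G" using wk[OF that] by (intro mult_right_mono) auto
    also have "\<dots> < real G" using G by simp
    finally show ?thesis using vr[OF that] by linarith
  qed
  have inner: "norm (\<Sum>g<G. ee (real g * (\<kappa> * w i - \<kappa> * w j))) \<le> 3 * real G * (1 / (real (nat \<bar>int (v i) - int (v j)\<bar>) + 1))"
    if ij: "i \<in> J" "j \<in> J" for i j
  proof -
    define \<theta> where "\<theta> = \<kappa> * w i - \<kappa> * w j"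
    define k where "k = nat \<bar>int (v i) - int (v j)\<bar>"
    have triv: "norm (\<Sum>g<G. ee (real g * \<theta>)) \<le> real G"
      by (rule order_trans[OF norm_sum]) simp
    have k: "real k = \<bar>real (v i) - real (v j)\<bar>" by (simp add: k_def)
    have \<theta>G: "\<theta> * real G = w i * (\<kappa> * real G) - w j * (\<kappa> * real G)" by (simp add: \<theta>_def algebra_simps)
    have kG: "real k - 1 \<le> \<bar>\<theta>\<bar> * real G"
    proof -
      have "real k - 1 \<le> \<bar>\<theta> * real G\<bar>" unfolding \<theta>G k using vr[OF ij(1)] vr[OF ij(2)] by linarith
      thus ?thesis by (simp add: abs_mult)
    qed
    have "norm (\<Sum>g<G. ee (real g * \<theta>)) \<le> 3 * real G * (1 / (real k + 1))"
    \<comment> \<open>Cell indices that differ by \<open>k\<close> only give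
      \<open>\<bar>\<theta>\<bar> * G \<ge> k - 1\<close>; points of neighbouring cells may be
      arbitrarily close, so the smallest \<open>k\<close> are left to the trivial bound.\<close>
    proof (cases "k \<le> 2")
      case True
      have "real G * 1 \<le> real G * (3 * (1 / (real k + 1)))"
        using True by (intro mult_left_mono) auto
      hence "real G \<le> 3 * real G * (1 / (real k + 1))" by (simp only: mult_ac mult_1_right)
      thus ?thesis using triv by linarith
    next
      case False
      have k3: "real k \<ge> 3" using False by linarith
      have t0: "\<bar>\<theta>\<bar> > 0" using kG k3 by (cases "\<theta> = 0") auto
      have "0 \<le> \<kappa> * w i" "0 \<le> \<kappa> * w j" using w ij \<kappa> by auto
      hence "\<bar>\<theta>\<bar> \<le> 1 / 2" using wk[OF ij(1)] wk[OF ij(2)] unfolding \<theta>_def by linarith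
      hence "norm (\<Sum>g<G. ee (real g * \<theta>)) \<le> 1 / \<bar>\<theta>\<bar>" using t0 by (intro geometric_ee_bound) auto
      also have "\<dots> \<le> 3 * real G * (1 / (real k + 1))"
      proof -
        have "real k + 1 \<le> 3 * (real k - 1)" using k3 by simp
        also have "\<dots> \<le> 3 * (\<bar>\<theta>\<bar> * real G)" using kG by simp
        finally show ?thesis using t0 k3 by (simp add: field_simps)
      qed
      finally show ?thesis .
    qed
    thus ?thesis by (simp only: \<theta>_def k_def)
  qed
  have "complex_of_real (\<Sum>g<G. (norm (\<Sum>j\<in>J. \<beta> j * ee (real g * (\<kappa> * w j))))\<^sup>2)
     = (\<Sum>g<G. \<Sum>i\<in>J. \<Sum>j\<in>J. \<beta> i * cnj (\<beta> j) * ee (real g * (\<kappa> * w i - \<kappa> * w j)))"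
    unfolding of_real_sum
  proof (intro sum.cong refl)
    fix g
    have "complex_of_real ((norm (\<Sum>j\<in>J. \<beta> j * ee (real g * (\<kappa> * w j))))\<^sup>2)
      = (\<Sum>j\<in>J. \<beta> j * ee (real g * (\<kappa> * w j))) * cnj (\<Sum>j\<in>J. \<beta> j * ee (real g * (\<kappa> * w j)))"
      by (rule complex_norm_square)
    also have "\<dots> = (\<Sum>i\<in>J. \<Sum>j\<in>J. \<beta> i * cnj (\<beta> j) * ee (real g * (\<kappa> * w i - \<kappa> * w j)))"
      by (simp add: sum_product cnj_sum right_diff_distrib ee_diff mult_ac)
    finally show "complex_of_real ((norm (\<Sum>j\<in>J. \<beta> j * ee (real g * (\<kappa> * w j))))\<^sup>2) = \<dots>" .
  qed
  also have "\<dots> = (\<Sum>i\<in>J. \<Sum>j\<in>J. \<beta> i * cnj (\<beta> j) * (\<Sum>g<G. ee (real g * (\<kappa> * w i - \<kappa> * w j))))"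
  proof -
    have "(\<Sum>g<G. \<Sum>i\<in>J. \<Sum>j\<in>J. \<beta> i * cnj (\<beta> j) * ee (real g * (\<kappa> * w i - \<kappa> * w j)))
      = (\<Sum>i\<in>J. \<Sum>g<G. \<Sum>j\<in>J. \<beta> i * cnj (\<beta> j) * ee (real g * (\<kappa> * w i - \<kappa> * w j)))"
      by (rule sum.swap)
    also have "\<dots> = (\<Sum>i\<in>J. \<Sum>j\<in>J. \<Sum>g<G. \<beta> i * cnj (\<beta> j) * ee (real g * (\<kappa> * w i - \<kappa> * w j)))"
      by (intro sum.cong refl sum.swap)
    finally show ?thesis by (simp only: sum_distrib_left)
  qed
  finally have eq: "complex_of_real (\<Sum>g<G. (norm (\<Sum>j\<in>J. \<beta> j * ee (real g * (\<kappa> * w j))))\<^sup>2) = \<dots>" .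
  have "(\<Sum>g<G. (norm (\<Sum>j\<in>J. \<beta> j * ee (real g * (\<kappa> * w j))))\<^sup>2)
    \<le> norm (complex_of_real (\<Sum>g<G. (norm (\<Sum>j\<in>J. \<beta> j * ee (real g * (\<kappa> * w j))))\<^sup>2))"
    unfolding norm_of_real by (rule abs_ge_self)
  also have "\<dots> \<le> (\<Sum>i\<in>J. \<Sum>j\<in>J. norm (\<beta> i * cnj (\<beta> j) * (\<Sum>g<G. ee (real g * (\<kappa> * w i - \<kappa> * w j)))))"
    unfolding eq by (intro sum_norm_le norm_sum)
  also have "\<dots> \<le> (\<Sum>i\<in>J. \<Sum>j\<in>J. 3 * real G * (1 / (real (nat \<bar>int (v i) - int (v j)\<bar>) + 1)))"
  proof (intro sum_mono)
    fix i j assume ij: "i \<in> J" "j \<in> J"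
    have "norm (\<beta> i * cnj (\<beta> j)) \<le> 1 * 1"
      unfolding norm_mult using \<beta>[OF ij(1)] \<beta>[OF ij(2)] by (intro mult_mono) auto
    hence "norm (\<beta> i * cnj (\<beta> j)) * norm (\<Sum>g<G. ee (real g * (\<kappa> * w i - \<kappa> * w j)))
      \<le> 1 * (3 * real G * (1 / (real (nat \<bar>int (v i) - int (v j)\<bar>) + 1)))"
      using inner[OF ij] by (intro mult_mono) auto
    thus "norm (\<beta> i * cnj (\<beta> j) * (\<Sum>g<G. ee (real g * (\<kappa> * w i - \<kappa> * w j)))) \<le> 3 * real G * (1 / (real (nat \<bar>int (v i) - int (v j)\<bar>) + 1))"
      by (simp add: norm_mult)
  qed
  also have "\<dots> = 3 * real G * (\<Sum>i\<in>J. \<Sum>j\<in>J. 1 / (real (nat \<bar>int (v i) - int (v j)\<bar>) + 1))"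
    by (simp only: sum_distrib_left)
  also have "\<dots> \<le> 3 * real G * (2 * harm G * real (card {(i, j). i \<in> J \<and> j \<in> J \<and> v i = v j}))"
    by (intro mult_left_mono sum_pairs_inverse_distance fin vG) auto
  also have "\<dots> \<le> 3 * real G * (2 * harm G * real (card {(i, j). i \<in> J \<and> j \<in> J \<and> \<bar>w i - w j\<bar> * (\<kappa> * real G) \<le> 1}))"
  proof (intro mult_left_mono of_nat_mono card_mono)
    show "finite {(i, j). i \<in> J \<and> j \<in> J \<and> \<bar>w i - w j\<bar> * (\<kappa> * real G) \<le> 1}"
      by (rule finite_subset[of _ "J \<times> J"]) (use fin in auto)
    show "{(i, j). i \<in> J \<and> j \<in> J \<and> v i = v j} \<subseteq> {(i, j). i \<in> J \<and> j \<in> J \<and> \<bar>w i - w j\<bar> * (\<kappa> * real G) \<le> 1}"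
    proof clarify
      fix i j assume ij: "i \<in> J" "j \<in> J" "v i = v j"
      have "\<bar>w i * (\<kappa> * real G) - w j * (\<kappa> * real G)\<bar> \<le> 1" using vr[OF ij(1)] vr[OF ij(2)] ij(3) by linarith
      moreover have "\<bar>w i * (\<kappa> * real G) - w j * (\<kappa> * real G)\<bar> = \<bar>w i - w j\<bar> * (\<kappa> * real G)"
        using \<kappa> by (simp add: abs_mult flip: left_diff_distrib)
      ultimately show "\<bar>w i - w j\<bar> * (\<kappa> * real G) \<le> 1" by simp
    qed
  qed (auto simp: harm_nonneg)
  finally show ?thesis by (simp add: mult_ac)
qed

text \<open>The double large sieve of Bombieri and Iwaniec in dimension one. Each \<open>t i\<close>
  is rounded down to a grid of step \<open>\<kappa> = 1 / (2 * w0)\<close>; \<open>G\<close> counts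
  the grid points up to \<open>R\<close>. On the grid, Cauchy's inequality separates the
  multiplicities of the grid points, which count close pairs in \<open>I\<close>, from a mean
  square, which counts close pairs in \<open>J\<close>. The rounding error is a phase of at most
  half a turn; its power series separates the variables and costs the factor
  \<open>exp pi\<close>.\<close>

lemma double_large_sieve:
  fixes t :: "'i \<Rightarrow> real" and w :: "'j \<Rightarrow> real" and \<beta> :: "'j \<Rightarrow> complex"
  assumes finI: "finite I" and finJ: "finite J"
    and t: "\<And>i. i \<in> I \<Longrightarrow> 0 \<le> t i \<and> t i \<le> R" and R: "R > 0"
    and w: "\<And>j. j \<in> J \<Longrightarrow> 0 \<le> w j \<and> w j \<le> w0" and w0: "w0 > 0"
    and \<beta>: "\<And>j. j \<in> J \<Longrightarrow> norm (\<beta> j) \<le> 1"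
  defines "G \<equiv> nat \<lfloor>2 * w0 * R\<rfloor> + 1"
  shows "(\<Sum>i\<in>I. norm (\<Sum>j\<in>J. \<beta> j * ee (t i * w j)))\<^sup>2
    \<le> (exp pi)\<^sup>2 * real (card {(i, i'). i \<in> I \<and> i' \<in> I \<and> \<bar>t i - t i'\<bar> * (2 * w0) \<le> 1})
      * (6 * real G * harm G * real (card {(j, j'). j \<in> J \<and> j' \<in> J \<and> \<bar>w j - w j'\<bar> * R \<le> 1}))"
proof -
  define \<kappa> where "\<kappa> = 1 / (2 * w0)"
  have \<kappa>: "\<kappa> > 0" using w0 by (simp add: \<kappa>_def)
  define g where "g i = nat \<lfloor>t i / \<kappa>\<rfloor>" for i
  define P where "P = real (card {(i, i'). i \<in> I \<and> i' \<in> I \<and> \<bar>t i - t i'\<bar> * (2 * w0) \<le> 1})"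
  define E where "E = real (card {(j, j'). j \<in> J \<and> j' \<in> J \<and> \<bar>w j - w j'\<bar> * R \<le> 1})"
  define Q where "Q = 6 * real G * harm G * E"
  have PQ: "P \<ge> 0" "Q \<ge> 0" by (auto simp: P_def Q_def E_def harm_nonneg)
  have G0: "G > 0" by (simp add: G_def)
  have RG: "R \<le> \<kappa> * real G"
  proof -
    have "2 * w0 * R \<le> real G" using w0 R unfolding G_def by linarith
    thus ?thesis using w0 by (simp add: \<kappa>_def field_simps)
  qed
  have gr: "real (g i) * \<kappa> \<le> t i \<and> t i \<le> (real (g i) + 1) * \<kappa>" if "i \<in> I" for i
  proof -
    have "t i / \<kappa> \<ge> 0" using t[OF that] \<kappa> by auto
    hence "real (g i) \<le> t i / \<kappa>" "t i / \<kappa> \<le> real (g i) + 1" unfolding g_def by linarith+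
    thus ?thesis using \<kappa> by (simp add: field_simps)
  qed
  have gG: "g i < G" if "i \<in> I" for i
  proof -
    have "t i / \<kappa> = 2 * w0 * t i" by (simp add: \<kappa>_def)
    also have "\<dots> \<le> 2 * w0 * R" using t[OF that] w0 by (intro mult_left_mono) auto
    finally have "\<lfloor>t i / \<kappa>\<rfloor> \<le> \<lfloor>2 * w0 * R\<rfloor>" by (rule floor_mono)
    thus ?thesis unfolding g_def G_def by linarith
  qed
  have grid: "(\<Sum>i\<in>I. norm (\<Sum>j\<in>J. \<gamma> j * ee (real (g i) * (\<kappa> * w j)))) \<le> sqrt (P * Q)"
    if \<gamma>: "\<And>j. j \<in> J \<Longrightarrow> norm (\<gamma> j) \<le> 1" for \<gamma> :: "'j \<Rightarrow> complex"
  proof -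
    define N where "N c = norm (\<Sum>j\<in>J. \<gamma> j * ee (real c * (\<kappa> * w j)))" for c :: nat
    define \<nu> where "\<nu> c = real (card {i \<in> I. g i = c})" for c
    have T: "finite {..<G}" "g ` I \<subseteq> {..<G}" using gG by auto
    have "(\<Sum>i\<in>I. N (g i)) = (\<Sum>c<G. \<nu> c * N c)"
      unfolding \<nu>_def by (rule sum_fiber[OF finI T])
    hence "(\<Sum>i\<in>I. N (g i))\<^sup>2 \<le> (\<Sum>c<G. (\<nu> c)\<^sup>2) * (\<Sum>c<G. (N c)\<^sup>2)"
      using Cauchy_Schwarz_ineq_sum[of \<nu> N "{..<G}"] by simp
    also have "\<dots> \<le> P * Q"
    proof (intro mult_mono)
      have "(\<Sum>c<G. (\<nu> c)\<^sup>2) = real (card {(i, i'). i \<in> I \<and> i' \<in> I \<and> g i = g i'})"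
        unfolding \<nu>_def by (rule card_fiber_pairs[OF finI T, symmetric])
      also have "\<dots> \<le> P" unfolding P_def
      proof (intro of_nat_mono card_mono)
        show "finite {(i, i'). i \<in> I \<and> i' \<in> I \<and> \<bar>t i - t i'\<bar> * (2 * w0) \<le> 1}"
          by (rule finite_subset[of _ "I \<times> I"]) (use finI in auto)
        show "{(i, i'). i \<in> I \<and> i' \<in> I \<and> g i = g i'} \<subseteq> {(i, i'). i \<in> I \<and> i' \<in> I \<and> \<bar>t i - t i'\<bar> * (2 * w0) \<le> 1}"
        proof clarify
          fix i i' assume ii: "i \<in> I" "i' \<in> I" "g i = g i'"
          have "(real (g i') + 1) * \<kappa> = real (g i') * \<kappa> + \<kappa>" by (simp add: algebra_simps)
          hence "\<bar>t i - t i'\<bar> \<le> \<kappa>" using gr[OF ii(1), unfolded ii(3)] gr[OF ii(2)] by linarith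
          hence "\<bar>t i - t i'\<bar> * (2 * w0) \<le> \<kappa> * (2 * w0)" using w0 by (intro mult_right_mono) auto
          thus "\<bar>t i - t i'\<bar> * (2 * w0) \<le> 1" using w0 by (simp add: \<kappa>_def)
        qed
      qed
      finally show "(\<Sum>c<G. (\<nu> c)\<^sup>2) \<le> P" .
      have "(\<Sum>c<G. (N c)\<^sup>2) \<le> 6 * real G * harm G * real (card {(i, j). i \<in> J \<and> j \<in> J \<and> \<bar>w i - w j\<bar> * (\<kappa> * real G) \<le> 1})"
        unfolding N_def \<kappa>_def by (rule mean_square_grid[OF finJ w w0 G0 \<gamma>])
      also have "\<dots> \<le> Q" unfolding Q_def E_def
      proof (intro mult_left_mono of_nat_mono card_mono)
        show "finite {(j, j'). j \<in> J \<and> j' \<in> J \<and> \<bar>w j - w j'\<bar> * R \<le> 1}"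
          by (rule finite_subset[of _ "J \<times> J"]) (use finJ in auto)
        show "{(i, j). i \<in> J \<and> j \<in> J \<and> \<bar>w i - w j\<bar> * (\<kappa> * real G) \<le> 1} \<subseteq> {(j, j'). j \<in> J \<and> j' \<in> J \<and> \<bar>w j - w j'\<bar> * R \<le> 1}"
        proof clarify
          fix a b assume "\<bar>w a - w b\<bar> * (\<kappa> * real G) \<le> 1"
          thus "\<bar>w a - w b\<bar> * R \<le> 1" using mult_left_mono[OF RG, of "\<bar>w a - w b\<bar>"] by simp
        qed
      qed (auto simp: harm_nonneg)
      finally show "(\<Sum>c<G. (N c)\<^sup>2) \<le> Q" .
    qed (use PQ in \<open>auto intro: sum_nonneg\<close>)
    finally have "(\<Sum>i\<in>I. N (g i)) \<le> sqrt (P * Q)" by (rule real_le_rsqrt)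
    thus ?thesis by (simp add: N_def)
  qed
  define r where "r i = (t i - real (g i) * \<kappa>) / \<kappa>" for i
  define \<omega> where "\<omega> j = w j / w0" for j
  have r: "0 \<le> r i \<and> r i \<le> 1" if "i \<in> I" for i
    using gr[OF that] \<kappa> by (auto simp: r_def field_simps)
  have \<omega>: "0 \<le> \<omega> j \<and> \<omega> j \<le> 1" if "j \<in> J" for j
    using w[OF that] w0 by (auto simp: \<omega>_def field_simps)
  \<comment> \<open>The powers of \<omega> lie in \<open>[0, 1]\<close> and are absorbed into the
    coefficients, so the grid estimate holds for every \<open>k\<close> with the same bound.\<close>
  define W where "W k i = (\<Sum>j\<in>J. (\<beta> j * of_real (\<omega> j) ^ k) * ee (real (g i) * (\<kappa> * w j)))" for k i
  have W: "(\<Sum>i\<in>I. norm (W k i)) \<le> sqrt (P * Q)" for k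
    unfolding W_def
  proof (rule grid)
    fix j assume j: "j \<in> J"
    have "norm (\<beta> j) * \<omega> j ^ k \<le> 1 * 1"
      using \<beta>[OF j] \<omega>[OF j] by (intro mult_mono power_le_one) auto
    thus "norm (\<beta> j * of_real (\<omega> j) ^ k) \<le> 1" using \<omega>[OF j] by (simp add: norm_mult norm_power)
  qed
  define z where "z i = \<i> * of_real (pi * r i)" for i
  have "(\<lambda>k. z i ^ k /\<^sub>R fact k * W k i) sums (\<Sum>j\<in>J. \<beta> j * ee (t i * w j))" if "i \<in> I" for i
  proof -
    have "(\<lambda>k. \<Sum>j\<in>J. \<beta> j * ee (real (g i) * (\<kappa> * w j)) * ((z i * of_real (\<omega> j)) ^ k /\<^sub>R fact k))
        sums (\<Sum>j\<in>J. \<beta> j * ee (real (g i) * (\<kappa> * w j)) * exp (z i * of_real (\<omega> j)))"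
      by (intro sums_sum sums_mult exp_converges)
    also have "(\<lambda>k. \<Sum>j\<in>J. \<beta> j * ee (real (g i) * (\<kappa> * w j)) * ((z i * of_real (\<omega> j)) ^ k /\<^sub>R fact k))
      = (\<lambda>k. z i ^ k /\<^sub>R fact k * W k i)"
      by (simp add: W_def sum_distrib_left power_mult_distrib mult_ac scaleR_conv_of_real)
    also have "(\<Sum>j\<in>J. \<beta> j * ee (real (g i) * (\<kappa> * w j)) * exp (z i * of_real (\<omega> j))) = (\<Sum>j\<in>J. \<beta> j * ee (t i * w j))"
    proof (intro sum.cong refl)
      fix j assume "j \<in> J"
      have "pi * r i * \<omega> j = 2 * pi * (t i * w j - real (g i) * (\<kappa> * w j))"
        using w0 by (simp add: r_def \<omega>_def \<kappa>_def field_simps)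
      moreover have "z i * of_real (\<omega> j) = \<i> * of_real (pi * r i * \<omega> j)"
        by (simp add: z_def mult.assoc)
      ultimately have "exp (z i * of_real (\<omega> j)) = ee (t i * w j - real (g i) * (\<kappa> * w j))"
        by (simp only: ee_def cis_conv_exp)
      thus "\<beta> j * ee (real (g i) * (\<kappa> * w j)) * exp (z i * of_real (\<omega> j)) = \<beta> j * ee (t i * w j)"
        by (simp add: mult.assoc flip: ee_add)
    qed
    finally show ?thesis .
  qed
  hence "(\<lambda>n. \<Sum>i\<in>I. norm (\<Sum>k<n. z i ^ k /\<^sub>R fact k * W k i)) \<longlonglongrightarrow> (\<Sum>i\<in>I. norm (\<Sum>j\<in>J. \<beta> j * ee (t i * w j)))"
    by (intro tendsto_sum tendsto_norm) (simp add: sums_def)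
  moreover have "(\<Sum>i\<in>I. norm (\<Sum>k<n. z i ^ k /\<^sub>R fact k * W k i)) \<le> exp pi * sqrt (P * Q)" for n
  proof -
    have "(\<Sum>i\<in>I. norm (\<Sum>k<n. z i ^ k /\<^sub>R fact k * W k i)) \<le> (\<Sum>i\<in>I. \<Sum>k<n. pi ^ k /\<^sub>R fact k * norm (W k i))"
    proof (intro sum_mono sum_norm_le)
      fix i k assume i: "i \<in> I"
      have "norm (z i) \<le> pi" using r[OF i] by (simp add: z_def norm_mult mult_left_le)
      hence "norm (z i) ^ k \<le> pi ^ k" by (intro power_mono) auto
      thus "norm (z i ^ k /\<^sub>R fact k * W k i) \<le> pi ^ k /\<^sub>R fact k * norm (W k i)"
        by (simp add: norm_mult norm_power divide_right_mono mult_right_mono mult_left_mono)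
    qed
    also have "\<dots> = (\<Sum>k<n. pi ^ k /\<^sub>R fact k * (\<Sum>i\<in>I. norm (W k i)))"
      by (subst sum.swap) (simp add: sum_distrib_left)
    also have "\<dots> \<le> (\<Sum>k<n. pi ^ k /\<^sub>R fact k * sqrt (P * Q))"
      by (intro sum_mono mult_left_mono W) auto
    also have "\<dots> = (\<Sum>k<n. pi ^ k /\<^sub>R fact k) * sqrt (P * Q)" by (simp add: sum_distrib_right)
    also have "\<dots> \<le> exp pi * sqrt (P * Q)"
    proof (intro mult_right_mono)
      show "(\<Sum>k<n. pi ^ k /\<^sub>R fact k) \<le> exp pi"
        unfolding exp_def by (intro sum_le_suminf summable_exp_generic) auto
    qed (use PQ in auto)
    finally show ?thesis .
  qed
  ultimately have "(\<Sum>i\<in>I. norm (\<Sum>j\<in>J. \<beta> j * ee (t i * w j))) \<le> exp pi * sqrt (P * Q)"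
    by (intro LIMSEQ_le_const2) auto
  hence "(\<Sum>i\<in>I. norm (\<Sum>j\<in>J. \<beta> j * ee (t i * w j)))\<^sup>2 \<le> (exp pi * sqrt (P * Q))\<^sup>2"
    by (intro power_mono sum_nonneg) auto
  also have "\<dots> = (exp pi)\<^sup>2 * P * Q" using PQ by (simp add: power_mult_distrib)
  finally show ?thesis by (simp add: P_def Q_def E_def)
qed

section \<open>Spacing of differences of reciprocals\<close>

lemma card_le_diameter:
  fixes X :: "nat set"
  assumes fin: "finite X" and w: "w \<ge> 0"
    and diam: "\<And>x y. x \<in> X \<Longrightarrow> y \<in> X \<Longrightarrow> x < y \<Longrightarrow> real y - real x \<le> w"
  shows "real (card X) \<le> w + 1"
proof (cases "X = {}")
  case False
  have mm: "Min X \<in> X" "Max X \<in> X" "Min X \<le> Max X" using False fin by auto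
  have "X \<subseteq> {Min X..Max X}" using fin by auto
  hence "card X \<le> Suc (Max X) - Min X" by (metis card_atLeastAtMost card_mono finite_atLeastAtMost)
  hence "real (card X) \<le> real (Max X) - real (Min X) + 1" using mm by linarith
  moreover have "real (Max X) - real (Min X) \<le> w"
    using diam[OF mm(1,2)] mm(3) w by (cases "Min X = Max X") auto
  ultimately show ?thesis by linarith
qed (use w in auto)

text \<open>Points more than \<open>L\<close> apart have distinct quotients by
  \<open>L\<close>.\<close>

lemma card_le_separated:
  fixes X :: "nat set"
  assumes X: "X \<subseteq> {M<..2*M}" and L: "L > 0"
    and sep: "\<And>x y. x \<in> X \<Longrightarrow> y \<in> X \<Longrightarrow> x < y \<Longrightarrow> L < y - x"
  shows "real (card X) \<le> real M / real L + 2"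
proof -
  have lt: "x div L < y div L" if "x \<in> X" "y \<in> X" "x < y" for x y
  proof -
    have "x + L \<le> y" using sep[OF that] by simp
    hence "(x + L) div L \<le> y div L" by (rule div_le_mono)
    thus ?thesis using L by simp
  qed
  have "inj_on (\<lambda>x. x div L) X"
    by (rule inj_onI) (metis lt linorder_neqE_nat order_less_irrefl)
  hence "card X = card ((\<lambda>x. x div L) ` X)" by (simp add: card_image)
  also have "\<dots> \<le> card {M div L..(2 * M) div L}"
    using X by (intro card_mono) (auto intro!: div_le_mono simp: subset_iff less_imp_le)
  also have "\<dots> = Suc ((2 * M) div L) - M div L" by simp
  finally have "real (card X) \<le> real ((2 * M) div L) + 1 - real (M div L)"
    using div_le_mono[of M "2 * M" L] by linarith
  moreover have "real ((2 * M) div L) \<le> 2 * (real M / real L)"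
    using of_nat_div_le_of_nat[where ?'a = real, of "2 * M" L] by simp
  moreover have "real M / real L - 1 \<le> real (M div L)" by (rule real_nat_div_ge)
  ultimately show ?thesis by linarith
qed

text \<open>The expression is \<open>m (m + a) n (n + b)\<close> times
  \<open>(1 / m - 1 / (m + a)) - (1 / n - 1 / (n + b))\<close>, so a close pair is a near coincidence of two differences of reciprocals.\<close>

definition close_pair :: "real \<Rightarrow> nat \<Rightarrow> nat \<Rightarrow> nat \<Rightarrow> nat \<Rightarrow> bool" where
  "close_pair Y a b m n \<longleftrightarrow> \<bar>real a * real n * (real n + real b) - real b * real m * (real m + real a)\<bar> \<le> Y"

text \<open>Only first coordinates are recorded, because the separation argument concerns them; the
  number of partners of each is controlled by \<open>card_close_n\<close>.\<close>

definition close_fst :: "nat \<Rightarrow> real \<Rightarrow> nat \<Rightarrow> nat \<Rightarrow> nat set" where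
  "close_fst M Y a b = {m \<in> {M<..2*M}. \<exists>n\<in>{M<..2*M}. close_pair Y a b m n}"

lemma finite_close_fst [simp]: "finite (close_fst M Y a b)"
  by (simp add: close_fst_def)

lemma card_close_fst_le: "card (close_fst M Y a b) \<le> M"
proof -
  have "card (close_fst M Y a b) \<le> card {M<..2*M}" unfolding close_fst_def by (intro card_mono) auto
  thus ?thesis by simp
qed

lemma close_pair_sym: "close_pair Y a b m n \<longleftrightarrow> close_pair Y b a n m"
  by (simp add: close_pair_def abs_minus_commute)

text \<open>The two products compared in \<open>close_pair\<close> are at least
  \<open>b * M\<^sup>2\<close> and at most \<open>6 * a * M\<^sup>2\<close>, and they differ by at
  most \<open>M\<^sup>2 / 2\<close>. Integrality removes the resulting \<open>1/2\<close>.\<close>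

lemma close_pair_ratio:
  assumes c: "close_pair Y a b m n" and m: "m \<in> {M<..2*M}" and n: "n \<in> {M<..2*M}"
    and b: "b \<le> M" and Y: "2 * Y \<le> (real M)\<^sup>2"
  shows "b \<le> 6 * a"
proof -
  have M: "real M > 0" "real M < real n" "real n \<le> 2 * real M" "real M < real m" "real b \<le> real M"
    using m n b by auto
  have "real b * (real M * real M) \<le> real b * (real m * (real m + real a))"
    using M by (intro mult_left_mono mult_mono) auto
  also have "\<dots> \<le> real a * (real n * (real n + real b)) + Y"
    using c unfolding close_pair_def by (simp add: algebra_simps abs_le_iff)
  also have "real a * (real n * (real n + real b)) \<le> real a * ((2 * real M) * (2 * real M + real M))"
    using M by (intro mult_left_mono mult_mono) auto
  also have "\<dots> + Y \<le> (6 * real a + 1 / 2) * (real M * real M)"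
    using Y by (simp add: algebra_simps power2_eq_square)
  finally have "real b \<le> 6 * real a + 1 / 2" using M by (simp add: mult_le_cancel_right)
  hence "real b < real (6 * a + 1)" by simp
  thus ?thesis by (simp only: of_nat_less_iff)
qed

text \<open>As a function of \<open>n\<close>, the product \<open>a * n * (n + b)\<close> grows by
  at least \<open>2 * a * M\<close> per step, and closeness confines it to a window of length
  \<open>2 * Y\<close>.\<close>

lemma card_close_n:
  assumes a: "a > 0" and M: "M > 0" and Y: "Y \<ge> 0"
  shows "real (card {n \<in> {M<..2*M}. close_pair Y a b m n}) \<le> Y / (real a * real M) + 1"
proof (rule card_le_diameter)
  show "Y / (real a * real M) \<ge> 0" using Y by simp
  fix x y assume xy: "x \<in> {n \<in> {M<..2*M}. close_pair Y a b m n}" "y \<in> {n \<in> {M<..2*M}. close_pair Y a b m n}" "x < y"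
  have "(real y - real x) * (2 * (real a * real M)) \<le> (real y - real x) * (real a * (real x + real y + real b))"
  proof (intro mult_left_mono)
    have "real a * (2 * real M) \<le> real a * (real x + real y + real b)"
      using xy by (intro mult_left_mono) auto
    thus "2 * (real a * real M) \<le> real a * (real x + real y + real b)" by simp
  qed (use xy in auto)
  also have "\<dots> = real a * real y * (real y + real b) - real a * real x * (real x + real b)"
    by (simp add: algebra_simps)
  also have "\<dots> \<le> 2 * Y" using xy by (auto simp: close_pair_def abs_le_iff)
  finally have "(real y - real x) * (real a * real M) \<le> Y" by simp
  thus "real y - real x \<le> Y / (real a * real M)" using a M by (simp add: pos_le_divide_eq)
qed auto

text \<open>Each first coordinate has at most \<open>Y / (a * M) + 1\<close> partners. The first
  term, summed over at most \<open>M\<close> values of \<open>m\<close> and over the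
  \<open>b \<le> 6 * a\<close> left by \<open>close_pair_ratio\<close>, amounts to at most
  \<open>6 * Y\<close> for each \<open>a\<close>.\<close>

lemma card_close_quadruples:
  assumes M: "M > 0" and A: "A \<le> M" and Y: "Y \<ge> 0" "2 * Y \<le> (real M)\<^sup>2"
  shows "real (card {(a, m, b, n). a \<in> {1..<A} \<and> b \<in> {1..<A} \<and> m \<in> {M<..2*M} \<and> n \<in> {M<..2*M} \<and> close_pair Y a b m n})
    \<le> (\<Sum>a\<in>{1..<A}. \<Sum>b\<in>{1..<A}. real (card (close_fst M Y a b))) + 6 * real A * Y"
proof -
  let ?Q = "{(a, m, b, n). a \<in> {1..<A} \<and> b \<in> {1..<A} \<and> m \<in> {M<..2*M} \<and> n \<in> {M<..2*M} \<and> close_pair Y a b m n}"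
  let ?S = "SIGMA a:{1..<A}. SIGMA b:{1..<A}. SIGMA m:close_fst M Y a b. {n \<in> {M<..2*M}. close_pair Y a b m n}"
  have "card ?Q = card ?S"
    by (rule bij_betw_same_card[of "\<lambda>(a, m, b, n). (a, b, m, n)"],
        rule bij_betw_byWitness[where f' = "\<lambda>(a, b, m, n). (a, m, b, n)"]) (auto simp: close_fst_def)
  also have "card ?S = (\<Sum>a\<in>{1..<A}. \<Sum>b\<in>{1..<A}. \<Sum>m\<in>close_fst M Y a b. card {n \<in> {M<..2*M}. close_pair Y a b m n})"
    by (subst card_SigmaI; (simp add: card_SigmaI)?)
  finally have "real (card ?Q) = (\<Sum>a\<in>{1..<A}. \<Sum>b\<in>{1..<A}. \<Sum>m\<in>close_fst M Y a b. real (card {n \<in> {M<..2*M}. close_pair Y a b m n}))"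
    by simp
  also have "\<dots> \<le> (\<Sum>a\<in>{1..<A}. \<Sum>b\<in>{1..<A}. \<Sum>m\<in>close_fst M Y a b. (Y / (real a * real M) + 1))"
    using M Y by (intro sum_mono card_close_n) auto
  also have "\<dots> = (\<Sum>a\<in>{1..<A}. \<Sum>b\<in>{1..<A}. real (card (close_fst M Y a b)) * (Y / (real a * real M))) + (\<Sum>a\<in>{1..<A}. \<Sum>b\<in>{1..<A}. real (card (close_fst M Y a b)))"
    by (simp add: sum.distrib distrib_left)
  also have "(\<Sum>a\<in>{1..<A}. \<Sum>b\<in>{1..<A}. real (card (close_fst M Y a b)) * (Y / (real a * real M))) \<le> (\<Sum>a\<in>{1..<A}. 6 * Y)"
  proof (intro sum_mono)
    fix a assume a: "a \<in> {1..<A}"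
    have "(\<Sum>b\<in>{1..<A}. real (card (close_fst M Y a b)) * (Y / (real a * real M))) \<le> (\<Sum>b\<in>{1..<A}. if b \<le> 6 * a then Y / real a else 0)"
    proof (intro sum_mono)
      fix b assume b: "b \<in> {1..<A}"
      show "real (card (close_fst M Y a b)) * (Y / (real a * real M)) \<le> (if b \<le> 6 * a then Y / real a else 0)"
      proof (cases "b \<le> 6 * a")
        case True
        have "real (card (close_fst M Y a b)) * (Y / (real a * real M)) \<le> real M * (Y / (real a * real M))"
          using card_close_fst_le[of M Y a b] Y by (intro mult_right_mono) auto
        thus ?thesis using True M by simp
      next
        case False
        have "b \<le> M" using b A by auto
        hence "close_fst M Y a b = {}" using False close_pair_ratio[OF _ _ _ _ Y(2), of a b] unfolding close_fst_def by blast
        thus ?thesis using False by simp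
      qed
    qed
    also have "\<dots> = (\<Sum>b\<in>{b \<in> {1..<A}. b \<le> 6 * a}. Y / real a)"
      by (subst sum.inter_filter) auto
    also have "\<dots> \<le> (\<Sum>b\<in>{1..6*a}. Y / real a)"
      using Y by (intro sum_mono2) auto
    also have "\<dots> = 6 * Y" using a by simp
    finally show "(\<Sum>b\<in>{1..<A}. real (card (close_fst M Y a b)) * (Y / (real a * real M))) \<le> 6 * Y" .
  qed
  also have "(\<Sum>a\<in>{1..<A}. 6 * Y) \<le> 6 * real A * Y"
  proof -
    have "real (A - 1) * (6 * Y) \<le> real A * (6 * Y)" using Y by (intro mult_right_mono) auto
    thus ?thesis by simp
  qed
  finally show ?thesis by simp
qed

text \<open>For fixed \<open>a\<close> and \<open>b\<close> the close pairs lie near a curve of nearly constant slope \<open>sqrt (b / a)\<close>. Hence two of them whose first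
  coordinates differ by a small \<open>q\<close> force \<open>b / a\<close> to be close to the square of a rational with
  denominator \<open>q\<close>, which happens for few pairs \<open>(a, b)\<close> only.\<close>

lemma close_pairs_curvature:
  fixes a b m n q L A M :: nat and p :: int
  assumes c0: "close_pair Y a b m n" and c1: "close_pair Y a b (m + q) n'"
    and p: "int n' = int n + p"
    and rng: "m \<in> {M<..2*M}" "n \<in> {M<..2*M}" "m + q \<in> {M<..2*M}" "n' \<in> {M<..2*M}"
    and q: "1 \<le> q" "q \<le> L" and L: "L \<le> A" and A: "A \<le> M" and AL: "real A ^ 2 * real L \<le> real M"
    and ab: "a \<in> {1..<A}" "b \<in> {1..<A}" and Y: "Y \<ge> 0" "2 * Y \<le> (real M)\<^sup>2" and a: "real a > Y / real M"
  shows "\<bar>p\<bar> \<le> 16 * int q" "\<bar>real a * (of_int p)\<^sup>2 - real b * (real q)\<^sup>2\<bar> \<le> 50000 * real q * (Y / real M + 1)"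
proof -
  \<comment> \<open>Real names for the integers involved. Here \<open>\<pi>\<close> is the value of
    \<open>p\<close>, not the circle constant, and \<open>\<theta>\<close> is the value of
    \<open>q\<close>.\<close>
  define \<alpha> \<beta> \<mu> \<nu> \<pi> \<theta> where "\<alpha> = real a" and "\<beta> = real b" and "\<mu> = real m" and "\<nu> = real n"
    and "\<pi> = real_of_int p" and "\<theta> = real q"
  note defs = \<alpha>_def \<beta>_def \<mu>_def \<nu>_def \<pi>_def \<theta>_def
  have n': "real n' = \<nu> + \<pi>" using p unfolding defs by (metis of_int_add of_int_of_nat_eq)
  have M: "real M > 0" using rng by auto
  have \<mu>: "real M < \<mu>" "\<mu> \<le> 2 * real M" and \<nu>: "real M < \<nu>" "\<nu> \<le> 2 * real M"
    and \<mu>q: "\<mu> + \<theta> \<le> 2 * real M" and \<nu>p: "real M < \<nu> + \<pi>" "\<nu> + \<pi> \<le> 2 * real M"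
    using rng n' unfolding \<mu>_def \<nu>_def \<theta>_def by auto
  have \<theta>: "1 \<le> \<theta>" "\<theta> \<le> real L" "\<theta> \<le> real A" "\<theta> \<le> real M" using q L A unfolding \<theta>_def by auto
  have \<alpha>: "1 \<le> \<alpha>" "\<alpha> \<le> real A" "\<alpha> \<le> real M" and \<beta>: "1 \<le> \<beta>" "\<beta> \<le> real A" "\<beta> \<le> real M"
    using ab A unfolding defs by auto
  have "b \<le> 6 * a" using close_pair_ratio[OF c0 rng(1,2) _ Y(2)] ab A by auto
  hence ba: "\<beta> \<le> 6 * \<alpha>" unfolding defs by linarith
  have "a \<le> 6 * b" using close_pair_ratio[OF c0[THEN close_pair_sym[THEN iffD1]] rng(2,1) _ Y(2)] ab A by auto
  hence ab': "\<alpha> \<le> 6 * \<beta>" unfolding defs by linarith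
  have aM: "Y < \<alpha> * real M" using a M unfolding defs by (simp add: field_simps)
  define e0 where "e0 = \<alpha> * \<nu> * (\<nu> + \<beta>) - \<beta> * \<mu> * (\<mu> + \<alpha>)"
  define e1 where "e1 = \<alpha> * (\<nu> + \<pi>) * (\<nu> + \<pi> + \<beta>) - \<beta> * (\<mu> + \<theta>) * (\<mu> + \<theta> + \<alpha>) - e0"
  have e0: "\<bar>e0\<bar> \<le> Y" using c0 unfolding close_pair_def e0_def defs .
  have "\<bar>\<alpha> * (\<nu> + \<pi>) * (\<nu> + \<pi> + \<beta>) - \<beta> * (\<mu> + \<theta>) * (\<mu> + \<theta> + \<alpha>)\<bar> \<le> Y"
    using c1 unfolding close_pair_def n' by (simp add: defs)
  hence e1: "\<bar>e1\<bar> \<le> 2 * Y" using e0 unfolding e1_def by linarith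
  have id1: "\<alpha> * (\<pi> * (2 * \<nu> + \<pi> + \<beta>)) = \<beta> * (\<theta> * (2 * \<mu> + \<theta> + \<alpha>)) + e1"
    unfolding e1_def e0_def by (simp add: algebra_simps)
  have pbound: "\<bar>\<pi>\<bar> \<le> 16 * \<theta>"
  proof -
    have "\<bar>\<pi>\<bar> * (2 * (\<alpha> * real M)) \<le> \<bar>\<pi>\<bar> * (\<alpha> * (2 * \<nu> + \<pi> + \<beta>))"
    proof (intro mult_left_mono)
      have "\<alpha> * (2 * real M) \<le> \<alpha> * (2 * \<nu> + \<pi> + \<beta>)" using \<alpha> \<nu> \<nu>p \<beta> by (intro mult_left_mono) auto
      thus "2 * (\<alpha> * real M) \<le> \<alpha> * (2 * \<nu> + \<pi> + \<beta>)" by simp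
    qed auto
    also have "\<dots> = \<bar>\<alpha> * (\<pi> * (2 * \<nu> + \<pi> + \<beta>))\<bar>"
      using \<alpha> \<nu> \<nu>p \<beta> by (simp add: abs_mult)
    also have "\<dots> \<le> \<bar>\<beta> * (\<theta> * (2 * \<mu> + \<theta> + \<alpha>))\<bar> + \<bar>e1\<bar>" unfolding id1 by (rule abs_triangle_ineq)
    also have "\<bar>\<beta> * (\<theta> * (2 * \<mu> + \<theta> + \<alpha>))\<bar> = \<beta> * (\<theta> * (2 * \<mu> + \<theta> + \<alpha>))"
      using \<alpha> \<beta> \<theta> \<mu> M by (intro abs_of_nonneg mult_nonneg_nonneg) auto
    also have "\<dots> \<le> (6 * \<alpha>) * (\<theta> * (5 * real M))"
      using \<alpha> \<beta> \<theta> \<mu> \<mu>q M ba by (intro mult_mono) auto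
    also have "\<bar>e1\<bar> \<le> 2 * (\<alpha> * real M)" using e1 aM by linarith
    finally have "\<bar>\<pi>\<bar> * (2 * (\<alpha> * real M)) \<le> (15 * \<theta> + 1) * (2 * (\<alpha> * real M))" by (simp add: algebra_simps)
    hence "\<bar>\<pi>\<bar> \<le> 15 * \<theta> + 1" using \<alpha> M by (simp add: mult_le_cancel_right)
    thus ?thesis using \<theta> by linarith
  qed
  show "\<bar>p\<bar> \<le> 16 * int q"
  proof -
    have "real_of_int \<bar>p\<bar> \<le> real_of_int (16 * int q)" using pbound unfolding defs by simp
    thus ?thesis by (simp only: of_int_le_iff)
  qed
  \<comment> \<open>Subtracting the two close relations gives a linear one, \<open>\<alpha> * \<pi>
    * \<nu> \<approx> \<beta> * \<theta> * \<mu>\<close>, with \<open>r\<close> collecting the terms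
    without \<open>\<mu>\<close> and \<open>\<nu>\<close>. The relation \<open>id3\<close> says that
    \<open>\<nu> / \<mu>\<close> is about \<open>sqrt (\<beta> / \<alpha>)\<close>.\<close>
  define r where "r = \<beta> * \<theta> * (\<theta> + \<alpha>) - \<alpha> * \<pi> * (\<pi> + \<beta>) + e1"
  have id2: "2 * \<alpha> * \<pi> * \<nu> = 2 * \<beta> * \<theta> * \<mu> + r"
    using id1 unfolding r_def by (simp add: algebra_simps)
  have id3: "\<alpha> * \<nu>\<^sup>2 = \<beta> * \<mu>\<^sup>2 - \<alpha> * \<beta> * (\<nu> - \<mu>) + e0"
    unfolding e0_def by (simp add: algebra_simps power2_eq_square)
  \<comment> \<open>The hypothesis relating \<open>A\<close>, \<open>L\<close> and \<open>M\<close>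
    enters here: it makes the quadratic corrections as small as \<open>M\<close>.\<close>
  have A2: "real A * real A * \<theta> \<le> real M"
  proof -
    have "real A * real A * \<theta> \<le> real A * real A * real L" using \<theta> by (intro mult_left_mono) auto
    thus ?thesis using AL by (simp add: power2_eq_square)
  qed
  have rb: "\<bar>r\<bar> \<le> 2 * Y + 274 * real M"
  proof -
    have "\<bar>\<beta> * \<theta> * (\<theta> + \<alpha>)\<bar> = \<beta> * \<theta> * (\<theta> + \<alpha>)" using \<alpha> \<beta> \<theta> by (intro abs_of_nonneg mult_nonneg_nonneg) auto
    also have "\<dots> \<le> real A * \<theta> * (2 * real A)" using \<alpha> \<beta> \<theta> by (intro mult_mono) auto
    also have "\<dots> = 2 * (real A * real A * \<theta>)" by simp
    finally have 1: "\<bar>\<beta> * \<theta> * (\<theta> + \<alpha>)\<bar> \<le> 2 * real M" using A2 by linarith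
    have "\<bar>\<alpha> * \<pi> * (\<pi> + \<beta>)\<bar> = \<alpha> * (\<bar>\<pi>\<bar> * \<bar>\<pi> + \<beta>\<bar>)" using \<alpha> by (simp add: abs_mult)
    also have "\<dots> \<le> real A * ((16 * \<theta>) * (17 * real A))"
      using \<alpha> \<beta> \<theta> pbound by (intro mult_mono) auto
    also have "\<dots> = 272 * (real A * real A * \<theta>)" by simp
    finally have 2: "\<bar>\<alpha> * \<pi> * (\<pi> + \<beta>)\<bar> \<le> 272 * real M" using A2 by linarith
    show ?thesis using 1 2 e1 unfolding r_def by linarith
  qed
  define Z where "Z = \<alpha> * \<pi>\<^sup>2 - \<beta> * \<theta>\<^sup>2"
  \<comment> \<open>Squaring \<open>id2\<close> and inserting \<open>id3\<close> eliminates
    \<open>\<nu>\<close> from the main terms. What remains expresses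
    \<open>Z * (4 * \<beta> * \<mu>\<^sup>2)\<close> by error terms only, each at most a multiple of
    \<open>\<theta> * S\<close> times \<open>4 * \<beta> * \<mu>\<^sup>2\<close>.\<close>
  have "(2 * \<alpha> * \<pi> * \<nu>)\<^sup>2 = 4 * (\<alpha> * \<pi>\<^sup>2) * (\<alpha> * \<nu>\<^sup>2)" by (simp add: power2_eq_square algebra_simps)
  also have "\<dots> = 4 * (\<alpha> * \<pi>\<^sup>2) * (\<beta> * \<mu>\<^sup>2 - \<alpha> * \<beta> * (\<nu> - \<mu>) + e0)" by (simp only: id3)
  finally have "(2 * \<beta> * \<theta> * \<mu> + r)\<^sup>2 = 4 * (\<alpha> * \<pi>\<^sup>2) * (\<beta> * \<mu>\<^sup>2 - \<alpha> * \<beta> * (\<nu> - \<mu>) + e0)" by (simp only: id2)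
  hence id4: "Z * (4 * \<beta> * \<mu>\<^sup>2) = 4 * \<beta> * \<theta> * \<mu> * r + r\<^sup>2 + 4 * \<alpha>\<^sup>2 * \<beta> * \<pi>\<^sup>2 * (\<nu> - \<mu>) - 4 * \<alpha> * \<pi>\<^sup>2 * e0"
    unfolding Z_def by (simp add: power2_eq_square algebra_simps)
  define S where "S = Y / real M + 1"
  have S1: "S \<ge> 1" using Y M by (simp add: S_def)
  have SM: "S * real M = Y + real M" using M by (simp add: S_def field_simps)
  have \<mu>2: "real M * \<mu> \<le> \<mu>\<^sup>2" using \<mu> by (simp add: power2_eq_square mult_right_mono)
  have \<mu>2': "(real M)\<^sup>2 \<le> \<mu>\<^sup>2" using \<mu> M by (intro power_mono) auto
  have bm: "4 * \<beta> * \<mu>\<^sup>2 > 0" using \<beta> \<mu> M by auto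
  have rS: "\<bar>r\<bar> \<le> 274 * (S * real M)" by (rule order_trans[OF rb]) (use Y(1) in \<open>simp add: SM\<close>)
  have t1: "\<bar>4 * \<beta> * \<theta> * \<mu> * r\<bar> \<le> 274 * (\<theta> * S) * (4 * \<beta> * \<mu>\<^sup>2)"
  proof -
    have "\<bar>4 * \<beta> * \<theta> * \<mu> * r\<bar> = 4 * \<beta> * \<theta> * \<mu> * \<bar>r\<bar>" using \<beta> \<theta> \<mu> M by (simp add: abs_mult)
    also have "\<dots> \<le> 4 * \<beta> * \<theta> * \<mu> * (274 * (S * real M))" using rS \<beta> \<theta> \<mu> M by (intro mult_left_mono) auto
    also have "\<dots> = 274 * (\<theta> * S) * (4 * \<beta> * (real M * \<mu>))" by simp
    also have "\<dots> \<le> 274 * (\<theta> * S) * (4 * \<beta> * \<mu>\<^sup>2)" using \<mu>2 \<beta> \<theta> S1 by (intro mult_left_mono) auto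
    finally show ?thesis .
  qed
  have t2: "\<bar>r\<^sup>2\<bar> \<le> 40000 * (\<theta> * S) * (4 * \<beta> * \<mu>\<^sup>2)"
  proof -
    have "\<bar>r\<^sup>2\<bar> = \<bar>r\<bar>\<^sup>2" by simp
    also have "\<dots> \<le> (2 * Y + 274 * real M)\<^sup>2" using rb by (intro power_mono) auto
    also have "\<dots> \<le> 8 * Y\<^sup>2 + 150152 * (real M)\<^sup>2"
      using sum_squares_bound[of "2 * Y" "274 * real M"] by (simp add: power2_eq_square algebra_simps)
    also have "8 * Y\<^sup>2 \<le> 48 * Y * (\<beta> * real M)"
    proof -
      have "Y \<le> 6 * (\<beta> * real M)" using aM ab' mult_right_mono[OF ab', of "real M"] by simp
      hence "8 * Y * Y \<le> 8 * Y * (6 * (\<beta> * real M))" using Y by (intro mult_left_mono) auto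
      thus ?thesis by (simp add: power2_eq_square)
    qed
    also have "48 * Y * (\<beta> * real M) = 12 * (Y / real M) * (4 * \<beta> * (real M)\<^sup>2)"
      using M by (simp add: power2_eq_square)
    also have "\<dots> \<le> 12 * (Y / real M) * (4 * \<beta> * \<mu>\<^sup>2)"
      using \<mu>2' \<beta> Y M by (intro mult_left_mono) auto
    also have "150152 * (real M)\<^sup>2 \<le> 37538 * (4 * \<beta> * \<mu>\<^sup>2)"
    proof -
      have "1 * (real M)\<^sup>2 \<le> \<beta> * \<mu>\<^sup>2" using \<beta> \<mu>2' by (intro mult_mono) auto
      thus ?thesis by simp
    qed
    also have "12 * (Y / real M) * (4 * \<beta> * \<mu>\<^sup>2) + 37538 * (4 * \<beta> * \<mu>\<^sup>2) \<le> 40000 * S * (4 * \<beta> * \<mu>\<^sup>2)"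
    proof -
      have aux: "12 * t + 37538 \<le> 40000 * (t + 1)" if "0 \<le> t" for t :: real using that by simp
      have "0 \<le> Y / real M" using Y M by simp
      hence "12 * (Y / real M) + 37538 \<le> 40000 * S" unfolding S_def by (rule aux)
      hence "(12 * (Y / real M) + 37538) * (4 * \<beta> * \<mu>\<^sup>2) \<le> 40000 * S * (4 * \<beta> * \<mu>\<^sup>2)"
        using bm by (intro mult_right_mono) auto
      thus ?thesis by (simp only: distrib_right)
    qed
    also have "\<dots> \<le> 40000 * (\<theta> * S) * (4 * \<beta> * \<mu>\<^sup>2)"
      using \<theta> S1 bm mult_right_mono[OF \<theta>(1), of S] by (intro mult_right_mono) auto
    finally show ?thesis by simp
  qed
  have t3: "\<bar>4 * \<alpha>\<^sup>2 * \<beta> * \<pi>\<^sup>2 * (\<nu> - \<mu>)\<bar> \<le> 256 * (\<theta> * S) * (4 * \<beta> * \<mu>\<^sup>2)"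
  proof -
    have p2: "\<pi>\<^sup>2 \<le> 256 * (\<theta> * \<theta>)"
    proof -
      have "\<bar>\<pi>\<bar>\<^sup>2 \<le> (16 * \<theta>)\<^sup>2" using pbound by (intro power_mono) auto
      thus ?thesis by (simp add: power2_eq_square)
    qed
    have "\<bar>4 * \<alpha>\<^sup>2 * \<beta> * \<pi>\<^sup>2 * (\<nu> - \<mu>)\<bar> = 4 * \<beta> * (\<alpha>\<^sup>2 * (\<pi>\<^sup>2 * \<bar>\<nu> - \<mu>\<bar>))"
      using \<beta> by (simp add: abs_mult)
    also have "\<dots> \<le> 4 * \<beta> * ((real A * real A) * ((256 * (\<theta> * \<theta>)) * real M))"
      using \<alpha> \<beta> p2 \<nu> \<mu> by (intro mult_left_mono mult_mono) (auto simp: power2_eq_square intro: mult_mono)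
    also have "\<dots> = 4 * \<beta> * (256 * \<theta> * ((real A * real A * \<theta>) * real M))" by simp
    also have "\<dots> \<le> 4 * \<beta> * (256 * \<theta> * (real M * real M))"
      using A2 \<beta> \<theta> M by (intro mult_left_mono mult_right_mono) auto
    also have "\<dots> \<le> 4 * \<beta> * (256 * (\<theta> * S) * \<mu>\<^sup>2)"
    proof -
      have "256 * \<theta> \<le> 256 * (\<theta> * S)" using \<theta> S1 by simp
      thus ?thesis using \<mu>2' \<beta> \<theta> S1 by (intro mult_left_mono mult_mono) (auto simp: power2_eq_square)
    qed
    finally show ?thesis by (simp add: mult_ac)
  qed
  have t4: "\<bar>4 * \<alpha> * \<pi>\<^sup>2 * e0\<bar> \<le> 1536 * (\<theta> * S) * (4 * \<beta> * \<mu>\<^sup>2)"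
  proof -
    have p2: "\<pi>\<^sup>2 \<le> 256 * (\<theta> * \<theta>)"
    proof -
      have "\<bar>\<pi>\<bar>\<^sup>2 \<le> (16 * \<theta>)\<^sup>2" using pbound by (intro power_mono) auto
      thus ?thesis by (simp add: power2_eq_square)
    qed
    have "\<bar>4 * \<alpha> * \<pi>\<^sup>2 * e0\<bar> = 4 * (\<alpha> * (\<pi>\<^sup>2 * \<bar>e0\<bar>))" using \<alpha> by (simp add: abs_mult)
    also have "\<dots> \<le> 4 * ((6 * \<beta>) * ((256 * (\<theta> * \<theta>)) * Y))"
      using ab' p2 e0 Y \<alpha> \<beta> \<theta> by (intro mult_left_mono mult_mono) auto
    also have "\<dots> = 1536 * \<theta> * (4 * \<beta> * (\<theta> * Y))" by simp
    also have "\<dots> \<le> 1536 * \<theta> * (4 * \<beta> * (real M * (S * real M)))"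
    proof -
      have "\<theta> * Y \<le> real M * (S * real M)" unfolding SM using \<theta> Y M by (intro mult_mono) auto
      thus ?thesis using \<theta> \<beta> by (intro mult_left_mono) auto
    qed
    also have "\<dots> = 1536 * (\<theta> * S) * (4 * \<beta> * (real M)\<^sup>2)" by (simp add: power2_eq_square)
    also have "\<dots> \<le> 1536 * (\<theta> * S) * (4 * \<beta> * \<mu>\<^sup>2)" using \<mu>2' \<beta> \<theta> S1 by (intro mult_left_mono) auto
    finally show ?thesis .
  qed
  have "\<bar>Z\<bar> * (4 * \<beta> * \<mu>\<^sup>2) = \<bar>Z * (4 * \<beta> * \<mu>\<^sup>2)\<bar>"
    by (simp only: abs_mult[of Z "4 * \<beta> * \<mu>\<^sup>2"] abs_of_pos[OF bm])
  also have "\<dots> \<le> \<bar>4 * \<beta> * \<theta> * \<mu> * r\<bar> + \<bar>r\<^sup>2\<bar> + \<bar>4 * \<alpha>\<^sup>2 * \<beta> * \<pi>\<^sup>2 * (\<nu> - \<mu>)\<bar> + \<bar>4 * \<alpha> * \<pi>\<^sup>2 * e0\<bar>"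
    unfolding id4 by linarith
  also have "\<dots> \<le> (274 * (\<theta> * S) + 40000 * (\<theta> * S) + 256 * (\<theta> * S) + 1536 * (\<theta> * S)) * (4 * \<beta> * \<mu>\<^sup>2)"
    using t1 t2 t3 t4 unfolding distrib_right by linarith
  also have "\<dots> \<le> 50000 * (\<theta> * S) * (4 * \<beta> * \<mu>\<^sup>2)"
    using \<theta> S1 bm by (intro mult_right_mono) auto
  finally have "\<bar>Z\<bar> \<le> 50000 * (\<theta> * S)" using bm by (simp only: mult_le_cancel_right)
  thus "\<bar>real a * (of_int p)\<^sup>2 - real b * (real q)\<^sup>2\<bar> \<le> 50000 * real q * (Y / real M + 1)"
    unfolding Z_def S_def defs by (simp add: mult.assoc)
qed

text \<open>A pair \<open>(a, b)\<close> is bad if two of its first coordinates differ by some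
  \<open>q \<le> L\<close>. Any other pair has at most \<open>M / L + 2\<close> first coordinates; a
  bad one is charged the trivial \<open>M\<close>. For \<open>a \<le> Y / M\<close>, outside the
  scope of the curvature estimate, \<open>b \<le> 6 * a\<close> limits the bad \<open>b\<close>. For
  larger \<open>a\<close> that estimate puts \<open>b\<close> close to
  \<open>a * P\<^sup>2 / q\<^sup>2\<close> with \<open>q \<le> L\<close> and
  \<open>P \<le> 16 * q\<close>.\<close>

lemma sum_card_close_fst:
  fixes L A M :: nat
  assumes M: "M > 0" and L: "1 \<le> L" "L \<le> A" and A: "A \<le> M" and AL: "real A ^ 2 * real L \<le> real M"
    and Y: "Y \<ge> 0" "2 * Y \<le> (real M)\<^sup>2"
  shows "(\<Sum>a\<in>{1..<A}. \<Sum>b\<in>{1..<A}. real (card (close_fst M Y a b)))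
    \<le> (real A)\<^sup>2 * (real M / real L + 2) + 6 * Y\<^sup>2 / real M
       + 17 * real A * real L * (100000 * (Y / real M + 1) + real L) * real M"
proof -
  define bad where "bad a b \<longleftrightarrow> (\<exists>m q. 1 \<le> q \<and> q \<le> L \<and> m \<in> close_fst M Y a b \<and> m + q \<in> close_fst M Y a b)" for a b
  define S where "S = Y / real M + 1"
  have S1: "S \<ge> 1" using Y M by (simp add: S_def)
  have card_le: "real (card (close_fst M Y a b)) \<le> (real M / real L + 2) + (if bad a b then real M else 0)" for a b
  proof (cases "bad a b")
    case True
    have "real (card (close_fst M Y a b)) \<le> real M" using card_close_fst_le by simp
    moreover have "real M / real L + 2 \<ge> 0" by simp
    ultimately show ?thesis unfolding if_P[OF True] by linarith
  next
    case False
    have "real (card (close_fst M Y a b)) \<le> real M / real L + 2"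
    proof (rule card_le_separated)
      show "close_fst M Y a b \<subseteq> {M<..2*M}" by (auto simp: close_fst_def)
      fix x y assume xy: "x \<in> close_fst M Y a b" "y \<in> close_fst M Y a b" "x < y"
      show "L < y - x"
      proof (rule ccontr)
        assume "\<not> L < y - x"
        hence "1 \<le> y - x \<and> y - x \<le> L \<and> x \<in> close_fst M Y a b \<and> x + (y - x) \<in> close_fst M Y a b" using xy by auto
        thus False using False unfolding bad_def by blast
      qed
    qed (use L in auto)
    thus ?thesis using False by simp
  qed
  have const: "(\<Sum>a\<in>{1..<A}. c) = real (A - 1) * c" for c :: real
    by (simp only: sum_constant card_atLeastLessThan)
  have bad_le: "b \<le> 6 * a" if "bad a b" "b \<in> {1..<A}" for a b
    using that A close_pair_ratio[OF _ _ _ _ Y(2)] unfolding bad_def close_fst_def by fastforce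
  have card_bad: "real (card {b \<in> {1..<A}. bad a b}) \<le> (if real a \<le> Y / real M then 6 * (Y / real M) else 0) + 17 * real L * (100000 * S + real L)"
    if a: "a \<in> {1..<A}" for a
  proof (cases "real a \<le> Y / real M")
    case True
    have "card {b \<in> {1..<A}. bad a b} \<le> card {1..6*a}"
      using bad_le[of a] by (intro card_mono) auto
    hence "real (card {b \<in> {1..<A}. bad a b}) \<le> 6 * real a" by simp
    moreover have "17 * real L * (100000 * S + real L) \<ge> 0" using S1 by simp
    ultimately show ?thesis using True by simp
  next
    case False
    \<comment> \<open>For given \<open>q\<close> and \<open>P\<close> this confines \<open>b\<close>
      to an interval of length \<open>100000 * S / q\<close>. Only the square of the difference of
      the second coordinates enters, so \<open>P\<close> stands for its absolute value.\<close>
    define B where "B q P = {b \<in> {1..<A}. \<bar>real a * (real P)\<^sup>2 - real b * (real q)\<^sup>2\<bar> \<le> 50000 * real q * S}" for q P :: nat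
    have "{b \<in> {1..<A}. bad a b} \<subseteq> (\<Union>q\<in>{1..L}. \<Union>P\<in>{..16*q}. B q P)"
    proof
      fix b assume "b \<in> {b \<in> {1..<A}. bad a b}"
      hence b: "b \<in> {1..<A}" and "bad a b" by auto
      then obtain m q where mq: "1 \<le> q" "q \<le> L" "m \<in> close_fst M Y a b" "m + q \<in> close_fst M Y a b"
        unfolding bad_def by blast
      then obtain n n' where nn: "m \<in> {M<..2*M}" "n \<in> {M<..2*M}" "close_pair Y a b m n"
        "m + q \<in> {M<..2*M}" "n' \<in> {M<..2*M}" "close_pair Y a b (m + q) n'"
        unfolding close_fst_def by blast
      define p where "p = int n' - int n"
      have p: "int n' = int n + p" by (simp add: p_def)
      have aY: "real a > Y / real M" using False by simp
      note cc = close_pairs_curvature[OF nn(3,6) p nn(1,2,4,5) mq(1,2) L(2) A AL a b Y aY]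
      have "nat \<bar>p\<bar> \<le> 16 * q" using cc(1) by linarith
      moreover have "(real (nat \<bar>p\<bar>))\<^sup>2 = (of_int p)\<^sup>2" by simp
      ultimately have "nat \<bar>p\<bar> \<in> {..16*q}" "b \<in> B q (nat \<bar>p\<bar>)"
        using cc(2) b unfolding B_def S_def by auto
      thus "b \<in> (\<Union>q\<in>{1..L}. \<Union>P\<in>{..16*q}. B q P)" using mq by auto
    qed
    hence "card {b \<in> {1..<A}. bad a b} \<le> card (\<Union>q\<in>{1..L}. \<Union>P\<in>{..16*q}. B q P)"
      by (intro card_mono) (auto simp: B_def)
    also have "\<dots> \<le> (\<Sum>q\<in>{1..L}. card (\<Union>P\<in>{..16*q}. B q P))" by (rule card_UN_le) simp
    also have "\<dots> \<le> (\<Sum>q\<in>{1..L}. \<Sum>P\<in>{..16*q}. card (B q P))" by (intro sum_mono card_UN_le) simp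
    finally have "real (card {b \<in> {1..<A}. bad a b}) \<le> (\<Sum>q\<in>{1..L}. \<Sum>P\<in>{..16*q}. real (card (B q P)))"
      by (metis (mono_tags, lifting) of_nat_le_iff of_nat_sum sum.cong)
    also have "\<dots> \<le> (\<Sum>q\<in>{1..L}. \<Sum>P\<in>{..16*q}. (100000 * S / real q + 1))"
    proof (intro sum_mono)
      fix q P assume q: "q \<in> {1..L}"
      show "real (card (B q P)) \<le> 100000 * S / real q + 1"
      proof (rule card_le_diameter)
        fix x y assume xy: "x \<in> B q P" "y \<in> B q P" "x < y"
        hence "(real y - real x) * (real q)\<^sup>2 \<le> 100000 * real q * S"
          by (auto simp: B_def abs_le_iff algebra_simps)
        hence "((real y - real x) * real q) * real q \<le> (100000 * S) * real q"
          by (simp add: power2_eq_square mult_ac)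
        hence "(real y - real x) * real q \<le> 100000 * S"
          using q by (simp only: mult_le_cancel_right) auto
        thus "real y - real x \<le> 100000 * S / real q"
          using q by (simp add: pos_le_divide_eq)
      qed (use S1 in \<open>auto simp: B_def\<close>)
    qed
    also have "\<dots> \<le> (\<Sum>q\<in>{1..L}. 17 * (100000 * S + real L))"
    proof (intro sum_mono)
      fix q assume q: "q \<in> {1..L}"
      have "(\<Sum>P\<in>{..16*q}. (100000 * S / real q + 1)) = (16 * real q + 1) * (100000 * S / real q + 1)" by simp
      also have "\<dots> \<le> (17 * real q) * (100000 * S / real q + 1)"
        using q S1 by (intro mult_right_mono) auto
      also have "\<dots> = 17 * (100000 * S + real q)" using q by (simp add: field_simps)
      also have "\<dots> \<le> 17 * (100000 * S + real L)" using q by simp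
      finally show "(\<Sum>P\<in>{..16*q}. (100000 * S / real q + 1)) \<le> 17 * (100000 * S + real L)" .
    qed
    also have "\<dots> = 17 * real L * (100000 * S + real L)" by simp
    finally show ?thesis using False by simp
  qed
  have "(\<Sum>a\<in>{1..<A}. \<Sum>b\<in>{1..<A}. real (card (close_fst M Y a b)))
     \<le> (\<Sum>a\<in>{1..<A}. \<Sum>b\<in>{1..<A}. (real M / real L + 2) + (if bad a b then real M else 0))"
    by (intro sum_mono card_le)
  also have "\<dots> = (\<Sum>a\<in>{1..<A}. \<Sum>b\<in>{1..<A}. (real M / real L + 2)) + (\<Sum>a\<in>{1..<A}. \<Sum>b\<in>{1..<A}. if bad a b then real M else 0)"
    by (simp only: sum.distrib)
  also have "(\<Sum>a\<in>{1..<A}. \<Sum>b\<in>{1..<A}. (real M / real L + 2)) \<le> (real A)\<^sup>2 * (real M / real L + 2)"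
  proof -
    have "real (A - 1) * (real (A - 1) * (real M / real L + 2)) \<le> real A * (real A * (real M / real L + 2))"
      by (intro mult_mono) auto
    thus ?thesis unfolding const power2_eq_square by (simp only: mult.assoc)
  qed
  also have "(\<Sum>a\<in>{1..<A}. \<Sum>b\<in>{1..<A}. if bad a b then real M else 0) = (\<Sum>a\<in>{1..<A}. real (card {b \<in> {1..<A}. bad a b}) * real M)"
  proof (intro sum.cong refl)
    fix a
    have "(\<Sum>b\<in>{1..<A}. if bad a b then real M else 0) = (\<Sum>b\<in>{b \<in> {1..<A}. bad a b}. real M)"
      by (rule sum.inter_filter [symmetric]) simp
    thus "(\<Sum>b\<in>{1..<A}. if bad a b then real M else 0) = real (card {b \<in> {1..<A}. bad a b}) * real M" by simp
  qed
  also have "\<dots> \<le> (\<Sum>a\<in>{1..<A}. ((if real a \<le> Y / real M then 6 * (Y / real M) else 0) + 17 * real L * (100000 * S + real L)) * real M)"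
    by (intro sum_mono mult_right_mono card_bad) auto
  also have "\<dots> = (\<Sum>a\<in>{1..<A}. if real a \<le> Y / real M then 6 * (Y / real M) else 0) * real M + (\<Sum>a\<in>{1..<A}. 17 * real L * (100000 * S + real L)) * real M"
    by (simp only: sum.distrib distrib_right sum_distrib_right)
  also have "(\<Sum>a\<in>{1..<A}. if real a \<le> Y / real M then 6 * (Y / real M) else 0) = (\<Sum>a\<in>{a \<in> {1..<A}. real a \<le> Y / real M}. 6 * (Y / real M))"
    by (rule sum.inter_filter [symmetric]) simp
  also have "\<dots> \<le> (Y / real M) * (6 * (Y / real M))"
  proof -
    have "{a \<in> {1..<A}. real a \<le> Y / real M} \<subseteq> {1..nat \<lfloor>Y / real M\<rfloor>}" by (auto simp: le_nat_floor)
    hence "card {a \<in> {1..<A}. real a \<le> Y / real M} \<le> card {1..nat \<lfloor>Y / real M\<rfloor>}" by (intro card_mono) auto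
    hence "real (card {a \<in> {1..<A}. real a \<le> Y / real M}) \<le> real (nat \<lfloor>Y / real M\<rfloor>)" by simp
    also have "\<dots> \<le> Y / real M" using Y M by (intro of_nat_floor) auto
    finally have "real (card {a \<in> {1..<A}. real a \<le> Y / real M}) * (6 * (Y / real M)) \<le> (Y / real M) * (6 * (Y / real M))"
      using Y M by (intro mult_right_mono) auto
    thus ?thesis by simp
  qed
  also have "(\<Sum>a\<in>{1..<A}. 17 * real L * (100000 * S + real L)) \<le> real A * (17 * real L * (100000 * S + real L))"
  proof -
    have "real (A - 1) * (17 * real L * (100000 * S + real L)) \<le> real A * (17 * real L * (100000 * S + real L))"
      using S1 by (intro mult_right_mono) auto
    thus ?thesis unfolding const .
  qed
  finally show ?thesis using M by (simp add: S_def power2_eq_square mult_ac)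
qed

section \<open>Bilinear sums with phase X / (n m)\<close>

lemma second_difference_inverse:
  fixes w y :: real
  assumes "w > 1"
  shows "y / (w + 1) - 2 * (y / w) + y / (w - 1) = 2 * (y / (w * (w\<^sup>2 - 1)))"
proof -
  have "w\<^sup>2 - 1 = (w + 1) * (w - 1)" by (simp add: power2_eq_square algebra_simps)
  thus ?thesis using assms by (simp add: divide_simps) (simp add: algebra_simps power2_eq_square)
qed

lemma inverse_cubic_difference:
  fixes w w' y y' \<delta> M :: real
  assumes y: "0 < y'" "y' < y" "y \<le> 1" and \<delta>: "0 \<le> \<delta>" "\<delta> \<le> 1"
    and w: "w = z + \<delta> * y" and w': "w' = z + \<delta> * y'" and M: "10 \<le> M" and z: "M + 2 \<le> z" "z + 1 \<le> 2 * M"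
  shows "(y - y') / (16 * M ^ 3) \<le> y / (w * (w\<^sup>2 - 1)) - y' / (w' * (w'\<^sup>2 - 1))"
    and "y / (w * (w\<^sup>2 - 1)) - y' / (w' * (w'\<^sup>2 - 1)) \<le> (y - y') / M ^ 3"
proof -
  define q where "q = w * (w\<^sup>2 - 1)"
  define q' where "q' = w' * (w'\<^sup>2 - 1)"
  have dy: "0 \<le> \<delta> * y'" "\<delta> * y' \<le> \<delta> * y" "\<delta> * y \<le> 1" "\<delta> * y' \<le> 1"
    using y \<delta> by (auto intro: mult_left_mono mult_le_one)
  have ww: "M + 2 \<le> w'" "w' \<le> w" "w \<le> w' + 1" "w \<le> 2 * M"
    using dy z w w' by auto
  have w'10: "w' \<ge> 12" using ww M by simp
  have cube: "M ^ 3 \<le> v * (v\<^sup>2 - 1)" if "M + 2 \<le> v" for v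
  proof -
    have "M\<^sup>2 \<le> v\<^sup>2 - 1"
    proof -
      have "(M + 2)\<^sup>2 \<le> v\<^sup>2" using that M by (intro power_mono) auto
      thus ?thesis using M by (simp add: power2_eq_square algebra_simps)
    qed
    hence "M * M\<^sup>2 \<le> v * (v\<^sup>2 - 1)" using that M by (intro mult_mono) auto
    thus ?thesis by (simp add: power3_eq_cube power2_eq_square)
  qed
  have M3: "M ^ 3 > 0" using M by simp
  have q: "M ^ 3 \<le> q" and q': "M ^ 3 \<le> q'" unfolding q_def q'_def using ww by (auto intro: cube)
  have qpos: "q > 0" "q' > 0" using q q' M3 by linarith+
  have qup: "q \<le> 8 * M ^ 3"
  proof -
    have "q \<le> w * w\<^sup>2" unfolding q_def using ww M by (intro mult_left_mono) auto
    also have "\<dots> \<le> (2 * M) * (2 * M)\<^sup>2" using ww M by (intro mult_mono power_mono) auto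
    finally show ?thesis by (simp add: power3_eq_cube power2_eq_square)
  qed
  \<comment> \<open>Chosen so that \<open>y' * (q - q') = (y - y') * c\<close>, which makes
    \<open>y - y'\<close> a factor of the numerator of \<open>y / q - y' / q'\<close>.\<close>
  define c where "c = y' * \<delta> * (w\<^sup>2 + w * w' + w'\<^sup>2 - 1)"
  have c0: "0 \<le> c" unfolding c_def
  proof (intro mult_nonneg_nonneg)
    have "1 \<le> w * w'" using ww w'10 mult_mono[of 1 w 1 w'] by auto
    thus "0 \<le> w\<^sup>2 + w * w' + w'\<^sup>2 - 1" by (simp add: add_increasing add_increasing2)
  qed (use y \<delta> in auto)
  have c1: "c \<le> q' / 2"
  proof -
    have "c \<le> 1 * (w\<^sup>2 + w * w' + w'\<^sup>2)" unfolding c_def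
    proof (rule mult_mono)
      show "y' * \<delta> \<le> 1" using dy by (simp add: mult.commute)
      show "0 \<le> w\<^sup>2 + w * w' + w'\<^sup>2 - 1"
        using mult_mono[of 1 w 1 w'] ww w'10 by (simp add: add_increasing add_increasing2)
    qed auto
    also have "\<dots> \<le> 3 * (w' + 1)\<^sup>2"
    proof -
      have "w\<^sup>2 \<le> (w' + 1)\<^sup>2" "w'\<^sup>2 \<le> (w' + 1)\<^sup>2" using ww w'10 by (auto intro!: power_mono)
      moreover have "w * w' \<le> (w' + 1) * (w' + 1)" using ww w'10 by (intro mult_mono) auto
      ultimately show ?thesis by (simp add: power2_eq_square)
    qed
    also have "\<dots> \<le> q' / 2"
    proof -
      have 1: "12 * (w' * w') \<le> w' * (w' * w')" and 2: "12 * w' \<le> w' * w'"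
        using w'10 by (auto intro!: mult_right_mono)
      have "3 * (w' + 1)\<^sup>2 = 3 * (w' * w') + 6 * w' + 3" "q' = w' * (w' * w') - w'"
        unfolding q'_def power2_eq_square by (simp_all add: algebra_simps)
      thus ?thesis using 1 2 w'10 by linarith
    qed
    finally show ?thesis .
  qed
  have id: "y / q - y' / q' = (y - y') * (q' - c) / (q * q')"
  proof -
    have "w - w' = \<delta> * (y - y')" using w w' by (simp add: algebra_simps)
    have "q - q' = (w - w') * (w\<^sup>2 + w * w' + w'\<^sup>2 - 1)"
      unfolding q_def q'_def by (simp add: algebra_simps power2_eq_square)
    also have "w - w' = \<delta> * (y - y')" using w w' by (simp add: algebra_simps)
    finally have qq: "y' * (q - q') = (y - y') * c" unfolding c_def by simp
    have "y * q' - y' * q = (y - y') * q' - y' * (q - q')" by (simp add: algebra_simps)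
    also have "\<dots> = (y - y') * (q' - c)" unfolding qq by (simp add: algebra_simps)
    finally have "y * q' - y' * q = (y - y') * (q' - c)" .
    thus ?thesis using qpos by (simp add: field_simps)
  qed
  have "(y - y') / (16 * M ^ 3) = (y - y') * (1 / 2) / (8 * M ^ 3)" by simp
  also have "\<dots> \<le> (y - y') * (1 / 2) / q"
    using qup qpos y M by (intro divide_left_mono mult_pos_pos) auto
  also have "\<dots> = (y - y') * (q' / 2) / (q * q')" using qpos by simp
  also have "\<dots> \<le> (y - y') * (q' - c) / (q * q')"
    using c1 qpos y by (intro divide_right_mono mult_left_mono) auto
  finally show "(y - y') / (16 * M ^ 3) \<le> y / (w * (w\<^sup>2 - 1)) - y' / (w' * (w'\<^sup>2 - 1))"
    using id by (simp add: q_def q'_def)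
  have "(y - y') * (q' - c) / (q * q') \<le> (y - y') * q' / (q * q')"
    using c0 qpos y by (intro divide_right_mono mult_left_mono) auto
  also have "\<dots> = (y - y') / q" using qpos by simp
  also have "\<dots> \<le> (y - y') / M ^ 3"
    by (rule divide_left_mono[OF q _ mult_pos_pos[OF qpos(1) M3]]) (use y in simp)
  finally show "y / (w * (w\<^sup>2 - 1)) - y' / (w' * (w'\<^sup>2 - 1)) \<le> (y - y') / M ^ 3"
    using id by (simp add: q_def q'_def)
qed

lemma sqrt_test_simplify:
  fixes lam :: real
  assumes "0 < lam" "0 \<le> k"
  shows "(k * lam * m + 3) * (9 / sqrt lam) = 9 * k * m * sqrt lam + 27 / sqrt lam"
proof -
  have "k * lam * m * (9 / sqrt lam) = 9 * k * m * (lam / sqrt lam)" by simp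
  also have "lam / sqrt lam = sqrt lam" using assms by (simp add: real_div_sqrt)
  finally have "k * lam * m * (9 / sqrt lam) = 9 * k * m * sqrt lam" .
  moreover have "3 * (9 / sqrt lam) = 27 / sqrt lam" by simp
  ultimately show ?thesis by (simp only: distrib_right)
qed

text \<open>With \<open>y = 1 / n\<close> the phase \<open>X / (n * m + \<delta>)\<close> becomes
  \<open>X * y / (m + \<delta> * y)\<close>, a reciprocal at a shifted argument, whose second
  difference is explicit. The difference of two such phases has second differences between \<rho>
  and \<open>16 * \<rho>\<close>; the normalisation of \<rho> is the lower bound in
  \<open>inverse_cubic_difference\<close>.\<close>

lemma type_II_inner_sum:
  fixes n n' M :: nat and X \<delta> :: real
  assumes nn: "0 < n" "n < n'" and \<delta>: "0 \<le> \<delta>" "\<delta> \<le> 1" and M: "10 \<le> M" and X: "X > 0"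
    and S: "S \<subseteq> {M<..2*M}"
    and conv: "\<And>m l k. m \<in> S \<Longrightarrow> k \<in> S \<Longrightarrow> m \<le> l \<Longrightarrow> l \<le> k \<Longrightarrow> l \<in> S"
  defines "\<rho> \<equiv> X * (1 / real n - 1 / real n') / (8 * real M ^ 3)"
  assumes \<rho>: "\<rho> \<le> 1"
  shows "norm (\<Sum>m\<in>S. ee (X / (real (n * m) + \<delta>) - X / (real (n' * m) + \<delta>))) \<le> 144 * real M * sqrt \<rho> + 27 / sqrt \<rho>"
proof -
  define y where "y = 1 / real n"
  define y' where "y' = 1 / real n'"
  have y: "0 < y'" "y' < y" "y \<le> 1" using nn by (auto simp: y_def y'_def field_simps)
  have \<rho>_eq: "\<rho> = X * (y - y') / (8 * real M ^ 3)" by (simp add: \<rho>_def y_def y'_def)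
  have \<rho>0: "\<rho> > 0" unfolding \<rho>_eq using X y M by auto
  define f where "f m = X / (real (n * m) + \<delta>) - X / (real (n' * m) + \<delta>)" for m
  have f: "f m = X * (y / (real m + \<delta> * y) - y' / (real m + \<delta> * y'))" for m
    using nn by (simp add: f_def y_def y'_def field_simps)
  have fin: "finite S" using S finite_subset by blast
  have "norm (\<Sum>m\<in>S. ee (f m)) \<le> (16 * \<rho> * real (card S) + 3) * (9 / sqrt \<rho>)"
  proof (rule second_difference_test[OF \<rho>0 \<rho> _ fin])
    fix m l k assume "m \<in> S" "k \<in> S" "m \<le> l" "l \<le> k"
    thus "l \<in> S" by (rule conv)
  next
    fix m assume m: "m \<in> S" "m + 2 \<in> S"
    define z where "z = real m + 1"
    define w where "w = z + \<delta> * y"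
    define w' where "w' = z + \<delta> * y'"
    have "m \<in> {M<..2*M}" "m + 2 \<in> {M<..2*M}" using m S by auto
    hence "M + 2 \<le> m + 1" "m + 2 \<le> 2 * M" by auto
    hence "real (M + 2) \<le> real (m + 1)" "real (m + 2) \<le> real (2 * M)" by (simp_all only: of_nat_le_iff)
    hence z: "real M + 2 \<le> z" "z + 1 \<le> 2 * real M" by (simp_all add: z_def)
    have M': "10 \<le> real M" using M by simp
    have w1: "w > 1" "w' > 1" using z M' y \<delta> mult_nonneg_nonneg[of \<delta> y] mult_nonneg_nonneg[of \<delta> y'] unfolding w_def w'_def by linarith+
    have e: "real (m + 2) + \<delta> * y = w + 1" "real (m + 1) + \<delta> * y = w" "real m + \<delta> * y = w - 1"
      "real (m + 2) + \<delta> * y' = w' + 1" "real (m + 1) + \<delta> * y' = w'" "real m + \<delta> * y' = w' - 1"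
      by (simp_all add: w_def w'_def z_def)
    have "f (m + 2) - 2 * f (m + 1) + f m
      = X * ((y / (w + 1) - 2 * (y / w) + y / (w - 1)) - (y' / (w' + 1) - 2 * (y' / w') + y' / (w' - 1)))"
      unfolding f e by (simp add: algebra_simps)
    also have "\<dots> = (2 * X) * (y / (w * (w\<^sup>2 - 1)) - y' / (w' * (w'\<^sup>2 - 1)))"
      unfolding second_difference_inverse[OF w1(1)] second_difference_inverse[OF w1(2)] by (simp add: algebra_simps)
    finally have sd: "f (m + 2) - 2 * f (m + 1) + f m = (2 * X) * (y / (w * (w\<^sup>2 - 1)) - y' / (w' * (w'\<^sup>2 - 1)))" .
    note cub = inverse_cubic_difference[OF y \<delta> w_def w'_def M' z]
    have "\<rho> = (2 * X) * ((y - y') / (16 * real M ^ 3))" by (simp add: \<rho>_eq)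
    also have "\<dots> \<le> f (m + 2) - 2 * f (m + 1) + f m"
      unfolding sd using X by (intro mult_left_mono cub(1)) auto
    finally have 1: "\<rho> \<le> f (m + 2) - 2 * f (m + 1) + f m" .
    have "f (m + 2) - 2 * f (m + 1) + f m \<le> (2 * X) * ((y - y') / real M ^ 3)"
      unfolding sd using X by (intro mult_left_mono cub(2)) auto
    also have "\<dots> = 16 * \<rho>" by (simp add: \<rho>_eq)
    finally show "\<rho> \<le> f (m + 2) - 2 * f (m + 1) + f m \<and> f (m + 2) - 2 * f (m + 1) + f m \<le> 16 * \<rho>"
      using 1 by blast
  qed (use \<rho>0 in simp)
  also have "\<dots> \<le> (16 * \<rho> * real M + 3) * (9 / sqrt \<rho>)"
  proof -
    have "card S \<le> card {M<..2*M}" using S by (intro card_mono) auto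
    hence "real (card S) \<le> real M" by simp
    thus ?thesis using \<rho>0 by (intro mult_right_mono add_right_mono mult_left_mono) auto
  qed
  also have "\<dots> = 144 * real M * sqrt \<rho> + 27 / sqrt \<rho>"
    using sqrt_test_simplify[OF \<rho>0, of 16 "real M"] by simp
  finally show ?thesis unfolding f_def .
qed

text \<open>The computation of \<open>type_II_inner_sum\<close> for a single phase. The range is
  given by a real \<open>L\<close>, because it arises as \<open>D / k\<close>.\<close>

lemma type_I_inner_sum:
  fixes k :: nat and X \<delta> L :: real
  assumes k: "0 < k" and \<delta>: "0 \<le> \<delta>" "\<delta> \<le> 1" and L: "10 \<le> L" and X: "X > 0"
    and S: "S \<subseteq> {l. L < real l \<and> real l \<le> 2 * L}"
    and conv: "\<And>m l k. m \<in> S \<Longrightarrow> k \<in> S \<Longrightarrow> m \<le> l \<Longrightarrow> l \<le> k \<Longrightarrow> l \<in> S"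
  defines "\<rho> \<equiv> X / (8 * real k * L ^ 3)"
  assumes \<rho>: "\<rho> \<le> 1"
  shows "norm (\<Sum>l\<in>S. ee (X / (real (k * l) + \<delta>))) \<le> 288 * L * sqrt \<rho> + 27 / sqrt \<rho>"
proof -
  define y where "y = 1 / real k"
  have y: "0 < y" "y \<le> 1" using k by (auto simp: y_def)
  have \<rho>_eq: "\<rho> = X * y / (8 * L ^ 3)" by (simp add: \<rho>_def y_def)
  have \<rho>0: "\<rho> > 0" unfolding \<rho>_eq using X y L by auto
  define f where "f l = X / (real (k * l) + \<delta>)" for l
  have f: "f l = X * (y / (real l + \<delta> * y))" for l
    using k by (simp add: f_def y_def field_simps)
  have fin: "finite S" by (rule finite_subset[OF S]) (auto intro: finite_subset[OF _ finite_nat_le_real[of "2 * L"]])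
  have "norm (\<Sum>m\<in>S. ee (f m)) \<le> (16 * \<rho> * real (card S) + 3) * (9 / sqrt \<rho>)"
  proof (rule second_difference_test[OF \<rho>0 \<rho> _ fin])
    fix m l k assume "m \<in> S" "k \<in> S" "m \<le> l" "l \<le> k"
    thus "l \<in> S" by (rule conv)
  next
    fix m assume m: "m \<in> S" "m + 2 \<in> S"
    define w where "w = real m + 1 + \<delta> * y"
    have z: "L < real m" "real m + 2 \<le> 2 * L" using m S by auto
    have dy: "0 \<le> \<delta> * y" "\<delta> * y \<le> 1" using y \<delta> by (auto intro: mult_le_one)
    have w: "L + 1 \<le> w" "w \<le> 2 * L" using z dy unfolding w_def by linarith+
    have w1: "w > 1" using w L by linarith
    have e: "real (m + 2) + \<delta> * y = w + 1" "real (m + 1) + \<delta> * y = w" "real m + \<delta> * y = w - 1"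
      by (simp_all add: w_def)
    have "f (m + 2) - 2 * f (m + 1) + f m = X * (y / (w + 1) - 2 * (y / w) + y / (w - 1))"
      unfolding f e by (simp add: algebra_simps)
    also have "\<dots> = (2 * X * y) / (w * (w\<^sup>2 - 1))"
      unfolding second_difference_inverse[OF w1] by simp
    finally have sd: "f (m + 2) - 2 * f (m + 1) + f m = (2 * X * y) / (w * (w\<^sup>2 - 1))" .
    have low: "L ^ 3 \<le> w * (w\<^sup>2 - 1)"
    proof -
      have "(L + 1)\<^sup>2 \<le> w\<^sup>2" using w L by (intro power_mono) auto
      hence "L\<^sup>2 \<le> w\<^sup>2 - 1" using L by (simp add: power2_eq_square algebra_simps)
      hence "L * L\<^sup>2 \<le> w * (w\<^sup>2 - 1)" using w L by (intro mult_mono) auto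
      thus ?thesis by (simp add: power3_eq_cube power2_eq_square)
    qed
    have L3: "L ^ 3 > 0" using L by simp
    have wp: "w * (w\<^sup>2 - 1) > 0" using low L3 by linarith
    have up: "w * (w\<^sup>2 - 1) \<le> 8 * L ^ 3"
    proof -
      have "w * (w\<^sup>2 - 1) \<le> w * w\<^sup>2" using w L by (intro mult_left_mono) auto
      also have "\<dots> \<le> (2 * L) * (2 * L)\<^sup>2" using w L by (intro mult_mono power_mono) auto
      finally show ?thesis by (simp add: power3_eq_cube power2_eq_square)
    qed
    have "\<rho> \<le> (2 * X * y) / (8 * L ^ 3)" unfolding \<rho>_eq using X y L3 by (intro divide_right_mono) auto
    also have "\<dots> \<le> (2 * X * y) / (w * (w\<^sup>2 - 1))"
      by (rule divide_left_mono[OF up _ mult_pos_pos[OF _ wp]]) (use X y L3 in simp_all)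
    finally have 1: "\<rho> \<le> f (m + 2) - 2 * f (m + 1) + f m" unfolding sd .
    have "(2 * X * y) / (w * (w\<^sup>2 - 1)) \<le> (2 * X * y) / L ^ 3"
      by (rule divide_left_mono[OF low _ mult_pos_pos[OF wp L3]]) (use X y in simp)
    also have "\<dots> = 16 * \<rho>" by (simp add: \<rho>_eq)
    finally show "\<rho> \<le> f (m + 2) - 2 * f (m + 1) + f m \<and> f (m + 2) - 2 * f (m + 1) + f m \<le> 16 * \<rho>"
      using 1 unfolding sd by blast
  qed (use \<rho>0 in simp)
  also have "\<dots> \<le> (16 * \<rho> * (2 * L) + 3) * (9 / sqrt \<rho>)"
  proof -
    have "S \<subseteq> {1..nat \<lfloor>2 * L\<rfloor>}"
    proof
      fix l assume "l \<in> S"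
      hence l: "L < real l" "real l \<le> 2 * L" using S by auto
      have "l \<noteq> 0" using l(1) L by (intro notI) simp
      thus "l \<in> {1..nat \<lfloor>2 * L\<rfloor>}" using l(2) by (simp add: le_nat_floor)
    qed
    hence "card S \<le> nat \<lfloor>2 * L\<rfloor>" using card_mono[of "{1..nat \<lfloor>2 * L\<rfloor>}" S] by simp
    hence "real (card S) \<le> 2 * L" using of_nat_floor[of "2 * L"] L by linarith
    thus ?thesis using \<rho>0 by (intro mult_right_mono add_right_mono mult_left_mono) auto
  qed
  also have "\<dots> = 288 * L * sqrt \<rho> + 27 / sqrt \<rho>"
    using sqrt_test_simplify[OF \<rho>0, of 16 "2 * L"] by simp
  finally show ?thesis unfolding f_def .
qed

text \<open>Partial summation from the upper end: the first weight and the increments are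
  nonnegative and add up to \<open>v q\<close>, and each is multiplied by a tail sum of norm at most
  \<open>B\<close>.\<close>

lemma norm_sum_monotone_weight:
  fixes z :: "nat \<Rightarrow> complex" and v :: "nat \<Rightarrow> real"
  assumes "p \<le> q" and v: "\<And>l. p \<le> l \<Longrightarrow> l < q \<Longrightarrow> v l \<le> v (Suc l)" "0 \<le> v p"
    and B: "\<And>j. p \<le> j \<Longrightarrow> j \<le> q \<Longrightarrow> norm (\<Sum>l=j..q. z l) \<le> B"
  shows "norm (\<Sum>l=p..q. of_real (v l) * z l) \<le> v q * B"
proof -
  have key: "norm ((\<Sum>l=j..q. of_real (v l) * z l) - of_real (v j) * (\<Sum>l=j..q. z l)) \<le> (v q - v j) * B" if "p \<le> j" "j \<le> q" for j
    using that(2,1)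
  proof (induction j rule: inc_induct)
    case base
    show ?case by simp
  next
    case (step j)
    have IH: "norm ((\<Sum>l=Suc j..q. of_real (v l) * z l) - of_real (v (Suc j)) * (\<Sum>l=Suc j..q. z l)) \<le> (v q - v (Suc j)) * B"
      using step by simp
    have split: "(\<Sum>l=j..q. F l) = F j + (\<Sum>l=Suc j..q. F l)" for F :: "nat \<Rightarrow> complex"
      using step.hyps by (simp add: sum.atLeast_Suc_atMost)
    have "(\<Sum>l=j..q. of_real (v l) * z l) - of_real (v j) * (\<Sum>l=j..q. z l)
      = ((\<Sum>l=Suc j..q. of_real (v l) * z l) - of_real (v (Suc j)) * (\<Sum>l=Suc j..q. z l)) + of_real (v (Suc j) - v j) * (\<Sum>l=Suc j..q. z l)"
      unfolding split by (simp add: algebra_simps)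
    also have "norm \<dots> \<le> (v q - v (Suc j)) * B + (v (Suc j) - v j) * B"
    proof (rule norm_triangle_mono[OF IH])
      have "0 \<le> v (Suc j) - v j" using v(1)[of j] step by simp
      moreover have "norm (\<Sum>l=Suc j..q. z l) \<le> B" using B[of "Suc j"] step by simp
      ultimately show "norm (of_real (v (Suc j) - v j) * (\<Sum>l=Suc j..q. z l)) \<le> (v (Suc j) - v j) * B"
        by (simp add: norm_mult mult_left_mono del: of_real_diff)
    qed
    finally show ?case by (simp add: algebra_simps)
  qed
  have "norm (\<Sum>l=p..q. of_real (v l) * z l) \<le> norm ((\<Sum>l=p..q. of_real (v l) * z l) - of_real (v p) * (\<Sum>l=p..q. z l)) + norm (of_real (v p) * (\<Sum>l=p..q. z l))"
    using norm_triangle_ineq[of "(\<Sum>l=p..q. of_real (v l) * z l) - of_real (v p) * (\<Sum>l=p..q. z l)" "of_real (v p) * (\<Sum>l=p..q. z l)"] by simp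
  also have "\<dots> \<le> (v q - v p) * B + v p * B"
    using key[of p] B[of p] v(2) \<open>p \<le> q\<close> by (intro add_mono) (auto simp: norm_mult intro!: mult_left_mono)
  finally show ?thesis by (simp add: algebra_simps)
qed

section \<open>Splitting a variable into blocks \<open>n div A\<close>\<close>

lemma card_div_image:
  fixes A N :: nat
  assumes "1 \<le> A" "A \<le> N"
  shows "real (card ((\<lambda>n. n div A) ` {N<..2*N})) \<le> 3 * real N / real A"
proof -
  have "card ((\<lambda>n. n div A) ` {N<..2*N}) \<le> card {N div A..(2*N) div A}"
    by (intro card_mono) (auto intro!: div_le_mono)
  also have "\<dots> = Suc ((2 * N) div A) - N div A" by simp
  finally have "real (card ((\<lambda>n. n div A) ` {N<..2*N})) \<le> real ((2 * N) div A) + 1 - real (N div A)"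
    using div_le_mono[of N "2 * N" A] by linarith
  moreover have "real ((2 * N) div A) \<le> 2 * (real N / real A)"
    using of_nat_div_le_of_nat[where ?'a = real, of "2 * N" A] by simp
  moreover have "real N / real A - 1 \<le> real (N div A)" by (rule real_nat_div_ge)
  moreover have "1 \<le> real N / real A" using assms by simp
  ultimately show ?thesis by simp
qed

lemma card_same_bucket:
  fixes A n :: nat
  assumes "A > 0"
  shows "finite {n'. n' div A = n div A}" "card {n'. n' div A = n div A} \<le> A"
proof -
  have sub: "{n'. n' div A = n div A} \<subseteq> {(n div A) * A..<(n div A) * A + A}"
  proof
    fix n' assume "n' \<in> {n'. n' div A = n div A}"
    hence "n' = (n div A) * A + n' mod A" by (metis (mono_tags) div_mult_mod_eq mem_Collect_eq)
    moreover have "n' mod A < A" using assms by simp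
    ultimately show "n' \<in> {(n div A) * A..<(n div A) * A + A}" by auto
  qed
  show "finite {n'. n' div A = n div A}" using sub finite_subset by blast
  show "card {n'. n' div A = n div A} \<le> A" using card_mono[OF _ sub] by simp
qed

lemma same_bucket_diff:
  fixes A n n' :: nat
  assumes "A > 0" "n div A = n' div A"
  shows "n' - n < A"
proof -
  have "n' = n div A * A + n' mod A" "n = n div A * A + n mod A" using assms(2) by (metis div_mult_mod_eq)+
  moreover have "n' mod A < A" using assms by simp
  ultimately show ?thesis by linarith
qed

lemma norm_squared_bucket_sum:
  fixes F :: "nat \<Rightarrow> complex"
  assumes "finite X"
  shows "complex_of_real (\<Sum>j\<in>(\<lambda>n. n div A) ` X. (norm (\<Sum>n | n \<in> X \<and> n div A = j. F n))\<^sup>2)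
    = (\<Sum>n\<in>X. \<Sum>n' | n' \<in> X \<and> n' div A = n div A. F n * cnj (F n'))"
proof -
  have "complex_of_real (\<Sum>j\<in>(\<lambda>n. n div A) ` X. (norm (\<Sum>n | n \<in> X \<and> n div A = j. F n))\<^sup>2)
     = (\<Sum>j\<in>(\<lambda>n. n div A) ` X. \<Sum>n | n \<in> X \<and> n div A = j. \<Sum>n' | n' \<in> X \<and> n' div A = j. F n * cnj (F n'))"
    by (simp only: of_real_sum complex_norm_square cnj_sum sum_product)
  also have "\<dots> = (\<Sum>j\<in>(\<lambda>n. n div A) ` X. \<Sum>n | n \<in> X \<and> n div A = j. \<Sum>n' | n' \<in> X \<and> n' div A = n div A. F n * cnj (F n'))"
    by (intro sum.cong refl) auto
  also have "\<dots> = (\<Sum>n\<in>X. \<Sum>n' | n' \<in> X \<and> n' div A = n div A. F n * cnj (F n'))"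
    by (rule sum.image_gen [symmetric]) (rule assms)
  finally show ?thesis .
qed

definition hyperbola_slice :: "nat \<Rightarrow> real \<Rightarrow> real \<Rightarrow> nat \<Rightarrow> nat set" where
  "hyperbola_slice M D D' n = {m \<in> {M<..2*M}. D < real (n * m) \<and> real (n * m) \<le> D'}"

lemma hyperbola_slice_convex:
  assumes "m \<in> hyperbola_slice M D D' n" "k \<in> hyperbola_slice M D D' n" "m \<le> l" "l \<le> k"
  shows "l \<in> hyperbola_slice M D D' n"
proof -
  have "n * m \<le> n * l" "n * l \<le> n * k" using assms by auto
  hence "real (n * m) \<le> real (n * l)" "real (n * l) \<le> real (n * k)" by (simp_all only: of_nat_le_iff)
  thus ?thesis using assms unfolding hyperbola_slice_def by auto
qed

text \<open>Cauchy's inequality is applied over pairs of \<open>m\<close> and a block \<open>n div A = j\<close>, so that the remaining sum over \<open>m\<close> has no weights.\<close>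

lemma type_II_smooth:
  fixes N M A :: nat and X \<delta> D D' \<alpha> \<beta> :: real and a b :: "nat \<Rightarrow> complex"
  assumes A: "1 \<le> A" "A \<le> N" and M: "10 \<le> M" and X: "X > 0" and \<delta>: "0 \<le> \<delta>" "\<delta> \<le> 1"
    and a: "\<And>n. n \<in> {N<..2*N} \<Longrightarrow> norm (a n) \<le> \<alpha>" and b: "\<And>m. m \<in> {M<..2*M} \<Longrightarrow> norm (b m) \<le> \<beta>"
    and lam: "X * real A \<le> 8 * real N ^ 2 * real M ^ 3"
  shows "(norm (\<Sum>n\<in>{N<..2*N}. \<Sum>m\<in>hyperbola_slice M D D' n. a n * b m * ee (X / (real (n * m) + \<delta>))))\<^sup>2
    \<le> \<alpha>\<^sup>2 * \<beta>\<^sup>2 * (3 * real N / real A) * real M *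
       (real N * real M + real N * real A * (200 * sqrt (X * real A / (real N ^ 2 * real M)) + 200 * sqrt (real N ^ 2 * real M ^ 3 / X)))"
proof -
  have N0: "N > 0" using A by linarith
  have \<alpha>0: "\<alpha> \<ge> 0" using order_trans[OF norm_ge_zero a[of "2*N"]] N0 by simp
  have \<beta>0: "\<beta> \<ge> 0" using order_trans[OF norm_ge_zero b[of "2*M"]] M by simp
  let ?I = "{N<..2*N}" and ?J = "{M<..2*M}"
  define T where "T = (\<lambda>n. n div A) ` ?I"
  define Bd where "Bd = 200 * sqrt (X * real A / (real N ^ 2 * real M)) + 200 * sqrt (real N ^ 2 * real M ^ 3 / X)"
  have Bd0: "Bd \<ge> 0" using X by (simp add: Bd_def)
  \<comment> \<open>The condition on \<open>n * m\<close> and the coefficient \<open>a n\<close> are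
    moved into \<open>F\<close>, so that after exchanging the sums only \<open>b m\<close> stays
    outside and is estimated by \<beta>.\<close>
  define F where "F m n = (if D < real (n * m) \<and> real (n * m) \<le> D' then a n * ee (X / (real (n * m) + \<delta>)) else 0)" for m n
  define V where "V j m = (\<Sum>n | n \<in> ?I \<and> n div A = j. F m n)" for j m
  have "(\<Sum>n\<in>?I. \<Sum>m\<in>hyperbola_slice M D D' n. a n * b m * ee (X / (real (n * m) + \<delta>))) = (\<Sum>n\<in>?I. \<Sum>m\<in>?J. b m * F m n)"
    unfolding hyperbola_slice_def F_def by (subst sum.inter_filter) (auto intro!: sum.cong)
  also have "\<dots> = (\<Sum>m\<in>?J. b m * (\<Sum>n\<in>?I. F m n))"
    by (subst sum.swap) (simp add: sum_distrib_left)
  also have "\<dots> = (\<Sum>m\<in>?J. b m * (\<Sum>j\<in>T. V j m))"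
    unfolding V_def T_def by (intro sum.cong refl arg_cong2[of _ _ _ _ "(*)"] sum.image_gen) simp
  finally have eq: "(\<Sum>n\<in>?I. \<Sum>m\<in>hyperbola_slice M D D' n. a n * b m * ee (X / (real (n * m) + \<delta>))) = (\<Sum>m\<in>?J. b m * (\<Sum>j\<in>T. V j m))" .
  have "norm (\<Sum>m\<in>?J. b m * (\<Sum>j\<in>T. V j m)) \<le> (\<Sum>m\<in>?J. \<Sum>j\<in>T. \<beta> * norm (V j m))"
  proof (rule sum_norm_le)
    fix m assume m: "m \<in> ?J"
    have "norm (b m * (\<Sum>j\<in>T. V j m)) \<le> \<beta> * (\<Sum>j\<in>T. norm (V j m))"
      unfolding norm_mult using b[OF m] \<beta>0 by (intro mult_mono norm_sum) auto
    thus "norm (b m * (\<Sum>j\<in>T. V j m)) \<le> (\<Sum>j\<in>T. \<beta> * norm (V j m))" by (simp add: sum_distrib_left)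
  qed
  also have "\<dots> = (\<Sum>x\<in>?J \<times> T. \<beta> * (case x of (m, j) \<Rightarrow> norm (V j m)))"
    by (simp add: sum.cartesian_product case_prod_unfold)
  finally have "(norm (\<Sum>m\<in>?J. b m * (\<Sum>j\<in>T. V j m)))\<^sup>2 \<le> (\<Sum>x\<in>?J \<times> T. \<beta> * (case x of (m, j) \<Rightarrow> norm (V j m)))\<^sup>2"
    by (intro power_mono) auto
  also have "\<dots> \<le> (\<Sum>x\<in>?J \<times> T. \<beta>\<^sup>2) * (\<Sum>x\<in>?J \<times> T. (case x of (m, j) \<Rightarrow> norm (V j m))\<^sup>2)"
    by (rule Cauchy_Schwarz_ineq_sum)
  also have "(\<Sum>x\<in>?J \<times> T. (case x of (m, j) \<Rightarrow> norm (V j m))\<^sup>2) = (\<Sum>m\<in>?J. \<Sum>j\<in>T. (norm (V j m))\<^sup>2)"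
    by (simp add: sum.cartesian_product case_prod_unfold)
  also have "\<dots> \<le> \<alpha>\<^sup>2 * (real N * real M + real N * real A * Bd)"
  proof -
    define K where "K n n' = (\<Sum>m\<in>?J. F m n * cnj (F m n'))" for n n'
    have "complex_of_real (\<Sum>m\<in>?J. \<Sum>j\<in>T. (norm (V j m))\<^sup>2) = (\<Sum>m\<in>?J. \<Sum>n\<in>?I. \<Sum>n' | n' \<in> ?I \<and> n' div A = n div A. F m n * cnj (F m n'))"
      unfolding T_def V_def of_real_sum[of _ ?J]
      by (intro sum.cong refl norm_squared_bucket_sum) simp
    also have "\<dots> = (\<Sum>n\<in>?I. \<Sum>m\<in>?J. \<Sum>n' | n' \<in> ?I \<and> n' div A = n div A. F m n * cnj (F m n'))"
      by (rule sum.swap)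
    also have "\<dots> = (\<Sum>n\<in>?I. \<Sum>n' | n' \<in> ?I \<and> n' div A = n div A. K n n')"
      unfolding K_def by (intro sum.cong refl sum.swap)
    finally have eq2: "complex_of_real (\<Sum>m\<in>?J. \<Sum>j\<in>T. (norm (V j m))\<^sup>2) = (\<Sum>n\<in>?I. \<Sum>n' | n' \<in> ?I \<and> n' div A = n div A. K n n')" .
    have Klt: "norm (K n n') \<le> \<alpha>\<^sup>2 * Bd" if nn: "n \<in> ?I" "n' \<in> ?I" "n' div A = n div A" "n < n'" for n n'
    proof -
      \<comment> \<open>An intersection of two intervals, hence convex; on it the coefficient
        \<open>a n * cnj (a n')\<close> is constant in \<open>m\<close>, which leaves a pure
        exponential sum.\<close>
      let ?S = "hyperbola_slice M D D' n \<inter> hyperbola_slice M D D' n'"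
      have "K n n' = (\<Sum>m\<in>?S. a n * cnj (a n') * ee (X / (real (n * m) + \<delta>) - X / (real (n' * m) + \<delta>)))"
        unfolding K_def F_def ee_diff hyperbola_slice_def
        by (intro sum.mono_neutral_cong_right) auto
      also have "\<dots> = a n * cnj (a n') * (\<Sum>m\<in>?S. ee (X / (real (n * m) + \<delta>) - X / (real (n' * m) + \<delta>)))"
        by (simp only: sum_distrib_left)
      also have "norm \<dots> \<le> \<alpha>\<^sup>2 * Bd"
      proof -
        define \<rho> where "\<rho> = X * (1 / real n - 1 / real n') / (8 * real M ^ 3)"
        have n: "0 < real n" "real N < real n" "real n \<le> 2 * real N" "real N < real n'" "real n' \<le> 2 * real N" using nn by auto
        have k: "real n' - real n \<le> real A" "1 \<le> real n' - real n"
          using same_bucket_diff[of A n n'] nn A by linarith+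
        have inv: "1 / real n - 1 / real n' = (real n' - real n) / (real n * real n')" using n by (simp add: field_simps)
        have MM: "real M ^ 3 > 0" "real N ^ 2 > 0" using M N0 by auto
        \<comment> \<open>Block mates differ by at most \<open>A\<close>, which bounds \<rho> above,
          and by at least 1, which bounds it below. The two terms of \<open>Bd\<close> come from
          these two extremes.\<close>
        have up: "\<rho> \<le> X * real A / (8 * real N ^ 2 * real M ^ 3)"
        proof -
          have "(real n' - real n) / (real n * real n') \<le> real A / (real N * real N)"
            using k n N0 by (intro frac_le mult_mono) auto
          hence "X * ((real n' - real n) / (real n * real n')) / (8 * real M ^ 3) \<le> X * (real A / (real N * real N)) / (8 * real M ^ 3)"
            using X by (intro divide_right_mono mult_left_mono) auto
          thus ?thesis unfolding \<rho>_def inv by (simp add: power2_eq_square mult_ac)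
        qed
        have low: "X / (32 * real N ^ 2 * real M ^ 3) \<le> \<rho>"
        proof -
          have "1 / (2 * real N * (2 * real N)) \<le> (real n' - real n) / (real n * real n')"
            using k n N0 by (intro frac_le mult_mono mult_pos_pos) auto
          hence "X * (1 / (2 * real N * (2 * real N))) / (8 * real M ^ 3) \<le> X * ((real n' - real n) / (real n * real n')) / (8 * real M ^ 3)"
            using X by (intro divide_right_mono mult_left_mono) auto
          thus ?thesis unfolding \<rho>_def inv by (simp add: power2_eq_square mult_ac)
        qed
        have lowpos: "X / (32 * real N ^ 2 * real M ^ 3) > 0" using X MM by auto
        have \<rho>0: "\<rho> > 0" using low lowpos by linarith
        have \<rho>1: "\<rho> \<le> 1"
        proof -
          have "X * real A / (8 * real N ^ 2 * real M ^ 3) \<le> 1" using lam MM by (simp add: divide_le_eq_1)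
          thus ?thesis using up by linarith
        qed
        have "norm (\<Sum>m\<in>?S. ee (X / (real (n * m) + \<delta>) - X / (real (n' * m) + \<delta>))) \<le> 144 * real M * sqrt \<rho> + 27 / sqrt \<rho>"
          unfolding \<rho>_def
        proof (rule type_II_inner_sum)
          show "0 < n" "n < n'" using n nn by auto
          show "?S \<subseteq> ?J" by (auto simp: hyperbola_slice_def)
          show "l \<in> ?S" if "m \<in> ?S" "k \<in> ?S" "m \<le> l" "l \<le> k" for m l k
            using that hyperbola_slice_convex by blast
        qed (use \<rho>1 \<delta> M X in \<open>auto simp: \<rho>_def\<close>)
        also have "\<dots> \<le> Bd"
        proof -
          have "144 * real M * sqrt \<rho> \<le> 144 * real M * sqrt (X * real A / (8 * real N ^ 2 * real M ^ 3))"
            using up by (intro mult_left_mono real_sqrt_le_mono) auto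
          also have "X * real A / (8 * real N ^ 2 * real M ^ 3) = (X * real A / (real N ^ 2 * real M)) / 8 / (real M)\<^sup>2"
            by (simp add: power2_eq_square power3_eq_cube)
          also have "144 * real M * sqrt \<dots> = 144 * sqrt ((X * real A / (real N ^ 2 * real M)) / 8)"
          proof -
            have eq: "sqrt (Z / (real M)\<^sup>2) = sqrt Z / real M" for Z by (simp add: real_sqrt_divide)
            show ?thesis unfolding eq using M by simp
          qed
          also have "\<dots> \<le> 200 * sqrt (X * real A / (real N ^ 2 * real M))"
          proof (intro mult_mono real_sqrt_le_mono)
            have aux: "t / 8 \<le> t" if "0 \<le> t" for t :: real using that by simp
            show "X * real A / (real N ^ 2 * real M) / 8 \<le> X * real A / (real N ^ 2 * real M)"
              by (rule aux) (use X in simp)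
          qed (use X in auto)
          finally have 1: "144 * real M * sqrt \<rho> \<le> 200 * sqrt (X * real A / (real N ^ 2 * real M))" .
          have "27 / sqrt \<rho> \<le> 27 / sqrt (X / (32 * real N ^ 2 * real M ^ 3))"
            using low lowpos \<rho>0 by (intro divide_left_mono real_sqrt_le_mono mult_pos_pos) auto
          also have "\<dots> = 27 * sqrt (32 * (real N ^ 2 * real M ^ 3 / X))"
            using X by (simp add: real_sqrt_divide real_sqrt_mult)
          also have "\<dots> \<le> 27 * sqrt (36 * (real N ^ 2 * real M ^ 3 / X))"
            using X by (intro mult_left_mono real_sqrt_le_mono mult_right_mono) auto
          also have "\<dots> = 162 * sqrt (real N ^ 2 * real M ^ 3 / X)"
            by (simp only: real_sqrt_mult) (simp add: real_sqrt_mult)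
          also have "\<dots> \<le> 200 * sqrt (real N ^ 2 * real M ^ 3 / X)"
            using X by (intro mult_right_mono) auto
          finally show ?thesis using 1 unfolding Bd_def by linarith
        qed
        finally have inner: "norm (\<Sum>m\<in>?S. ee (X / (real (n * m) + \<delta>) - X / (real (n' * m) + \<delta>))) \<le> Bd" .
        have "norm (a n * cnj (a n')) \<le> \<alpha> * \<alpha>" unfolding norm_mult using a[OF nn(1)] a[OF nn(2)] \<alpha>0 by (intro mult_mono) auto
        hence "norm (a n * cnj (a n')) * norm (\<Sum>m\<in>?S. ee (X / (real (n * m) + \<delta>) - X / (real (n' * m) + \<delta>))) \<le> (\<alpha> * \<alpha>) * Bd"
          using inner \<alpha>0 by (intro mult_mono) auto
        thus ?thesis by (simp only: norm_mult power2_eq_square)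
      qed
      finally show ?thesis .
    qed
    \<comment> \<open>The second differences are positive for \<open>n < n'\<close> only; the
      opposite order is reduced to it by conjugation.\<close>
    have Ksym: "norm (K n n') = norm (K n' n)" for n n'
    proof -
      have "K n n' = cnj (K n' n)" by (simp add: K_def mult.commute)
      thus ?thesis by simp
    qed
    have Keq: "norm (K n n) \<le> \<alpha>\<^sup>2 * real M" if "n \<in> ?I" for n
    proof -
      have "norm (K n n) \<le> (\<Sum>m\<in>?J. \<alpha>\<^sup>2)" unfolding K_def
      proof (rule sum_norm_le)
        fix m
        have "norm (F m n) \<le> \<alpha>" using a[OF that] \<alpha>0 by (simp add: F_def norm_mult)
        hence "norm (F m n) * norm (F m n) \<le> \<alpha> * \<alpha>" using \<alpha>0 by (intro mult_mono) auto
        thus "norm (F m n * cnj (F m n)) \<le> \<alpha>\<^sup>2" by (simp add: norm_mult power2_eq_square)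
      qed
      thus ?thesis by (simp add: mult.commute)
    qed
    have Kall: "norm (K n n') \<le> (if n' = n then \<alpha>\<^sup>2 * real M else 0) + \<alpha>\<^sup>2 * Bd" if "n \<in> ?I" "n' \<in> ?I" "n' div A = n div A" for n n'
    proof -
      consider "n = n'" | "n < n'" | "n' < n" by linarith
      thus ?thesis
      proof cases
        case 1
        have "0 \<le> \<alpha>\<^sup>2 * Bd" using Bd0 by simp
        thus ?thesis using 1 Keq[OF that(1)] by simp
      next
        case 2 thus ?thesis using Klt[OF that(1,2,3)] by simp
      next
        case 3 thus ?thesis using Klt[OF that(2,1)] that Ksym[of n n'] by simp
      qed
    qed
    have fin: "finite {n'. n' \<in> ?I \<and> n' div A = n div A}" for n by simp
    have "(\<Sum>m\<in>?J. \<Sum>j\<in>T. (norm (V j m))\<^sup>2) \<le> norm (complex_of_real (\<Sum>m\<in>?J. \<Sum>j\<in>T. (norm (V j m))\<^sup>2))"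
      unfolding norm_of_real by (rule abs_ge_self)
    also have "\<dots> \<le> (\<Sum>n\<in>?I. \<Sum>n' | n' \<in> ?I \<and> n' div A = n div A. (if n' = n then \<alpha>\<^sup>2 * real M else 0) + \<alpha>\<^sup>2 * Bd)"
      unfolding eq2 by (intro sum_norm_le Kall) auto
    also have "\<dots> \<le> (\<Sum>n\<in>?I. \<alpha>\<^sup>2 * real M + real A * (\<alpha>\<^sup>2 * Bd))"
    proof (rule sum_mono)
      fix n assume n: "n \<in> ?I"
      have "(\<Sum>n' | n' \<in> ?I \<and> n' div A = n div A. (if n' = n then \<alpha>\<^sup>2 * real M else 0) + \<alpha>\<^sup>2 * Bd)
        = \<alpha>\<^sup>2 * real M + real (card {n'. n' \<in> ?I \<and> n' div A = n div A}) * (\<alpha>\<^sup>2 * Bd)"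
        using n by (simp add: sum.distrib sum.delta[OF fin])
      also have "card {n'. n' \<in> ?I \<and> n' div A = n div A} \<le> A"
        using card_same_bucket[of A n] A card_mono[of "{n'. n' div A = n div A}" "{n'. n' \<in> ?I \<and> n' div A = n div A}"] by force
      finally show "(\<Sum>n' | n' \<in> ?I \<and> n' div A = n div A. (if n' = n then \<alpha>\<^sup>2 * real M else 0) + \<alpha>\<^sup>2 * Bd) \<le> \<alpha>\<^sup>2 * real M + real A * (\<alpha>\<^sup>2 * Bd)"
        using Bd0 by (simp add: mult_right_mono)
    qed
    also have "\<dots> = \<alpha>\<^sup>2 * (real N * real M + real N * real A * Bd)" by (simp add: algebra_simps)
    finally show ?thesis .
  qed
  also have "(\<Sum>x\<in>?J \<times> T. \<beta>\<^sup>2) \<le> real M * (3 * real N / real A) * \<beta>\<^sup>2"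
  proof -
    have "real (card T) \<le> 3 * real N / real A" unfolding T_def using A by (rule card_div_image)
    hence "real M * real (card T) * \<beta>\<^sup>2 \<le> real M * (3 * real N / real A) * \<beta>\<^sup>2"
      by (intro mult_right_mono mult_left_mono) auto
    thus ?thesis by (simp add: card_cartesian_product)
  qed
  finally show ?thesis unfolding eq Bd_def
    using \<alpha>0 Bd0[unfolded Bd_def] by (simp add: mult_ac mult_right_mono)
qed

lemma norm_ee_diff_le: "norm (ee s - ee t) \<le> 2 * pi * \<bar>s - t\<bar>"
proof -
  have "ee s - ee t = ee t * (ee (s - t) - 1)" by (simp add: right_diff_distrib flip: ee_add)
  hence "norm (ee s - ee t) = 2 * \<bar>sin (pi * (s - t))\<bar>" by (simp add: norm_mult norm_ee_minus_one)
  also have "\<bar>sin (pi * (s - t))\<bar> \<le> \<bar>pi * (s - t)\<bar>" by (rule abs_sin_x_le_abs_x)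
  also have "2 * \<bar>pi * (s - t)\<bar> = 2 * pi * \<bar>s - t\<bar>" by (simp add: abs_mult)
  finally show ?thesis by simp
qed

text \<open>The phase change \<open>- X * \<delta> / (u * (u + \<delta>))\<close> is of order
  \<open>X / Z\<^sup>2\<close>, and comparing it at points at distance \<open>w\<close> gains a
  further factor \<open>w / Z\<close>.\<close>

lemma shift_phase_variation:
  fixes X \<delta> u v Z w :: real
  assumes X: "X > 0" and \<delta>: "0 \<le> \<delta>" "\<delta> \<le> 1" and Z: "Z > 0" and uv: "Z \<le> u" "Z \<le> v" and w: "\<bar>u - v\<bar> \<le> w"
  shows "\<bar>(X / (u + \<delta>) - X / u) - (X / (v + \<delta>) - X / v)\<bar> \<le> 2 * X * w / Z ^ 3"
proof -
  have pos: "u > 0" "v > 0" "u + \<delta> > 0" "v + \<delta> > 0" using assms by auto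
  have "(X / (u + \<delta>) - X / u) - (X / (v + \<delta>) - X / v) = X * \<delta> * (u - v) * (1 / (u * v)) * ((u + v + \<delta>) / ((u + \<delta>) * (v + \<delta>)))"
    using pos by (simp add: divide_simps) (simp add: algebra_simps)
  also have "\<bar>\<dots>\<bar> = X * \<delta> * \<bar>u - v\<bar> * (1 / (u * v)) * ((u + v + \<delta>) / ((u + \<delta>) * (v + \<delta>)))"
    using X \<delta> pos by (simp add: abs_mult)
  also have "\<dots> \<le> X * 1 * w * (1 / (Z * Z)) * (2 / Z)"
  proof (intro mult_mono)
    show "1 / (u * v) \<le> 1 / (Z * Z)" using Z uv by (intro divide_left_mono mult_mono) auto
    have "(u + v + \<delta>) / ((u + \<delta>) * (v + \<delta>)) \<le> ((u + \<delta>) + (v + \<delta>)) / ((u + \<delta>) * (v + \<delta>))"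
      using pos \<delta> by (intro divide_right_mono) auto
    also have "\<dots> = 1 / (v + \<delta>) + 1 / (u + \<delta>)" using pos by (simp add: field_simps)
    also have "\<dots> \<le> 1 / Z + 1 / Z" using Z uv \<delta> by (intro add_mono divide_left_mono) auto
    finally show "(u + v + \<delta>) / ((u + \<delta>) * (v + \<delta>)) \<le> 2 / Z" by simp
  qed (use X \<delta> pos w Z in auto)
  also have "\<dots> = 2 * X * w / Z ^ 3" by (simp add: power3_eq_cube)
  finally show ?thesis .
qed

text \<open>Along a block the product \<open>n * m\<close> is monotone, so a block with points
  inside and outside the slice must contain the integral part of \<open>D / n\<close> or of
  \<open>D' / n\<close>.\<close>

lemma hyperbola_slice_bucket_boundary:
  fixes A n :: nat
  assumes n: "n > 0" and D: "D \<ge> 0" "D' \<ge> 0" and j: "m \<in> hyperbola_slice M D D' n" "m div A = j" and m': "m' \<in> {M<..2*M}" "m' div A = j" "m' \<notin> hyperbola_slice M D D' n"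
  shows "j \<in> {nat \<lfloor>D / real n\<rfloor> div A, nat \<lfloor>D' / real n\<rfloor> div A}"
proof -
  have m: "m \<in> {M<..2*M}" "D < real n * real m" "real n * real m \<le> D'" using j(1) by (auto simp: hyperbola_slice_def)
  have "real n * real m' \<le> D \<or> D' < real n * real m'" using m' by (auto simp: hyperbola_slice_def)
  thus ?thesis
  proof
    assume "real n * real m' \<le> D"
    hence "real m' \<le> D / real n" "D / real n < real m" using n m by (auto simp: field_simps)
    hence "m' \<le> nat \<lfloor>D / real n\<rfloor>" "nat \<lfloor>D / real n\<rfloor> \<le> m" using D n
      by (auto simp: le_nat_floor nat_le_iff floor_le_iff intro!: less_imp_le)
    hence "m' div A \<le> nat \<lfloor>D / real n\<rfloor> div A" "nat \<lfloor>D / real n\<rfloor> div A \<le> m div A" by (auto intro: div_le_mono)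
    thus ?thesis using j m' by auto
  next
    assume "D' < real n * real m'"
    hence "real m \<le> D' / real n" "D' / real n < real m'" using n m by (auto simp: field_simps)
    hence "m \<le> nat \<lfloor>D' / real n\<rfloor>" "nat \<lfloor>D' / real n\<rfloor> \<le> m'" using D n
      by (auto simp: le_nat_floor nat_le_iff floor_le_iff intro!: less_imp_le)
    hence "m div A \<le> nat \<lfloor>D' / real n\<rfloor> div A" "nat \<lfloor>D' / real n\<rfloor> div A \<le> m' div A" by (auto intro: div_le_mono)
    thus ?thesis using j m' by auto
  qed
qed

text \<open>On a block \<open>m div A = j\<close> the shift \<open>\<delta>\<close> changes the phase by a nearly constant amount, and the
  condition \<open>D < n m \<le> D'\<close> cuts through at most two blocks.\<close>

lemma bucket_approximation:
  fixes A M n :: nat and X \<delta> D D' \<beta> :: real and b :: "nat \<Rightarrow> complex"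
  assumes A: "A > 0" and M: "M > 0" and n: "n > 0" and X: "X > 0" and \<delta>: "0 \<le> \<delta>" "\<delta> \<le> 1" and D: "D \<ge> 0" "D' \<ge> 0"
    and b: "\<And>m. m \<in> {M<..2*M} \<Longrightarrow> norm (b m) \<le> \<beta>"
  shows "norm (\<Sum>m\<in>hyperbola_slice M D D' n. b m * ee (X / (real (n * m) + \<delta>)))
    \<le> (\<Sum>j\<in>(\<lambda>m. m div A) ` {M<..2*M}. norm (\<Sum>m | m \<in> {M<..2*M} \<and> m div A = j. b m * ee (X / real n * (1 / real m))))
      + 2 * \<beta> * real A + \<beta> * real M * (2 * pi * (2 * X * real A / (real n ^ 2 * real M ^ 3)))"
proof -
  have \<beta>0: "\<beta> \<ge> 0" using order_trans[OF norm_ge_zero b[of "2*M"]] M by simp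
  let ?J = "{M<..2*M}"
  define T where "T = (\<lambda>m. m div A) ` ?J"
  define B where "B j = {m. m \<in> ?J \<and> m div A = j}" for j
  define err where "err = 2 * pi * (2 * X * real A / (real n ^ 2 * real M ^ 3))"
  have err0: "err \<ge> 0" using X by (simp add: err_def)
  define S where "S = {nat \<lfloor>D / real n\<rfloor> div A, nat \<lfloor>D' / real n\<rfloor> div A}"
  have finB: "finite (B j)" for j by (simp add: B_def)
  have finc: "finite (hyperbola_slice M D D' n)" by (simp add: hyperbola_slice_def)
  have cardB: "card (B j) \<le> A" for j
  proof (cases "B j = {}")
    case False
    then obtain m where "m \<in> B j" by blast
    hence "B j \<subseteq> {m'. m' div A = m div A}" by (auto simp: B_def)
    thus ?thesis using card_same_bucket[OF A, of m] card_mono order_trans by blast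
  qed simp
  have piece: "norm (\<Sum>m\<in>hyperbola_slice M D D' n \<inter> B j. b m * ee (X / (real (n * m) + \<delta>)))
     \<le> norm (\<Sum>m\<in>B j. b m * ee (X / real n * (1 / real m))) + (if j \<in> S then \<beta> * real A else 0) + real (card (B j)) * (\<beta> * err)" for j
  proof -
    \<comment> \<open>A block may miss the slice, lie inside it, or be cut by it. The last case is
      confined to the at most two indices in \<open>S\<close> and estimated trivially.\<close>
    consider "hyperbola_slice M D D' n \<inter> B j = {}" | "B j \<subseteq> hyperbola_slice M D D' n" "B j \<noteq> {}" | m m' where "m \<in> hyperbola_slice M D D' n" "m \<in> B j" "m' \<in> B j" "m' \<notin> hyperbola_slice M D D' n"
      by blast
    thus ?thesis
    proof cases
      case 1
      thus ?thesis using \<beta>0 err0 by (simp add: add_nonneg_nonneg)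
    next
      case 2
      \<comment> \<open>The phase change \<open>\<psi>\<close> caused by the shift, not to be
        confused with the sawtooth, is frozen at an arbitrary point \<open>m0\<close> of the block;
        the resulting factor has modulus 1 and disappears in the norm.\<close>
      then obtain m0 where m0: "m0 \<in> B j" by blast
      define \<psi> where "\<psi> m = X / (real (n * m) + \<delta>) - X / real (n * m)" for m
      have e: "ee (X / (real (n * m) + \<delta>)) = ee (X / real n * (1 / real m)) * ee (\<psi> m)" for m
        by (simp add: \<psi>_def flip: ee_add)
      have var: "\<bar>\<psi> m - \<psi> m0\<bar> \<le> 2 * X * real A / (real n ^ 2 * real M ^ 3)" if "m \<in> B j" for m
      proof -
        have mm: "M < m" "M < m0" "m div A = m0 div A" using that m0 by (auto simp: B_def)
        have "m - m0 < A" "m0 - m < A" using same_bucket_diff[OF A] mm(3) by auto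
        hence "\<bar>real m - real m0\<bar> \<le> real A" by linarith
        hence "real n * \<bar>real m - real m0\<bar> \<le> real n * real A" by (intro mult_left_mono) auto
        hence "\<bar>real (n * m) - real (n * m0)\<bar> \<le> real n * real A" by (simp add: abs_mult flip: right_diff_distrib)
        hence "\<bar>\<psi> m - \<psi> m0\<bar> \<le> 2 * X * (real n * real A) / (real n * real M) ^ 3"
          unfolding \<psi>_def using mm n M X \<delta> by (intro shift_phase_variation) auto
        also have "\<dots> = 2 * X * real A / (real n ^ 2 * real M ^ 3)"
          using n M by (simp add: power_mult_distrib power3_eq_cube power2_eq_square field_simps)
        finally show ?thesis .
      qed
      have "(\<Sum>m\<in>hyperbola_slice M D D' n \<inter> B j. b m * ee (X / (real (n * m) + \<delta>))) = (\<Sum>m\<in>B j. b m * ee (X / (real (n * m) + \<delta>)))"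
        using 2 by (intro sum.cong) auto
      also have "\<dots> = ee (\<psi> m0) * (\<Sum>m\<in>B j. b m * ee (X / real n * (1 / real m)))
          + (\<Sum>m\<in>B j. b m * ee (X / real n * (1 / real m)) * (ee (\<psi> m) - ee (\<psi> m0)))"
        unfolding e by (simp add: sum_distrib_left algebra_simps sum_subtractf)
      also have "norm \<dots> \<le> norm (\<Sum>m\<in>B j. b m * ee (X / real n * (1 / real m))) + real (card (B j)) * (\<beta> * err)"
      proof (rule norm_triangle_mono)
        have "norm (\<Sum>m\<in>B j. b m * ee (X / real n * (1 / real m)) * (ee (\<psi> m) - ee (\<psi> m0))) \<le> (\<Sum>m\<in>B j. \<beta> * err)"
        proof (rule sum_norm_le)
          fix m assume m: "m \<in> B j"
          have "norm (ee (\<psi> m) - ee (\<psi> m0)) \<le> 2 * pi * \<bar>\<psi> m - \<psi> m0\<bar>" by (rule norm_ee_diff_le)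
          also have "\<dots> \<le> err" unfolding err_def using var[OF m] by (intro mult_left_mono) auto
          finally have "norm (ee (\<psi> m) - ee (\<psi> m0)) \<le> err" .
          moreover have "norm (b m) \<le> \<beta>" using m by (intro b) (auto simp: B_def)
          ultimately have "norm (b m) * norm (ee (\<psi> m) - ee (\<psi> m0)) \<le> \<beta> * err" using \<beta>0 by (intro mult_mono) auto
          thus "norm (b m * ee (X / real n * (1 / real m)) * (ee (\<psi> m) - ee (\<psi> m0))) \<le> \<beta> * err" by (simp add: norm_mult)
        qed
        thus "norm (\<Sum>m\<in>B j. b m * ee (X / real n * (1 / real m)) * (ee (\<psi> m) - ee (\<psi> m0))) \<le> real (card (B j)) * (\<beta> * err)" by simp
      qed (simp add: norm_mult)
      finally show ?thesis using \<beta>0 by (auto intro: order_trans add_increasing2)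
    next
      case 3
      hence "j \<in> S" unfolding S_def using n D by (intro hyperbola_slice_bucket_boundary[of n D D' m M A j m']) (auto simp: B_def)
      have "norm (\<Sum>m\<in>hyperbola_slice M D D' n \<inter> B j. b m * ee (X / (real (n * m) + \<delta>))) \<le> (\<Sum>m\<in>hyperbola_slice M D D' n \<inter> B j. \<beta>)"
        using b by (intro sum_norm_le) (auto simp: norm_mult B_def)
      also have "\<dots> \<le> (\<Sum>m\<in>B j. \<beta>)" using \<beta>0 finB by (intro sum_mono2) auto
      also have "\<dots> \<le> \<beta> * real A" using cardB[of j] \<beta>0 by (simp add: mult.commute mult_left_mono)
      finally show ?thesis using \<open>j \<in> S\<close> \<beta>0 err0 by (simp add: add_increasing add_increasing2)
    qed
  qed
  have "(\<Sum>m\<in>hyperbola_slice M D D' n. b m * ee (X / (real (n * m) + \<delta>))) = (\<Sum>j\<in>T. \<Sum>m | m \<in> hyperbola_slice M D D' n \<and> m div A = j. b m * ee (X / (real (n * m) + \<delta>)))"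
    by (rule sum.group [symmetric]) (auto simp: finc T_def hyperbola_slice_def)
  also have "\<dots> = (\<Sum>j\<in>T. \<Sum>m\<in>hyperbola_slice M D D' n \<inter> B j. b m * ee (X / (real (n * m) + \<delta>)))"
    by (intro sum.cong) (auto simp: B_def hyperbola_slice_def)
  also have "norm \<dots> \<le> (\<Sum>j\<in>T. norm (\<Sum>m\<in>B j. b m * ee (X / real n * (1 / real m))) + (if j \<in> S then \<beta> * real A else 0) + real (card (B j)) * (\<beta> * err))"
    by (intro sum_norm_le piece)
  also have "\<dots> = (\<Sum>j\<in>T. norm (\<Sum>m\<in>B j. b m * ee (X / real n * (1 / real m)))) + (\<Sum>j\<in>T. if j \<in> S then \<beta> * real A else 0) + (\<Sum>j\<in>T. real (card (B j))) * (\<beta> * err)"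
    by (simp only: sum.distrib sum_distrib_right)
  also have "(\<Sum>j\<in>T. if j \<in> S then \<beta> * real A else 0) \<le> 2 * \<beta> * real A"
  proof -
    have finT: "finite T" by (simp add: T_def)
    have "(\<Sum>j\<in>T. if j \<in> S then \<beta> * real A else 0) = (\<Sum>j\<in>{j \<in> T. j \<in> S}. \<beta> * real A)"
      by (rule sum.inter_filter [symmetric]) (rule finT)
    also have "\<dots> \<le> (\<Sum>j\<in>S. \<beta> * real A)" using \<beta>0 by (intro sum_mono2) (auto simp: S_def)
    also have "\<dots> \<le> 2 * (\<beta> * real A)"
    proof -
      have "card S \<le> 2" unfolding S_def by (simp add: card_insert_if)
      hence "real (card S) \<le> 2" by simp
      hence "real (card S) * (\<beta> * real A) \<le> 2 * (\<beta> * real A)" using \<beta>0 by (intro mult_right_mono) auto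
      thus ?thesis by simp
    qed
    finally show ?thesis by simp
  qed
  also have "(\<Sum>j\<in>T. real (card (B j))) = real M"
  proof -
    have "(\<Sum>j\<in>T. real (card (B j))) = (\<Sum>j\<in>T. \<Sum>m | m \<in> ?J \<and> m div A = j. 1)"
      by (simp add: B_def)
    also have "\<dots> = (\<Sum>m\<in>?J. 1)" unfolding T_def by (rule sum.image_gen [symmetric]) simp
    finally show ?thesis by simp
  qed
  finally show ?thesis by (simp add: T_def B_def err_def mult_ac)
qed

text \<open>The diagonal plus twice the real part of the sum over pairs \<open>m < m'\<close>.
  Ordering the pairs makes the new frequencies \<open>1 / m - 1 / m'\<close> nonnegative, as
  required by \<open>double_large_sieve\<close>.\<close>

lemma bucket_square_bound:
  fixes A M :: nat and t \<beta> :: real and b :: "nat \<Rightarrow> complex"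
  assumes b: "\<And>m. m \<in> {M<..2*M} \<Longrightarrow> norm (b m) \<le> \<beta>" and \<beta>: "\<beta> \<ge> 0"
  shows "(\<Sum>j\<in>(\<lambda>m. m div A) ` {M<..2*M}. (norm (\<Sum>m | m \<in> {M<..2*M} \<and> m div A = j. b m * ee (t * (1 / real m))))\<^sup>2)
    \<le> \<beta>\<^sup>2 * real M + 2 * norm (\<Sum>(m, m')\<in>{(m, m'). m \<in> {M<..2*M} \<and> m' \<in> {M<..2*M} \<and> m < m' \<and> m div A = m' div A}.
          b m * cnj (b m') * ee (t * (1 / real m - 1 / real m')))"
proof -
  let ?J = "{M<..2*M}"
  let ?P = "{(m, m'). m \<in> ?J \<and> m' \<in> ?J \<and> m < m' \<and> m div A = m' div A}"
  let ?P' = "{(m, m'). m \<in> ?J \<and> m' \<in> ?J \<and> m' < m \<and> m div A = m' div A}"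
  let ?E = "{(m, m'). m \<in> ?J \<and> m' = m}"
  define F where "F m = b m * ee (t * (1 / real m))" for m
  define K where "K = (\<lambda>(m, m'). F m * cnj (F m'))"
  have finP: "finite ?P" "finite ?P'" "finite ?E"
    by (rule finite_subset[of _ "?J \<times> ?J"]; auto)+
  have "complex_of_real (\<Sum>j\<in>(\<lambda>m. m div A) ` ?J. (norm (\<Sum>m | m \<in> ?J \<and> m div A = j. F m))\<^sup>2)
     = (\<Sum>m\<in>?J. \<Sum>m' | m' \<in> ?J \<and> m' div A = m div A. F m * cnj (F m'))"
    by (rule norm_squared_bucket_sum) simp
  also have "\<dots> = sum K (SIGMA m:?J. {m'. m' \<in> ?J \<and> m' div A = m div A})"
    unfolding K_def by (subst sum.Sigma) auto
  also have "(SIGMA m:?J. {m'. m' \<in> ?J \<and> m' div A = m div A}) = ?E \<union> (?P \<union> ?P')"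
    by (auto simp: not_less)
  also have "sum K \<dots> = sum K ?E + (sum K ?P + sum K ?P')"
  proof -
    have "sum K (?E \<union> (?P \<union> ?P')) = sum K ?E + sum K (?P \<union> ?P')"
      by (rule sum.union_disjoint) (use finP in \<open>auto\<close>)
    also have "sum K (?P \<union> ?P') = sum K ?P + sum K ?P'"
      by (rule sum.union_disjoint) (use finP in \<open>auto\<close>)
    finally show ?thesis .
  qed
  also have "sum K ?P' = cnj (sum K ?P)"
    unfolding cnj_sum K_def
    by (rule sum.reindex_bij_witness[of _ "\<lambda>(m, m'). (m', m)" "\<lambda>(m, m'). (m', m)"]) (auto simp: mult.commute)
  finally have eq: "complex_of_real (\<Sum>j\<in>(\<lambda>m. m div A) ` ?J. (norm (\<Sum>m | m \<in> ?J \<and> m div A = j. F m))\<^sup>2) = sum K ?E + (sum K ?P + cnj (sum K ?P))" .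
  have "(\<Sum>j\<in>(\<lambda>m. m div A) ` ?J. (norm (\<Sum>m | m \<in> ?J \<and> m div A = j. F m))\<^sup>2)
    \<le> norm (complex_of_real (\<Sum>j\<in>(\<lambda>m. m div A) ` ?J. (norm (\<Sum>m | m \<in> ?J \<and> m div A = j. F m))\<^sup>2))"
    unfolding norm_of_real by (rule abs_ge_self)
  also have "\<dots> \<le> norm (sum K ?E) + (norm (sum K ?P) + norm (sum K ?P))"
    unfolding eq by (rule norm_triangle_mono[OF order_refl], rule order_trans[OF norm_triangle_ineq]) (simp del: cnj_sum)
  also have "norm (sum K ?E) \<le> \<beta>\<^sup>2 * real M"
  proof -
    have "?E = (\<lambda>m. (m, m)) ` ?J" by auto
    hence card: "card ?E = M" by (simp add: card_image inj_on_def)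
    have "norm (sum K ?E) \<le> (\<Sum>p\<in>?E. \<beta>\<^sup>2)"
    proof (rule sum_norm_le)
      fix p assume "p \<in> ?E"
      then obtain m where m: "p = (m, m)" "m \<in> ?J" by auto
      have "norm (b m) * norm (b m) \<le> \<beta> * \<beta>" using b[OF m(2)] \<beta> by (intro mult_mono) auto
      thus "norm (K p) \<le> \<beta>\<^sup>2" by (simp add: K_def F_def m norm_mult power2_eq_square)
    qed
    thus ?thesis using card by (simp add: mult.commute)
  qed
  also have "sum K ?P = (\<Sum>(m, m')\<in>?P. b m * cnj (b m') * ee (t * (1 / real m - 1 / real m')))"
    unfolding K_def F_def by (intro sum.cong refl) (auto simp: right_diff_distrib ee_diff mult_ac)
  finally show ?thesis unfolding F_def by simp
qed

text \<open>In \<open>h * n' = h' * n\<close> the pair \<open>(h, n')\<close> is free; then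
  \<open>h'\<close> is one of the divisors of \<open>h * n'\<close>, and \<open>n\<close> is
  determined.\<close>

lemma count_equal_fractions:
  fixes H N :: nat
  assumes \<tau>: "\<And>k. 0 < k \<Longrightarrow> k \<le> 4 * H * N \<Longrightarrow> real (num_divisors k) \<le> \<tau>" and HN: "H > 0" "N > 0"
  shows "real (card {((h, n), (h', n')). h \<in> {H..<2*H} \<and> n \<in> {N<..2*N} \<and> h' \<in> {H..<2*H} \<and> n' \<in> {N<..2*N} \<and> h * n' = h' * n}) \<le> real H * real N * \<tau>"
proof -
  let ?S = "{((h, n), (h', n')). h \<in> {H..<2*H} \<and> n \<in> {N<..2*N} \<and> h' \<in> {H..<2*H} \<and> n' \<in> {N<..2*N} \<and> h * n' = h' * n}"
  let ?T = "SIGMA p:{H..<2*H} \<times> {N<..2*N}. {d. d dvd fst p * snd p}"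
  have finT: "finite ?T" using HN by (intro finite_SigmaI) (auto intro!: finite_divisors_nat)
  define \<phi> :: "(nat \<times> nat) \<times> nat \<times> nat \<Rightarrow> (nat \<times> nat) \<times> nat" where "\<phi> = (\<lambda>((h, n), (h', n')). ((h, n'), h'))"
  have inj: "inj_on \<phi> ?S"
  proof (rule inj_onI)
    fix s t assume st: "s \<in> ?S" "t \<in> ?S" "\<phi> s = \<phi> t"
    obtain h n h' n' where s: "s = ((h, n), (h', n'))" by (metis surj_pair)
    obtain g m g' m' where t: "t = ((g, m), (g', m'))" by (metis surj_pair)
    have "h = g" "n' = m'" "h' = g'" using st s t by (auto simp: \<phi>_def)
    moreover have "h' * n = h' * m" using st s t calculation by auto
    moreover have "h' > 0" using st s HN by auto
    ultimately show "s = t" using s t by simp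
  qed
  have im: "\<phi> ` ?S \<subseteq> ?T"
  proof
    fix y assume "y \<in> \<phi> ` ?S"
    then obtain h n h' n' where "y = ((h, n'), h')" "h \<in> {H..<2*H}" "n' \<in> {N<..2*N}" "h * n' = h' * n"
      by (auto simp: \<phi>_def)
    thus "y \<in> ?T" by auto
  qed
  have "card ?S \<le> card ?T" using card_inj_on_le[OF inj im finT] .
  also have "card ?T = (\<Sum>p\<in>{H..<2*H} \<times> {N<..2*N}. num_divisors (fst p * snd p))"
    using HN by (subst card_SigmaI) (auto intro!: finite_divisors_nat simp: num_divisors_def)
  finally have "real (card ?S) \<le> (\<Sum>p\<in>{H..<2*H} \<times> {N<..2*N}. real (num_divisors (fst p * snd p)))"
    by (metis (mono_tags, lifting) of_nat_le_iff of_nat_sum sum.cong)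
  also have "\<dots> \<le> (\<Sum>p\<in>{H..<2*H} \<times> {N<..2*N}. \<tau>)"
  proof (rule sum_mono)
    fix p assume p: "p \<in> {H..<2*H} \<times> {N<..2*N}"
    have "fst p * snd p \<le> (2 * H) * (2 * N)" using p by (intro mult_le_mono) auto
    thus "real (num_divisors (fst p * snd p)) \<le> \<tau>" using p HN by (intro \<tau>) auto
  qed
  also have "\<dots> = real H * real N * \<tau>" by (simp add: card_cartesian_product)
  finally show ?thesis .
qed

text \<open>Multiplying by \<open>m * m' * n * n' \<le> 16 * M ^ 4\<close> clears the denominators
  and gives the expression of \<open>close_pair\<close>. A pair \<open>m < m'\<close> of block mates
  is encoded by its difference, less than \<open>A\<close>, and its first member, which is
  injective.\<close>

lemma count_close_differences:
  fixes A M :: nat and R Y :: real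
  assumes A: "A > 0" and M: "M > 0" and R: "R > 0" and Y: "16 * real M ^ 4 / R \<le> Y"
  defines "P \<equiv> {(m, m'). m \<in> {M<..2*M} \<and> m' \<in> {M<..2*M} \<and> m < m' \<and> m div A = m' div A}"
  shows "card {(p, p'). p \<in> P \<and> p' \<in> P \<and> \<bar>(1 / real (fst p) - 1 / real (snd p)) - (1 / real (fst p') - 1 / real (snd p'))\<bar> * R \<le> 1}
    \<le> card {(a, m, b, n). a \<in> {1..<A} \<and> b \<in> {1..<A} \<and> m \<in> {M<..2*M} \<and> n \<in> {M<..2*M} \<and> close_pair Y a b m n}"
proof -
  let ?S = "{(p, p'). p \<in> P \<and> p' \<in> P \<and> \<bar>(1 / real (fst p) - 1 / real (snd p)) - (1 / real (fst p') - 1 / real (snd p'))\<bar> * R \<le> 1}"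
  let ?Q = "{(a, m, b, n). a \<in> {1..<A} \<and> b \<in> {1..<A} \<and> m \<in> {M<..2*M} \<and> n \<in> {M<..2*M} \<and> close_pair Y a b m n}"
  define \<phi> :: "(nat \<times> nat) \<times> nat \<times> nat \<Rightarrow> nat \<times> nat \<times> nat \<times> nat" where "\<phi> = (\<lambda>((m, m'), (n, n')). (m' - m, m, n' - n, n))"
  have fin: "finite ?Q"
    by (rule finite_subset[of _ "{1..<A} \<times> {M<..2*M} \<times> {1..<A} \<times> {M<..2*M}"]) auto
  have inj: "inj_on \<phi> ?S"
    by (rule inj_onI) (auto simp: \<phi>_def P_def)
  have im: "\<phi> ` ?S \<subseteq> ?Q"
  proof
    fix y assume "y \<in> \<phi> ` ?S"
    then obtain m m' n n' where y: "y = (m' - m, m, n' - n, n)"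
      and m: "m \<in> {M<..2*M}" "m' \<in> {M<..2*M}" "m < m'" "m div A = m' div A"
      and n: "n \<in> {M<..2*M}" "n' \<in> {M<..2*M}" "n < n'" "n div A = n' div A"
      and close: "\<bar>(1 / real m - 1 / real m') - (1 / real n - 1 / real n')\<bar> * R \<le> 1"
      by (auto simp: \<phi>_def P_def)
    define a where "a = m' - m"
    define b where "b = n' - n"
    have ab: "m' = m + a" "n' = n + b" "a \<ge> 1" "b \<ge> 1" using m n by (auto simp: a_def b_def)
    have "a < A" "b < A" using same_bucket_diff[OF A m(4)] same_bucket_diff[OF A n(4)] by (auto simp: a_def b_def)
    have pos: "real m > 0" "real n > 0" "real m' > 0" "real n' > 0" using m n by auto
    define W where "W = real m * real m' * (real n * real n')"
    have W0: "W > 0" using pos by (simp add: W_def)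
    have "W \<le> (2 * real M) * (2 * real M) * ((2 * real M) * (2 * real M))"
      unfolding W_def using m n by (intro mult_mono) auto
    hence W1: "W \<le> 16 * real M ^ 4" by (simp add: power4_eq_xxxx)
    have id: "W * ((1 / real m - 1 / real m') - (1 / real n - 1 / real n')) = real a * real n * (real n + real b) - real b * real m * (real m + real a)"
    proof -
      have "W * ((1 / real m - 1 / real m') - (1 / real n - 1 / real n')) = real n * real n' * (real m' - real m) - real m * real m' * (real n' - real n)"
        using pos unfolding W_def by (simp add: field_simps)
      thus ?thesis unfolding ab by (simp add: algebra_simps)
    qed
    have "\<bar>(1 / real m - 1 / real m') - (1 / real n - 1 / real n')\<bar> \<le> 1 / R" using close R by (simp add: field_simps)
    hence "W * \<bar>(1 / real m - 1 / real m') - (1 / real n - 1 / real n')\<bar> \<le> (16 * real M ^ 4) * (1 / R)"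
      using W0 W1 R by (intro mult_mono) auto
    hence "\<bar>W * ((1 / real m - 1 / real m') - (1 / real n - 1 / real n'))\<bar> \<le> 16 * real M ^ 4 / R"
      using W0 by (simp add: abs_mult)
    hence "close_pair Y a b m n" unfolding close_pair_def id using Y by linarith
    moreover have "y = (a, m, b, n)" using y by (simp add: a_def b_def)
    ultimately show "y \<in> ?Q" using m(1) n(1) \<open>a < A\<close> \<open>b < A\<close> ab(3,4) by simp
  qed
  show ?thesis by (rule card_inj_on_le[OF inj im fin])
qed

text \<open>\<open>bucket_approximation\<close> removes \<delta> and the condition on
  \<open>n * m\<close>, so that the phase factors into \<open>h * x / n\<close> and
  \<open>1 / m\<close>. Cauchy's inequality over \<open>h\<close>, \<open>n\<close> and the blocks
  then leads to the double large sieve with points \<open>h * x / n\<close> and frequencies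
  \<open>1 / m - 1 / m'\<close>. The hypothesis \<open>close\<close> keeps distinct points apart;
  the hypothesis \<open>Y\<close> translates the closeness of frequencies into
  \<open>close_pair\<close>.\<close>

lemma type_II_large_sieve:
  fixes N M A H :: nat and x \<delta> D D' \<alpha> \<beta> \<tau> Y E :: real and a b :: "nat \<Rightarrow> complex"
  assumes A: "1 \<le> A" "A \<le> M" and N: "N > 0" and H: "H > 0" and x: "x > 0" and \<delta>: "0 \<le> \<delta>" "\<delta> \<le> 1" and D: "D \<ge> 0" "D' \<ge> 0"
    and a: "\<And>n. n \<in> {N<..2*N} \<Longrightarrow> norm (a n) \<le> \<alpha>" and b: "\<And>m. m \<in> {M<..2*M} \<Longrightarrow> norm (b m) \<le> \<beta>"
    and \<beta>: "\<beta> > 0"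
    and close: "2 * real N ^ 2 * real M ^ 2 < x * real A"
    and \<tau>: "\<And>k. 0 < k \<Longrightarrow> k \<le> 4 * H * N \<Longrightarrow> real (num_divisors k) \<le> \<tau>"
    and Y: "8 * real M ^ 4 * real N / (real H * x) \<le> Y"
    and E: "real (card {(a, m, b, n). a \<in> {1..<A} \<and> b \<in> {1..<A} \<and> m \<in> {M<..2*M} \<and> n \<in> {M<..2*M} \<and> close_pair Y a b m n}) \<le> E"
  defines "G \<equiv> nat \<lfloor>2 * (real A / real M ^ 2) * (2 * real H * x / real N)\<rfloor> + 1"
  shows "(\<Sum>h\<in>{H..<2*H}. norm (\<Sum>n\<in>{N<..2*N}. \<Sum>m\<in>hyperbola_slice M D D' n. a n * b m * ee (real h * x / (real (n * m) + \<delta>))))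
    \<le> \<alpha> * \<beta> * (sqrt (3 * real H * real N * real M / real A * (real H * real N * real M + 2 * (exp pi * sqrt (real H * real N * \<tau> * (6 * real G * harm G * E)))))
       + 2 * real H * real N * real A + real H * real N * real M * (2 * pi * (4 * real H * x * real A / (real N ^ 2 * real M ^ 3))))"
proof -
  have M0: "M > 0" and A0: "A > 0" using A by auto
  have \<alpha>0: "\<alpha> \<ge> 0" using order_trans[OF norm_ge_zero a[of "2*N"]] N by simp
  let ?I = "{N<..2*N}" and ?J = "{M<..2*M}" and ?H = "{H..<2*H}"
  define T where "T = (\<lambda>m. m div A) ` ?J"
  define V where "V j t = norm (\<Sum>m | m \<in> ?J \<and> m div A = j. b m * ee (t * (1 / real m)))" for j t
  define err where "err = 2 * pi * (4 * real H * x * real A / (real N ^ 2 * real M ^ 3))"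
  define t where "t = (\<lambda>(h :: nat, n :: nat). real h * x / real n)"
  have step1: "norm (\<Sum>n\<in>?I. \<Sum>m\<in>hyperbola_slice M D D' n. a n * b m * ee (real h * x / (real (n * m) + \<delta>)))
     \<le> \<alpha> * (\<Sum>n\<in>?I. (\<Sum>j\<in>T. V j (t (h, n))) + (2 * \<beta> * real A + \<beta> * real M * err))" if h: "h \<in> ?H" for h
  proof -
    have "norm (\<Sum>n\<in>?I. \<Sum>m\<in>hyperbola_slice M D D' n. a n * b m * ee (real h * x / (real (n * m) + \<delta>)))
      \<le> (\<Sum>n\<in>?I. \<alpha> * ((\<Sum>j\<in>T. V j (t (h, n))) + (2 * \<beta> * real A + \<beta> * real M * err)))"
    proof (rule sum_norm_le)
      fix n assume n: "n \<in> ?I"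
      have X: "real h * x > 0" using h H x by auto
      have "(\<Sum>m\<in>hyperbola_slice M D D' n. a n * b m * ee (real h * x / (real (n * m) + \<delta>))) = a n * (\<Sum>m\<in>hyperbola_slice M D D' n. b m * ee (real h * x / (real (n * m) + \<delta>)))"
        by (simp add: sum_distrib_left mult_ac)
      also have "norm \<dots> \<le> \<alpha> * ((\<Sum>j\<in>T. V j (t (h, n))) + (2 * \<beta> * real A + \<beta> * real M * err))"
        unfolding norm_mult
      proof (rule mult_mono)
        have "norm (\<Sum>m\<in>hyperbola_slice M D D' n. b m * ee (real h * x / (real (n * m) + \<delta>)))
          \<le> (\<Sum>j\<in>T. V j (t (h, n))) + 2 * \<beta> * real A + \<beta> * real M * (2 * pi * (2 * (real h * x) * real A / (real n ^ 2 * real M ^ 3)))"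
          unfolding T_def V_def t_def prod.case
          by (rule bucket_approximation[OF A0 M0 _ X \<delta> D b]) (use n in auto)
        also have "2 * (real h * x) * real A / (real n ^ 2 * real M ^ 3) \<le> (4 * real H * x * real A) / (real N ^ 2 * real M ^ 3)"
        proof (rule frac_le)
          have "real h \<le> 2 * real H" using h by auto
          hence "2 * (real h * x) * real A \<le> 2 * ((2 * real H) * x) * real A" using x by (intro mult_mono) auto
          thus "2 * (real h * x) * real A \<le> 4 * real H * x * real A" by simp
          show "real N ^ 2 * real M ^ 3 \<le> real n ^ 2 * real M ^ 3" using n by (intro mult_mono power_mono) auto
        qed (use N M0 x in auto)
        finally show "norm (\<Sum>m\<in>hyperbola_slice M D D' n. b m * ee (real h * x / (real (n * m) + \<delta>))) \<le> (\<Sum>j\<in>T. V j (t (h, n))) + (2 * \<beta> * real A + \<beta> * real M * err)"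
          using \<beta> by (simp add: err_def mult_left_mono)
      qed (use a[OF n] \<alpha>0 in auto)
      finally show "norm (\<Sum>m\<in>hyperbola_slice M D D' n. a n * b m * ee (real h * x / (real (n * m) + \<delta>))) \<le> \<alpha> * ((\<Sum>j\<in>T. V j (t (h, n))) + (2 * \<beta> * real A + \<beta> * real M * err))" .
    qed
    thus ?thesis by (simp only: sum_distrib_left)
  qed
  have "(\<Sum>h\<in>?H. norm (\<Sum>n\<in>?I. \<Sum>m\<in>hyperbola_slice M D D' n. a n * b m * ee (real h * x / (real (n * m) + \<delta>))))
     \<le> (\<Sum>h\<in>?H. \<alpha> * (\<Sum>n\<in>?I. (\<Sum>j\<in>T. V j (t (h, n))) + (2 * \<beta> * real A + \<beta> * real M * err)))"
    by (intro sum_mono step1)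
  also have "\<dots> = \<alpha> * ((\<Sum>h\<in>?H. \<Sum>n\<in>?I. \<Sum>j\<in>T. V j (t (h, n))) + real H * real N * (2 * \<beta> * real A + \<beta> * real M * err))"
    by (simp add: sum_distrib_left sum.distrib distrib_left mult.assoc)
  also have "(\<Sum>h\<in>?H. \<Sum>n\<in>?I. \<Sum>j\<in>T. V j (t (h, n))) = (\<Sum>u\<in>?H \<times> ?I. \<Sum>j\<in>T. V j (t u))"
    by (subst sum.cartesian_product) (simp add: case_prod_unfold)
  also have "\<dots> = (\<Sum>(u, j)\<in>(?H \<times> ?I) \<times> T. V j (t u))"
    by (rule sum.cartesian_product)
  finally have main: "(\<Sum>h\<in>?H. norm (\<Sum>n\<in>?I. \<Sum>m\<in>hyperbola_slice M D D' n. a n * b m * ee (real h * x / (real (n * m) + \<delta>))))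
     \<le> \<alpha> * ((\<Sum>(u, j)\<in>(?H \<times> ?I) \<times> T. V j (t u)) + real H * real N * (2 * \<beta> * real A + \<beta> * real M * err))" .
  define P where "P = {(m, m'). m \<in> ?J \<and> m' \<in> ?J \<and> m < m' \<and> m div A = m' div A}"
  have finP: "finite P" unfolding P_def by (rule finite_subset[of _ "?J \<times> ?J"]) auto
  define w where "w p = 1 / real (fst p) - 1 / real (snd p)" for p :: "nat \<times> nat"
  \<comment> \<open>Normalised by the square of \<beta>, since the large sieve takes coefficients of
    modulus at most 1.\<close>
  define \<gamma> where "\<gamma> p = b (fst p) * cnj (b (snd p)) / of_real (\<beta>\<^sup>2)" for p
  define w0 where "w0 = real A / real M ^ 2"
  define R where "R = 2 * real H * x / real N"
  define Z where "Z = (\<Sum>u\<in>?H \<times> ?I. norm (\<Sum>p\<in>P. \<gamma> p * ee (t u * w p)))"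
  define Q where "Q = real H * real N * \<tau> * (6 * real G * harm G * E)"
  have w0: "w0 > 0" and R: "R > 0" using A0 M0 H x N by (auto simp: w0_def R_def)
  have "Z\<^sup>2 \<le> (exp pi)\<^sup>2 * real (card {(u, u'). u \<in> ?H \<times> ?I \<and> u' \<in> ?H \<times> ?I \<and> \<bar>t u - t u'\<bar> * (2 * w0) \<le> 1})
      * (6 * real G * harm G * real (card {(p, p'). p \<in> P \<and> p' \<in> P \<and> \<bar>w p - w p'\<bar> * R \<le> 1}))"
    unfolding Z_def G_def w0_def [symmetric] R_def [symmetric]
  proof (rule double_large_sieve)
    fix u assume "u \<in> ?H \<times> ?I"
    then obtain h n where u: "u = (h, n)" "h \<in> ?H" "n \<in> ?I" by auto
    have "real h * x / real n \<le> (2 * real H * x) / real N" using u x N by (intro frac_le mult_right_mono) auto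
    thus "0 \<le> t u \<and> t u \<le> R" using u x by (simp add: t_def R_def)
  next
    fix p assume "p \<in> P"
    then obtain m m' where p: "p = (m, m')" "m \<in> ?J" "m' \<in> ?J" "m < m'" "m div A = m' div A" by (auto simp: P_def)
    have "real m' - real m \<le> real A" using same_bucket_diff[OF A0 p(5)] p(4) by linarith
    moreover have "real M * real M \<le> real m * real m'" using p by (intro mult_mono) auto
    moreover have "w p = (real m' - real m) / (real m * real m')" using p by (simp add: w_def field_simps)
    ultimately show "0 \<le> w p \<and> w p \<le> w0" using p M0 unfolding w0_def power2_eq_square
      by (auto intro!: frac_le)
    have "norm (b m) * norm (b m') \<le> \<beta> * \<beta>" using b p \<beta> by (intro mult_mono) auto
    thus "norm (\<gamma> p) \<le> 1" using p \<beta> by (simp add: \<gamma>_def norm_mult norm_divide power2_eq_square)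
  qed (use finP w0 R in auto)
  also have "\<dots> \<le> (exp pi)\<^sup>2 * (real H * real N * \<tau>) * (6 * real G * harm G * E)"
  proof (intro mult_mono mult_left_mono)
    have fin: "finite {((h, n), (h', n')). h \<in> ?H \<and> n \<in> ?I \<and> h' \<in> ?H \<and> n' \<in> ?I \<and> h * n' = h' * n}"
      by (rule finite_subset[of _ "(?H \<times> ?I) \<times> (?H \<times> ?I)"]) auto
    \<comment> \<open>Points this close satisfy \<open>\<bar>h * n' - h' * n\<bar> < 1\<close>, and
      integrality makes the two fractions equal.\<close>
    have sub: "{(u, u'). u \<in> ?H \<times> ?I \<and> u' \<in> ?H \<times> ?I \<and> \<bar>t u - t u'\<bar> * (2 * w0) \<le> 1}
       \<subseteq> {((h, n), (h', n')). h \<in> ?H \<and> n \<in> ?I \<and> h' \<in> ?H \<and> n' \<in> ?I \<and> h * n' = h' * n}"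
    proof
      fix s assume "s \<in> {(u, u'). u \<in> ?H \<times> ?I \<and> u' \<in> ?H \<times> ?I \<and> \<bar>t u - t u'\<bar> * (2 * w0) \<le> 1}"
      then obtain h n h' n' where s: "s = ((h, n), (h', n'))" "h \<in> ?H" "n \<in> ?I" "h' \<in> ?H" "n' \<in> ?I"
        and c: "\<bar>real h * x / real n - real h' * x / real n'\<bar> * (2 * w0) \<le> 1"
        by (auto simp: t_def)
      have npos: "real n > 0" "real n' > 0" using s by auto
      have "\<bar>real h * real n' - real h' * real n\<bar> * (x * (2 * w0)) = (\<bar>real h * x / real n - real h' * x / real n'\<bar> * (2 * w0)) * (real n * real n')"
      proof -
        have "real h * x / real n - real h' * x / real n' = (real h * real n' - real h' * real n) * x / (real n * real n')"
          using npos by (simp add: field_simps)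
        thus ?thesis using npos x by (simp add: abs_mult abs_divide)
      qed
      also have "\<dots> \<le> 1 * (2 * real N * (2 * real N))"
        using c s w0 by (intro mult_mono) auto
      finally have "\<bar>real h * real n' - real h' * real n\<bar> * (x * (2 * w0)) \<le> 4 * real N ^ 2" by (simp add: power2_eq_square)
      moreover have "4 * real N ^ 2 < 1 * (x * (2 * w0))"
        using close M0 by (simp add: w0_def field_simps)
      ultimately have "\<bar>real h * real n' - real h' * real n\<bar> * (x * (2 * w0)) < 1 * (x * (2 * w0))" by linarith
      hence "\<bar>real h * real n' - real h' * real n\<bar> < 1" using x w0 by (simp only: mult_less_cancel_right) auto
      hence "\<bar>real_of_int (int (h * n') - int (h' * n))\<bar> < 1" by simp
      hence "int (h * n') - int (h' * n) = 0" by linarith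
      hence "h * n' = h' * n" by linarith
      thus "s \<in> {((h, n), (h', n')). h \<in> ?H \<and> n \<in> ?I \<and> h' \<in> ?H \<and> n' \<in> ?I \<and> h * n' = h' * n}" using s by simp
    qed
    have "real (card {(u, u'). u \<in> ?H \<times> ?I \<and> u' \<in> ?H \<times> ?I \<and> \<bar>t u - t u'\<bar> * (2 * w0) \<le> 1})
       \<le> real (card {((h, n), (h', n')). h \<in> ?H \<and> n \<in> ?I \<and> h' \<in> ?H \<and> n' \<in> ?I \<and> h * n' = h' * n})"
      by (intro of_nat_mono card_mono fin sub)
    also have "\<dots> \<le> real H * real N * \<tau>" by (rule count_equal_fractions[OF \<tau> H N])
    finally show "real (card {(u, u'). u \<in> ?H \<times> ?I \<and> u' \<in> ?H \<times> ?I \<and> \<bar>t u - t u'\<bar> * (2 * w0) \<le> 1}) \<le> real H * real N * \<tau>" .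
    have "16 * real M ^ 4 / R \<le> Y" using Y by (simp add: R_def mult_ac)
    hence "card {(p, p'). p \<in> P \<and> p' \<in> P \<and> \<bar>w p - w p'\<bar> * R \<le> 1}
      \<le> card {(a, m, b, n). a \<in> {1..<A} \<and> b \<in> {1..<A} \<and> m \<in> ?J \<and> n \<in> ?J \<and> close_pair Y a b m n}"
      unfolding P_def w_def by (rule count_close_differences[OF A0 M0 R])
    thus "real (card {(p, p'). p \<in> P \<and> p' \<in> P \<and> \<bar>w p - w p'\<bar> * R \<le> 1}) \<le> E" using E by linarith
    have "real (num_divisors 1) \<le> \<tau>" using H N by (intro \<tau>) auto
    thus "0 \<le> (exp pi)\<^sup>2 * (real H * real N * \<tau>)" by (auto intro!: mult_nonneg_nonneg)
  qed (auto simp: harm_nonneg)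
  also have "\<dots> = (exp pi)\<^sup>2 * Q" by (simp add: Q_def)
  finally have ZQ: "Z \<le> exp pi * sqrt Q"
    by (metis real_le_rsqrt real_sqrt_mult real_sqrt_abs abs_of_nonneg exp_ge_zero)
  have "(\<Sum>(u, j)\<in>(?H \<times> ?I) \<times> T. V j (t u))\<^sup>2 = (\<Sum>s\<in>(?H \<times> ?I) \<times> T. 1 * V (snd s) (t (fst s)))\<^sup>2"
    by (simp add: case_prod_unfold)
  also have "\<dots> \<le> (\<Sum>s\<in>(?H \<times> ?I) \<times> T. 1\<^sup>2) * (\<Sum>s\<in>(?H \<times> ?I) \<times> T. (V (snd s) (t (fst s)))\<^sup>2)"
    by (rule Cauchy_Schwarz_ineq_sum)
  also have "\<dots> \<le> (3 * real H * real N * real M / real A) * (\<beta>\<^sup>2 * (real H * real N * real M + 2 * (exp pi * sqrt Q)))"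
  proof (rule mult_mono)
    have "real H * real N * real (card T) \<le> real H * real N * (3 * real M / real A)"
      unfolding T_def by (intro mult_left_mono card_div_image A) auto
    thus "(\<Sum>s\<in>(?H \<times> ?I) \<times> T. 1\<^sup>2) \<le> 3 * real H * real N * real M / real A"
      by (simp add: card_cartesian_product mult_ac)
    have "(\<Sum>s\<in>(?H \<times> ?I) \<times> T. (V (snd s) (t (fst s)))\<^sup>2) = (\<Sum>u\<in>?H \<times> ?I. \<Sum>j\<in>T. (V j (t u))\<^sup>2)"
      by (simp add: sum.cartesian_product case_prod_unfold)
    also have "\<dots> \<le> (\<Sum>u\<in>?H \<times> ?I. \<beta>\<^sup>2 * real M + 2 * (\<beta>\<^sup>2 * norm (\<Sum>p\<in>P. \<gamma> p * ee (t u * w p))))"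
    proof (rule sum_mono)
      fix u
      have "(\<Sum>j\<in>T. (V j (t u))\<^sup>2) \<le> \<beta>\<^sup>2 * real M + 2 * norm (\<Sum>(m, m')\<in>P. b m * cnj (b m') * ee (t u * (1 / real m - 1 / real m')))"
        unfolding T_def V_def P_def using b \<beta> by (intro bucket_square_bound) auto
      also have "(\<Sum>(m, m')\<in>P. b m * cnj (b m') * ee (t u * (1 / real m - 1 / real m'))) = of_real (\<beta>\<^sup>2) * (\<Sum>p\<in>P. \<gamma> p * ee (t u * w p))"
        unfolding sum_distrib_left \<gamma>_def w_def using \<beta> by (intro sum.cong refl) (simp add: case_prod_unfold)
      also have "norm \<dots> = \<beta>\<^sup>2 * norm (\<Sum>p\<in>P. \<gamma> p * ee (t u * w p))"
        by (simp add: norm_mult norm_power)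
      finally show "(\<Sum>j\<in>T. (V j (t u))\<^sup>2) \<le> \<beta>\<^sup>2 * real M + 2 * (\<beta>\<^sup>2 * norm (\<Sum>p\<in>P. \<gamma> p * ee (t u * w p)))" .
    qed
    also have "\<dots> = \<beta>\<^sup>2 * (real H * real N * real M + 2 * Z)"
      unfolding Z_def by (simp add: sum.distrib card_cartesian_product distrib_left mult_ac flip: sum_distrib_left)
    also have "\<dots> \<le> \<beta>\<^sup>2 * (real H * real N * real M + 2 * (exp pi * sqrt Q))"
      using ZQ by (intro mult_left_mono) auto
    finally show "(\<Sum>s\<in>(?H \<times> ?I) \<times> T. (V (snd s) (t (fst s)))\<^sup>2) \<le> \<beta>\<^sup>2 * (real H * real N * real M + 2 * (exp pi * sqrt Q))" .
  qed (auto intro!: sum_nonneg)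
  also have "\<dots> = \<beta>\<^sup>2 * (3 * real H * real N * real M / real A * (real H * real N * real M + 2 * (exp pi * sqrt Q)))"
    by simp
  finally have "(\<Sum>(u, j)\<in>(?H \<times> ?I) \<times> T. V j (t u)) \<le> sqrt (\<beta>\<^sup>2 * (3 * real H * real N * real M / real A * (real H * real N * real M + 2 * (exp pi * sqrt Q))))"
    by (rule real_le_rsqrt)
  also have "\<dots> = \<beta> * sqrt (3 * real H * real N * real M / real A * (real H * real N * real M + 2 * (exp pi * sqrt Q)))"
    using \<beta> by (simp only: real_sqrt_mult real_sqrt_abs abs_of_pos)
  finally have "\<alpha> * ((\<Sum>(u, j)\<in>(?H \<times> ?I) \<times> T. V j (t u)) + real H * real N * (2 * \<beta> * real A + \<beta> * real M * err))
    \<le> \<alpha> * (\<beta> * sqrt (3 * real H * real N * real M / real A * (real H * real N * real M + 2 * (exp pi * sqrt Q))) + real H * real N * (2 * \<beta> * real A + \<beta> * real M * err))"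
    using \<alpha>0 by (intro mult_left_mono) auto
  also have "\<dots> = \<alpha> * \<beta> * (sqrt (3 * real H * real N * real M / real A * (real H * real N * real M + 2 * (exp pi * sqrt Q)))
       + 2 * real H * real N * real A + real H * real N * real M * err)"
    by (simp add: algebra_simps)
  finally show ?thesis using main by (simp add: Q_def err_def)
qed

section \<open>The type II estimate\<close>

lemma sqrt_powr: "x > 0 \<Longrightarrow> sqrt (x powr a) = x powr (a / 2)"
  by (simp add: powr_half_sqrt [symmetric] powr_powr)

lemma powr_pow: "x > 0 \<Longrightarrow> (x powr a) ^ k = x powr (real k * a)"
  by (simp add: powr_power)

lemma le_sqrt_from_square:
  fixes s :: real
  assumes "s\<^sup>2 \<le> x powr (2 * p)" "x > 0"
  shows "s \<le> x powr p"
proof -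
  have "x powr (2 * p) = (x powr p)\<^sup>2" using assms by (simp add: powr_power)
  thus ?thesis using assms(1) by (metis abs_le_square_iff abs_ge_self abs_of_nonneg order_trans powr_ge_zero)
qed

text \<open>Sizes are measured by exponents of \<open>x\<close>: \<open>n\<close> and
  \<open>m\<close> for the variables, \<open>d\<close> for the range of the product,
  \<open>h\<close> for the frequency. Up to multiples of \<eta>, the diagonal \<open>t1\<close>
  dictates the block length, and \<open>t2\<close> stays below \<open>x powr (34/36)\<close> as long
  as \<open>n + d + h\<close> is at most \<open>56/72\<close>; the threshold \<open>55/72\<close>
  leaves some room.\<close>

lemma type_II_box_short:
  fixes N M A H :: nat and x \<eta> \<delta> D D' n m h d X :: real and a b :: "nat \<Rightarrow> complex"
  assumes x: "x \<ge> 1" and \<eta>: "0 < \<eta>" "\<eta> \<le> 1 / 100000" and K: "x powr \<eta> \<ge> 10 ^ 8"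
    and NM: "real N = x powr n" "real M = x powr m"
    and A: "real A \<le> x powr (4 / 36)" "x powr (4 / 36 - \<eta>) \<le> real A" "A \<le> N"
    and d: "17 / 36 \<le> d" "d \<le> 19 / 36" "0 \<le> h" "h \<le> d - 17 / 36 + \<eta>" "n \<le> m" "d - \<eta> \<le> n + m" "n + m \<le> d + \<eta>"
    and short: "n + d + h \<le> 55 / 72"
    and X: "x powr (h + 1) \<le> X" "X \<le> 2 * x powr (h + 1)"
    and \<delta>: "0 \<le> \<delta>" "\<delta> \<le> 1"
    and a: "\<And>k. k \<in> {N<..2*N} \<Longrightarrow> norm (a k) \<le> x powr \<eta>" and b: "\<And>k. k \<in> {M<..2*M} \<Longrightarrow> norm (b k) \<le> x powr \<eta>"
  shows "norm (\<Sum>n\<in>{N<..2*N}. \<Sum>m\<in>hyperbola_slice M D D' n. a n * b m * ee (X / (real (n * m) + \<delta>))) \<le> x powr (17 / 36 + 5 * \<eta>)"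
proof -
  have x0: "x > 0" using x by simp
  note pm = powr_mono[OF _ x]
  have A0: "real A > 0" by (rule less_le_trans[OF _ A(2)]) (use x0 in simp)
  have A1: "1 \<le> A" using A0 by simp
  have X0: "X > 0" by (rule less_le_trans[OF _ X(1)]) (use x0 in simp)
  have two: "2 \<le> x powr \<eta>" using K by simp
  have Xup: "X \<le> x powr (h + 1 + \<eta>)"
  proof -
    have "2 * x powr (h + 1) \<le> x powr \<eta> * x powr (h + 1)" using two by (intro mult_right_mono) auto
    thus ?thesis using X(2) by (simp add: powr_add [symmetric] algebra_simps)
  qed
  have M10: "10 \<le> M"
  proof -
    have "10 ^ 8 \<le> x powr m" using K pm[of \<eta> m] d \<eta> by linarith
    hence "10 \<le> real M" using NM by simp
    thus ?thesis by simp
  qed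
  have lam: "X * real A \<le> 8 * real N ^ 2 * real M ^ 3"
  proof -
    have "X * real A \<le> x powr (h + 1 + \<eta>) * x powr (4 / 36)" using Xup A X0 by (intro mult_mono) auto
    also have "\<dots> = x powr (h + 1 + \<eta> + 4 / 36)" by (simp only: powr_add)
    also have "\<dots> \<le> x powr (2 * n + 3 * m)" using d \<eta> by (intro pm) linarith
    also have "\<dots> = real N ^ 2 * real M ^ 3" unfolding NM powr_pow[OF x0] by (simp add: powr_add [symmetric] algebra_simps)
    finally have "X * real A \<le> real N ^ 2 * real M ^ 3" .
    moreover have "0 \<le> real N ^ 2 * real M ^ 3" by simp
    ultimately show ?thesis by linarith
  qed
  let ?S = "norm (\<Sum>n\<in>{N<..2*N}. \<Sum>m\<in>hyperbola_slice M D D' n. a n * b m * ee (X / (real (n * m) + \<delta>)))"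
  define s1 where "s1 = sqrt (X * real A / (real N ^ 2 * real M))"
  define s2 where "s2 = sqrt (real N ^ 2 * real M ^ 3 / X)"
  have s1: "s1 \<le> x powr ((h + 1 + \<eta> + 4 / 36 - 2 * n - m) / 2)"
  proof -
    have "X * real A / (real N ^ 2 * real M) \<le> x powr (h + 1 + \<eta>) * x powr (4 / 36) / (real N ^ 2 * real M)"
      using Xup A X0 by (intro divide_right_mono mult_mono) auto
    also have "\<dots> = x powr (h + 1 + \<eta> + 4 / 36 - 2 * n - m)"
      unfolding NM powr_pow[OF x0] by (simp add: powr_add [symmetric] powr_diff [symmetric] algebra_simps)
    finally show ?thesis unfolding s1_def using real_sqrt_le_mono sqrt_powr[OF x0] by metis
  qed
  have s2: "s2 \<le> x powr ((2 * n + 3 * m - (h + 1)) / 2)"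
  proof -
    have "real N ^ 2 * real M ^ 3 / X \<le> real N ^ 2 * real M ^ 3 / x powr (h + 1)"
      using X x0 X0 by (intro frac_le) auto
    also have "\<dots> = x powr (2 * n + 3 * m - (h + 1))"
      unfolding NM powr_pow[OF x0] by (simp add: powr_add [symmetric] powr_diff [symmetric] algebra_simps)
    finally show ?thesis unfolding s2_def using real_sqrt_le_mono sqrt_powr[OF x0] by metis
  qed
  have t1: "real N * real M * (real N * real M) / real A \<le> x powr (34 / 36 + 3 * \<eta>)"
  proof -
    have "real N * real M * (real N * real M) / real A \<le> real N * real M * (real N * real M) / x powr (4 / 36 - \<eta>)"
      using A x0 by (intro frac_le) auto
    also have "\<dots> = x powr (n + m + (n + m) - (4 / 36 - \<eta>))"
      unfolding NM by (simp add: powr_add [symmetric] powr_diff [symmetric] algebra_simps)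
    also have "\<dots> \<le> x powr (34 / 36 + 3 * \<eta>)" using d by (intro pm) linarith
    finally show ?thesis .
  qed
  have t2: "real N * real M * real N * s1 \<le> x powr (34 / 36 + 3 * \<eta>)"
  proof -
    have "real N * real M * real N * s1 \<le> real N * real M * real N * x powr ((h + 1 + \<eta> + 4 / 36 - 2 * n - m) / 2)"
      using s1 by (intro mult_left_mono) auto
    also have "\<dots> = x powr (n + m + n + (h + 1 + \<eta> + 4 / 36 - 2 * n - m) / 2)"
      unfolding NM by (simp only: powr_add)
    also have "\<dots> \<le> x powr (34 / 36 + 3 * \<eta>)" using d short \<eta> by (intro pm) argo
    finally show ?thesis .
  qed
  have t3: "real N * real M * real N * s2 \<le> x powr (34 / 36 + 3 * \<eta>)"
  proof -
    have "real N * real M * real N * s2 \<le> real N * real M * real N * x powr ((2 * n + 3 * m - (h + 1)) / 2)"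
      using s2 by (intro mult_left_mono) auto
    also have "\<dots> = x powr (n + m + n + (2 * n + 3 * m - (h + 1)) / 2)"
      unfolding NM by (simp only: powr_add)
    also have "\<dots> \<le> x powr (34 / 36 + 3 * \<eta>)" using d short \<eta> by (intro pm) argo
    finally show ?thesis .
  qed
  have "?S\<^sup>2 \<le> (x powr \<eta>)\<^sup>2 * (x powr \<eta>)\<^sup>2 * (3 * real N / real A) * real M *
       (real N * real M + real N * real A * (200 * s1 + 200 * s2))"
    unfolding s1_def s2_def by (rule type_II_smooth[OF A1 A(3) M10 X0 \<delta> a b lam])
  also have "\<dots> = (x powr \<eta>)\<^sup>2 * (x powr \<eta>)\<^sup>2 * (3 * (real N * real M * (real N * real M) / real A) + 600 * (real N * real M * real N * s1) + 600 * (real N * real M * real N * s2))"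
    using A0 by (simp add: field_simps)
  also have "\<dots> \<le> (x powr \<eta>)\<^sup>2 * (x powr \<eta>)\<^sup>2 * (3 * x powr (34 / 36 + 3 * \<eta>) + 600 * x powr (34 / 36 + 3 * \<eta>) + 600 * x powr (34 / 36 + 3 * \<eta>))"
    using t1 t2 t3 by (intro mult_left_mono add_mono) auto
  also have "\<dots> \<le> (x powr \<eta>)\<^sup>2 * (x powr \<eta>)\<^sup>2 * (x powr \<eta> * x powr (34 / 36 + 3 * \<eta>))"
  proof (intro mult_left_mono)
    have "1203 * x powr (34 / 36 + 3 * \<eta>) \<le> x powr \<eta> * x powr (34 / 36 + 3 * \<eta>)"
      using K by (intro mult_right_mono) auto
    thus "3 * x powr (34 / 36 + 3 * \<eta>) + 600 * x powr (34 / 36 + 3 * \<eta>) + 600 * x powr (34 / 36 + 3 * \<eta>) \<le> x powr \<eta> * x powr (34 / 36 + 3 * \<eta>)"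
      by linarith
  qed auto
  also have "\<dots> = x powr (2 * \<eta> + 2 * \<eta> + (\<eta> + (34 / 36 + 3 * \<eta>)))"
    unfolding powr_pow[OF x0] by (simp add: powr_add [symmetric] algebra_simps)
  also have "\<dots> \<le> x powr (2 * (17 / 36 + 5 * \<eta>))" using \<eta> by (intro pm) simp
  finally show ?thesis using x0 by (rule le_sqrt_from_square)
qed

text \<open>The target \<open>x powr (1 - 2 * n)\<close> is what the large sieve can afford. The
  trivial bound \<open>A\<^sup>2 * M\<close> meets it once \<open>m\<close> exceeds
  \<open>2 * d - 28/36\<close>, which is at most \<open>100/360\<close>; hence the threshold
  \<open>101/360\<close>. Below it the two variables are nearly equal, and the separation length
  \<open>L\<close>, about \<open>x powr (1/60)\<close>, supplies the missing saving of at most about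
  \<open>x powr (1/72)\<close>.\<close>

lemma spacing_count_bound:
  fixes N M A L :: nat and x \<eta> n m h d Y :: real
  assumes x: "x \<ge> 1" and \<eta>: "0 < \<eta>" "\<eta> \<le> 1 / 100000" and K: "x powr \<eta> \<ge> 10 ^ 8"
    and M: "real M = x powr m"
    and A: "real A \<le> x powr (4 / 36)" "A \<le> M"
    and L: "1 \<le> L" "L \<le> A" "real L \<le> x powr (1 / 60)" "x powr (1 / 60 - \<eta>) \<le> real L"
    and d: "17 / 36 \<le> d" "d \<le> 19 / 36" "0 \<le> h" "h \<le> d - 17 / 36 + \<eta>" "n \<le> m" "d - \<eta> \<le> n + m" "n + m \<le> d + \<eta>"
    and long: "n + d + h > 55 / 72"
    and Y: "Y = 8 * x powr (4 * m + n - h - 1)"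
  shows "real (card {(a, m, b, n). a \<in> {1..<A} \<and> b \<in> {1..<A} \<and> m \<in> {M<..2*M} \<and> n \<in> {M<..2*M} \<and> close_pair Y a b m n})
    \<le> x powr (1 - 2 * n + 2 * \<eta>)"
proof -
  have x0: "x > 0" using x by simp
  note pm = powr_mono[OF _ x]
  have M0: "M > 0" using M x0 by (metis of_nat_0_less_iff powr_gt_zero less_irrefl)
  have Y0: "Y \<ge> 0" by (simp add: Y)
  have Yup: "Y \<le> x powr (4 * m + n - h - 1 + \<eta>)"
  proof -
    have "8 * x powr (4 * m + n - h - 1) \<le> x powr \<eta> * x powr (4 * m + n - h - 1)" using K by (intro mult_right_mono) auto
    thus ?thesis unfolding Y by (simp add: powr_add [symmetric] algebra_simps)
  qed
  have YM: "2 * Y \<le> (real M)\<^sup>2"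
  proof -
    have "2 * Y \<le> x powr \<eta> * x powr (4 * m + n - h - 1 + \<eta>)" using K Yup Y0 by (intro mult_mono) auto
    also have "\<dots> = x powr (\<eta> + (4 * m + n - h - 1 + \<eta>))" by (simp only: powr_add)
    also have "\<dots> \<le> x powr (2 * m)" using d long \<eta> by (intro pm) argo
    also have "\<dots> = (real M)\<^sup>2" unfolding M powr_pow[OF x0] by simp
    finally show ?thesis .
  qed
  have base: "real (card {(a, m, b, n). a \<in> {1..<A} \<and> b \<in> {1..<A} \<and> m \<in> {M<..2*M} \<and> n \<in> {M<..2*M} \<and> close_pair Y a b m n})
    \<le> (\<Sum>a\<in>{1..<A}. \<Sum>b\<in>{1..<A}. real (card (close_fst M Y a b))) + 6 * real A * Y"
    by (rule card_close_quadruples[OF M0 A(2) Y0 YM])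
  have A2: "(real A)\<^sup>2 \<le> x powr (8 / 36)"
  proof -
    have "(real A)\<^sup>2 \<le> (x powr (4 / 36))\<^sup>2" using A by (intro power_mono) auto
    also have "\<dots> = x powr (8 / 36)" unfolding powr_pow[OF x0] by simp
    finally show ?thesis .
  qed
  have AY: "real A * Y \<le> x powr (4 / 36 + (4 * m + n - h - 1 + \<eta>))"
  proof -
    have "real A * Y \<le> x powr (4 / 36) * x powr (4 * m + n - h - 1 + \<eta>)" using A Yup Y0 by (intro mult_mono) auto
    thus ?thesis by (simp only: powr_add)
  qed
  define B where "B = x powr (1 - 2 * n + \<eta>)"
  have B0: "B \<ge> 0" by (simp add: B_def)
  have absorb: "k * B \<le> x powr (1 - 2 * n + 2 * \<eta>)" if "k \<le> 10 ^ 8" for k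
  proof -
    have "k * B \<le> x powr \<eta> * B" using that K B0 by (intro mult_right_mono) auto
    thus ?thesis unfolding B_def by (simp add: powr_add [symmetric] algebra_simps)
  qed
  have AYB: "real A * Y \<le> B"
    unfolding B_def by (rule order_trans[OF AY]) (use d long \<eta> in \<open>intro pm, argo\<close>)
  show ?thesis
  proof (cases "m \<le> 101 / 360")
    case False
    have "(\<Sum>a\<in>{1..<A}. \<Sum>b\<in>{1..<A}. real (card (close_fst M Y a b))) \<le> (\<Sum>a\<in>{1..<A}. \<Sum>b\<in>{1..<A}. real M)"
      using card_close_fst_le by (intro sum_mono) simp
    also have "\<dots> = real (A - 1) * (real (A - 1) * real M)" by (simp only: sum_constant card_atLeastLessThan)
    also have "\<dots> \<le> real A * (real A * real M)" by (intro mult_mono) auto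
    also have "\<dots> = (real A)\<^sup>2 * real M" by (simp add: power2_eq_square)
    also have "\<dots> \<le> x powr (8 / 36) * x powr m" using A2 M by (intro mult_mono) auto
    also have "\<dots> = x powr (8 / 36 + m)" by (simp only: powr_add)
    also have "\<dots> \<le> B" unfolding B_def using d False \<eta> by (intro pm) argo
    finally have "(\<Sum>a\<in>{1..<A}. \<Sum>b\<in>{1..<A}. real (card (close_fst M Y a b))) + 6 * real A * Y \<le> 7 * B" using AYB by simp
    also have "\<dots> \<le> x powr (1 - 2 * n + 2 * \<eta>)" by (rule absorb) simp
    finally show ?thesis using base by linarith
  next
    case True
    have AL: "(real A)\<^sup>2 * real L \<le> real M"
    proof -
      have "(real A)\<^sup>2 * real L \<le> x powr (8 / 36) * x powr (1 / 60)" using A2 L by (intro mult_mono) auto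
      also have "\<dots> = x powr (8 / 36 + 1 / 60)" by (simp only: powr_add)
      also have "\<dots> \<le> x powr m" using d long \<eta> by (intro pm) argo
      finally show ?thesis using M by simp
    qed
    \<comment> \<open>Compared with the target, this term is largest when \<open>m\<close> is
      smallest, and \<open>n \<le> m\<close> keeps \<open>m\<close> above about
      \<open>d / 2\<close>.\<close>
    have e1: "(real A)\<^sup>2 * (real M / real L) \<le> B"
    proof -
      have "(real A)\<^sup>2 * (real M / real L) \<le> x powr (8 / 36) * (x powr m / x powr (1 / 60 - \<eta>))"
        using A2 M L x0 by (intro mult_mono frac_le) auto
      also have "\<dots> = x powr (8 / 36 + m - (1 / 60 - \<eta>))" by (simp add: powr_add [symmetric] powr_diff [symmetric] algebra_simps)
      also have "\<dots> \<le> B" unfolding B_def using d True \<eta> by (intro pm) argo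
      finally show ?thesis .
    qed
    have e2: "(real A)\<^sup>2 \<le> B"
      unfolding B_def by (rule order_trans[OF A2]) (use d \<eta> in \<open>intro pm, argo\<close>)
    have e3: "Y\<^sup>2 / real M \<le> B"
    proof -
      have "Y\<^sup>2 / real M \<le> (x powr (4 * m + n - h - 1 + \<eta>))\<^sup>2 / x powr m"
        unfolding M using Yup Y0 by (intro divide_right_mono power_mono) auto
      also have "\<dots> = x powr (2 * (4 * m + n - h - 1 + \<eta>) - m)"
        unfolding powr_pow[OF x0] by (simp add: powr_add [symmetric] powr_diff [symmetric] algebra_simps)
      also have "\<dots> \<le> B" unfolding B_def using d True long \<eta> by (intro pm) argo
      finally show ?thesis .
    qed
    \<comment> \<open>Here the upper bound on \<open>m\<close> is used: apart from \<eta> the claim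
      is \<open>46/360 + 4 * m + 3 * n - h \<le> 2\<close>, and the left side is at most
      \<open>717/360\<close>.\<close>
    have e4: "real A * real L * Y \<le> B"
    proof -
      have "real A * real L * Y \<le> x powr (4 / 36) * x powr (1 / 60) * x powr (4 * m + n - h - 1 + \<eta>)"
        using A L Yup Y0 by (intro mult_mono) auto
      also have "\<dots> = x powr (4 / 36 + 1 / 60 + (4 * m + n - h - 1 + \<eta>))" by (simp only: powr_add)
      also have "\<dots> \<le> B" unfolding B_def using d True \<eta> by (intro pm) argo
      finally show ?thesis .
    qed
    have e5: "real A * real L * real L * real M \<le> B"
    proof -
      have "real A * real L * real L * real M \<le> x powr (4 / 36) * x powr (1 / 60) * x powr (1 / 60) * x powr m"
        using A L M by (intro mult_mono) auto
      also have "\<dots> = x powr (4 / 36 + 1 / 60 + 1 / 60 + m)" by (simp only: powr_add)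
      also have "\<dots> \<le> B" unfolding B_def using d \<eta> by (intro pm) argo
      finally show ?thesis .
    qed
    have e6: "real A * real L * real M \<le> B"
    proof -
      have "real A * real L * 1 * real M \<le> real A * real L * real L * real M" using L by (intro mult_mono) auto
      thus ?thesis using e5 by simp
    qed
    have "(\<Sum>a\<in>{1..<A}. \<Sum>b\<in>{1..<A}. real (card (close_fst M Y a b)))
      \<le> (real A)\<^sup>2 * (real M / real L + 2) + 6 * Y\<^sup>2 / real M + 17 * real A * real L * (100000 * (Y / real M + 1) + real L) * real M"
      by (rule sum_card_close_fst[OF M0 L(1,2) A(2) AL Y0 YM])
    also have "\<dots> = (real A)\<^sup>2 * (real M / real L) + 2 * (real A)\<^sup>2 + 6 * (Y\<^sup>2 / real M) + 1700000 * (real A * real L * Y)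
        + 1700000 * (real A * real L * real M) + 17 * (real A * real L * real L * real M)"
      using M0 by (simp add: field_simps)
    also have "\<dots> \<le> B + 2 * B + 6 * B + 1700000 * B + 1700000 * B + 17 * B"
      using e1 e2 e3 e4 e5 e6 by (intro add_mono mult_left_mono) auto
    finally have "(\<Sum>a\<in>{1..<A}. \<Sum>b\<in>{1..<A}. real (card (close_fst M Y a b))) + 6 * real A * Y \<le> 3400032 * B" using AYB by simp
    also have "\<dots> \<le> x powr (1 - 2 * n + 2 * \<eta>)" by (rule absorb) simp
    finally show ?thesis using base by linarith
  qed
qed

lemma exp_pi_le: "exp pi \<le> (81 :: real)"
proof -
  have "exp pi \<le> exp (4 :: real)" using pi_less_4 by simp
  also have "exp (4 :: real) = exp 1 ^ 4" by (simp flip: exp_of_nat_mult)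
  also have "\<dots> \<le> 3 ^ 4" using exp_le by (intro power_mono) auto
  finally show ?thesis by simp
qed

lemma harm_le_ln:
  assumes "n > 0"
  shows "harm n \<le> 1 + ln (real n)"
  using assms
proof (induction n rule: nat_induct_non_zero)
  case 1
  thus ?case by (simp add: harm_expand)
next
  case (Suc n)
  have "ln (real n / real (Suc n)) \<le> real n / real (Suc n) - 1" using Suc by (intro ln_le_minus_one) auto
  also have "\<dots> = - inverse (real (Suc n))" by (simp add: field_simps)
  finally have "inverse (real (Suc n)) \<le> ln (real (Suc n)) - ln (real n)" using Suc by (simp add: ln_div)
  thus ?case using Suc by (simp add: harm_Suc)
qed

text \<open>With \<open>E = x powr (1 - 2 * n)\<close> the off-diagonal term \<open>f2\<close> has
  exponent \<open>2 * h + 34/36\<close> up to multiples of \<eta>, whatever \<open>n\<close> and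
  \<open>m\<close> are; the diagonal \<open>f1\<close> reaches this size only at
  \<open>d = 19/36\<close>. The terms \<open>R2\<close>, from blocks cut by the slice, and
  \<open>R3\<close>, from freezing the shift, are smaller.\<close>

lemma type_II_box_long:
  fixes N M A H L :: nat and x \<eta> \<delta> D D' n m h d :: real and a b :: "nat \<Rightarrow> complex"
  assumes x: "x \<ge> 1" and \<eta>: "0 < \<eta>" "\<eta> \<le> 1 / 100000" and K: "x powr \<eta> \<ge> 10 ^ 8" "1 + 3 * ln x \<le> x powr \<eta>"
    and NM: "real N = x powr n" "real M = x powr m" "real H = x powr h"
    and A: "real A \<le> x powr (4 / 36)" "x powr (4 / 36 - \<eta>) \<le> real A" "A \<le> N"
    and L: "1 \<le> L" "L \<le> A" "real L \<le> x powr (1 / 60)" "x powr (1 / 60 - \<eta>) \<le> real L"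
    and d: "17 / 36 \<le> d" "d \<le> 19 / 36" "0 \<le> h" "h \<le> d - 17 / 36 + \<eta>" "n \<le> m" "d - \<eta> \<le> n + m" "n + m \<le> d + \<eta>"
    and long: "n + d + h > 55 / 72"
    and \<tau>: "\<And>k. 0 < k \<Longrightarrow> real k \<le> x \<Longrightarrow> real (num_divisors k) \<le> x powr \<eta>"
    and \<delta>: "0 \<le> \<delta>" "\<delta> \<le> 1" and D: "D \<ge> 0" "D' \<ge> 0"
    and a: "\<And>k. k \<in> {N<..2*N} \<Longrightarrow> norm (a k) \<le> x powr \<eta>" and b: "\<And>k. k \<in> {M<..2*M} \<Longrightarrow> norm (b k) \<le> x powr \<eta>"
  shows "(\<Sum>h\<in>{H..<2*H}. norm (\<Sum>n\<in>{N<..2*N}. \<Sum>m\<in>hyperbola_slice M D D' n. a n * b m * ee (real h * x / (real (n * m) + \<delta>))))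
    \<le> x powr (h + 17 / 36 + 12 * \<eta>)"
proof -
  have x0: "x > 0" using x by simp
  note pm = powr_mono[OF _ x]
  have pos: "N > 0" "M > 0" "H > 0" using NM x0 by (metis of_nat_0_less_iff powr_gt_zero less_irrefl)+
  have A0: "real A > 0" by (rule less_le_trans[OF _ A(2)]) (use x0 in simp)
  have A1: "1 \<le> A" using A0 by simp
  have "N \<le> M"
  proof -
    have "real N \<le> real M" unfolding NM using d by (intro pm)
    thus ?thesis by simp
  qed
  hence AM: "A \<le> M" using A(3) by simp
  define Y where "Y = 8 * x powr (4 * m + n - h - 1)"
  have Y: "8 * real M ^ 4 * real N / (real H * x) \<le> Y"
  proof -
    have "8 * real M ^ 4 * real N / (real H * x) = 8 * (x powr (4 * m) * x powr n / (x powr h * x powr 1))"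
      unfolding NM powr_pow[OF x0] using x0 by simp
    also have "\<dots> = Y" unfolding Y_def by (simp only: powr_add [symmetric] powr_diff [symmetric]) (simp add: algebra_simps)
    finally show ?thesis by simp
  qed
  have close: "2 * real N ^ 2 * real M ^ 2 < x * real A"
  proof -
    have "2 * real N ^ 2 * real M ^ 2 = 2 * x powr (2 * n + 2 * m)"
      unfolding NM powr_pow[OF x0] by (simp add: powr_add [symmetric] algebra_simps)
    also have "\<dots> < x powr \<eta> * x powr (2 * n + 2 * m)" using K x0 by (intro mult_strict_right_mono) auto
    also have "\<dots> = x powr (\<eta> + (2 * n + 2 * m))" by (simp only: powr_add)
    also have "\<dots> \<le> x powr (1 + (4 / 36 - \<eta>))" using d \<eta> by (intro pm) argo
    also have "\<dots> = x * x powr (4 / 36 - \<eta>)" using x0 by (simp only: powr_add powr_one)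
    also have "\<dots> \<le> x * real A" using A x0 by (intro mult_left_mono) auto
    finally show ?thesis .
  qed
  have HN4: "4 * x powr (h + n) \<le> x"
  proof -
    have "4 * x powr (h + n) \<le> x powr \<eta> * x powr (h + n)" using K by (intro mult_right_mono) auto
    also have "\<dots> = x powr (\<eta> + (h + n))" by (simp only: powr_add)
    also have "\<dots> \<le> x powr 1" using d \<eta> by (intro pm) argo
    finally show ?thesis using x0 by simp
  qed
  have \<tau>': "real (num_divisors k) \<le> x powr \<eta>" if "0 < k" "k \<le> 4 * H * N" for k
  proof (rule \<tau>[OF that(1)])
    have "real k \<le> real (4 * H * N)" using that by (simp only: of_nat_le_iff)
    also have "\<dots> = 4 * x powr (h + n)" unfolding of_nat_mult NM by (simp add: powr_add [symmetric] algebra_simps)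
    finally show "real k \<le> x" using HN4 by linarith
  qed
  define E where "E = x powr (1 - 2 * n + 2 * \<eta>)"
  have E: "real (card {(a, m, b, n). a \<in> {1..<A} \<and> b \<in> {1..<A} \<and> m \<in> {M<..2*M} \<and> n \<in> {M<..2*M} \<and> close_pair Y a b m n}) \<le> E"
    unfolding E_def by (rule spacing_count_bound[OF x \<eta> K(1) NM(2) A(1) AM L d long Y_def])
  define G where "G = nat \<lfloor>2 * (real A / real M ^ 2) * (2 * real H * x / real N)\<rfloor> + 1"
  define g where "g = h + 1 + 4 / 36 - n - 2 * m"
  have g0: "g + 5 * \<eta> \<ge> 0" "g \<le> 2" unfolding g_def using d \<eta> long by argo+
  have Gup: "real G \<le> x powr (g + 5 * \<eta> + \<eta>)"
  proof -
    have "2 * (real A / real M ^ 2) * (2 * real H * x / real N) \<le> 2 * (x powr (4 / 36) / real M ^ 2) * (2 * real H * x / real N)"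
      using A x0 by (intro mult_right_mono mult_left_mono divide_right_mono) auto
    also have "\<dots> = 4 * (x powr (4 / 36) / x powr (2 * m) * (x powr h * x powr 1 / x powr n))"
      unfolding NM powr_pow[OF x0] using x0 by simp
    also have "\<dots> = 4 * x powr g"
      unfolding g_def by (simp only: powr_add [symmetric] powr_diff [symmetric]) (simp add: algebra_simps)
    also have "\<dots> \<le> 4 * x powr (g + 5 * \<eta>)" using \<eta> by (intro mult_left_mono pm) auto
    finally have "2 * (real A / real M ^ 2) * (2 * real H * x / real N) \<le> 4 * x powr (g + 5 * \<eta>)" .
    moreover have "2 * (real A / real M ^ 2) * (2 * real H * x / real N) \<ge> 0" using x0 by simp
    ultimately have "real G \<le> 4 * x powr (g + 5 * \<eta>) + 1" unfolding G_def by linarith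
    also have "1 \<le> x powr (g + 5 * \<eta>)" using g0 x by (simp add: ge_one_powr_ge_zero)
    also have "4 * x powr (g + 5 * \<eta>) + x powr (g + 5 * \<eta>) = 5 * x powr (g + 5 * \<eta>)" by simp
    also have "\<dots> \<le> x powr \<eta> * x powr (g + 5 * \<eta>)" using K by (intro mult_right_mono) auto
    also have "\<dots> = x powr (g + 5 * \<eta> + \<eta>)" by (simp only: powr_add mult_ac)
    finally show ?thesis by simp
  qed
  have harmG: "harm G \<le> x powr \<eta>"
  proof -
    have G0: "G > 0" by (simp add: G_def)
    have "harm G \<le> 1 + ln (real G)" by (rule harm_le_ln[OF G0])
    also have "ln (real G) \<le> ln (x powr 3)"
    proof -
      have "real G \<le> x powr 3" by (rule order_trans[OF Gup]) (use g0 \<eta> in \<open>intro pm, argo\<close>)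
      thus ?thesis using G0 x0 by (subst ln_le_cancel_iff) auto
    qed
    also have "\<dots> = 3 * ln x" using x0 by (simp add: ln_realpow ln_powr)
    finally show ?thesis using K(2) by linarith
  qed
  define Q where "Q = real H * real N * x powr \<eta> * (6 * real G * harm G * E)"
  have Q: "Q \<le> x powr (h + n + \<eta> + (\<eta> + (g + 6 * \<eta>) + \<eta> + (1 - 2 * n + 2 * \<eta>)))"
  proof -
    have "6 * real G * harm G * E \<le> x powr \<eta> * x powr (g + 5 * \<eta> + \<eta>) * x powr \<eta> * x powr (1 - 2 * n + 2 * \<eta>)"
      unfolding E_def using K Gup harmG by (intro mult_mono) (auto simp: harm_nonneg)
    hence "Q \<le> x powr h * x powr n * x powr \<eta> * (x powr \<eta> * x powr (g + 5 * \<eta> + \<eta>) * x powr \<eta> * x powr (1 - 2 * n + 2 * \<eta>))"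
      unfolding Q_def NM by (intro mult_left_mono) auto
    also have "\<dots> = x powr (h + n + \<eta> + (\<eta> + (g + 5 * \<eta> + \<eta>) + \<eta> + (1 - 2 * n + 2 * \<eta>)))" by (simp only: powr_add)
    finally show ?thesis by (simp add: algebra_simps)
  qed
  have sQ: "sqrt Q \<le> x powr ((h + n + \<eta> + (\<eta> + (g + 6 * \<eta>) + \<eta> + (1 - 2 * n + 2 * \<eta>))) / 2)"
    using real_sqrt_le_mono[OF Q] sqrt_powr[OF x0] by metis
  define W where "W = h + 17 / 36 + 7 * \<eta>"
  have invA: "real M / real A \<le> x powr (m - (4 / 36 - \<eta>))"
  proof -
    have "real M / real A \<le> x powr m / x powr (4 / 36 - \<eta>)" unfolding NM using A x0 by (intro frac_le) auto
    thus ?thesis by (simp only: powr_diff)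
  qed
  have f1: "real H * real N * (real M / real A) * (real H * real N * real M) \<le> x powr (2 * W)"
  proof -
    have "real H * real N * (real M / real A) * (real H * real N * real M) \<le> x powr h * x powr n * x powr (m - (4 / 36 - \<eta>)) * (x powr h * x powr n * x powr m)"
      unfolding NM(1) NM(3) using invA NM(2) by (intro mult_mono) auto
    also have "\<dots> = x powr (h + n + (m - (4 / 36 - \<eta>)) + (h + n + m))" by (simp only: powr_add)
    also have "\<dots> \<le> x powr (2 * W)" unfolding W_def using d \<eta> by (intro pm) argo
    finally show ?thesis .
  qed
  have f2: "real H * real N * (real M / real A) * sqrt Q \<le> x powr (2 * W)"
  proof -
    have "real H * real N * (real M / real A) * sqrt Q \<le> x powr h * x powr n * x powr (m - (4 / 36 - \<eta>)) * x powr ((h + n + \<eta> + (\<eta> + (g + 6 * \<eta>) + \<eta> + (1 - 2 * n + 2 * \<eta>))) / 2)"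
      unfolding NM(1) NM(3) using invA sQ E by (intro mult_mono) (auto simp: Q_def E_def harm_nonneg)
    also have "\<dots> = x powr (h + n + (m - (4 / 36 - \<eta>)) + (h + n + \<eta> + (\<eta> + (g + 6 * \<eta>) + \<eta> + (1 - 2 * n + 2 * \<eta>))) / 2)" by (simp only: powr_add)
    also have "\<dots> \<le> x powr (2 * W)" unfolding W_def g_def using d \<eta> by (intro pm) argo
    finally show ?thesis .
  qed
  have R1: "sqrt (3 * real H * real N * real M / real A * (real H * real N * real M + 2 * (exp pi * sqrt Q))) \<le> x powr (W + \<eta>)"
  proof (rule le_sqrt_from_square)
    have Q0: "Q \<ge> 0" unfolding Q_def E_def by (simp add: harm_nonneg)
    have "(sqrt (3 * real H * real N * real M / real A * (real H * real N * real M + 2 * (exp pi * sqrt Q))))\<^sup>2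
      = 3 * real H * real N * real M / real A * (real H * real N * real M + 2 * (exp pi * sqrt Q))"
      using Q0 by (intro real_sqrt_pow2 mult_nonneg_nonneg) auto
    also have "\<dots> = 3 * (real H * real N * (real M / real A) * (real H * real N * real M)) + (6 * exp pi) * (real H * real N * (real M / real A) * sqrt Q)"
      by (simp add: field_simps add_divide_distrib)
    also have "\<dots> \<le> 3 * x powr (2 * W) + (6 * 81) * x powr (2 * W)"
      using f1 f2 exp_pi_le Q0 by (intro add_mono mult_mono) auto
    also have "\<dots> = 489 * x powr (2 * W)" by simp
    also have "\<dots> \<le> x powr \<eta> * x powr (2 * W)" using K by (intro mult_right_mono) auto
    also have "\<dots> = x powr (\<eta> + 2 * W)" by (simp only: powr_add)
    also have "\<dots> \<le> x powr (2 * (W + \<eta>))" using \<eta> by (intro pm) simp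
    finally show "(sqrt (3 * real H * real N * real M / real A * (real H * real N * real M + 2 * (exp pi * sqrt Q))))\<^sup>2 \<le> x powr (2 * (W + \<eta>))" .
  qed (rule x0)
  have R2: "2 * real H * real N * real A \<le> x powr W"
  proof -
    have "2 * real H * real N * real A \<le> x powr \<eta> * x powr h * x powr n * x powr (4 / 36)"
      unfolding NM using K A by (intro mult_mono) auto
    also have "\<dots> = x powr (\<eta> + h + n + 4 / 36)" by (simp only: powr_add)
    also have "\<dots> \<le> x powr W" unfolding W_def using d \<eta> by (intro pm) argo
    finally show ?thesis .
  qed
  have R3: "real H * real N * real M * (2 * pi * (4 * real H * x * real A / (real N ^ 2 * real M ^ 3))) \<le> x powr W"
  proof -
    have "2 * pi * (4 * real H * x * real A / (real N ^ 2 * real M ^ 3)) = (8 * pi) * (real H * x * real A / (real N ^ 2 * real M ^ 3))" by simp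
    also have "\<dots> \<le> x powr \<eta> * (x powr h * x powr 1 * x powr (4 / 36) / (x powr (2 * n) * x powr (3 * m)))"
    proof (rule mult_mono)
      have "real H * x * real A \<le> x powr h * x powr 1 * x powr (4 / 36)" unfolding NM using A x0 by (intro mult_mono) auto
      thus "real H * x * real A / (real N ^ 2 * real M ^ 3) \<le> x powr h * x powr 1 * x powr (4 / 36) / (x powr (2 * n) * x powr (3 * m))"
        unfolding NM powr_pow[OF x0] of_nat_numeral by (rule divide_right_mono) simp
    qed (use K pi_less_4 x0 in auto)
    finally have "real H * real N * real M * (2 * pi * (4 * real H * x * real A / (real N ^ 2 * real M ^ 3)))
      \<le> x powr h * x powr n * x powr m * (x powr \<eta> * (x powr h * x powr 1 * x powr (4 / 36) / (x powr (2 * n) * x powr (3 * m))))"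
      unfolding NM by (intro mult_left_mono) auto
    also have "\<dots> = x powr (h + n + m + (\<eta> + (h + 1 + 4 / 36 - (2 * n + 3 * m))))" by (simp only: powr_add powr_diff)
    also have "\<dots> \<le> x powr W" unfolding W_def using d \<eta> by (intro pm) argo
    finally show ?thesis .
  qed
  have "(\<Sum>h\<in>{H..<2*H}. norm (\<Sum>n\<in>{N<..2*N}. \<Sum>m\<in>hyperbola_slice M D D' n. a n * b m * ee (real h * x / (real (n * m) + \<delta>))))
    \<le> x powr \<eta> * x powr \<eta> * (sqrt (3 * real H * real N * real M / real A * (real H * real N * real M + 2 * (exp pi * sqrt Q)))
       + 2 * real H * real N * real A + real H * real N * real M * (2 * pi * (4 * real H * x * real A / (real N ^ 2 * real M ^ 3))))"
    unfolding Q_def G_def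
    by (rule type_II_large_sieve[OF A1 AM pos(1,3) x0 \<delta> D a b _ close \<tau>' Y E]) (use x0 in auto)
  also have "\<dots> \<le> x powr \<eta> * x powr \<eta> * (x powr (W + \<eta>) + x powr (W + \<eta>) + x powr (W + \<eta>))"
  proof (intro mult_left_mono add_mono R1)
    have "x powr W \<le> x powr (W + \<eta>)" using \<eta> by (intro pm) simp
    thus "2 * real H * real N * real A \<le> x powr (W + \<eta>)" 
      "real H * real N * real M * (2 * pi * (4 * real H * x * real A / (real N ^ 2 * real M ^ 3))) \<le> x powr (W + \<eta>)"
      using R2 R3 by linarith+
  qed auto
  also have "\<dots> = 3 * (x powr \<eta> * x powr \<eta> * x powr (W + \<eta>))" by simp
  also have "\<dots> \<le> x powr \<eta> * (x powr \<eta> * x powr \<eta> * x powr (W + \<eta>))"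
    using K by (intro mult_right_mono) auto
  also have "\<dots> = x powr (\<eta> + (\<eta> + \<eta> + (W + \<eta>)))" by (simp only: powr_add)
  also have "\<dots> \<le> x powr (h + 17 / 36 + 12 * \<eta>)" unfolding W_def using \<eta> by (intro pm) simp
  finally show ?thesis .
qed

text \<open>The factor \<open>x powr \<eta>\<close> absorbs all numerical constants, logarithms and divisor functions, so that the estimates
  below hold without implied constants for every such \<open>x\<close>.\<close>

definition large_for :: "real \<Rightarrow> real \<Rightarrow> bool" where
  "large_for \<eta> x \<longleftrightarrow> x > 1 \<and> x powr \<eta> \<ge> 10 ^ 8 \<and> 1 + 3 * ln x \<le> x powr \<eta> \<and>
     (\<forall>k::nat. 0 < k \<longrightarrow> real k \<le> x \<longrightarrow> real (num_divisors k) \<le> x powr \<eta>)"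

lemma eventually_large_for:
  assumes \<eta>: "\<eta> > 0"
  shows "eventually (large_for \<eta>) at_top"
proof -
  \<comment> \<open>The divisor bound is taken with half the exponent, so that the other half
    eventually exceeds the constant \<open>C\<close>.\<close>
  obtain C where C: "C \<ge> 1" "\<And>n. n > 0 \<Longrightarrow> real (num_divisors n) \<le> C * real n powr (\<eta> / 2)"
    using num_divisors_bound[of "\<eta> / 2"] \<eta> by auto
  have "eventually (\<lambda>x::real. x > 1) at_top" by (rule eventually_gt_at_top)
  moreover have "eventually (\<lambda>x. x powr \<eta> \<ge> 10 ^ 8) at_top"
  proof -
    have "filterlim (\<lambda>x::real. x powr \<eta>) at_top at_top" using \<eta> by real_asymp
    thus ?thesis by (simp add: filterlim_at_top)
  qed
  moreover have "eventually (\<lambda>x. 1 + 3 * ln x \<le> x powr \<eta>) at_top" using \<eta> by real_asymp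
  moreover have "eventually (\<lambda>x. C * x powr (\<eta> / 2) \<le> x powr \<eta>) at_top" using \<eta> by real_asymp
  ultimately show ?thesis
  proof eventually_elim
    case (elim x)
    have "real (num_divisors k) \<le> x powr \<eta>" if k: "0 < k" "real k \<le> x" for k
    proof -
      have "real (num_divisors k) \<le> C * real k powr (\<eta> / 2)" by (rule C(2)[OF k(1)])
      also have "\<dots> \<le> C * x powr (\<eta> / 2)" using k \<eta> C(1) by (intro mult_left_mono powr_mono2) auto
      finally show ?thesis using elim(4) by linarith
    qed
    thus ?case using elim unfolding large_for_def by blast
  qed
qed

text \<open>The factor \<open>x powr \<eta>\<close> pays for the constant \<open>c\<close> and for
  rounding down.\<close>

lemma nat_floor_powr_lower:
  fixes x \<eta> p c :: real
  assumes x: "x \<ge> 1" and K: "x powr \<eta> \<ge> 10 ^ 8" and p: "\<eta> \<le> p" and c: "1 / 4 \<le> c"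
  shows "x powr (p - \<eta>) \<le> real (nat \<lfloor>c * x powr p\<rfloor>)"
proof -
  have x0: "x > 0" using x by simp
  have "1 \<le> x powr (p - \<eta>)" using x p by (simp add: ge_one_powr_ge_zero)
  moreover have "x powr p = x powr \<eta> * x powr (p - \<eta>)" by (simp flip: powr_add)
  moreover have "10 ^ 8 * x powr (p - \<eta>) \<le> x powr \<eta> * x powr (p - \<eta>)" using K by (intro mult_right_mono) auto
  ultimately have "10 ^ 8 * x powr (p - \<eta>) \<le> x powr p" "1 \<le> x powr (p - \<eta>)" by simp_all
  moreover have "1 / 4 * x powr p \<le> c * x powr p" using c by (intro mult_right_mono) auto
  ultimately have "x powr (p - \<eta>) + 1 \<le> c * x powr p" by simp
  thus ?thesis by linarith
qed

text \<open>Sizes are translated into exponents by logarithms to base \<open>x\<close>; the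
  constants in the size conditions turn into a summand \<eta>. The distinction at
  \<open>55/72\<close> decides between Cauchy's inequality over blocks of the smaller variable and
  the large sieve.\<close>

lemma type_II_box:
  fixes N M H :: nat and x \<eta> \<delta> D D' :: real and a b :: "nat \<Rightarrow> complex"
  assumes lg: "large_for \<eta> x" and \<eta>: "0 < \<eta>" "\<eta> \<le> 1 / 100000"
    and D: "x powr (17 / 36) \<le> D" "D \<le> x powr (19 / 36)" "0 \<le> D'"
    and NM: "0 < N" "N \<le> M" "real N * real M \<le> 2 * D" "D \<le> 4 * real N * real M" and N: "x powr (1 / 9) \<le> 2 * real N"
    and H: "0 < H" "real H \<le> 2 * D / x powr (17 / 36)"
    and \<delta>: "0 \<le> \<delta>" "\<delta> \<le> 1"
    and a: "\<And>k. 0 < k \<Longrightarrow> real k \<le> x \<Longrightarrow> norm (a k) \<le> x powr \<eta>" and b: "\<And>k. 0 < k \<Longrightarrow> real k \<le> x \<Longrightarrow> norm (b k) \<le> x powr \<eta>"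
  shows "(\<Sum>h\<in>{H..<2*H}. norm (\<Sum>n\<in>{N<..2*N}. \<Sum>m\<in>hyperbola_slice M D D' n. a n * b m * ee (real h * x / (real (n * m) + \<delta>))))
    \<le> real H * x powr (17 / 36 + 12 * \<eta>)"
proof -
  have x1: "x > 1" and K: "x powr \<eta> \<ge> 10 ^ 8" "1 + 3 * ln x \<le> x powr \<eta>"
    and \<tau>: "\<And>k. 0 < k \<Longrightarrow> real k \<le> x \<Longrightarrow> real (num_divisors k) \<le> x powr \<eta>"
    using lg unfolding large_for_def by blast+
  have x0: "x > 0" and xge: "x \<ge> 1" using x1 by auto
  note pm = powr_mono[OF _ xge]
  have M0: "M > 0" using NM by linarith
  have D0: "D > 0" by (rule less_le_trans[OF _ D(1)]) (use x0 in simp)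
  define n m h d where "n = log x (real N)" and "m = log x (real M)" and "h = log x (real H)" and "d = log x D"
  have pw: "real N = x powr n" "real M = x powr m" "real H = x powr h" "D = x powr d"
    using x1 NM(1) M0 H(1) D0 by (simp_all add: n_def m_def h_def d_def)
  have cmp: "p \<le> q" if "x powr p \<le> x powr q" for p q using that x1 by simp
  have d1: "17 / 36 \<le> d" "d \<le> 19 / 36" by (rule cmp, use D(1,2) pw(4) in simp)+
  have K2: "8 \<le> x powr \<eta>" using K by simp
  have h0: "0 \<le> h"
  proof -
    have "x powr 0 \<le> x powr h" using H(1) x0 pw(3) by (metis One_nat_def Suc_leI of_nat_1 of_nat_le_iff powr_zero_eq_one less_irrefl)
    thus ?thesis by (rule cmp)
  qed
  have hd: "h \<le> d - 17 / 36 + \<eta>"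
  proof (rule cmp)
    have "x powr h \<le> 2 * (x powr d / x powr (17 / 36))" using H(2) pw by simp
    also have "\<dots> \<le> x powr \<eta> * (x powr d / x powr (17 / 36))" using K2 by (intro mult_right_mono) auto
    also have "\<dots> = x powr (d - 17 / 36 + \<eta>)" by (simp add: powr_add [symmetric] powr_diff [symmetric] algebra_simps)
    finally show "x powr h \<le> x powr (d - 17 / 36 + \<eta>)" .
  qed
  have nm: "n \<le> m"
  proof (rule cmp)
    have "real N \<le> real M" using NM(2) by simp
    thus "x powr n \<le> x powr m" unfolding pw .
  qed
  have nmd: "n + m \<le> d + \<eta>"
  proof (rule cmp)
    have "x powr (n + m) \<le> 2 * x powr d" using NM(3) pw by (simp add: powr_add [symmetric] algebra_simps)
    also have "\<dots> \<le> x powr \<eta> * x powr d" using K2 by (intro mult_right_mono) auto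
    finally show "x powr (n + m) \<le> x powr (d + \<eta>)" by (simp add: powr_add [symmetric] algebra_simps)
  qed
  have nmd': "d - \<eta> \<le> n + m"
  proof -
    have "x powr d \<le> 4 * x powr (n + m)" using NM(4) unfolding pw by (simp only: powr_add mult.assoc)
    also have "\<dots> \<le> x powr \<eta> * x powr (n + m)" using K2 by (intro mult_right_mono) auto
    finally have "x powr d \<le> x powr (\<eta> + (n + m))" by (simp add: powr_add [symmetric] algebra_simps)
    hence "d \<le> \<eta> + (n + m)" by (rule cmp)
    thus ?thesis by simp
  qed
  \<comment> \<open>Since \<open>4/36 = 1/9\<close>, the factor \<open>1/4\<close> ensures
    \<open>A \<le> N\<close> from \<open>x powr (1/9) \<le> 2 * N\<close>.\<close>
  define A where "A = nat \<lfloor>(1 / 4) * x powr (4 / 36)\<rfloor>"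
  have A1: "real A \<le> (1 / 4) * x powr (4 / 36)" unfolding A_def by (intro of_nat_floor) auto
  have A2: "x powr (4 / 36 - \<eta>) \<le> real A" unfolding A_def using \<eta> by (intro nat_floor_powr_lower xge K) auto
  have A: "real A \<le> x powr (4 / 36)" using A1 powr_ge_zero[of x "4 / 36"] by linarith
  have AN: "A \<le> N"
  proof -
    have "real A \<le> real N" using A1 N powr_ge_zero[of x "4 / 36"] by simp
    thus ?thesis by simp
  qed
  define L where "L = nat \<lfloor>1 * x powr (1 / 60)\<rfloor>"
  have L1: "real L \<le> x powr (1 / 60)" unfolding L_def using of_nat_floor[of "1 * x powr (1 / 60)"] by simp
  have L2: "x powr (1 / 60 - \<eta>) \<le> real L" unfolding L_def using \<eta> by (intro nat_floor_powr_lower xge K) auto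
  have L3: "1 \<le> L"
  proof -
    have "1 \<le> x powr (1 / 60 - \<eta>)" using xge \<eta> by (simp add: ge_one_powr_ge_zero)
    thus ?thesis using L2 by linarith
  qed
  have LA: "L \<le> A"
  proof -
    have "x powr (1 / 60) \<le> x powr (4 / 36 - \<eta>)" using \<eta> by (intro pm) auto
    thus ?thesis using L1 A2 by linarith
  qed
  have Dx: "4 * D \<le> x"
  proof -
    have "4 * x powr d \<le> x powr \<eta> * x powr d" using K2 by (intro mult_right_mono) auto
    also have "\<dots> = x powr (\<eta> + d)" by (simp only: powr_add)
    also have "\<dots> \<le> x powr 1" using d1 \<eta> by (intro pm) simp
    finally show ?thesis using x0 pw by simp
  qed
  have big: "2 * real N \<le> x" "2 * real M \<le> x"
  proof -
    have "real N * 1 \<le> real N * real M" "1 * real M \<le> real N * real M"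
      using NM(1) M0 by (intro mult_mono; simp)+
    thus "2 * real N \<le> x" "2 * real M \<le> x" using NM(3) Dx by linarith+
  qed
  have a': "norm (a k) \<le> x powr \<eta>" if "k \<in> {N<..2*N}" for k
    using that big(1) by (intro a) auto
  have b': "norm (b k) \<le> x powr \<eta>" if "k \<in> {M<..2*M}" for k
    using that big(2) by (intro b) auto
  show ?thesis
  proof (cases "n + d + h \<le> 55 / 72")
    case True
    have "(\<Sum>h\<in>{H..<2*H}. norm (\<Sum>n\<in>{N<..2*N}. \<Sum>m\<in>hyperbola_slice M D D' n. a n * b m * ee (real h * x / (real (n * m) + \<delta>))))
       \<le> (\<Sum>h\<in>{H..<2*H}. x powr (17 / 36 + 5 * \<eta>))"
    proof (rule sum_mono)
      fix k assume k: "k \<in> {H..<2*H}"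
      have Hx: "x powr (h + 1) = real H * x" unfolding pw powr_add using x0 by simp
      show "norm (\<Sum>n\<in>{N<..2*N}. \<Sum>m\<in>hyperbola_slice M D D' n. a n * b m * ee (real k * x / (real (n * m) + \<delta>))) \<le> x powr (17 / 36 + 5 * \<eta>)"
      proof (rule type_II_box_short[OF xge \<eta> K(1) pw(1,2) A A2 AN d1 h0 hd nm nmd' nmd True _ _ \<delta> a' b'])
        show "x powr (h + 1) \<le> real k * x" unfolding Hx using k x0 by (intro mult_right_mono) auto
        have "real k \<le> 2 * real H" using k by auto
        hence "real k * x \<le> 2 * real H * x" using x0 by (intro mult_right_mono) auto
        thus "real k * x \<le> 2 * x powr (h + 1)" unfolding Hx by simp
      qed
    qed
    also have "\<dots> = real H * x powr (17 / 36 + 5 * \<eta>)" by simp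
    also have "\<dots> \<le> real H * x powr (17 / 36 + 12 * \<eta>)" using \<eta> by (intro mult_left_mono pm) auto
    finally show ?thesis .
  next
    case False
    have "(\<Sum>h\<in>{H..<2*H}. norm (\<Sum>n\<in>{N<..2*N}. \<Sum>m\<in>hyperbola_slice M D D' n. a n * b m * ee (real h * x / (real (n * m) + \<delta>))))
       \<le> x powr (h + 17 / 36 + 12 * \<eta>)"
      by (rule type_II_box_long[OF xge \<eta> K pw(1-3) A A2 AN L3 LA L1 L2 d1 h0 hd nm nmd' nmd _ \<tau> \<delta> _ _ a' b'])
         (use False D0 D(3) in auto)
    also have "\<dots> = real H * x powr (17 / 36 + 12 * \<eta>)" unfolding pw(3) by (simp add: add.assoc flip: powr_add)
    finally show ?thesis .
  qed
qed

section \<open>Dyadic decomposition of the type II sums\<close>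

lemma box_swap:
  fixes f :: "nat \<Rightarrow> nat \<Rightarrow> complex"
  shows "(\<Sum>n\<in>{N<..2*N}. \<Sum>m\<in>hyperbola_slice M D D' n. f n m) = (\<Sum>m\<in>{M<..2*M}. \<Sum>n\<in>hyperbola_slice N D D' m. f n m)"
proof -
  have "(\<Sum>n\<in>{N<..2*N}. \<Sum>m\<in>hyperbola_slice M D D' n. f n m) = (\<Sum>n\<in>{N<..2*N}. \<Sum>m\<in>{m\<in>{M<..2*M}. D < real (n * m) \<and> real (n * m) \<le> D'}. f n m)"
    by (simp add: hyperbola_slice_def)
  also have "\<dots> = (\<Sum>m\<in>{M<..2*M}. \<Sum>n\<in>{n\<in>{N<..2*N}. D < real (n * m) \<and> real (n * m) \<le> D'}. f n m)"
    by (rule sum.swap_restrict) auto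
  also have "\<dots> = (\<Sum>m\<in>{M<..2*M}. \<Sum>n\<in>hyperbola_slice N D D' m. f n m)"
    by (simp add: hyperbola_slice_def mult.commute)
  finally show ?thesis .
qed

text \<open>Index of the range \<open>{2 ^ i<..2 * 2 ^ i}\<close> that contains \<open>k\<close>.
  None of these ranges contains 1, so the characterisation below requires \<open>k > 1\<close>; it
  is applied to variables larger than \<open>U \<ge> 1\<close>.\<close>

definition dyadic :: "nat \<Rightarrow> nat" where
  "dyadic k = (LEAST i. k \<le> 2 ^ Suc i)"

lemma dyadic_iff:
  assumes "k > 1"
  shows "dyadic k = i \<longleftrightarrow> k \<in> {2 ^ i<..2 * 2 ^ i}"
proof -
  have "k \<le> 2 ^ Suc k" using less_exp[of "Suc k"] by linarith
  hence le: "k \<le> 2 ^ Suc (dyadic k)" unfolding dyadic_def by (rule LeastI)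
  have lt: "2 ^ dyadic k < k"
  proof (cases "dyadic k")
    case 0
    thus ?thesis using assms by simp
  next
    case (Suc j)
    have "\<not> k \<le> 2 ^ Suc j" using not_less_Least[of j "\<lambda>i. k \<le> 2 ^ Suc i"] Suc unfolding dyadic_def by simp
    thus ?thesis using Suc by simp
  qed
  show ?thesis
  proof
    assume "dyadic k = i" thus "k \<in> {2 ^ i<..2 * 2 ^ i}" using le lt by auto
  next
    assume k: "k \<in> {2 ^ i<..2 * 2 ^ i}"
    show "dyadic k = i"
    proof (rule ccontr)
      assume "dyadic k \<noteq> i"
      then consider "Suc (dyadic k) \<le> i" | "Suc i \<le> dyadic k" by linarith
      thus False
      proof cases
        case 1
        hence "(2::nat) ^ Suc (dyadic k) \<le> 2 ^ i" by (intro power_increasing) auto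
        thus False using le k by (meson greaterThanAtMost_iff leD order_trans)
      next
        case 2
        hence "(2::nat) ^ Suc i \<le> 2 ^ dyadic k" by (intro power_increasing) auto
        hence "k < k" using k lt by (metis greaterThanAtMost_iff order_le_less_trans order_trans power_Suc)
        thus False by simp
      qed
    qed
  qed
qed

text \<open>Coefficients that vanish up to \<open>U\<close> leave the slice as the only condition in
  a dyadic box. A box without contributing pairs vanishes; in any other box one pair
  \<open>(k, l)\<close> yields the size conditions of \<open>type_II_box\<close>, namely that
  \<open>N * M\<close> is comparable to \<open>D\<close> and that both variables are long enough for
  a block. There are at most \<open>x powr (2 * \<eta>)\<close> boxes.\<close>

lemma type_II_bound:
  fixes U H :: nat and x \<eta> \<delta> D D' :: real and a b :: "nat \<Rightarrow> complex"
  assumes lg: "large_for \<eta> x" and \<eta>: "0 < \<eta>" "\<eta> \<le> 1 / 100000"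
    and D: "x powr (17 / 36) \<le> D" "D \<le> x powr (19 / 36)" "D \<le> D'" "D' \<le> 2 * D"
    and U: "x powr (1 / 9) \<le> real U + 1" "1 \<le> U"
    and H: "0 < H" "real H \<le> 2 * D / x powr (17 / 36)"
    and \<delta>: "0 \<le> \<delta>" "\<delta> \<le> 1"
    and a: "\<And>k. 0 < k \<Longrightarrow> real k \<le> x \<Longrightarrow> norm (a k) \<le> x powr \<eta>" and b: "\<And>k. 0 < k \<Longrightarrow> real k \<le> x \<Longrightarrow> norm (b k) \<le> x powr \<eta>"
  shows "(\<Sum>h\<in>{H..<2*H}. norm (\<Sum>(k, l)\<in>prod_pairs D D'. (if k > U \<and> l > U then a k * b l else 0) * ee (real h * x / (real (k * l) + \<delta>))))
    \<le> real H * x powr (17 / 36 + 14 * \<eta>)"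
proof -
  have x1: "x > 1" and K: "x powr \<eta> \<ge> 10 ^ 8" "1 + 3 * ln x \<le> x powr \<eta>"
    using lg unfolding large_for_def by blast+
  have x0: "x > 0" and xge: "x \<ge> 1" using x1 by auto
  have D0: "D > 0" by (rule less_le_trans[OF _ D(1)]) (use x0 in simp)
  have D'0: "0 \<le> D'" using D0 D by linarith
  define a' where "a' k = (if k > U then a k else 0)" for k
  define b' where "b' k = (if k > U then b k else 0)" for k
  have ab': "norm (a' k) \<le> x powr \<eta>" "norm (b' k) \<le> x powr \<eta>" if "0 < k" "real k \<le> x" for k
    using a[OF that] b[OF that] by (auto simp: a'_def b'_def)
  define Q where "Q = {(k, l). (k, l) \<in> prod_pairs D D' \<and> k > U \<and> l > U}"
  have finpp: "finite (prod_pairs D D')" using D0 by (intro finite_prod_pairs) auto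
  have finQ: "finite Q" by (rule finite_subset[OF _ finpp]) (auto simp: Q_def)
  define I where "I = nat \<lfloor>3 / 2 * ln x\<rfloor>"
  have Dx: "4 * D \<le> x"
  proof -
    have "4 * D \<le> x powr \<eta> * x powr (19 / 36)" using K D by (intro mult_mono) auto
    also have "\<dots> = x powr (\<eta> + 19 / 36)" by (simp only: powr_add)
    also have "\<dots> \<le> x powr 1" using \<eta> by (intro powr_mono xge) simp
    finally show ?thesis using x0 by simp
  qed
  have dyI: "dyadic k \<le> I" if "k > 1" "real k \<le> x" for k
  proof -
    have "2 ^ dyadic k < k" using dyadic_iff[OF that(1), of "dyadic k"] by auto
    hence "(2::real) ^ dyadic k \<le> x" using that(2)
      by (metis less_imp_le of_nat_le_iff of_nat_numeral of_nat_power order_trans)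
    hence "ln ((2::real) ^ dyadic k) \<le> ln x" using x0 by (subst ln_le_cancel_iff) auto
    hence "real (dyadic k) * ln 2 \<le> ln x" by (simp add: ln_realpow)
    moreover have "real (dyadic k) * (2 / 3) \<le> real (dyadic k) * ln 2"
      using ln2_ge_two_thirds by (intro mult_left_mono) auto
    ultimately have "real (dyadic k) \<le> 3 / 2 * ln x" by simp
    thus ?thesis unfolding I_def by (simp add: le_nat_floor)
  qed
  define g where "g h k l = a' k * b' l * ee (real h * x / (real (k * l) + \<delta>))" for h k l
  define box where "box h i j = (\<Sum>n\<in>{2^i<..2*2^i}. \<Sum>m\<in>hyperbola_slice (2^j) D D' n. g h n m)" for h i j
  have decomp: "(\<Sum>(k, l)\<in>prod_pairs D D'. (if k > U \<and> l > U then a k * b l else 0) * ee (real h * x / (real (k * l) + \<delta>)))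
     = (\<Sum>p\<in>{..I} \<times> {..I}. box h (fst p) (snd p))" for h
  proof -
    have "(\<Sum>(k, l)\<in>prod_pairs D D'. (if k > U \<and> l > U then a k * b l else 0) * ee (real h * x / (real (k * l) + \<delta>)))
      = (\<Sum>(k, l)\<in>Q. g h k l)"
      using finpp by (intro sum.mono_neutral_cong_right) (auto simp: Q_def g_def a'_def b'_def split: if_splits)
    also have "\<dots> = (\<Sum>p\<in>{..I} \<times> {..I}. \<Sum>q | q \<in> Q \<and> (case q of (k, l) \<Rightarrow> (dyadic k, dyadic l)) = p. case q of (k, l) \<Rightarrow> g h k l)"
    proof (rule sum.group[symmetric])
      show "(\<lambda>q. case q of (k, l) \<Rightarrow> (dyadic k, dyadic l)) ` Q \<subseteq> {..I} \<times> {..I}"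
      proof (rule image_subsetI)
        fix q assume q: "q \<in> Q"
        obtain k l where kq: "q = (k, l)" by force
        hence "(k, l) \<in> Q" using q by simp
        hence kl: "(k, l) \<in> prod_pairs D D'" "k > 1" "l > 1" using U by (auto simp: Q_def)
        have "real k \<le> x" "real l \<le> x" using prod_pairs_pos[OF kl(1)] D0 D Dx by auto
        thus "(case q of (k, l) \<Rightarrow> (dyadic k, dyadic l)) \<in> {..I} \<times> {..I}" using dyI kl kq by auto
      qed
    qed (use finQ in auto)
    also have "\<dots> = (\<Sum>p\<in>{..I} \<times> {..I}. box h (fst p) (snd p))"
    proof (intro sum.cong refl)
      fix p :: "nat \<times> nat"
      obtain i j where p: "p = (i, j)" by force
      have "(\<Sum>q | q \<in> Q \<and> (case q of (k, l) \<Rightarrow> (dyadic k, dyadic l)) = p. case q of (k, l) \<Rightarrow> g h k l)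
        = (\<Sum>q\<in>(SIGMA n:{2^i<..2*2^i}. hyperbola_slice (2^j) D D' n). case q of (k, l) \<Rightarrow> g h k l)"
      proof (intro sum.mono_neutral_cong_left ballI)
        show "finite (SIGMA n:{2^i<..2*2^i}. hyperbola_slice (2^j) D D' n)" by (auto simp: hyperbola_slice_def)
        show "{q. q \<in> Q \<and> (case q of (k, l) \<Rightarrow> (dyadic k, dyadic l)) = p} \<subseteq> (SIGMA n:{2^i<..2*2^i}. hyperbola_slice (2^j) D D' n)"
        proof
          fix q assume q: "q \<in> {q. q \<in> Q \<and> (case q of (k, l) \<Rightarrow> (dyadic k, dyadic l)) = p}"
          obtain k l where kq: "q = (k, l)" by force
          have kl: "(k, l) \<in> Q" "(dyadic k, dyadic l) = p" using q kq by simp_all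
          hence k1: "k > 1" "l > 1" "dyadic k = i" "dyadic l = j" using U p by (auto simp: Q_def)
          thus "q \<in> (SIGMA n:{2^i<..2*2^i}. hyperbola_slice (2^j) D D' n)"
            using dyadic_iff[OF k1(1), of i] dyadic_iff[OF k1(2), of j] kl(1) kq by (auto simp: hyperbola_slice_def Q_def prod_pairs_def)
        qed
        fix q assume q: "q \<in> (SIGMA n:{2^i<..2*2^i}. hyperbola_slice (2^j) D D' n) - {q. q \<in> Q \<and> (case q of (k, l) \<Rightarrow> (dyadic k, dyadic l)) = p}"
        obtain k l where kl: "q = (k, l)" by force
        have mem: "k \<in> {2^i<..2*2^i}" "l \<in> {2^j<..2*2^j}" "(k, l) \<in> prod_pairs D D'"
          using q kl by (auto simp: hyperbola_slice_def prod_pairs_def)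
        have "(1::nat) \<le> 2^i" "(1::nat) \<le> 2^j" by simp_all
        hence "k > 1" "l > 1" using mem by auto
        hence "dyadic k = i" "dyadic l = j" using dyadic_iff mem by auto
        hence "\<not> (k > U \<and> l > U)" using q kl mem p by (auto simp: Q_def)
        thus "(case q of (k, l) \<Rightarrow> g h k l) = 0" by (auto simp: kl g_def a'_def b'_def)
      qed auto
      also have "\<dots> = box h i j" unfolding box_def by (subst sum.Sigma) (auto simp: hyperbola_slice_def)
      finally show "(\<Sum>q | q \<in> Q \<and> (case q of (k, l) \<Rightarrow> (dyadic k, dyadic l)) = p. case q of (k, l) \<Rightarrow> g h k l) = box h (fst p) (snd p)"
        using p by simp
    qed
    finally show ?thesis .
  qed
  have boxbound: "(\<Sum>h\<in>{H..<2*H}. norm (box h i j)) \<le> real H * x powr (17 / 36 + 12 * \<eta>)" for i j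
  proof (cases "\<exists>k l. k \<in> {2^i<..2*2^i} \<and> l \<in> hyperbola_slice (2^j) D D' k \<and> k > U \<and> l > U")
    case False
    have "box h i j = 0" for h
      unfolding box_def g_def a'_def b'_def using False by (intro sum.neutral ballI) auto
    thus ?thesis by simp
  next
    case True
    then obtain k l where kl: "k \<in> {2^i<..2*2^i}" "l \<in> {2^j<..2*2^j}" "D < real k * real l" "real k * real l \<le> D'" "k > U" "l > U"
      by (auto simp: hyperbola_slice_def)
    define N M where "N = (2::nat)^i" and "M = (2::nat)^j"
    have k: "real N \<le> real k" "real k \<le> 2 * real N" "real M \<le> real l" "real l \<le> 2 * real M"
    proof -
      have "N \<le> k" "k \<le> 2 * N" "M \<le> l" "l \<le> 2 * M" using kl by (auto simp: N_def M_def)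
      hence "real N \<le> real k" "real k \<le> real (2 * N)" "real M \<le> real l" "real l \<le> real (2 * M)" by (simp_all only: of_nat_le_iff)
      thus "real N \<le> real k" "real k \<le> 2 * real N" "real M \<le> real l" "real l \<le> 2 * real M" by simp_all
    qed
    have NM0: "0 < N" "0 < M" by (simp_all add: N_def M_def)
    have "real N * real M \<le> real k * real l" using k by (intro mult_mono) auto
    hence up: "real N * real M \<le> 2 * D" using kl D by linarith
    have "real k * real l \<le> (2 * real N) * (2 * real M)" using k by (intro mult_mono) auto
    hence low: "D \<le> 4 * real N * real M" using kl by simp
    have lowN: "x powr (1 / 9) \<le> 2 * real N" "x powr (1 / 9) \<le> 2 * real M" using U kl k by linarith+
    show ?thesis
    proof (cases "N \<le> M")
      case True
      thus ?thesis unfolding box_def g_def N_def [symmetric] M_def [symmetric]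
        by (intro type_II_box[OF lg \<eta> D(1,2) D'0 NM0(1) True up low lowN(1) H \<delta>] ab')
    next
      case False
      \<comment> \<open>The estimate for a box expects the smaller variable first, so sums and
        coefficients are exchanged.\<close>
      have eq: "box h i j = (\<Sum>m\<in>{M<..2*M}. \<Sum>n\<in>hyperbola_slice N D D' m. b' m * a' n * ee (real h * x / (real (m * n) + \<delta>)))" for h
        unfolding box_def N_def [symmetric] M_def [symmetric] box_swap[where N = N and M = M] g_def by (simp add: mult_ac)
      show ?thesis unfolding eq
        by (intro type_II_box[OF lg \<eta> D(1,2) D'0 NM0(2) _ _ _ lowN(2) H \<delta>] ab') (use False up low in \<open>auto simp: mult_ac\<close>)
    qed
  qed
  have "(\<Sum>h\<in>{H..<2*H}. norm (\<Sum>(k, l)\<in>prod_pairs D D'. (if k > U \<and> l > U then a k * b l else 0) * ee (real h * x / (real (k * l) + \<delta>))))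
     \<le> (\<Sum>h\<in>{H..<2*H}. \<Sum>p\<in>{..I} \<times> {..I}. norm (box h (fst p) (snd p)))"
    unfolding decomp by (intro sum_mono norm_sum)
  also have "\<dots> = (\<Sum>p\<in>{..I} \<times> {..I}. \<Sum>h\<in>{H..<2*H}. norm (box h (fst p) (snd p)))"
    by (rule sum.swap)
  also have "\<dots> \<le> (\<Sum>p\<in>{..I} \<times> {..I}. real H * x powr (17 / 36 + 12 * \<eta>))"
    by (intro sum_mono boxbound)
  also have "\<dots> = (real I + 1) * (real I + 1) * (real H * x powr (17 / 36 + 12 * \<eta>))"
    by (simp add: card_cartesian_product algebra_simps)
  also have "\<dots> \<le> x powr \<eta> * x powr \<eta> * (real H * x powr (17 / 36 + 12 * \<eta>))"
  proof -
    have "ln x \<ge> 0" using xge by simp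
    hence "real I \<le> 3 / 2 * ln x" unfolding I_def by (intro of_nat_floor) simp
    hence "real I + 1 \<le> x powr \<eta>" using K(2) \<open>ln x \<ge> 0\<close> by linarith
    thus ?thesis by (intro mult_right_mono mult_mono) auto
  qed
  also have "\<dots> = real H * (x powr \<eta> * x powr \<eta> * x powr (17 / 36 + 12 * \<eta>))" by simp
  also have "x powr \<eta> * x powr \<eta> * x powr (17 / 36 + 12 * \<eta>) = x powr (17 / 36 + 14 * \<eta>)"
    by (simp add: algebra_simps flip: powr_add)
  finally show ?thesis .
qed

text \<open>For fixed \<open>k\<close> the variable \<open>l\<close> runs over an interval of length
  at most \<open>D / k\<close>, and the second derivative test gives a bound \<open>B\<close>
  uniform in \<open>k\<close>: the factor \<open>k\<close> cancels in one term and only helps in the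
  other. The increasing weight \<open>v\<close>, a logarithm or 1, is removed by partial summation.
  Summing trivially over \<open>k \<le> U\<close> yields at most about
  \<open>x powr (15/36)\<close>.\<close>

lemma type_I_bound:
  fixes U :: nat and x \<eta> \<delta> D D' h X :: real and c v :: "nat \<Rightarrow> real"
  assumes lg: "large_for \<eta> x" and \<eta>: "0 < \<eta>" "\<eta> \<le> 1 / 100000"
    and D: "x powr (17 / 36) \<le> D" "D \<le> x powr (19 / 36)" "D \<le> D'" "D' \<le> 2 * D"
    and U: "real U \<le> x powr (1 / 9)"
    and X: "x \<le> X" "X \<le> x powr (1 + 2 / 36 + 2 * \<eta>)" "X \<le> 4 * D * x / x powr (17 / 36)"
    and \<delta>: "0 \<le> \<delta>" "\<delta> \<le> 1"
    and c: "\<And>k. 0 < k \<Longrightarrow> real k \<le> x \<Longrightarrow> \<bar>c k\<bar> \<le> x powr \<eta>"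
    and v: "\<And>l. 0 < l \<Longrightarrow> 0 \<le> v l \<and> v l \<le> v (Suc l)" "\<And>l. 0 < l \<Longrightarrow> real l \<le> x \<Longrightarrow> v l \<le> x powr \<eta>"
  shows "norm (\<Sum>(k, l)\<in>prod_pairs D D'. (if k \<le> U then c k * v l else 0) * ee (X / (real (k * l) + \<delta>))) \<le> x powr (17 / 36)"
proof -
  have x1: "x > 1" and K: "x powr \<eta> \<ge> 10 ^ 8" using lg unfolding large_for_def by blast+
  have x0: "x > 0" and xge: "x \<ge> 1" using x1 by auto
  note pm = powr_mono[OF _ xge]
  have D0: "D > 0" by (rule less_le_trans[OF _ D(1)]) (use x0 in simp)
  have X0: "X > 0" using X x0 by linarith
  have Dx: "4 * D \<le> x"
  proof -
    have "4 * D \<le> x powr \<eta> * x powr (19 / 36)" using K D by (intro mult_mono) auto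
    also have "\<dots> = x powr (\<eta> + 19 / 36)" by (simp only: powr_add)
    also have "\<dots> \<le> x powr 1" using \<eta> by (intro powr_mono xge) simp
    finally show ?thesis using x0 by simp
  qed
  have U1: "real U \<le> x"
  proof -
    have "x powr (1 / 9) \<le> x powr 1" by (intro pm) simp
    thus ?thesis using U x0 by simp
  qed
  define P where "P k = {l. D < real (k * l) \<and> real (k * l) \<le> D'}" for k
  define B where "B = 288 * sqrt (X / (8 * D)) + 27 * sqrt (8 * D ^ 3 / X)"
  have B0: "B \<ge> 0" using X0 D0 by (simp add: B_def)
  have Pfin: "finite (P k)" if "k > 0" for k
  proof (rule finite_subset[OF _ finite_nat_le_real[of D']])
    show "P k \<subseteq> {n. real n \<le> D'}"
    proof
      fix l assume "l \<in> P k"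
      moreover have "l \<le> k * l" using that by simp
      hence "real l \<le> real (k * l)" by (simp only: of_nat_le_iff)
      ultimately show "l \<in> {n. real n \<le> D'}" unfolding P_def mem_Collect_eq by linarith
    qed
  qed
  \<comment> \<open>Stated for convex subsets of \<open>P k\<close>, since partial summation needs
    the bound for all tails.\<close>
  have inner: "norm (\<Sum>l\<in>S. ee (X / (real (k * l) + \<delta>))) \<le> B"
    if k: "0 < k" "k \<le> U" and S: "S \<subseteq> P k" and conv: "\<And>m l j. m \<in> S \<Longrightarrow> j \<in> S \<Longrightarrow> m \<le> l \<Longrightarrow> l \<le> j \<Longrightarrow> l \<in> S" for k S
  proof -
    define L where "L = D / real k"
    have kU: "real k \<le> x powr (1 / 9)" using k U by (meson of_nat_le_iff order_trans)
    have L10: "10 \<le> L"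
    proof -
      have "10 * real k \<le> x powr \<eta> * x powr (1 / 9)" using K kU by (intro mult_mono) auto
      also have "\<dots> = x powr (\<eta> + 1 / 9)" by (simp only: powr_add)
      also have "\<dots> \<le> x powr (17 / 36)" using \<eta> by (intro pm) simp
      finally show ?thesis using D k unfolding L_def by (simp add: field_simps)
    qed
    have \<rho>: "X / (8 * real k * L ^ 3) = X * real k ^ 2 / (8 * D ^ 3)"
      using k D0 unfolding L_def by (simp add: field_simps power2_eq_square power3_eq_cube)
    have \<rho>1: "X / (8 * real k * L ^ 3) \<le> 1"
    proof -
      have "X * real k ^ 2 \<le> x powr (1 + 2 / 36 + 2 * \<eta>) * (x powr (1 / 9)) ^ 2"
        using X kU X0 by (intro mult_mono power_mono) auto
      also have "\<dots> = x powr (1 + 2 / 36 + 2 * \<eta> + 2 / 9)" unfolding powr_pow[OF x0] by (simp add: powr_add [symmetric] algebra_simps)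
      also have "\<dots> \<le> x powr (51 / 36)" using \<eta> by (intro pm) simp
      also have "\<dots> = (x powr (17 / 36)) ^ 3" using x0 by (simp add: powr_power)
      also have "\<dots> \<le> D ^ 3" using D by (intro power_mono) auto
      also have "\<dots> \<le> 8 * D ^ 3" using D0 by simp
      finally have "X * real k ^ 2 \<le> 8 * D ^ 3" .
      thus ?thesis unfolding \<rho> using D0 by (simp add: divide_le_eq_1)
    qed
    have "norm (\<Sum>l\<in>S. ee (X / (real (k * l) + \<delta>))) \<le> 288 * L * sqrt (X / (8 * real k * L ^ 3)) + 27 / sqrt (X / (8 * real k * L ^ 3))"
    proof (rule type_I_inner_sum[OF k(1) \<delta> L10 X0 _ conv \<rho>1])
      show "S \<subseteq> {l. L < real l \<and> real l \<le> 2 * L}"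
      proof
        fix l assume "l \<in> S"
        hence "D < real k * real l" "real k * real l \<le> 2 * D" using S D by (auto simp: P_def)
        thus "l \<in> {l. L < real l \<and> real l \<le> 2 * L}" using k unfolding L_def by (auto simp: field_simps)
      qed
    qed auto
    also have "\<dots> \<le> B" unfolding B_def
    proof (rule add_mono)
      have "288 * L * sqrt (X / (8 * real k * L ^ 3)) = 288 * sqrt (X / (8 * D))"
      proof -
        have "L * sqrt (X / (8 * real k * L ^ 3)) = sqrt (L ^ 2 * (X / (8 * real k * L ^ 3)))"
          unfolding real_sqrt_mult[of "L ^ 2"] using L10 by simp
        also have "L ^ 2 * (X / (8 * real k * L ^ 3)) = X / (8 * D)"
          using k D0 unfolding L_def by (simp add: field_simps power2_eq_square power3_eq_cube)
        finally show ?thesis by simp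
      qed
      thus "288 * L * sqrt (X / (8 * real k * L ^ 3)) \<le> 288 * sqrt (X / (8 * D))" by simp
      have "27 / sqrt (X / (8 * real k * L ^ 3)) = 27 * sqrt (8 * D ^ 3 / (X * real k ^ 2))"
        unfolding \<rho> by (simp add: real_sqrt_divide)
      also have "\<dots> \<le> 27 * sqrt (8 * D ^ 3 / X)"
      proof (intro mult_left_mono real_sqrt_le_mono divide_left_mono)
        have "1 \<le> real k ^ 2" using k by simp
        hence "X * 1 \<le> X * real k ^ 2" using X0 by (intro mult_left_mono) auto
        thus "X \<le> X * real k ^ 2" by simp
      qed (use X0 D0 k in auto)
      finally show "27 / sqrt (X / (8 * real k * L ^ 3)) \<le> 27 * sqrt (8 * D ^ 3 / X)" .
    qed
    finally show ?thesis .
  qed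
  have weighted: "norm (\<Sum>l\<in>P k. v l * ee (X / (real (k * l) + \<delta>))) \<le> x powr \<eta> * B" if k: "0 < k" "k \<le> U" for k
  proof (cases "P k = {}")
    case True
    thus ?thesis using B0 by simp
  next
    case False
    have fin: "finite (P k)" by (rule Pfin[OF k(1)])
    let ?p = "Min (P k)" and ?q = "Max (P k)"
    have pq: "?p \<in> P k" "?q \<in> P k" "?p \<le> ?q" using False fin by auto
    have convP: "l \<in> P k" if "m \<in> P k" "j \<in> P k" "m \<le> l" "l \<le> j" for m l j
    proof -
      have "k * m \<le> k * l" "k * l \<le> k * j" using that by auto
      hence "real (k * m) \<le> real (k * l)" "real (k * l) \<le> real (k * j)" by (simp_all only: of_nat_le_iff)
      thus ?thesis using that unfolding P_def mem_Collect_eq by linarith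
    qed
    have Pk: "P k = {?p..?q}"
    proof (intro equalityI subsetI)
      fix l assume "l \<in> P k" thus "l \<in> {?p..?q}" using fin by (simp add: Min_le Max_ge)
    next
      fix l assume "l \<in> {?p..?q}"
      hence "?p \<le> l" "l \<le> ?q" by (simp_all only: atLeastAtMost_iff)
      thus "l \<in> P k" by (rule convP[OF pq(1,2)])
    qed
    obtain p q where p: "p = ?p" and q: "q = ?q" by blast
    have Pk': "P k = {p..q}" using Pk p q by simp
    have p0: "0 < p" using pq(1) D0 unfolding p by (intro Nat.gr0I) (auto simp: P_def)
    have qx: "real q \<le> x"
    proof -
      have "q \<in> P k" using pq(2) q by simp
      moreover have "q \<le> k * q" using k by simp
      hence "real q \<le> real (k * q)" by (simp only: of_nat_le_iff)
      ultimately show ?thesis using D Dx D0 unfolding P_def mem_Collect_eq by linarith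
    qed
    have "norm (\<Sum>l=p..q. of_real (v l) * ee (X / (real (k * l) + \<delta>))) \<le> v q * B"
    proof (rule norm_sum_monotone_weight)
      show "p \<le> q" using pq(3) p q by simp
      show "v l \<le> v (Suc l)" if "p \<le> l" for l using v(1)[of l] that p0 by auto
      show "0 \<le> v p" using v(1)[OF p0] by auto
      show "norm (\<Sum>l=j..q. ee (X / (real (k * l) + \<delta>))) \<le> B" if "p \<le> j" for j
        using that by (intro inner[OF k]) (auto simp: Pk')
    qed
    also have "\<dots> \<le> x powr \<eta> * B"
      using v(2)[of q] p0 qx pq(3) p q B0 by (intro mult_right_mono) auto
    finally show ?thesis unfolding Pk' .
  qed
  have finpp: "finite (prod_pairs D D')" using D0 by (intro finite_prod_pairs) auto
  have "(\<Sum>(k, l)\<in>prod_pairs D D'. (if k \<le> U then c k * v l else 0) * ee (X / (real (k * l) + \<delta>)))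
     = (\<Sum>(k, l)\<in>(SIGMA k:{1..U}. P k). (c k * v l) * ee (X / (real (k * l) + \<delta>)))"
  proof (intro sum.mono_neutral_cong_right finpp)
    show "(SIGMA k:{1..U}. P k) \<subseteq> prod_pairs D D'" by (auto simp: P_def prod_pairs_def)
    show "\<forall>i\<in>prod_pairs D D' - (SIGMA k:{1..U}. P k). (case i of (k, l) \<Rightarrow> of_real (if k \<le> U then c k * v l else 0) * ee (X / (real (k * l) + \<delta>))) = 0"
    proof
      fix i assume i: "i \<in> prod_pairs D D' - (SIGMA k:{1..U}. P k)"
      obtain k l where kl: "i = (k, l)" by force
      have "k > 0" using prod_pairs_pos(1)[of k l D D'] i kl D0 by auto
      hence "\<not> k \<le> U" using i kl by (auto simp: P_def prod_pairs_def)
      thus "(case i of (k, l) \<Rightarrow> of_real (if k \<le> U then c k * v l else 0) * ee (X / (real (k * l) + \<delta>))) = 0" by (simp add: kl)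
    qed
  qed auto
  also have "\<dots> = (\<Sum>k\<in>{1..U}. of_real (c k) * (\<Sum>l\<in>P k. v l * ee (X / (real (k * l) + \<delta>))))"
    using Pfin by (subst sum.Sigma [symmetric]) (auto simp: sum_distrib_left mult.assoc)
  also have "norm \<dots> \<le> (\<Sum>k\<in>{1..U}. x powr \<eta> * (x powr \<eta> * B))"
  proof (rule sum_norm_le)
    fix k assume k: "k \<in> {1..U}"
    have "\<bar>c k\<bar> \<le> x powr \<eta>"
    proof (rule c)
      show "real k \<le> x" using k U1 by (meson atLeastAtMost_iff of_nat_le_iff order_trans)
    qed (use k in auto)
    thus "norm (of_real (c k) * (\<Sum>l\<in>P k. v l * ee (X / (real (k * l) + \<delta>)))) \<le> x powr \<eta> * (x powr \<eta> * B)"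
      unfolding norm_mult norm_of_real using k weighted[of k] by (intro mult_mono) auto
  qed
  also have "\<dots> = real U * (x powr \<eta> * (x powr \<eta> * B))" by simp
  also have "\<dots> \<le> x powr (1 / 9) * (x powr \<eta> * (x powr \<eta> * x powr (11 / 36)))"
  proof (intro mult_mono mult_left_mono U)
    have b1: "288 * sqrt (X / (8 * D)) \<le> x powr (105 / 360)"
    proof -
      have "X / (8 * D) \<le> (4 * D * x / x powr (17 / 36)) / (8 * D)" using X D0 by (intro divide_right_mono) auto
      also have "\<dots> = x powr 1 / x powr (17 / 36) / 2" using D0 x0 by simp
      also have "\<dots> \<le> x powr 1 / x powr (17 / 36)" 
      proof -
        have half: "y / 2 \<le> y" if "y \<ge> 0" for y :: real using that by simp
        show ?thesis by (rule half) simp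
      qed
      also have "\<dots> = x powr (19 / 36)" by (simp only: powr_diff [symmetric]) simp
      finally have "sqrt (X / (8 * D)) \<le> x powr (19 / 36 / 2)" using real_sqrt_le_mono sqrt_powr[OF x0] by metis
      hence "288 * sqrt (X / (8 * D)) \<le> x powr \<eta> * x powr (19 / 36 / 2)" using K by (intro mult_mono) (use X0 D0 in auto)
      also have "\<dots> = x powr (\<eta> + 19 / 36 / 2)" by (simp only: powr_add)
      also have "\<dots> \<le> x powr (105 / 360)" using \<eta> by (intro pm) simp
      finally show ?thesis .
    qed
    have b2: "27 * sqrt (8 * D ^ 3 / X) \<le> x powr (107 / 360)"
    proof -
      have "8 * D ^ 3 / X \<le> 8 * (x powr (19 / 36)) ^ 3 / x"
        using D D0 X x0 by (intro frac_le mult_left_mono power_mono) auto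
      also have "\<dots> = 8 * (x powr (57 / 36) / x powr 1)" using x0 by (simp add: powr_power)
      also have "\<dots> = 8 * x powr (21 / 36)" by (simp only: powr_diff [symmetric]) simp
      also have "\<dots> \<le> x powr \<eta> * x powr (21 / 36)" using K by (intro mult_right_mono) auto
      also have "\<dots> = x powr (\<eta> + 21 / 36)" by (simp only: powr_add)
      finally have "sqrt (8 * D ^ 3 / X) \<le> x powr ((\<eta> + 21 / 36) / 2)" using real_sqrt_le_mono sqrt_powr[OF x0] by metis
      hence "27 * sqrt (8 * D ^ 3 / X) \<le> x powr \<eta> * x powr ((\<eta> + 21 / 36) / 2)" using K by (intro mult_mono) (use X0 D0 in auto)
      also have "\<dots> = x powr (\<eta> + (\<eta> + 21 / 36) / 2)" by (simp only: powr_add)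
      also have "\<dots> \<le> x powr (107 / 360)" using \<eta> by (intro pm) argo
      finally show ?thesis .
    qed
    have "B \<le> x powr (107 / 360) + x powr (107 / 360)"
      unfolding B_def using b1 b2 pm[of "105 / 360" "107 / 360"] by linarith
    also have "\<dots> \<le> x powr \<eta> * x powr (107 / 360)" using K by (simp add: mult_right_mono flip: mult_2)
    also have "\<dots> = x powr (\<eta> + 107 / 360)" by (simp only: powr_add)
    also have "\<dots> \<le> x powr (11 / 36)" using \<eta> by (intro pm) simp
    finally show "B \<le> x powr (11 / 36)" .
  qed (use B0 in auto)
  also have "\<dots> = x powr (1 / 9 + (\<eta> + (\<eta> + 11 / 36)))" by (simp only: powr_add)
  also have "\<dots> \<le> x powr (17 / 36)" using \<eta> by (intro pm) simp
  finally show ?thesis .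
qed

section \<open>Sums over prime powers\<close>

text \<open>All coefficients in Vaughan's identity are at most \<open>x powr \<eta>\<close>. The
  type I parts are estimated for each \<open>h\<close> separately, the type II parts only on average
  over the dyadic range of \<open>h\<close>, because the large sieve exploits this average.\<close>

lemma exp_sum_bound:
  fixes H :: nat and x \<eta> \<delta> D D' :: real
  assumes lg: "large_for \<eta> x" and \<eta>: "0 < \<eta>" "\<eta> \<le> 1 / 100000"
    and D: "x powr (17 / 36) \<le> D" "D \<le> x powr (19 / 36)" "D \<le> D'" "D' \<le> 2 * D"
    and H: "0 < H" "real H \<le> 2 * D / x powr (17 / 36)"
    and \<delta>: "0 \<le> \<delta>" "\<delta> \<le> 1"
  shows "(\<Sum>h\<in>{H..<2*H}. norm (\<Sum>d | D < real d \<and> real d \<le> D'. mangoldt d * ee (real h * x / (real d + \<delta>))))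
    \<le> real H * x powr (17 / 36 + 15 * \<eta>)"
proof -
  have x1: "x > 1" and K: "x powr \<eta> \<ge> 10 ^ 8" "1 + 3 * ln x \<le> x powr \<eta>"
    and \<tau>: "\<And>k. 0 < k \<Longrightarrow> real k \<le> x \<Longrightarrow> real (num_divisors k) \<le> x powr \<eta>"
    using lg unfolding large_for_def by blast+
  have x0: "x > 0" and xge: "x \<ge> 1" using x1 by auto
  note pm = powr_mono[OF _ xge]
  have lnx: "0 < ln x" "ln x \<le> x powr \<eta>" using K x1 ln_gt_zero[of x] by linarith+
  define U where "U = nat \<lfloor>x powr (1 / 9)\<rfloor>"
  have U1: "real U \<le> x powr (1 / 9)" unfolding U_def by (intro of_nat_floor) simp
  have U2: "x powr (1 / 9) \<le> real U + 1" unfolding U_def by linarith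
  have U3: "1 \<le> U" unfolding U_def using x1 by (simp add: le_nat_floor ge_one_powr_ge_zero)
  have U4: "real U * U * U \<le> D"
  proof -
    have "real U * U * U \<le> x powr (1 / 9) * x powr (1 / 9) * x powr (1 / 9)"
      using U1 by (intro mult_mono) auto
    also have "\<dots> = x powr (1 / 9 + 1 / 9 + 1 / 9)" by (simp only: powr_add)
    also have "\<dots> \<le> x powr (17 / 36)" by (intro pm) simp
    finally show ?thesis using D(1) by linarith
  qed
  have ln_le: "ln (real k) \<le> x powr \<eta>" if "0 < k" "real k \<le> x" for k :: nat
  proof -
    have "ln (real k) \<le> ln x" using that x0 by simp
    thus ?thesis using lnx by linarith
  qed
  have \<gamma>: "\<bar>vaughan_gamma U k\<bar> \<le> x powr \<eta>" if "0 < k" "real k \<le> x" for k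
    using abs_vaughan_gamma_le[OF that(1), of U] ln_le[OF that] by linarith
  have \<beta>: "\<bar>vaughan_beta U k\<bar> \<le> x powr \<eta>" if "0 < k" "real k \<le> x" for k
  proof (cases "k = 1")
    case True
    have "vaughan_beta U 1 = 0" using U3 by (simp add: vaughan_beta_def)
    thus ?thesis using True by simp
  next
    case False
    hence "\<bar>vaughan_beta U k\<bar> \<le> real (num_divisors k)" using that by (intro abs_vaughan_beta_le) simp
    thus ?thesis using \<tau>[OF that] by linarith
  qed
  have \<mu>: "\<bar>moebius_mu k\<bar> \<le> x powr \<eta>" for k
    by (rule order_trans[OF abs_moebius_mu_le]) (use K in simp)
  have \<Lambda>: "norm (complex_of_real (mangoldt k)) \<le> x powr \<eta>" if "0 < k" "real k \<le> x" for k
    using mangoldt_le[of k] mangoldt_nonneg[of k] ln_le[OF that] that by simp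
  define G where "G h c = (\<Sum>(k, l)\<in>prod_pairs D D'. complex_of_real (c k l) * ee (real h * x / (real (k * l) + \<delta>)))" for h :: nat and c :: "nat \<Rightarrow> nat \<Rightarrow> real"
  define c1 where "c1 k l = (if k \<le> U then moebius_mu k * ln (real l) else 0)" for k l
  define c2 where "c2 k l = (if k \<le> U then vaughan_gamma U k else 0)" for k and l :: nat
  define c3 where "c3 k l = (if k > U \<and> l > U then vaughan_gamma U k else 0)" for k l
  define c4 where "c4 k l = (if k > U \<and> l > U then vaughan_beta U k * mangoldt l else 0)" for k l
  have split: "(\<Sum>d | D < real d \<and> real d \<le> D'. mangoldt d * ee (real h * x / (real d + \<delta>))) = G h c1 - G h c2 - G h c3 + G h c4" for h
  proof -
    have U0: "U > 0" using U3 by simp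
    show ?thesis
      unfolding vaughan_sum[OF U4 U0, where D' = D' and g = "\<lambda>d. ee (real h * x / (real d + \<delta>))"] G_def c1_def c2_def c3_def c4_def
      by simp
  qed
  have typeI: "norm (G h c1) \<le> x powr (17 / 36)" "norm (G h c2) \<le> x powr (17 / 36)" if h: "h \<in> {H..<2*H}" for h
  proof -
    define X where "X = real h * x"
    have h1: "1 \<le> real h" "real h \<le> 2 * real H" using h H by auto
    have Xlo: "x \<le> X" using h1 x0 unfolding X_def by simp
    have Xhi: "X \<le> 4 * D * x / x powr (17 / 36)"
    proof -
      have "real h \<le> 4 * D / x powr (17 / 36)" using h1 H(2) by simp
      hence "real h * x \<le> 4 * D / x powr (17 / 36) * x" using x0 by (intro mult_right_mono) auto
      thus ?thesis unfolding X_def by simp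
    qed
    have Xmid: "X \<le> x powr (1 + 2 / 36 + 2 * \<eta>)"
    proof -
      have "4 * D * x / x powr (17 / 36) \<le> x powr \<eta> * x powr (19 / 36) * x powr 1 / x powr (17 / 36)"
        using K D x0 by (intro divide_right_mono mult_mono) auto
      also have "\<dots> = x powr (\<eta> + 19 / 36 + 1 - 17 / 36)" by (simp only: powr_add powr_diff)
      also have "\<dots> \<le> x powr (1 + 2 / 36 + 2 * \<eta>)" using \<eta> by (intro pm) simp
      finally show ?thesis using Xhi by linarith
    qed
    show "norm (G h c1) \<le> x powr (17 / 36)"
      unfolding G_def c1_def X_def [symmetric]
    proof (rule type_I_bound[OF lg \<eta> D U1 Xlo Xmid Xhi \<delta> \<mu>])
      show "0 \<le> ln (real l) \<and> ln (real l) \<le> ln (real (Suc l))" if "0 < l" for l using that by simp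
    qed (rule ln_le)
    have "norm (\<Sum>(k, l)\<in>prod_pairs D D'. complex_of_real (if k \<le> U then vaughan_gamma U k * 1 else 0) * ee (X / (real (k * l) + \<delta>))) \<le> x powr (17 / 36)"
      by (rule type_I_bound[OF lg \<eta> D U1 Xlo Xmid Xhi \<delta> \<gamma>]) (use K in auto)
    thus "norm (G h c2) \<le> x powr (17 / 36)" unfolding G_def c2_def X_def mult_1_right .
  qed
  have typeII1: "(\<Sum>h\<in>{H..<2*H}. norm (G h c3)) \<le> real H * x powr (17 / 36 + 14 * \<eta>)"
  proof -
    have "(\<Sum>h\<in>{H..<2*H}. norm (\<Sum>(k, l)\<in>prod_pairs D D'. (if k > U \<and> l > U then complex_of_real (vaughan_gamma U k) * 1 else 0) * ee (real h * x / (real (k * l) + \<delta>))))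
      \<le> real H * x powr (17 / 36 + 14 * \<eta>)"
      by (rule type_II_bound[OF lg \<eta> D U2 U3 H \<delta>]) (use \<gamma> K in auto)
    moreover have "G h c3 = (\<Sum>(k, l)\<in>prod_pairs D D'. (if k > U \<and> l > U then complex_of_real (vaughan_gamma U k) * 1 else 0) * ee (real h * x / (real (k * l) + \<delta>)))" for h
      unfolding G_def by (intro sum.cong) (auto simp: c3_def)
    ultimately show ?thesis by simp
  qed
  have typeII2: "(\<Sum>h\<in>{H..<2*H}. norm (G h c4)) \<le> real H * x powr (17 / 36 + 14 * \<eta>)"
  proof -
    have "(\<Sum>h\<in>{H..<2*H}. norm (\<Sum>(k, l)\<in>prod_pairs D D'. (if k > U \<and> l > U then complex_of_real (vaughan_beta U k) * complex_of_real (mangoldt l) else 0) * ee (real h * x / (real (k * l) + \<delta>))))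
      \<le> real H * x powr (17 / 36 + 14 * \<eta>)"
      by (rule type_II_bound[OF lg \<eta> D U2 U3 H \<delta>]) (use \<beta> \<Lambda> in auto)
    moreover have "G h c4 = (\<Sum>(k, l)\<in>prod_pairs D D'. (if k > U \<and> l > U then complex_of_real (vaughan_beta U k) * complex_of_real (mangoldt l) else 0) * ee (real h * x / (real (k * l) + \<delta>)))" for h
      unfolding G_def by (intro sum.cong) (auto simp: c4_def)
    ultimately show ?thesis by simp
  qed
  have "(\<Sum>h\<in>{H..<2*H}. norm (\<Sum>d | D < real d \<and> real d \<le> D'. mangoldt d * ee (real h * x / (real d + \<delta>))))
     \<le> (\<Sum>h\<in>{H..<2*H}. 2 * x powr (17 / 36) + norm (G h c3) + norm (G h c4))"
  proof (rule sum_mono)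
    fix h assume h: "h \<in> {H..<2*H}"
    have "norm (G h c1 - G h c2 - G h c3 + G h c4) \<le> norm (G h c1) + norm (G h c2) + norm (G h c3) + norm (G h c4)"
      by (intro norm_triangle_mono order_trans[OF norm_triangle_ineq4] add_mono order_refl)
    thus "norm (\<Sum>d | D < real d \<and> real d \<le> D'. mangoldt d * ee (real h * x / (real d + \<delta>)))
       \<le> 2 * x powr (17 / 36) + norm (G h c3) + norm (G h c4)"
      unfolding split using typeI[OF h] by linarith
  qed
  also have "\<dots> = real H * (2 * x powr (17 / 36)) + (\<Sum>h\<in>{H..<2*H}. norm (G h c3)) + (\<Sum>h\<in>{H..<2*H}. norm (G h c4))"
    by (simp add: sum.distrib)
  also have "\<dots> \<le> real H * (2 * x powr (17 / 36 + 14 * \<eta>)) + real H * x powr (17 / 36 + 14 * \<eta>) + real H * x powr (17 / 36 + 14 * \<eta>)"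
    using \<eta> by (intro add_mono typeII1 typeII2 mult_left_mono pm) auto
  also have "\<dots> = real H * (4 * x powr (17 / 36 + 14 * \<eta>))" by simp
  also have "\<dots> \<le> real H * (x powr \<eta> * x powr (17 / 36 + 14 * \<eta>))"
    using K by (intro mult_left_mono mult_right_mono) auto
  also have "\<dots> = real H * x powr (17 / 36 + 15 * \<eta>)" by (simp add: powr_add [symmetric] algebra_simps)
  finally show ?thesis .
qed

lemma ex_power2_between:
  fixes r :: real
  assumes "r \<ge> 1"
  obtains J :: nat where "r \<le> 2 ^ J" "2 ^ J \<le> 2 * r"
proof -
  define J where "J = nat \<lceil>log 2 r\<rceil>"
  have l0: "0 \<le> log 2 r" using assms by simp
  have J: "log 2 r \<le> real J" "real J \<le> log 2 r + 1" using l0 unfolding J_def by linarith+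
  have r: "r = 2 powr log 2 r" using assms by simp
  have "2 powr log 2 r \<le> 2 powr real J" "2 powr real J \<le> 2 powr (log 2 r + 1)" using J by simp_all
  hence "r \<le> 2 ^ J" "2 ^ J \<le> 2 * r" using r by (simp_all add: powr_realpow powr_add)
  thus ?thesis by (rule that)
qed

lemma sum_div_le_dyadic:
  fixes s :: "nat \<Rightarrow> real"
  assumes s: "\<And>h. s h \<ge> 0"
  shows "(\<Sum>h\<in>{1..<2^J}. s h / real h) \<le> (\<Sum>i<J. (\<Sum>h\<in>{2^i..<2*2^i}. s h) / 2 ^ i)"
proof (induction J)
  case (Suc J)
  have "(1::nat) \<le> 2 ^ J" by simp
  hence "{1..<2 ^ Suc J} = {1..<2 ^ J} \<union> {2 ^ J..<2 * 2 ^ J :: nat}" by auto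
  hence "(\<Sum>h\<in>{1..<2^Suc J}. s h / real h) = (\<Sum>h\<in>{1..<2^J}. s h / real h) + (\<Sum>h\<in>{2^J..<2*2^J}. s h / real h)"
    by (simp only:) (rule sum.union_disjoint; auto)
  also have "(\<Sum>h\<in>{2^J..<2*2^J}. s h / real h) \<le> (\<Sum>h\<in>{2^J..<2*2^J}. s h / 2 ^ J)"
  proof (rule sum_mono)
    fix h :: nat assume "h \<in> {2^J..<2*2^J}"
    hence "2 ^ J \<le> h" by simp
    hence "real (2 ^ J) \<le> real h" by (simp only: of_nat_le_iff)
    hence "(2::real) ^ J \<le> real h" by simp
    thus "s h / real h \<le> s h / 2 ^ J" using s[of h] by (intro frac_le) auto
  qed
  finally show ?case using Suc by (simp add: sum_divide_distrib)
qed simp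

lemma nat_le_powr_of_power2_le:
  assumes lg: "large_for \<eta> x" and J: "(2::real) ^ J \<le> x"
  shows "real J + 2 \<le> x powr \<eta>"
proof -
  have x1: "x > 1" and K: "x powr \<eta> \<ge> 10 ^ 8" "1 + 3 * ln x \<le> x powr \<eta>"
    using lg unfolding large_for_def by blast+
  have "ln ((2::real) ^ J) \<le> ln x" using J x1 by (subst ln_le_cancel_iff) auto
  hence "real J * ln 2 \<le> ln x" by (simp add: ln_realpow)
  moreover have "real J * (2 / 3) \<le> real J * ln 2"
    using ln2_ge_two_thirds by (intro mult_left_mono) auto
  ultimately have "2 * real J \<le> 3 * ln x" by simp
  moreover have "10 \<le> x powr \<eta>" using K by simp
  ultimately show ?thesis using K(2) by linarith
qed

text \<open>The number \<open>2 ^ J\<close> of frequencies is about \<open>D / T\<close>, so that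
  the truncation error, of order \<open>D / 2 ^ J\<close>, has the size of \<open>T\<close>. The
  weights \<open>1 / h\<close> turn the average over each dyadic range of \<open>h\<close> into a
  bound free of \<open>H\<close>.\<close>

lemma dyadic_psi_bound:
  fixes x \<eta> \<delta> D D' :: real
  assumes lg: "large_for \<eta> x" and \<eta>: "0 < \<eta>" "\<eta> \<le> 1 / 100000"
    and D: "x powr (17 / 36) \<le> D" "D \<le> x powr (19 / 36)" "D \<le> D'" "D' \<le> 2 * D"
    and \<delta>: "0 \<le> \<delta>" "\<delta> \<le> 1"
  shows "\<bar>\<Sum>d | D < real d \<and> real d \<le> D'. mangoldt d * psi (x / (real d + \<delta>))\<bar> \<le> x powr (17 / 36 + 18 * \<eta>)"
proof -
  have x1: "x > 1" and K: "x powr \<eta> \<ge> 10 ^ 8" "1 + 3 * ln x \<le> x powr \<eta>"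
    using lg unfolding large_for_def by blast+
  have x0: "x > 0" and xge: "x \<ge> 1" using x1 by auto
  note pm = powr_mono[OF _ xge]
  have lnx: "0 < ln x" "ln x \<le> x powr \<eta>" using K x1 ln_gt_zero[of x] by linarith+
  define T where "T = x powr (17 / 36)"
  have T0: "T > 0" using x0 by (simp add: T_def)
  have DT: "1 \<le> D / T" using D(1) T0 by (simp add: T_def)
  have D0: "D > 0" by (rule less_le_trans[OF _ D(1)]) (use x0 in simp)
  obtain J :: nat where J: "D / T \<le> 2 ^ J" "2 ^ J \<le> 2 * (D / T)" using ex_power2_between[OF DT] .
  have Dx: "4 * D \<le> x"
  proof -
    have "4 * D \<le> x powr \<eta> * x powr (19 / 36)" using K D by (intro mult_mono) auto
    also have "\<dots> = x powr (\<eta> + 19 / 36)" by (simp only: powr_add)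
    also have "\<dots> \<le> x powr 1" using \<eta> by (intro pm) simp
    finally show ?thesis using x0 by simp
  qed
  have Jx: "real J + 2 \<le> x powr \<eta>"
  proof (rule nat_le_powr_of_power2_le[OF lg])
    have "1 \<le> T" unfolding T_def using xge by (simp add: ge_one_powr_ge_zero)
    hence "D / T \<le> D / 1" using D0 by (intro divide_left_mono) auto
    thus "2 ^ J \<le> x" using J(2) Dx D0 by simp
  qed
  define P where "P = {d :: nat. D < real d \<and> real d \<le> D'}"
  have Psub: "P \<subseteq> {1..nat \<lfloor>2 * D\<rfloor>}"
    using D0 D(4) by (auto simp: P_def le_nat_floor Suc_le_eq intro!: Nat.gr0I)
  have finP: "finite P" by (rule finite_subset[OF Psub]) simp
  have C: "(\<Sum>d\<in>P. mangoldt d) \<le> 2 * D * x powr \<eta>"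
  proof -
    have "(\<Sum>d\<in>P. mangoldt d) \<le> (\<Sum>d\<in>P. x powr \<eta>)"
    proof (rule sum_mono)
      fix d assume "d \<in> P"
      hence d: "0 < d" "real d \<le> x" using Psub D(4) Dx D0 by (auto simp: P_def Suc_le_eq)
      have "mangoldt d \<le> ln (real d)" by (rule mangoldt_le) (rule d)
      also have "\<dots> \<le> ln x" using d x0 by simp
      finally show "mangoldt d \<le> x powr \<eta>" using lnx by linarith
    qed
    also have "\<dots> = real (card P) * x powr \<eta>" by simp
    also have "\<dots> \<le> 2 * D * x powr \<eta>"
    proof (rule mult_right_mono)
      have "card P \<le> nat \<lfloor>2 * D\<rfloor>" using card_mono[OF _ Psub] by simp
      thus "real (card P) \<le> 2 * D" using of_nat_floor[of "2 * D"] D0 by linarith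
    qed simp
    finally show ?thesis .
  qed
  define s where "s h = norm (\<Sum>d\<in>P. mangoldt d * ee (real h * (x / (real d + \<delta>))))" for h :: nat
  have s0: "s h \<ge> 0" for h by (simp add: s_def)
  have sb: "(\<Sum>h\<in>{2^i..<2*2^i}. s h) / 2 ^ i \<le> x powr (17 / 36 + 15 * \<eta>)" if "i \<in> {..<Suc J}" for i
  proof -
    have "real (2 ^ i) \<le> 2 ^ J" using that by simp
    also have "\<dots> \<le> 2 * (D / T)" by (rule J(2))
    finally have H: "real (2 ^ i) \<le> 2 * D / x powr (17 / 36)" by (simp add: T_def)
    have "(\<Sum>h\<in>{2^i..<2*2^i}. s h) \<le> real (2 ^ i) * x powr (17 / 36 + 15 * \<eta>)"
      unfolding s_def P_def times_divide_eq_right by (rule exp_sum_bound[OF lg \<eta> D _ H \<delta>]) simp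
    thus ?thesis by (simp add: pos_divide_le_eq mult.commute)
  qed
  have "\<bar>\<Sum>d\<in>P. mangoldt d * psi (x / (real d + \<delta>))\<bar>
    \<le> 65 * (real J + 1) * ((\<Sum>d\<in>P. mangoldt d) / 2 ^ J + (\<Sum>h=1..2^J. s h / real h))"
    using psi_sum_bound[OF finP, of mangoldt "\<lambda>d. x / (real d + \<delta>)" J] mangoldt_nonneg
    by (simp only: s_def of_real_mangoldt)
  also have "\<dots> \<le> 65 * x powr \<eta> * (2 * x powr (17 / 36 + 16 * \<eta>) + x powr (17 / 36 + 16 * \<eta>))"
  proof (intro mult_mono add_mono)
    show "real J + 1 \<le> x powr \<eta>" using Jx by simp
    have "(\<Sum>d\<in>P. mangoldt d) / 2 ^ J \<le> 2 * D * x powr \<eta> / (D / T)"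
      using C J(1) D0 T0 by (intro frac_le) auto
    also have "\<dots> = 2 * (x powr (17 / 36) * x powr \<eta>)" using D0 T0 by (simp add: T_def)
    also have "\<dots> = 2 * x powr (17 / 36 + \<eta>)" by (simp only: powr_add)
    also have "\<dots> \<le> 2 * x powr (17 / 36 + 16 * \<eta>)" using \<eta> by (intro mult_left_mono pm) auto
    finally show "(\<Sum>d\<in>P. mangoldt d) / 2 ^ J \<le> 2 * x powr (17 / 36 + 16 * \<eta>)" .
    have "(\<Sum>h=1..2^J. s h / real h) \<le> (\<Sum>h\<in>{1..<2^Suc J}. s h / real h)"
      using s0 by (intro sum_mono2) (auto simp: less_le_trans intro!: le_less_trans[of _ "2 ^ J"])
    also have "\<dots> \<le> (\<Sum>i<Suc J. (\<Sum>h\<in>{2^i..<2*2^i}. s h) / 2 ^ i)" by (rule sum_div_le_dyadic[OF s0])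
    also have "\<dots> \<le> (\<Sum>i<Suc J. x powr (17 / 36 + 15 * \<eta>))" by (intro sum_mono sb)
    also have "\<dots> = (real J + 1) * x powr (17 / 36 + 15 * \<eta>)" by (simp add: algebra_simps)
    also have "\<dots> \<le> x powr \<eta> * x powr (17 / 36 + 15 * \<eta>)" using Jx by (intro mult_right_mono) auto
    also have "\<dots> = x powr (17 / 36 + 16 * \<eta>)" by (simp add: powr_add [symmetric] algebra_simps)
    finally show "(\<Sum>h=1..2^J. s h / real h) \<le> x powr (17 / 36 + 16 * \<eta>)" .
  qed (auto intro!: add_nonneg_nonneg divide_nonneg_nonneg sum_nonneg mangoldt_nonneg s0)
  also have "\<dots> = 195 * (x powr \<eta> * x powr (17 / 36 + 16 * \<eta>))" by simp
  also have "\<dots> \<le> x powr \<eta> * (x powr \<eta> * x powr (17 / 36 + 16 * \<eta>))" using K by (intro mult_right_mono) auto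
  also have "\<dots> = x powr (17 / 36 + 18 * \<eta>)" by (simp add: powr_add [symmetric] algebra_simps)
  finally show ?thesis unfolding P_def .
qed

text \<open>The range is halved from the top until \<open>T\<close> is reached; the number of pieces
  is logarithmic and absorbed by \<open>x powr \<eta>\<close>.\<close>

lemma psi_mangoldt_bound:
  fixes x \<eta> \<delta> :: real
  assumes lg: "large_for \<eta> x" and \<eta>: "0 < \<eta>" "\<eta> \<le> 1 / 100000" and \<delta>: "0 \<le> \<delta>" "\<delta> \<le> 1"
  shows "\<bar>\<Sum>d | x powr (17 / 36) < real d \<and> real d \<le> x powr (19 / 36). mangoldt d * psi (x / (real d + \<delta>))\<bar>
    \<le> x powr (17 / 36 + 19 * \<eta>)"
proof -
  have x1: "x > 1" and K: "x powr \<eta> \<ge> 10 ^ 8" using lg unfolding large_for_def by blast+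
  have x0: "x > 0" and xge: "x \<ge> 1" using x1 by auto
  note pm = powr_mono[OF _ xge]
  define T where "T = x powr (17 / 36)"
  have T0: "T > 0" using x0 by (simp add: T_def)
  define E where "E = x powr (17 / 36 + 18 * \<eta>)"
  have E0: "E \<ge> 0" by (simp add: E_def)
  define f where "f d = mangoldt d * psi (x / (real d + \<delta>))" for d
  have step: "\<bar>\<Sum>d | T < real d \<and> real d \<le> y. f d\<bar> \<le> real i * E"
    if "T \<le> y" "y \<le> T * 2 ^ i" "y \<le> x powr (19 / 36)" for i y
    using that
  proof (induction i arbitrary: y)
    case 0
    hence empty: "{d. T < real d \<and> real d \<le> y} = {}" by auto
    show ?case unfolding empty by simp
  next
    case (Suc i)
    \<comment> \<open>The maximum stops the last piece at \<open>T\<close>, the lower limit allowed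
      in \<open>dyadic_psi_bound\<close>.\<close>
    define D where "D = max T (y / 2)"
    have "1 * T \<le> 2 ^ i * T" using T0 by (intro mult_right_mono) auto
    hence D: "T \<le> D" "D \<le> T * 2 ^ i" "D \<le> y" "y \<le> 2 * D"
      using Suc.prems T0 by (auto simp: D_def mult.commute)
    have "{d. T < real d \<and> real d \<le> y} = {d. T < real d \<and> real d \<le> D} \<union> {d. D < real d \<and> real d \<le> y}"
      using D by auto
    hence "(\<Sum>d | T < real d \<and> real d \<le> y. f d) = (\<Sum>d | T < real d \<and> real d \<le> D. f d) + (\<Sum>d | D < real d \<and> real d \<le> y. f d)"
      by (simp only:) (rule sum.union_disjoint; auto intro: finite_subset[OF _ finite_nat_le_real])
    moreover have "\<bar>\<Sum>d | T < real d \<and> real d \<le> D. f d\<bar> \<le> real i * E"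
      using D Suc.prems by (intro Suc.IH) auto
    moreover have "\<bar>\<Sum>d | D < real d \<and> real d \<le> y. f d\<bar> \<le> E"
      unfolding E_def f_def using D Suc.prems by (intro dyadic_psi_bound[OF lg \<eta> _ _ _ _ \<delta>]) (auto simp: T_def)
    ultimately have "\<bar>\<Sum>d | T < real d \<and> real d \<le> y. f d\<bar> \<le> real i * E + E" by linarith
    thus ?case by (simp add: algebra_simps)
  qed
  have Ty: "T \<le> x powr (19 / 36)" unfolding T_def by (intro pm) simp
  hence r: "1 \<le> x powr (19 / 36) / T" using T0 by simp
  obtain J :: nat where J: "x powr (19 / 36) / T \<le> 2 ^ J" "2 ^ J \<le> 2 * (x powr (19 / 36) / T)"
    using ex_power2_between[OF r] .
  have Jx: "real J + 2 \<le> x powr \<eta>"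
  proof (rule nat_le_powr_of_power2_le[OF lg])
    have "2 * (x powr (19 / 36) / T) = 2 * x powr (2 / 36)" unfolding T_def by (simp add: powr_diff [symmetric])
    also have "\<dots> \<le> x powr \<eta> * x powr (2 / 36)" using K by (intro mult_right_mono) auto
    also have "\<dots> = x powr (\<eta> + 2 / 36)" by (simp only: powr_add)
    also have "\<dots> \<le> x powr 1" using \<eta> by (intro pm) simp
    finally show "2 ^ J \<le> x" using J(2) x0 by simp
  qed
  have "\<bar>\<Sum>d | T < real d \<and> real d \<le> x powr (19 / 36). f d\<bar> \<le> real J * E"
    using J(1) T0 Ty by (intro step) (auto simp: field_simps)
  also have "\<dots> \<le> x powr \<eta> * E" using Jx E0 by (intro mult_right_mono) auto
  also have "\<dots> = x powr (17 / 36 + 19 * \<eta>)" unfolding E_def by (simp add: powr_add [symmetric] algebra_simps)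
  finally show ?thesis unfolding T_def f_def .
qed

section \<open>The main term and the final error estimate\<close>

lemma mangoldt_tail:
  fixes B :: nat
  defines "f \<equiv> \<lambda>d :: nat. mangoldt d / (real d * (real d + 1)) :: real"
  shows "f summable_on {Suc B..}" "0 \<le> infsum f {Suc B..}" "infsum f {Suc B..} \<le> (ln (real (Suc B)) + 1) / real (Suc B)"
proof -
  have f0: "f d \<ge> 0" for d by (simp add: f_def mangoldt_nonneg)
  \<comment> \<open>A discrete antiderivative: \<open>f d \<le> F d - F (Suc d)\<close> follows from
    \<open>mangoldt d \<le> ln d\<close> and \<open>ln (d + 1) - ln d \<le> 1 / d\<close>, so the
    tail telescopes to at most \<open>F (Suc B)\<close>.\<close>
  define F where "F d = (ln (real d) + 1) / real d" for d :: nat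
  have F0: "F d \<ge> 0" for d by (cases "d = 0") (auto simp: F_def)
  have fF: "f d \<le> F d - F (Suc d)" if "d > 0" for d
  proof -
    have d: "real d > 0" using that by simp
    have "ln (1 + 1 / real d) \<le> 1 / real d" using d by (intro ln_add_one_self_le_self) auto
    moreover have "1 + 1 / real d = (real d + 1) / real d" using d by (simp add: field_simps)
    ultimately have "ln (real d + 1) - ln (real d) \<le> 1 / real d" using d by (simp add: ln_div)
    hence "real d * (ln (real d + 1) - ln (real d)) \<le> 1" using d by (simp add: field_simps)
    moreover have "mangoldt d \<le> ln (real d)" using that by (intro mangoldt_le)
    ultimately have "mangoldt d \<le> (real d + 1) * (ln (real d) + 1) - real d * (ln (real d + 1) + 1)"
      by (simp add: algebra_simps)
    hence "f d \<le> ((real d + 1) * (ln (real d) + 1) - real d * (ln (real d + 1) + 1)) / (real d * (real d + 1))"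
      unfolding f_def using d by (intro divide_right_mono) auto
    also have "\<dots> = F d - F (Suc d)" using d unfolding F_def by (simp add: field_simps)
    finally show ?thesis .
  qed
  have part: "sum f S \<le> F (Suc B)" if S: "finite S" "S \<subseteq> {Suc B..}" for S
  proof -
    have tel: "(\<Sum>d\<in>{Suc B..<Suc B + n}. f d) \<le> F (Suc B) - F (Suc B + n)" for n
    proof (induction n)
      case (Suc n)
      thus ?case using fF[of "Suc B + n"] by simp
    qed simp
    obtain m where m: "\<forall>d\<in>S. d < m" using S(1) by (metis finite_nat_set_iff_bounded)
    have "S \<subseteq> {Suc B..<Suc B + m}"
    proof
      fix d assume "d \<in> S"
      hence "d < m" "Suc B \<le> d" using m S(2) by auto
      thus "d \<in> {Suc B..<Suc B + m}" by simp
    qed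
    hence "sum f S \<le> sum f {Suc B..<Suc B + m}" using f0 by (intro sum_mono2) auto
    thus ?thesis using tel[of m] F0[of "Suc B + m"] by linarith
  qed
  show sm: "f summable_on {Suc B..}"
    using part f0 by (intro nonneg_bdd_above_summable_on bdd_aboveI2[where M = "F (Suc B)"]) auto
  show "0 \<le> infsum f {Suc B..}" by (rule infsum_nonneg) (rule f0)
  show "infsum f {Suc B..} \<le> (ln (real (Suc B)) + 1) / real (Suc B)"
    using infsum_le_finite_sums[OF sm part] by (simp add: F_def)
qed

lemma nat_floor_div_eq_iff:
  fixes x :: real and n d :: nat
  assumes "x > 0" "n > 0" "d > 0"
  shows "nat \<lfloor>x / real n\<rfloor> = d \<longleftrightarrow> n \<in> {nat \<lfloor>x / (real d + 1)\<rfloor><..nat \<lfloor>x / real d\<rfloor>}"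
proof -
  have "nat \<lfloor>x / real n\<rfloor> = d \<longleftrightarrow> \<lfloor>x / real n\<rfloor> = int d" using assms(3) by auto
  also have "\<dots> \<longleftrightarrow> real d \<le> x / real n \<and> x / real n < real d + 1" by (simp add: floor_eq_iff)
  also have "real d \<le> x / real n \<longleftrightarrow> real n \<le> x / real d" using assms by (simp add: field_simps)
  also have "x / real n < real d + 1 \<longleftrightarrow> x / (real d + 1) < real n" using assms by (simp add: field_simps)
  also have "real n \<le> x / real d \<longleftrightarrow> n \<le> nat \<lfloor>x / real d\<rfloor>" using assms by (simp add: le_nat_iff le_floor_iff)
  also have "x / (real d + 1) < real n \<longleftrightarrow> nat \<lfloor>x / (real d + 1)\<rfloor> < n" using assms by (simp add: nat_less_iff floor_less_iff)
  finally show ?thesis by auto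
qed

text \<open>The \<open>n\<close> with quotient \<open>d\<close> fill the interval between the
  integral parts of \<open>x / (d + 1)\<close> and \<open>x / d\<close>; the constants
  \<open>1/2\<close> of the two sawtooth terms cancel. The summand \<open>+ 0\<close> gives both
  terms the common form \<open>d + \<delta>\<close>.\<close>

lemma sum_mangoldt_floor:
  fixes x :: real and B :: nat
  assumes x: "x > 0"
  shows "(\<Sum>n | 1 \<le> n \<and> real n \<le> x \<and> nat \<lfloor>x / real n\<rfloor> \<le> B. mangoldt (nat \<lfloor>x / real n\<rfloor>))
    = (\<Sum>d\<in>{1..B}. mangoldt d * (x / (real d * (real d + 1)) - psi (x / (real d + 0)) + psi (x / (real d + 1))))"
proof -
  define S where "S = {n :: nat. 1 \<le> n \<and> real n \<le> x \<and> nat \<lfloor>x / real n\<rfloor> \<le> B}"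
  have finS: "finite S" by (rule finite_subset[OF _ finite_nat_le_real[of x]]) (auto simp: S_def)
  have im: "(\<lambda>n. nat \<lfloor>x / real n\<rfloor>) ` S \<subseteq> {1..B}"
    by (auto simp: S_def le_nat_floor Suc_le_eq field_simps zero_less_floor)
  have "(\<Sum>n\<in>S. mangoldt (nat \<lfloor>x / real n\<rfloor>)) = (\<Sum>d\<in>{1..B}. \<Sum>n | n \<in> S \<and> nat \<lfloor>x / real n\<rfloor> = d. mangoldt (nat \<lfloor>x / real n\<rfloor>) :: real)"
    by (rule sum.group [symmetric]) (use finS im in auto)
  also have "\<dots> = (\<Sum>d\<in>{1..B}. mangoldt d * (x / (real d * (real d + 1)) - psi (x / (real d + 0)) + psi (x / (real d + 1))))"
  proof (intro sum.cong refl)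
    fix d assume d: "d \<in> {1..B}"
    define a b where "a = nat \<lfloor>x / (real d + 1)\<rfloor>" and "b = nat \<lfloor>x / real d\<rfloor>"
    have ab: "a \<le> b" unfolding a_def b_def using d x by (intro nat_mono floor_mono frac_le) auto
    have eq: "{n. n \<in> S \<and> nat \<lfloor>x / real n\<rfloor> = d} = {a<..b}"
    proof (intro equalityI subsetI)
      fix n assume "n \<in> {n. n \<in> S \<and> nat \<lfloor>x / real n\<rfloor> = d}"
      thus "n \<in> {a<..b}" unfolding a_def b_def using nat_floor_div_eq_iff[OF x, of n d] d by (auto simp: S_def)
    next
      fix n assume n: "n \<in> {a<..b}"
      hence n0: "n > 0" by simp
      have e: "nat \<lfloor>x / real n\<rfloor> = d" using n n0 d nat_floor_div_eq_iff[OF x n0, of d] by (simp add: a_def b_def)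
      have "real n \<le> real b" using n by simp
      also have "\<dots> \<le> x / real d" unfolding b_def using x by (intro of_nat_floor) auto
      also have "\<dots> \<le> x / 1" using d x by (intro divide_left_mono) auto
      finally show "n \<in> {n. n \<in> S \<and> nat \<lfloor>x / real n\<rfloor> = d}" using e d n0 by (simp add: S_def)
    qed
    have "(\<Sum>n | n \<in> S \<and> nat \<lfloor>x / real n\<rfloor> = d. mangoldt (nat \<lfloor>x / real n\<rfloor>)) = (\<Sum>n | n \<in> S \<and> nat \<lfloor>x / real n\<rfloor> = d. mangoldt d :: real)"
      by (intro sum.cong) auto
    also have "\<dots> = real (b - a) * mangoldt d" unfolding eq by simp
    also have "real (b - a) = real b - real a" using ab by (simp add: of_nat_diff)
    also have "real b = x / real d - psi (x / (real d + 0)) - 1 / 2" unfolding b_def psi_def using x by simp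
    also have "real a = x / (real d + 1) - psi (x / (real d + 1)) - 1 / 2" unfolding a_def psi_def using x by simp
    also have "(x / real d - psi (x / (real d + 0)) - 1 / 2 - (x / (real d + 1) - psi (x / (real d + 1)) - 1 / 2)) * mangoldt d
      = mangoldt d * ((x / real d - x / (real d + 1)) - psi (x / (real d + 0)) + psi (x / (real d + 1)))"
      by (simp add: algebra_simps)
    also have "x / real d - x / (real d + 1) = x / (real d * (real d + 1))" using d by (simp add: field_simps)
    finally show "(\<Sum>n | n \<in> S \<and> nat \<lfloor>x / real n\<rfloor> = d. mangoldt (nat \<lfloor>x / real n\<rfloor>))
      = mangoldt d * (x / (real d * (real d + 1)) - psi (x / (real d + 0)) + psi (x / (real d + 1)))" .
  qed
  finally show ?thesis unfolding S_def .
qed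

text \<open>The trivial estimate for both extreme ranges, with the weights \<open>psi\<close> for
  small \<open>d\<close> and 1 for small \<open>n\<close>.\<close>

lemma sum_mangoldt_le:
  fixes x :: real and S :: "nat set"
  assumes "finite S" "real (card S) \<le> C" and lg: "ln x \<le> E" "x > 0" and g: "\<And>n. n \<in> S \<Longrightarrow> 0 < g n \<and> real (g n) \<le> x" and E: "E \<ge> 0" and w: "\<And>n. n \<in> S \<Longrightarrow> \<bar>w n\<bar> \<le> 1"
  shows "\<bar>\<Sum>n\<in>S. mangoldt (g n) * w n\<bar> \<le> C * E"
proof -
  have "\<bar>\<Sum>n\<in>S. mangoldt (g n) * w n\<bar> \<le> (\<Sum>n\<in>S. E * 1)"
  proof (intro order_trans[OF sum_abs] sum_mono)
    fix n assume n: "n \<in> S"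
    have "mangoldt (g n) \<le> ln (real (g n))" using g[OF n] by (intro mangoldt_le) auto
    also have "\<dots> \<le> ln x" using g[OF n] lg by simp
    finally have "mangoldt (g n) \<le> E" using lg by linarith
    thus "\<bar>mangoldt (g n) * w n\<bar> \<le> E * 1"
      unfolding abs_mult using w[OF n] mangoldt_nonneg[of "g n"] E by (intro mult_mono) auto
  qed
  also have "\<dots> = real (card S) * E" by simp
  also have "\<dots> \<le> C * E" using assms by (intro mult_right_mono)
  finally show ?thesis .
qed

lemma card_nat_le_real:
  assumes "S \<subseteq> {n :: nat. 1 \<le> n \<and> real n \<le> y}" "y \<ge> 0"
  shows "real (card S) \<le> y"
proof -
  have "S \<subseteq> {1..nat \<lfloor>y\<rfloor>}" using assms(1) by (auto simp: le_nat_floor)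
  hence "card S \<le> nat \<lfloor>y\<rfloor>" using card_mono[of "{1..nat \<lfloor>y\<rfloor>}" S] by simp
  thus ?thesis using of_nat_floor[OF assms(2)] by linarith
qed

lemma abs_psi_le: "\<bar>psi t\<bar> \<le> 1"
  unfolding psi_def by linarith

text \<open>Since \<open>x = T * y\<close> and \<open>B\<close> is the integral part of
  \<open>y\<close>, a quotient above \<open>B\<close> forces \<open>n \<le> T\<close>. These terms,
  the \<open>d \<le> T\<close>, and the tail of the series beyond \<open>B\<close> all cost about
  \<open>T\<close> up to logarithms. The pieces add up to \<open>8 = 1 + 3 + 2 + 2\<close> times the
  error of the sawtooth sums, absorbed by one more \<open>x powr \<eta>\<close>.\<close>

lemma mangoldt_floor_sum_error:
  fixes x \<eta> :: real
  assumes lg: "large_for \<eta> x" and \<eta>: "0 < \<eta>" "\<eta> \<le> 1 / 100000"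
  shows "\<bar>(\<Sum>n\<in>{n::nat. 1 \<le> n \<and> real n \<le> x}. (mangoldt (nat \<lfloor>x / real n\<rfloor>) :: real))
            - x * (\<Sum>\<^sub>\<infinity>d\<in>{1::nat..}. mangoldt d / (real d * (real d + 1)))\<bar> \<le> x powr (17 / 36 + 20 * \<eta>)"
proof -
  have x1: "x > 1" and K: "x powr \<eta> \<ge> 10 ^ 8" "1 + 3 * ln x \<le> x powr \<eta>"
    using lg unfolding large_for_def by blast+
  have x0: "x > 0" and xge: "x \<ge> 1" using x1 by auto
  note pm = powr_mono[OF _ xge]
  have lnx: "0 < ln x" "ln x \<le> x powr \<eta>" using K x1 ln_gt_zero[of x] by linarith+
  define T where "T = x powr (17 / 36)"
  define y where "y = x powr (19 / 36)"
  have T0: "T > 0" and y0: "y > 0" using x0 by (simp_all add: T_def y_def)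
  have Ty: "T \<le> y" unfolding T_def y_def by (intro pm) simp
  have yx: "y \<le> x" using pm[of "19 / 36" 1] x0 by (simp add: y_def)
  have y1: "1 \<le> y" unfolding y_def using xge by (simp add: ge_one_powr_ge_zero)
  have xT: "x = T * y" using x0 unfolding T_def y_def by (simp flip: powr_add)
  define B where "B = nat \<lfloor>y\<rfloor>"
  have B: "real B \<le> y" "y \<le> real (Suc B)" unfolding B_def using y0 by linarith+
  define f where "f d = mangoldt d / (real d * (real d + 1))" for d :: nat
  define g where "g n = nat \<lfloor>x / real n\<rfloor>" for n :: nat
  define V where "V \<delta> = (\<Sum>d\<in>{1..B}. mangoldt d * psi (x / (real d + \<delta>)))" for \<delta>
  define S1 where "S1 = {n :: nat. 1 \<le> n \<and> real n \<le> x \<and> \<not> g n \<le> B}"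
  have TE: "T * x powr \<eta> \<le> x powr (17 / 36 + 19 * \<eta>)"
    unfolding T_def using \<eta> by (simp add: powr_add [symmetric] x1)
  have psi_part: "\<bar>V \<delta>\<bar> \<le> 2 * x powr (17 / 36 + 19 * \<eta>)" if \<delta>: "0 \<le> \<delta>" "\<delta> \<le> 1" for \<delta>
  proof -
    have "{1..B} = {d. 1 \<le> d \<and> real d \<le> T} \<union> {d. T < real d \<and> real d \<le> y}"
    proof (intro equalityI subsetI)
      fix d assume "d \<in> {1..B}"
      hence "1 \<le> d" "real d \<le> real B" by auto
      thus "d \<in> {d. 1 \<le> d \<and> real d \<le> T} \<union> {d. T < real d \<and> real d \<le> y}" using B(1) by auto
    next
      fix d assume "d \<in> {d. 1 \<le> d \<and> real d \<le> T} \<union> {d. T < real d \<and> real d \<le> y}"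
      hence "0 < d" "real d \<le> y" using Ty T0 by (auto intro!: Nat.gr0I)
      thus "d \<in> {1..B}" unfolding B_def by (simp add: le_nat_floor)
    qed
    hence "V \<delta> = (\<Sum>d | 1 \<le> d \<and> real d \<le> T. mangoldt d * psi (x / (real d + \<delta>))) + (\<Sum>d | T < real d \<and> real d \<le> y. mangoldt d * psi (x / (real d + \<delta>)))"
      unfolding V_def by (simp only:) (rule sum.union_disjoint; auto intro: finite_subset[OF _ finite_nat_le_real])
    moreover have "\<bar>\<Sum>d | 1 \<le> d \<and> real d \<le> T. mangoldt d * psi (x / (real d + \<delta>))\<bar> \<le> T * x powr \<eta>"
    proof (rule sum_mangoldt_le[OF _ _ lnx(2) x0])
      show "finite {d :: nat. 1 \<le> d \<and> real d \<le> T}" by (auto intro: finite_subset[OF _ finite_nat_le_real[of T]])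
      show "real (card {d :: nat. 1 \<le> d \<and> real d \<le> T}) \<le> T" using T0 by (intro card_nat_le_real) auto
    qed (use Ty yx in \<open>auto intro: abs_psi_le\<close>)
    moreover have "\<bar>\<Sum>d | T < real d \<and> real d \<le> y. mangoldt d * psi (x / (real d + \<delta>))\<bar> \<le> x powr (17 / 36 + 19 * \<eta>)"
      unfolding T_def y_def by (rule psi_mangoldt_bound[OF lg \<eta> \<delta>])
    ultimately show ?thesis using TE by linarith
  qed
  have S1: "\<bar>\<Sum>n\<in>S1. mangoldt (g n) * 1\<bar> \<le> T * x powr \<eta>"
  proof (rule sum_mangoldt_le[OF _ _ lnx(2) x0])
    show "finite S1" by (rule finite_subset[OF _ finite_nat_le_real[of x]]) (auto simp: S1_def)
    show "real (card S1) \<le> T"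
    proof (rule card_nat_le_real)
      show "S1 \<subseteq> {n. 1 \<le> n \<and> real n \<le> T}"
      proof
        fix n assume n: "n \<in> S1"
        hence n0: "0 < real n" "Suc B \<le> g n" by (auto simp: S1_def)
        have "y \<le> real (g n)" using B(2) n0(2) by linarith
        also have "\<dots> \<le> x / real n" unfolding g_def using x0 by (intro of_nat_floor) auto
        finally have "real n * y \<le> T * y" using n0 by (simp add: xT field_simps)
        hence "real n \<le> T" using y0 by simp
        thus "n \<in> {n. 1 \<le> n \<and> real n \<le> T}" using n by (simp add: S1_def)
      qed
    qed (use T0 in simp)
    show "0 < g n \<and> real (g n) \<le> x" if n: "n \<in> S1" for n
    proof
      show "0 < g n" using n by (auto simp: S1_def)
      have "real (g n) \<le> x / real n" unfolding g_def using x0 by (intro of_nat_floor) auto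
      also have "\<dots> \<le> x / 1" using n x0 by (intro divide_left_mono) (auto simp: S1_def)
      finally show "real (g n) \<le> x" by simp
    qed
  qed auto
  have sumsplit: "(\<Sum>n | 1 \<le> n \<and> real n \<le> x. mangoldt (g n)) = (\<Sum>n\<in>S1. mangoldt (g n) * 1) + (x * sum f {1..B} - V 0 + V 1)"
  proof -
    have "{n. 1 \<le> n \<and> real n \<le> x} = S1 \<union> {n. 1 \<le> n \<and> real n \<le> x \<and> g n \<le> B}" by (auto simp: S1_def)
    hence "(\<Sum>n | 1 \<le> n \<and> real n \<le> x. mangoldt (g n) :: real) = (\<Sum>n\<in>S1. mangoldt (g n)) + (\<Sum>n | 1 \<le> n \<and> real n \<le> x \<and> g n \<le> B. mangoldt (g n))"
      by (simp only:) (rule sum.union_disjoint; auto simp: S1_def intro: finite_subset[OF _ finite_nat_le_real[of x]])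
    also have "(\<Sum>n | 1 \<le> n \<and> real n \<le> x \<and> g n \<le> B. mangoldt (g n))
      = (\<Sum>d\<in>{1..B}. mangoldt d * (x / (real d * (real d + 1)) - psi (x / (real d + 0)) + psi (x / (real d + 1))))"
      unfolding g_def by (rule sum_mangoldt_floor[OF x0])
    also have "\<dots> = x * sum f {1..B} - V 0 + V 1"
      unfolding V_def f_def by (simp add: sum_distrib_left sum.distrib sum_subtractf algebra_simps)
    finally show ?thesis by simp
  qed
  have infsplit: "infsum f {1..} = sum f {1..B} + infsum f {Suc B..}"
  proof -
    have "{1::nat..} = {1..B} \<union> {Suc B..}" by auto
    thus ?thesis
      using infsum_Un_disjoint[of f "{1..B}" "{Suc B..}"] mangoldt_tail(1)[of B] by (simp add: f_def [abs_def])
  qed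
  have tail: "0 \<le> x * infsum f {Suc B..}" "x * infsum f {Suc B..} \<le> 3 * (T * x powr \<eta>)"
  proof -
    show "0 \<le> x * infsum f {Suc B..}" using mangoldt_tail(2)[of B] x0 by (simp add: f_def [abs_def])
    have "real (Suc B) \<le> 2 * x" using B yx x1 by simp
    hence "ln (real (Suc B)) \<le> ln (2 * x)" using x0 by (subst ln_le_cancel_iff) auto
    hence "ln (real (Suc B)) + 1 \<le> ln x + 2" using x0 ln_2_less_1 by (simp add: ln_mult)
    moreover have "ln x + 2 \<le> 3 * x powr \<eta>" using K lnx by linarith
    ultimately have L: "ln (real (Suc B)) + 1 \<le> 3 * x powr \<eta>" by linarith
    have "infsum f {Suc B..} \<le> (ln (real (Suc B)) + 1) / real (Suc B)"
      using mangoldt_tail(3)[of B] by (simp add: f_def [abs_def])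
    also have "\<dots> \<le> (3 * x powr \<eta>) / y" using L B y0 by (intro frac_le) auto
    finally have "x * infsum f {Suc B..} \<le> x * ((3 * x powr \<eta>) / y)" using x0 by (intro mult_left_mono) auto
    also have "\<dots> = 3 * (T * x powr \<eta>)" using y0 by (simp add: xT)
    finally show "x * infsum f {Suc B..} \<le> 3 * (T * x powr \<eta>)" .
  qed
  have "\<bar>(\<Sum>n | 1 \<le> n \<and> real n \<le> x. mangoldt (g n)) - x * infsum f {1..}\<bar> \<le> 8 * x powr (17 / 36 + 19 * \<eta>)"
    unfolding sumsplit infsplit distrib_left using S1 tail TE psi_part[of 0] psi_part[of 1] by (simp add: abs_le_iff)
  also have "\<dots> \<le> x powr \<eta> * x powr (17 / 36 + 19 * \<eta>)" using K by (intro mult_right_mono) auto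
  also have "\<dots> = x powr (17 / 36 + 20 * \<eta>)" by (simp add: powr_add [symmetric] algebra_simps)
  finally show ?thesis unfolding g_def f_def [abs_def] .
qed

theorem theorem1p2:
  fixes \<epsilon> :: real
  assumes "\<epsilon> > 0"
  shows "(\<lambda>x::real. (\<Sum>n\<in>{n::nat. 1 \<le> n \<and> real n \<le> x}. (mangoldt (nat \<lfloor>x / real n\<rfloor>) :: real))
            - x * (\<Sum>\<^sub>\<infinity>d\<in>{1::nat..}. mangoldt d / (real d * (real d + 1))))
         \<in> O[at_top](\<lambda>x. x powr (17 / 36 + \<epsilon>))"
proof -
  \<comment> \<open>The total loss is \<open>x powr (20 * \<eta>)\<close>; the second bound leaves
    enough slack in the strict inequalities between exponents.\<close>
  define \<eta> where "\<eta> = min (\<epsilon> / 20) (1 / 100000)"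
  have \<eta>: "0 < \<eta>" "\<eta> \<le> 1 / 100000" "20 * \<eta> \<le> \<epsilon>" using assms by (auto simp: \<eta>_def)
  show ?thesis
  proof (rule bigoI[where c = 1])
    show "eventually (\<lambda>x. norm ((\<Sum>n\<in>{n::nat. 1 \<le> n \<and> real n \<le> x}. (mangoldt (nat \<lfloor>x / real n\<rfloor>) :: real))
            - x * (\<Sum>\<^sub>\<infinity>d\<in>{1::nat..}. mangoldt d / (real d * (real d + 1)))) \<le> 1 * norm (x powr (17 / 36 + \<epsilon>))) at_top"
      using eventually_large_for[OF \<eta>(1)]
    proof eventually_elim
      case (elim x)
      hence "x \<ge> 1" by (simp add: large_for_def)
      hence "x powr (17 / 36 + 20 * \<eta>) \<le> x powr (17 / 36 + \<epsilon>)" using \<eta>(3) by (intro powr_mono) auto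
      thus ?case using mangoldt_floor_sum_error[OF elim \<eta>(1,2)] by simp
    qed
  qed
qed

end
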